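(* Let $p$ be a power of $2$, let $q$ be a power of $p$, let $R(x)=\sum_{i=0}^e a_ix^{p^i}\in\mathbb{F}_q[x]$ with $e\ge 1$, $a_e\ne 0$, and let $A\subset H_R$ be a maximal abelian subgroup with $A\subset\mathbb{F}_q^2$. Let $\psi$ be a nontrivial character of $\mathbb{F}_p$ and let $\xi\in A_\psi^\vee$. With $\alpha,\beta_\xi\in\mathbb{F}_q$ and $(a_{W_2},b_{W_2})\in W_2(\mathbb{F}_p)^\times$ as defined in the context, put $$c_{R,\xi}:=\bigl(\alpha+b_{W_2}/a_{W_2}^2\bigr)^{1/2}+a_{W_2}\beta_\xi\in\mathbb{F}_q .$$ Then the eigenvalue $\tau_{R,\xi,q}$ of the geometric Frobenius $\mathrm{Fr}_q$ on the one-dimensional space $H^1_{\rm c}(\mathbb{A}^1_{\mathbb{F}},\mathcal{Q}_\xi)$ is $$\tau_{R,\xi,q}=\xi_q(c_{R,\xi},0)^{-1}\cdot(-1-\sqrt{-1})^{[\mathbb{F}_q:\mathbb{F}_2]},$$ where $(c_{R,\xi},0)$ is regarded as an element of $W_2(\mathbb{F}_q)$.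
   Context: Basics. $\mathbb{F}$ is an algebraic closure of $\mathbb{F}_q$; finite fields are viewed inside $\mathbb{F}$; $\ell$ is an odd prime; for $u\in\mathbb{F}$, $u^{1/2}$ and $u^{p^{-i}}$ denote the unique roots. $G^\vee=\mathrm{Hom}(G,\overline{\mathbb{Q}}_\ell^\times)$ for a finite abelian group $G$. $\mathscr{A}$ is the set of $\mathbb{F}_p$-linearized polynomials $\sum_i c_ix^{p^i}\in\mathbb{F}_q[x]$; $\mathrm{Ker}\,g=\{x\in\mathbb{F}: g(x)=0\}$ for $g\in\mathscr{A}$. $C_R$ is the affine curve $y^p-y=xR(x)$ over $\mathbb{F}_q$. Heisenberg group. Put $E_R(x)=R(x)^{p^e}+\sum_{i=0}^e(a_ix)^{p^{e-i}}$, $f_R(x,y)=-\sum_{i=0}^{e-1}\bigl(\sum_{j=0}^{e-i-1}(a_ix^{p^i}y)^{p^j}+(xR(y))^{p^i}\bigr)$ and $V_R=\mathrm{Ker}\,E_R$ (an $\mathbb{F}_p$-space of dimension $2e$). $H_R=\{(a,b)\in V_R\times\mathbb{F}: b^p-b=aR(a)\}$ is a group under $(a,b)\cdot(a',b')=(a+a',b+b'+f_R(a,a'))$, with center $Z(H_R)=\{0\}\times\mathbb{F}_p\simeq\mathbb{F}_p$. It acts on $C_{R,\mathbb{F}}$ on the right by $(x,y)\cdot(a,b)=(x+a,y+b+f_R(x,a))$. Let $\pi:H_R\to V_R$, $(a,b)\mapsto a$. Choices attached to $A$. $\overline{A}=\pi(A)\subset\mathbb{F}_q$ is an $e$-dimensional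 $\mathbb{F}_p$-subspace and $A=\pi^{-1}(\overline{A})$. Put $\overline{U}=\{a\in\overline{A}: f_R(a,a)=0\}$, an $\mathbb{F}_p$-subspace of dimension $e-1$. Fix (such data exist) a separable $f_{\overline{U}}\in\mathscr{A}$, an element $s_0\in\mathbb{F}_q$ with $S(x)=x^p+s_0x$, and $\Delta\in\mathbb{F}_q[x]$ with $\Delta(0)=0$, such that $\overline{U}=\mathrm{Ker}\,f_{\overline{U}}$, $\overline{A}=\mathrm{Ker}(f_{\overline{U}}^p+f_{\overline{U}})$ and $\Delta(x)^p+\Delta(x)=xR(x)+f_{\overline{U}}(x)S(f_{\overline{U}}(x))$. Put $F_A=f_{\overline{U}}^p+f_{\overline{U}}$. Fix $\alpha\in\mathbb{F}_q$ with $\alpha^{p^{-1}}+\alpha=s_0+1$ (it exists), and an $\mathbb{F}_p$-linear map $r:\overline{A}\to\overline{U}$ restricting to the identity on $\overline{U}$. Witt vectors. $W_2$ is the ring scheme of length-$2$ Witt vectors over $\mathbb{F}_2$: $(a,b)+(c,d)=(a+c,b+d+ac)$, $(a,b)\cdot(c,d)=(ac,bc^2+a^2d)$. $\mathrm{Tr}_{2^m/2^n}:W_2(\mathbb{F}_{2^m})\to W_2(\mathbb{F}_{2^n})$, for $n\mid m$, is $(a,b)\mapsto\sum_{i=0}^{m/n-1}(a^{2^{in}},b^{2^{in}})$ (sum in $W_2$). Fix a faithful character $\xi_2$ of $W_2(\mathbb{F}_2)\simeq\mathbb{Z}/4\mathbb{Z}$, put $\sqrt{-1}:=\xi_2(1,0)$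 and $\xi_{2^n}:=\xi_2\circ\mathrm{Tr}_{2^n/2}$. Characters. The map $\varphi:A\to W_2(\mathbb{F}_p)\times\overline{U}$, $(a,b)\mapsto\bigl((f_{\overline{U}}(a),\,b+\Delta(a)+\alpha^{p^{-1}}f_{\overline{U}}(a)^2),\,r(a)\bigr)$, is an isomorphism of groups. $A_\psi^\vee$ is the set of $\xi\in A^\vee$ with $\xi(0,c)=\psi(c)$ for $c\in\mathbb{F}_p$. Write $\xi=(\xi_{W_2}\boxtimes\xi_{\overline{U}})\circ\varphi$ with $\xi_{W_2}\in W_2(\mathbb{F}_p)^\vee$, $\xi_{\overline{U}}\in\overline{U}^\vee$. There is a unique $(a_{W_2},b_{W_2})\in W_2(\mathbb{F}_p)^\times$ (so $a_{W_2}\neq0$) with $\xi_{W_2}(x,y)=\xi_p((a_{W_2},b_{W_2})\cdot(x,y))$ for all $(x,y)\in W_2(\mathbb{F}_p)$. There is a unique $a(x)\in\mathscr{A}$ with $x^q+x=a(F_A(x))=F_A(a(x))$; it induces a surjection $\mathbb{F}_q\to\overline{A}$. $\beta_\xi\in\mathbb{F}_q$ is the unique element with $\xi_{\overline{U}}(r(a(x)))=\psi(\mathrm{Tr}_{\mathbb{F}_q/\mathbb{F}_p}(\beta_\xi x))$ for all $x\in\mathbb{F}_q$. Sheaf. $C_R\to\mathbb{A}^1_{\mathbb{F}_q}$, $(x,y)\mapsto F_A(x)$, is a finite étale Galois covering with group $A$. $\mathcal{Q}_\xi$ is the rank-one smooth $\overline{\mathbb{Q}}_\ell$-sheaf on $\mathbb{A}^1_{\mathbb{F}_q}$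 associated with this covering and $\xi$ (Deligne's convention: if $t\in\mathbb{A}^1(\mathbb{F}_{q^m})$, $P\in C_R(\mathbb{F})$ lies over $t$ and the $q^m$-power Frobenius sends $P$ to $P\cdot g$ with $g\in A$, then the geometric Frobenius at $t$ acts on the stalk by $\xi(g)$). $H^1_{\rm c}(\mathbb{A}^1_{\mathbb{F}},\mathcal{Q}_\xi)$ is one-dimensional and the other $H^i_{\rm c}$ vanish. *)

theory Defs
  imports "HOL-Algebra.Algebraic_Closure_Type"
begin

section \<open>Fields, polynomials, characters\<close>

definition polys_over :: "'a::zero set \<Rightarrow> 'a poly set" where
  "polys_over K = {P. \<forall>i. Polynomial.coeff P i \<in> K}"

definition algebraic_over :: "'a::field set \<Rightarrow> 'a \<Rightarrow> bool" where
  "algebraic_over K x \<longleftrightarrow> (\<exists>P \<in> polys_over K. P \<noteq> 0 \<and> poly P x = 0)"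

text \<open>The finite subfield with \<open>q\<close> elements of a fixed algebraically closed field.\<close>

definition GF :: "nat \<Rightarrow> 'f::field set" where
  "GF q = {x. x ^ q = x}"

text \<open>The root \<open>u^{1/n}\<close>; only used for \<open>n\<close> a power of the characteristic, where it is unique.\<close>

definition froot :: "nat \<Rightarrow> 'f::field \<Rightarrow> 'f" where
  "froot n u = (THE z. z ^ n = u)"

definition linearized :: "nat \<Rightarrow> 'f::field set \<Rightarrow> 'f poly set" where
  "linearized p K =
     {(\<Sum>i<m. Polynomial.monom (c i) (p ^ i)) | m (c :: nat \<Rightarrow> 'f). \<forall>i<m. c i \<in> K}"

definition Ker :: "'f::field poly \<Rightarrow> 'f set" where
  "Ker g = {x. poly g x = 0}"

text \<open>The field \<open>'k\<close>, assumed algebraically closed of characteristic \<open>0\<close>, with the absolute value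
  \<open>v\<close> is an algebraic closure of \<open>\<rat>\<^sub>l\<close> with its canonical topology: \<open>v\<close> extends the \<open>l\<close>-adic absolute
  value, the closure of \<open>\<rat>\<close> is complete (hence is \<open>\<rat>\<^sub>l\<close>), and \<open>'k\<close> is algebraic over it.\<close>

definition rat_closure :: "('k::field_char_0 \<Rightarrow> real) \<Rightarrow> 'k set" where
  "rat_closure v = {x. \<forall>\<epsilon>>0. \<exists>r\<in>\<rat>. v (x - r) < \<epsilon>}"

definition is_Qlbar :: "nat \<Rightarrow> ('k::{field_char_0, alg_closed_field} \<Rightarrow> real) \<Rightarrow> bool" where
  "is_Qlbar l v \<longleftrightarrow>
     (\<forall>x. v x \<ge> 0) \<and> (\<forall>x. v x = 0 \<longleftrightarrow> x = 0) \<and>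
     (\<forall>x y. v (x * y) = v x * v y) \<and> (\<forall>x y. v (x + y) \<le> max (v x) (v y)) \<and>
     v (of_nat l) = 1 / real l \<and>
     (\<forall>s :: nat \<Rightarrow> 'k. (\<forall>n. s n \<in> \<rat>) \<longrightarrow> (\<forall>\<epsilon>>0. \<exists>N. \<forall>m\<ge>N. \<forall>n\<ge>N. v (s m - s n) < \<epsilon>) \<longrightarrow>
        (\<exists>x. \<forall>\<epsilon>>0. \<exists>N. \<forall>n\<ge>N. v (s n - x) < \<epsilon>)) \<and>
     (\<forall>x. algebraic_over (rat_closure v) x)"

definition mult_group_of_field :: "'k::field monoid" where
  "mult_group_of_field = \<lparr>carrier = UNIV - {0}, monoid.mult = (*), one = 1\<rparr>"

definition add_group_on :: "'f::field set \<Rightarrow> 'f monoid" where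
  "add_group_on S = \<lparr>carrier = S, monoid.mult = (+), one = 0\<rparr>"

definition dual :: "('g, 'm) monoid_scheme \<Rightarrow> ('g \<Rightarrow> 'k::field) set" where
  "dual G = hom G mult_group_of_field"

definition max_abelian_subgroup :: "'g set \<Rightarrow> 'g monoid \<Rightarrow> bool" where
  "max_abelian_subgroup A G \<longleftrightarrow> subgroup A G \<and> comm_group (G\<lparr>carrier := A\<rparr>) \<and>
     (\<forall>B. subgroup B G \<longrightarrow> comm_group (G\<lparr>carrier := B\<rparr>) \<longrightarrow> A \<subseteq> B \<longrightarrow> B = A)"

section \<open>Witt vectors of length two in characteristic two\<close>

definition W2 :: "'f::field set \<Rightarrow> ('f \<times> 'f) ring" where
  "W2 K = \<lparr>carrier = K \<times> K,
           monoid.mult = (\<lambda>(a, b) (c, d). (a * c, b * c\<^sup>2 + a\<^sup>2 * d)),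
           one = (1, 0),
           ring.zero = (0, 0),
           add = (\<lambda>(a, b) (c, d). (a + c, b + d + a * c))\<rparr>"

text \<open>The trace from \<open>W\<^sub>2\<close> of the field with \<open>2^m\<close> elements to \<open>W\<^sub>2\<close> of the field with \<open>2^n\<close>
  elements, and the character \<open>\<xi>\<^sub>2 \<circ> Tr\<close> of \<open>W\<^sub>2\<close> of the field with \<open>2^m\<close> elements.\<close>

definition W2_trace :: "nat \<Rightarrow> nat \<Rightarrow> 'f::field \<times> 'f \<Rightarrow> 'f \<times> 'f" where
  "W2_trace m n z =
     finsum (W2 UNIV) (\<lambda>i. (fst z ^ (2 ^ (i * n)), snd z ^ (2 ^ (i * n)))) {..<m div n}"

definition W2_char :: "('f::field \<times> 'f \<Rightarrow> 'k) \<Rightarrow> nat \<Rightarrow> 'f \<times> 'f \<Rightarrow> 'k" where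
  "W2_char \<xi>2 m = \<xi>2 \<circ> W2_trace m 1"

section \<open>The curve \<open>C_R\<close> and the Heisenberg group\<close>

text \<open>The coefficients of \<open>R\<close> are \<open>a 0, \<dots>, a e\<close>.\<close>

definition R_poly :: "nat \<Rightarrow> nat \<Rightarrow> (nat \<Rightarrow> 'c::field) \<Rightarrow> 'c poly" where
  "R_poly p e a = (\<Sum>i\<le>e. Polynomial.monom (a i) (p ^ i))"

definition E_R :: "nat \<Rightarrow> nat \<Rightarrow> (nat \<Rightarrow> 'c::field) \<Rightarrow> 'c \<Rightarrow> 'c" where
  "E_R p e a x = poly (R_poly p e a) x ^ (p ^ e) + (\<Sum>i\<le>e. (a i * x) ^ (p ^ (e - i)))"

definition f_R :: "nat \<Rightarrow> nat \<Rightarrow> (nat \<Rightarrow> 'c::field) \<Rightarrow> 'c \<Rightarrow> 'c \<Rightarrow> 'c" where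
  "f_R p e a x y =
     - (\<Sum>i<e. (\<Sum>j<e - i. (a i * x ^ (p ^ i) * y) ^ (p ^ j))
                + (x * poly (R_poly p e a) y) ^ (p ^ i))"

definition H_R :: "nat \<Rightarrow> nat \<Rightarrow> (nat \<Rightarrow> 'f::field) \<Rightarrow> ('f \<times> 'f) monoid" where
  "H_R p e a =
     \<lparr>carrier = {(x, b). E_R p e a x = 0 \<and> b ^ p - b = x * poly (R_poly p e a) x},
      monoid.mult = (\<lambda>(x, b) (x', b'). (x + x', b + b' + f_R p e a x x')),
      one = (0, 0)\<rparr>"

section \<open>Galois theory of the function field of the affine line\<close>

text \<open>\<open>'f\<close> is the algebraically closed constant field, \<open>'f poly fract\<close> the function field \<open>'f(t)\<close>
  of the affine line, and \<open>'f poly fract alg_closure\<close> its algebraic closure, whose automorphism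
  group over \<open>'f(t)\<close> is the absolute Galois group.\<close>

definition const_ac :: "'f::field \<Rightarrow> 'f poly fract alg_closure" where
  "const_ac c = to_ac (Fract [:c:] 1)"

definition t_ac :: "'f::field poly fract alg_closure" where
  "t_ac = to_ac (Fract [:0, 1:] 1)"

definition field_auts :: "('w::field \<Rightarrow> 'w) set" where
  "field_auts = {\<sigma>. bij \<sigma> \<and> (\<forall>x y. \<sigma> (x + y) = \<sigma> x + \<sigma> y) \<and> (\<forall>x y. \<sigma> (x * y) = \<sigma> x * \<sigma> y)}"

text \<open>The Galois groups of \<open>'f(t)\<close> and of \<open>\<bbbF>\<^sub>q(t)\<close>.\<close>

definition gal_geom :: "('f::field poly fract alg_closure \<Rightarrow> 'f poly fract alg_closure) set" where
  "gal_geom = {\<sigma> \<in> field_auts. \<forall>z. \<sigma> (to_ac z) = to_ac z}"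

definition gal_arith ::
  "nat \<Rightarrow> ('f::field poly fract alg_closure \<Rightarrow> 'f poly fract alg_closure) set" where
  "gal_arith q = {\<sigma> \<in> field_auts. \<sigma> t_ac = t_ac \<and> (\<forall>c \<in> GF q. \<sigma> (const_ac c) = const_ac c)}"

text \<open>Places of the algebraic closure over the constants \<open>'f\<close>, given by their valuation rings. A
  place \<open>V\<close> lies over a point of the affine line if \<open>t \<in> V\<close> and over \<open>\<infinity>\<close> otherwise.\<close>

definition is_place :: "'f::field poly fract alg_closure set \<Rightarrow> bool" where
  "is_place V \<longleftrightarrow> V \<noteq> UNIV \<and> range const_ac \<subseteq> V \<and>
     (\<forall>x\<in>V. \<forall>y\<in>V. x + y \<in> V \<and> x * y \<in> V) \<and> (\<forall>x. x \<in> V \<or> inverse x \<in> V)"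

definition place_ideal :: "'w::field set \<Rightarrow> 'w set" where
  "place_ideal V = {x \<in> V. x = 0 \<or> inverse x \<notin> V}"

definition decomp_group :: "'f::field poly fract alg_closure set \<Rightarrow>
    ('f poly fract alg_closure \<Rightarrow> 'f poly fract alg_closure) set" where
  "decomp_group V = {\<sigma> \<in> gal_geom. \<sigma> ` V = V}"

definition inertia_group :: "'f::field poly fract alg_closure set \<Rightarrow>
    ('f poly fract alg_closure \<Rightarrow> 'f poly fract alg_closure) set" where
  "inertia_group V = {\<sigma> \<in> decomp_group V. \<forall>x\<in>V. \<sigma> x - x \<in> place_ideal V}"

section \<open>Compactly supported cohomology of rank-one sheaves\<close>

text \<open>A smooth rank-one sheaf on the affine line over \<open>\<bbbF>\<^sub>q\<close> is given by the character \<open>\<rho>\<close> of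
  \<open>gal_arith q\<close>, unramified at the places with \<open>t \<in> V\<close>, by which the Galois group acts on the stalk
  \<open>'k\<close> at the geometric generic point. Its compactly supported cohomology over \<open>'f\<close>, that is the
  cohomology of its extension by zero to the projective line, is the cohomology of the complex
  \<open>Cone(C(\<pi>\<^sub>1, 'k) \<rightarrow> C(D, 'k))[-1]\<close>, where \<open>\<pi>\<^sub>1\<close> is the fundamental group of the affine line over
  \<open>'f\<close>, \<open>D\<close> is the Galois group of the (henselised) local field at \<open>\<infinity>\<close>, i.e.\ the decomposition
  group of a place \<open>V\<close> over \<open>\<infinity>\<close>, and \<open>C\<close> denotes continuous cochains. This is the definition in
  terms of Galois cohomology of J. S. Milne, Arithmetic Duality Theorems, Section II.2 (here over
  an algebraically closed constant field); the group \<open>\<pi>\<^sub>1\<close> suffices for the first cohomology.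

  Here \<open>\<pi>\<^sub>1\<close> is the quotient of \<open>gal_geom\<close> by the closed normal subgroup generated by the inertia
  groups of the places with \<open>t \<in> V\<close>, so its continuous cochains are the continuous cochains on
  \<open>gal_geom\<close> invariant under these inertia groups. Cochains are HOL functions of which only the
  values on \<open>gal_geom\<close> matter. In degree one the complex has the elements \<open>(c, m)\<close> with \<open>c\<close> a
  1-cochain on \<open>\<pi>\<^sub>1\<close> and \<open>m\<close> a 0-cochain on \<open>D\<close>.\<close>

type_synonym ('f, 'k) cochain =
  "('f poly fract alg_closure \<Rightarrow> 'f poly fract alg_closure) \<Rightarrow> 'k"

definition continuous_cochain :: "('k::field \<Rightarrow> real) \<Rightarrow> ('f::field, 'k) cochain \<Rightarrow> bool" where
  "continuous_cochain v c \<longleftrightarrow>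
     (\<forall>\<sigma> \<in> gal_geom. \<forall>\<epsilon>>0. \<exists>S. finite S \<and>
        (\<forall>\<tau> \<in> gal_geom. (\<forall>s\<in>S. \<tau> s = \<sigma> s) \<longrightarrow> v (c \<tau> - c \<sigma>) < \<epsilon>))"

definition pi1_cochain :: "('f::field, 'k) cochain \<Rightarrow> bool" where
  "pi1_cochain c \<longleftrightarrow>
     (\<forall>V. is_place V \<longrightarrow> t_ac \<in> V \<longrightarrow>
        (\<forall>\<sigma> \<in> gal_geom. \<forall>\<tau> \<in> inertia_group V. c (\<sigma> \<circ> \<tau>) = c \<sigma>))"

definition Z1c :: "('k::field \<Rightarrow> real) \<Rightarrow> ('f::field, 'k) cochain \<Rightarrow>
    'f poly fract alg_closure set \<Rightarrow> (('f, 'k) cochain \<times> 'k) set" where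
  "Z1c v \<rho> V = {(c, m). continuous_cochain v c \<and> pi1_cochain c \<and>
     (\<forall>\<sigma> \<in> gal_geom. \<forall>\<tau> \<in> gal_geom. c (\<sigma> \<circ> \<tau>) = c \<sigma> + \<rho> \<sigma> * c \<tau>) \<and>
     (\<forall>\<sigma> \<in> decomp_group V. c \<sigma> = \<rho> \<sigma> * m - m)}"

definition B1c :: "('f::field, 'k::field) cochain \<Rightarrow> (('f, 'k) cochain \<times> 'k) set" where
  "B1c \<rho> = {(c, m). \<forall>\<sigma> \<in> gal_geom. c \<sigma> = \<rho> \<sigma> * m - m}"

text \<open>The geometric Frobenius acts on \<open>H\<^sup>1\<^sub>c = Z1c / B1c\<close> through any lift \<open>\<Phi>\<close> to the Galois group
  of \<open>\<bbbF>\<^sub>q(t)\<close> of the inverse of \<open>u \<mapsto> u^q\<close> that preserves the place \<open>V\<close>: it acts on cochains by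
  conjugation and on the coefficients by \<open>\<rho> \<Phi>\<close>. Two lifts differ by an element of
  \<open>decomp_group V\<close>, which acts trivially on \<open>H\<^sup>1\<^sub>c\<close>.\<close>

definition is_geom_frob_lift :: "nat \<Rightarrow> 'f::field poly fract alg_closure set \<Rightarrow>
    ('f poly fract alg_closure \<Rightarrow> 'f poly fract alg_closure) \<Rightarrow> bool" where
  "is_geom_frob_lift q V \<Phi> \<longleftrightarrow>
     \<Phi> \<in> gal_arith q \<and> (\<forall>u. \<Phi> (const_ac (u ^ q)) = const_ac u) \<and> \<Phi> ` V = V"

definition frob_act :: "('f::field, 'k::field) cochain \<Rightarrow>
    ('f poly fract alg_closure \<Rightarrow> 'f poly fract alg_closure) \<Rightarrow>
    ('f, 'k) cochain \<times> 'k \<Rightarrow> ('f, 'k) cochain \<times> 'k" where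
  "frob_act \<rho> \<Phi> z =
     ((\<lambda>\<sigma>. \<rho> \<Phi> * fst z (inv_into UNIV \<Phi> \<circ> \<sigma> \<circ> \<Phi>)), \<rho> \<Phi> * snd z)"

definition H1c_eigenvalue :: "('k::field \<Rightarrow> real) \<Rightarrow> ('f::field, 'k) cochain \<Rightarrow>
    'f poly fract alg_closure set \<Rightarrow>
    ('f poly fract alg_closure \<Rightarrow> 'f poly fract alg_closure) \<Rightarrow> 'k \<Rightarrow> bool" where
  "H1c_eigenvalue v \<rho> V \<Phi> \<tau> \<longleftrightarrow>
     (\<exists>z \<in> Z1c v \<rho> V. z \<notin> B1c \<rho> \<and>
        ((\<lambda>\<sigma>. fst (frob_act \<rho> \<Phi> z) \<sigma> - \<tau> * fst z \<sigma>), snd (frob_act \<rho> \<Phi> z) - \<tau> * snd z) \<in> B1c \<rho>)"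

section \<open>The sheaf \<open>Q_\<xi>\<close>\<close>

text \<open>The geometric generic fibre of \<open>C_R \<rightarrow> \<bbbA>\<^sup>1, (x, y) \<mapsto> F_A(x)\<close>, and the right action of
  \<open>H_R\<close> on it.\<close>

definition generic_fibre :: "nat \<Rightarrow> nat \<Rightarrow> (nat \<Rightarrow> 'f::field) \<Rightarrow> 'f poly \<Rightarrow>
    ('f poly fract alg_closure \<times> 'f poly fract alg_closure) set" where
  "generic_fibre p e a F =
     {(x, y). y ^ p - y = x * poly (R_poly p e (const_ac \<circ> a)) x \<and>
              poly (map_poly const_ac F) x = t_ac}"

definition curve_act :: "nat \<Rightarrow> nat \<Rightarrow> (nat \<Rightarrow> 'f::field) \<Rightarrow>
    'f poly fract alg_closure \<times> 'f poly fract alg_closure \<Rightarrow> 'f \<times> 'f \<Rightarrow>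
    'f poly fract alg_closure \<times> 'f poly fract alg_closure" where
  "curve_act p e a = (\<lambda>(x, y) (h, b).
     (x + const_ac h, y + const_ac b + f_R p e (const_ac \<circ> a) x (const_ac h)))"

text \<open>For \<open>\<sigma>\<close> in the Galois group of \<open>\<bbbF>\<^sub>q(t)\<close> there is a unique \<open>g \<in> A\<close> with \<open>\<sigma>(P) = P \<cdot> g\<close> for
  every point \<open>P\<close> of the generic fibre (the same for all \<open>P\<close>, as \<open>A\<close> is abelian with coordinates in
  \<open>\<bbbF>\<^sub>q\<close>). In Deligne's convention, if the arithmetic Frobenius at a point sends \<open>P\<close> to \<open>P \<cdot> g\<close>, then
  the geometric Frobenius acts on the stalk by \<open>\<xi> g\<close>; so \<open>\<sigma>\<close> acts by the inverse of \<open>\<xi> g\<close>.\<close>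

definition Q_char :: "nat \<Rightarrow> nat \<Rightarrow> (nat \<Rightarrow> 'f::field) \<Rightarrow> ('f \<times> 'f) set \<Rightarrow> 'f poly \<Rightarrow>
    ('f \<times> 'f \<Rightarrow> 'k::field) \<Rightarrow> ('f, 'k) cochain" where
  "Q_char p e a A F \<xi> \<sigma> =
     inverse (\<xi> (THE g. g \<in> A \<and> (\<forall>P \<in> generic_fibre p e a F.
       map_prod \<sigma> \<sigma> P = curve_act p e a P g)))"

end

(* In coordinates S, Z on the fibre of C_R the isomorphism phi turns the covering into an Artin-Schreier
   covering for W_2(F_p). Multiplying by (a_W, b_W), taking the trace to W_2(F_2) and adding constants,
   one obtains (s, z) with s^2 + s = a_W t + c and z^2 + z = s^3 + s^2 on which the Galois group acts through xi.
   So, up to the constant twist xi_q(c, 0)^-1 of Frobenius, xi is the character of order four of the cyclic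
   covering of the affine line by the supersingular elliptic curve E : z^2 + z = s^3 + s^2, whose group is
   generated by the rotation i : (s, z) |-> (s + 1, z + s + 1).

   A class in H^1_c restricts to a homomorphism C from the fundamental group of E to 'k which is an eigenvector
   for the rotation. The line z + z_P + s_P (s + s_P) = 0 has the divisor [P] + [F P] + [i P] for the Frobenius F
   of E, so that F = - 1 - i on divisor classes of degree zero. By Kummer theory C satisfies the same
   relation, and Fr_q acts by (- 1 - i)^[F_q : F_2]. For the existence of C one counts
   the points of E over the fields with 256^m elements: there are (16^m - 1)^2, hence enough l-power torsion. *)

theory Submission
  imports Defs "HOL-Library.Poly_Mapping" "HOL-Algebra.Sylow"
begin

text \<open>Points of curves are places of the algebraic closure of 'f(t), and the Galois group of
  the elliptic curve is \<open>NN\<close>, the automorphisms that fix its function field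
  \<open>Lf\<close>. An element fixed by \<open>NN\<close> is only known to have a 2^j-th power in
  \<open>Lf\<close>; the exponents 2^j that occur throughout do no harm, because l is odd and 'f has
  no nontrivial roots of unity of 2-power order. Kummer theory needs characters with values in 'f,
  whereas classes take values in 'k. So relations are tested by composing with characters of 'k into
  'f, and in the other direction a compatible system of l-power roots of unity is turned into an
  element of 'k by an l-adic logarithm. Only some unramified homomorphism is constructed; if it
  belongs to the wrong eigenvalue of the rotation, an automorphism of E that conjugates the rotation
  to its inverse repairs this. The point at infinity is the origin of the group law and carries all
  the ramification: its decomposition group maps onto the cyclic group of order four, so a class is
  determined by its restriction to \<open>NN\<close>, and a homomorphism on \<open>NN\<close> can be
  extended to a cocycle.\<close>

abbreviation cst :: "'f::field => 'f poly fract alg_closure" where "cst \<equiv> const_ac"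
abbreviation mi :: "'w::field set => 'w set" where "mi \<equiv> place_ideal"
abbreviation iv :: "('w => 'w) => 'w => 'w" where "iv \<equiv> inv_into UNIV"
abbreviation mul :: "int => ('p \<Rightarrow>\<^sub>0 int) => 'p \<Rightarrow>\<^sub>0 int" where "mul \<equiv> frag_cmul"
abbreviation mlt :: "('p \<Rightarrow>\<^sub>0 int) => 'p => int" where "mlt \<equiv> Poly_Mapping.lookup"
abbreviation supp :: "('p \<Rightarrow>\<^sub>0 int) => 'p set" where "supp \<equiv> Poly_Mapping.keys"
lemmas sqr = power2_eq_square
lemmas sq_simps = power2_eq_square algebra_simps
lemmas has_root = alg_closed_imp_poly_has_root

section \<open>Extension of partial automorphisms\<close>

text \<open>An isomorphism between subfields is represented by its graph, so that a chain of partial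
  isomorphisms has its union as upper bound.\<close>

definition iso_graph :: "('w::field \<times> 'w) set => bool" where
 "iso_graph R \<longleftrightarrow> (1, 1) : R & (\<forall>y. (0, y) : R --> y = 0) &
   (\<forall>x y. (x, y) : R --> (- x, - y) : R & (inverse x, inverse y) : R) &
   (\<forall>x y x' y'. (x, y) : R --> (x', y') : R --> (x + x', y + y') : R & (x * x', y * y') : R)"

text \<open>The graph of the induced isomorphism of polynomial rings.\<close>

definition gpoly :: "('w::field \<times> 'w) set => ('w poly \<times> 'w poly) set" where
 "gpoly R = {(a, b). \<forall>i. (coeff a i, coeff b i) : R}"

context
 fixes R :: "('w::field \<times> 'w) set"
 assumes R: "iso_graph R"
begin

lemma iso_graph_1: "(1, 1) : R" and iso_graph_uminus: "(x, y) : R ==> (- x, - y) : R"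
 and iso_graph_inverse: "(x, y) : R ==> (inverse x, inverse y) : R"
 and iso_graph_add: "(x, y) : R ==> (x', y') : R ==> (x + x', y + y') : R"
 and iso_graph_mult: "(x, y) : R ==> (x', y') : R ==> (x * x', y * y') : R" and iso_graph_0D: "(0, y) : R ==> y = 0"
 using R by (auto simp: iso_graph_def)

lemma iso_graph_0: "(0, 0) : R" using iso_graph_add[OF iso_graph_1 iso_graph_uminus[OF iso_graph_1]] by simp

lemma iso_graph_diff: "(x, y) : R ==> (x', y') : R ==> (x - x', y - y') : R"
 using iso_graph_add[OF _ iso_graph_uminus] by fastforce

lemma iso_graph_divide: "(x, y) : R ==> (x', y') : R ==> (x / x', y / y') : R"
 using iso_graph_mult[OF _ iso_graph_inverse] by (simp add: field_class.field_divide_inverse)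

lemma iso_graph_0_iff: "(x, y) : R ==> x = 0 \<longleftrightarrow> y = 0"
proof
 assume xy: "(x, y) : R" "y = 0"
 show "x = 0"
 proof (rule ccontr)
  assume "x ~= 0"
  thus False using iso_graph_mult[OF iso_graph_inverse[OF xy(1)] xy(1)] xy(2) iso_graph_0D[of 1] iso_graph_diff[OF iso_graph_1, of 1 0] by simp
 qed
qed (use iso_graph_0D in auto)

lemma iso_graph_eq_iff: "(x, y) : R ==> (x', y') : R ==> x = x' \<longleftrightarrow> y = y'"
 using iso_graph_0_iff[OF iso_graph_diff] by fastforce

lemma iso_graph_sum: "(!!i. i : I ==> (f i, g i) : R) ==> (sum f I, sum g I) : R"
 by (induction I rule: infinite_finite_induct) (auto intro: iso_graph_add iso_graph_0)

lemma gpoly_0: "(0, 0) : gpoly R" and gpoly_1: "(1, 1) : gpoly R" and gpoly_X: "([:0, 1:], [:0, 1:]) : gpoly R"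
 and gpoly_const: "(x, y) : R ==> ([:x:], [:y:]) : gpoly R"
 and gpoly_monom: "(x, y) : R ==> (monom x n, monom y n) : gpoly R"
 and gpoly_add: "(a, b) : gpoly R ==> (a', b') : gpoly R ==> (a + a', b + b') : gpoly R"
 and gpoly_diff: "(a, b) : gpoly R ==> (a', b') : gpoly R ==> (a - a', b - b') : gpoly R"
 and gpoly_uminus: "(a, b) : gpoly R ==> (- a, - b) : gpoly R"
 by (auto simp: gpoly_def coeff_pCons Polynomial.coeff_1 split: nat.splits
   intro: iso_graph_0 iso_graph_1 iso_graph_add iso_graph_diff iso_graph_uminus)

lemma gpoly_mult: "(a, b) : gpoly R ==> (a', b') : gpoly R ==> (a * a', b * b') : gpoly R"
 by (auto simp: gpoly_def coeff_mult intro!: iso_graph_sum iso_graph_mult)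

lemma gpoly_0_iff: "(a, b) : gpoly R ==> a = 0 \<longleftrightarrow> b = 0"
 using iso_graph_0_iff by (auto simp: gpoly_def poly_eq_iff)

lemma gpoly_coeff: "(a, b) : gpoly R ==> (coeff a i, coeff b i) : R" by (auto simp: gpoly_def)

lemma gpoly_degree: "(a, b) : gpoly R ==> degree a = degree b" using iso_graph_0_iff[OF gpoly_coeff]
 by (metis coeff_0 le_antisym le_degree leading_coeff_0_iff)

text \<open>Leading coefficients correspond under \<open>R\<close>, so one division algorithm runs
  on both components in parallel. Minimal polynomials and Bezout relations can thereby be carried
  across the graph.\<close>

lemma gpoly_divmod:
 assumes ab: "(a, b) : gpoly R" and m: "(m, n) : gpoly R" "m ~= 0"
 shows "\<exists>q q' r r'. (q, q') : gpoly R & (r, r') : gpoly R & a = q * m + r &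
      b = q' * n + r' & (r = 0 \<or> degree r < degree m)" using ab
proof (induction "degree a" arbitrary: a b rule: less_induct)
 case less
 show ?case
 proof (cases "a = 0 \<or> degree a < degree m")
  case True
  thus ?thesis using less.prems gpoly_0 by force
 next
  case False
  define k x y where "k = degree a - degree m" and "x = lead_coeff a / lead_coeff m"
   and "y = lead_coeff b / lead_coeff n"
  have deg: "degree a = degree b" "degree m = degree n" using gpoly_degree less.prems m by auto
  have xy: "(x, y) : R" unfolding x_def y_def using deg gpoly_coeff[OF less.prems] gpoly_coeff[OF m(1)]
   by (metis iso_graph_divide)
  have mon: "(monom x k, monom y k) : gpoly R" by (rule gpoly_monom[OF xy])
  define a' b' where "a' = a - monom x k * m" and "b' = b - monom y k * n"
  have ab': "(a', b') : gpoly R" unfolding a'_def b'_def by (intro gpoly_diff gpoly_mult less.prems m mon)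
  show ?thesis
  proof (cases "a' = 0")
   case True
   hence "b' = 0" using gpoly_0_iff[OF ab'] by simp
   with True have "a = monom x k * m + 0" "b = monom y k * n + 0" by (simp_all add: a'_def b'_def)
   thus ?thesis using mon gpoly_0 by blast
  next
   case a': False
   have dm: "degree (monom x k * m) = degree a" using False m(2) by (subst degree_mult_eq)
     (auto simp: x_def k_def degree_monom_eq monom_eq_0_iff)
   have "coeff a' (degree a) = 0" using False m(2) by (auto simp: a'_def x_def k_def coeff_monom_mult)
   moreover have "degree a' <= degree a" unfolding a'_def using dm by (metis degree_diff_le order_refl)
   ultimately have "degree a' < degree a" using a' by (metis leading_coeff_0_iff le_neq_implies_less)
   from less.hyps[OF this ab'] obtain q q' r r' where
    *: "(q, q') : gpoly R" "(r, r') : gpoly R" "a' = q * m + r" "b' = q' * n + r'" "r = 0 \<or> degree r < degree m"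
    by blast
   show ?thesis using *(3,4) *(1,2,5) gpoly_add[OF *(1) mon] by (force simp: a'_def b'_def algebra_simps)
  qed
 qed
qed

lemma iso_graph_converse: "iso_graph (R\<inverse>)"
 unfolding iso_graph_def using R iso_graph_0_iff by (auto simp: iso_graph_def)

text \<open>\<open>m\<close> is a minimal polynomial of \<open>x\<close> over
  \<open>Domain R\<close>, not normalised, and \<open>n\<close> its counterpart over
  \<open>Range R\<close>.\<close>

definition min_pair :: "'w => 'w poly \<times> 'w poly => bool" where
 "min_pair x = (%(m, n). (m, n) : gpoly R & m ~= 0 & poly m x = 0 &
   (\<forall>(a, b)  \<in>gpoly R. a ~= 0 --> poly a x = 0 --> degree m <= degree a))"

text \<open>The isomorphism from \<open>Domain R\<close> with \<open>x\<close> adjoined to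
  \<open>Range R\<close> with \<open>y\<close> adjoined. Values of polynomials suffice: for
  algebraic \<open>x\<close> inverses are again polynomials in \<open>x\<close>
  (\<open>adjoin_unit\<close>).\<close>

definition adjoin_graph :: "'w => 'w => ('w \<times> 'w) set" where
 "adjoin_graph x y = {(poly a x, poly b y) | a b. (a, b) : gpoly R}"

lemma min_pair_exists:
 assumes "algebraic_over (Domain R) x" obtains m n where "min_pair x (m, n)"
proof -
 obtain a where a: "a : polys_over (Domain R)" "a ~= 0" "poly a x = 0"
  using assms by (auto simp: algebraic_over_def)
 define h where "h z = (SOME w. (z, w) : R)" for z
 have h: "(z, h z) : R" if "z : Domain R" for z unfolding h_def by (rule someI_ex) (use that in blast)
 define b where "b = map_poly h a"
 have "(a, b) : gpoly R" using iso_graph_0_iff[OF h, of 0] iso_graph_0 a(1) h by (force simp: gpoly_def b_def polys_over_def coeff_map_poly)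
 with a(2,3) have "\<exists>m. m : gpoly R & fst m ~= 0 & poly (fst m) x = 0" by force
 from ex_has_least_nat[where P="%m. m : gpoly R & fst m ~= 0 & poly (fst m) x = 0"
   and m="%m. degree (fst m)"] this
 obtain m where "m : gpoly R & fst m ~= 0 & poly (fst m) x = 0"
  "\<forall>a. a : gpoly R & fst a ~= 0 & poly (fst a) x = 0 --> degree (fst m) <= degree (fst a)" by blast
 hence "min_pair x m" by (auto simp: min_pair_def)
 thus ?thesis using that by (metis surj_pair)
qed

context
 fixes x y :: 'w and m n :: "'w poly"
 assumes min: "min_pair x (m, n)" and y: "poly n y = 0"
begin

lemma min_D: "(m, n) : gpoly R" "m ~= 0" "poly m x = 0"
  "(a, b) : gpoly R ==> a ~= 0 ==> poly a x = 0 ==> degree m <= degree a" using min by (auto simp: min_pair_def)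

lemma adjoin_0_iff_aux:
 assumes ab: "(a, b) : gpoly R" and 0: "poly a x = 0"
 shows "poly b y = 0"
proof -
 obtain q q' r r' where *: "(q, q') : gpoly R" "(r, r') : gpoly R" "a = q * m + r"
  "b = q' * n + r'" "r = 0 \<or> degree r < degree m" using gpoly_divmod[OF ab min_D(1,2)] by blast
 have "r = 0" using 0 * min_D(3) min_D(4)[OF *(2)] *(5) by force
 thus ?thesis using gpoly_0_iff[OF *(2)] * y by simp
qed

text \<open>Euclid's algorithm for \<open>a\<close> and \<open>m\<close> on both sides of the graph
  at once. If the remainder of \<open>m\<close> by \<open>a\<close> vanishes at \<open>x\<close>,
  then \<open>a\<close> divides \<open>m\<close>, the cofactor vanishes at \<open>x\<close>, and
  minimality forces \<open>a\<close> to be constant.\<close>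

lemma adjoin_unit:
 assumes "(a, b) : gpoly R" "poly a x ~= 0"
 shows "\<exists>u v. (u, v) : gpoly R & poly u x * poly a x = 1 & poly v y * poly b y = 1" using assms
proof (induction "degree a" arbitrary: a b rule: less_induct)
 case less
 have a0: "a ~= 0" using less.prems(2) by auto
 show ?case
 proof (cases "degree m <= degree a")
  case True
  obtain q q' r r' where *: "(q, q') : gpoly R" "(r, r') : gpoly R" "a = q * m + r"
   "b = q' * n + r'" "r = 0 \<or> degree r < degree m" using gpoly_divmod[OF less.prems(1) min_D(1,2)] by blast
  have "poly r x = poly a x" "poly r' y = poly b y" using * min_D(3) y by simp_all
  thus ?thesis using less.hyps[OF _ *(2)] *(5) True less.prems(2) by auto
 next
  case False
  obtain q q' r r' where *: "(q, q') : gpoly R" "(r, r') : gpoly R" "m = q * a + r"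
   "n = q' * b + r'" "r = 0 \<or> degree r < degree a" using gpoly_divmod[OF min_D(1) less.prems(1) a0] by blast
  have xy: "poly q x * poly a x + poly r x = 0" "poly q' y * poly b y + poly r' y = 0"
   using * min_D(3) y by (metis poly_add poly_mult)+
  show ?thesis
  proof (cases "poly r x = 0")
   case r: False
   then obtain u v where "(u, v) : gpoly R" "poly u x * poly r x = 1" "poly v y * poly r' y = 1"
    using less.hyps[OF _ *(2)] *(5) by auto
   moreover have "poly r x = - (poly q x * poly a x)" "poly r' y = - (poly q' y * poly b y)"
    using xy by (simp_all add: eq_neg_iff_add_eq_0 add.commute)
   ultimately show ?thesis using gpoly_uminus[OF gpoly_mult[OF _ *(1)], of u v]
    by (intro exI[of _ "- (u * q)"] exI[of _ "- (v * q')"]) (simp add: mult.assoc)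
  next
   case True
   hence "r = 0" using min_D(4)[OF *(2)] *(5) False by fastforce
   hence q: "q ~= 0" "degree m = degree q + degree a" "poly q x = 0"
    using *(3) min_D(2) a0 xy(1) less.prems(2) by (auto simp: degree_mult_eq)
   hence "degree a = 0" using min_D(4)[OF *(1)] by simp
   moreover have "degree b = 0" using gpoly_degree[OF less.prems(1)] calculation by simp
   ultimately obtain c d where cd: "a = [:c:]" "b = [:d:]" by (metis degree_eq_zeroE)
   hence R: "(c, d) : R" using gpoly_coeff[OF less.prems(1), of 0] by simp
   moreover have "c ~= 0" "d ~= 0" using a0 cd iso_graph_0_iff[OF R] by auto
   ultimately show ?thesis using gpoly_const[OF iso_graph_inverse[OF R]] cd
    by (intro exI[of _ "[:inverse c:]"] exI[of _ "[:inverse d:]"]) simp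
  qed
 qed
qed

lemma iso_graph_adjoin: "iso_graph (adjoin_graph x y)" unfolding iso_graph_def
proof (intro conjI allI impI)
 show "(1, 1) : adjoin_graph x y" unfolding adjoin_graph_def using gpoly_1 by force
 show "y' = 0" if "(0, y') : adjoin_graph x y" for y'
  using that adjoin_0_iff_aux by (auto simp: adjoin_graph_def)
 fix x1 y1 assume 1: "(x1, y1) : adjoin_graph x y"
 then obtain a b where ab: "(a, b) : gpoly R" "x1 = poly a x" "y1 = poly b y" by (auto simp: adjoin_graph_def)
 show "(- x1, - y1) : adjoin_graph x y" unfolding adjoin_graph_def mem_Collect_eq
  by (intro exI[of _ "-a"] exI[of _ "-b"]) (use ab gpoly_uminus in auto)
 show "(inverse x1, inverse y1) : adjoin_graph x y"
 proof (cases "x1 = 0")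
  case True
  hence "y1 = 0" using ab adjoin_0_iff_aux by auto
  with True 1 show ?thesis by simp
 next
  case False
  then obtain u v where uv: "(u, v) : gpoly R" "poly u x * poly a x = 1" "poly v y * poly b y = 1"
   using adjoin_unit[OF ab(1)] ab by auto
  have "inverse x1 = poly u x" "inverse y1 = poly v y" using uv ab by (metis inverse_unique mult.commute)+
  thus ?thesis using uv(1) by (auto simp: adjoin_graph_def)
 qed
 fix x2 y2 assume "(x2, y2) : adjoin_graph x y"
 then obtain a' b' where ab': "(a', b') : gpoly R" "x2 = poly a' x" "y2 = poly b' y"
  by (auto simp: adjoin_graph_def)
 show "(x1 + x2, y1 + y2) : adjoin_graph x y" unfolding adjoin_graph_def mem_Collect_eq
  by (intro exI[of _ "a+a'"] exI[of _ "b+b'"]) (use ab ab' gpoly_add in auto)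
 show "(x1 * x2, y1 * y2) : adjoin_graph x y" unfolding adjoin_graph_def mem_Collect_eq
  by (intro exI[of _ "a*a'"] exI[of _ "b*b'"]) (use ab ab' gpoly_mult in auto)
qed

end

lemma adjoin_graph_supset: "R <= adjoin_graph x y"
proof
 fix p assume "p : R"
 hence "(poly [:fst p:] x, poly [:snd p:] y) : adjoin_graph x y"
  unfolding adjoin_graph_def using gpoly_const[of "fst p" "snd p"]
  by (metis (mono_tags, lifting) mem_Collect_eq prod.collapse)
 thus "p : adjoin_graph x y" by simp
qed

lemma adjoin_graph_mem: "(x, y) : adjoin_graph x y"
proof -
 have "(poly [:0, 1:] x, poly [:0, 1:] y) : adjoin_graph x y" unfolding adjoin_graph_def using gpoly_X by blast
 thus ?thesis by simp
qed

end

lemma algebraic_over_mono: "algebraic_over M x ==> M <= M' ==> algebraic_over M' x"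
 by (auto simp: algebraic_over_def polys_over_def)

lemma iso_graph_extend_Domain:
 fixes R :: "('w::alg_closed_field \<times> 'w) set"
 assumes R: "iso_graph R" and x: "algebraic_over (Domain R) x"
 obtains R' where "iso_graph R'" "R <= R'" "x : Domain R'"
proof -
 obtain m n where mn: "min_pair R x (m, n)" using min_pair_exists[OF R x] .
 hence mnD: "(m, n) : gpoly R" "m ~= 0" "poly m x = 0" by (auto simp: min_pair_def[OF R])
 have "degree m > 0"
 proof (rule ccontr)
  assume "~ degree m > 0"
  then obtain c where "m = [:c:]" by (auto elim: degree_eq_zeroE)
  with mnD(2,3) show False by simp
 qed
 hence "degree n > 0" using gpoly_degree[OF R mnD(1)] by simp
 then obtain y where y: "poly n y = 0" using has_root by blast
 show ?thesis using that iso_graph_adjoin[OF R mn y] adjoin_graph_supset[OF R] adjoin_graph_mem[OF R] by blast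
qed

text \<open>\<open>P\<close> is a further condition on the graphs: containing a given one, and later
  also respecting two places.\<close>

lemma iso_graph_Union_chain:
 assumes "K ~= {}" "subset.chain {R. iso_graph R & P R} K"
 shows "iso_graph (\<Union>K)"
proof -
 have c: "K <= {R. iso_graph R & P R}" "\<forall>Y\<in>K. \<forall>Z\<in>K. Y <= Z \<or> Z <= Y"
  using assms(2) by (simp_all add: subset_chain_def)
 have *: "\<exists>R\<in>K. Y <= R & Z <= R" if "Y : K" "Z : K" for Y Z using c(2) that by metis
 have iso: "iso_graph Z" if "Z : K" for Z using subsetD[OF c(1) that] by simp
 show ?thesis unfolding iso_graph_def
 proof (intro conjI allI impI)
  show "(1, 1) : \<Union>K" using assms(1) iso iso_graph_1 by fastforce
  show "y = 0" if "(0, y) : \<Union>K" for y using that iso iso_graph_0D by fastforce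
  show "(- x, - y) : \<Union>K" if "(x, y) : \<Union>K" for x y using that iso iso_graph_uminus by fastforce
  show "(inverse x, inverse y) : \<Union>K" if "(x, y) : \<Union>K" for x y using that iso iso_graph_inverse by fastforce
  fix x y x' y' assume "(x, y) : \<Union>K" "(x', y') : \<Union>K"
  then obtain Z where Z: "Z : K" "(x, y) : Z" "(x', y') : Z" using * by (meson UnionE subsetD)
  show "(x + x', y + y') : \<Union>K" using Z iso_graph_add[OF iso[OF Z(1)]] by blast
  show "(x * x', y * y') : \<Union>K" using Z iso_graph_mult[OF iso[OF Z(1)]] by blast
 qed
qed

lemma iso_graph_total:
 fixes R :: "('w::field \<times> 'w) set"
 assumes R: "iso_graph R" and dom: "Domain R = UNIV" and ran: "Range R = UNIV"
 obtains \<sigma> where "\<sigma> : field_auts" "!!x y. (x, y) : R \<longleftrightarrow> \<sigma> x = y"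
proof -
 define \<sigma> where "\<sigma> x = (SOME y. (x, y) : R)" for x
 have \<sigma>: "(x, \<sigma> x) : R" for x unfolding \<sigma>_def by (rule someI_ex) (use dom in blast)
 have eq: "(x, y) : R \<longleftrightarrow> \<sigma> x = y" for x y using \<sigma> iso_graph_eq_iff[OF R] by blast
 have "inj \<sigma>" using \<sigma> iso_graph_eq_iff[OF R] by (metis injI)
 moreover have "surj \<sigma>" using ran eq by (metis Range_iff UNIV_I surj_def)
 ultimately have "\<sigma> : field_auts" unfolding field_auts_def bij_def
  using eq iso_graph_add[OF R \<sigma> \<sigma>] iso_graph_mult[OF R \<sigma> \<sigma>] by auto
 thus ?thesis using eq that by blast
qed

text \<open>A maximal extension has full domain by the extension step and full range by the same
  step for the converse graph; hence algebraicity is asked on both sides.\<close>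

theorem iso_graph_extend_automorphism:
 fixes R :: "('w::alg_closed_field \<times> 'w) set"
 assumes R: "iso_graph R" and dom: "!!x. algebraic_over (Domain R) x" and ran: "!!x. algebraic_over (Range R) x"
 obtains \<sigma> where "\<sigma> : field_auts" "!!x y. (x, y) : R ==> \<sigma> x = y"
proof -
 define Q where "Q = {Z. iso_graph Z & R <= Z}"
 have "\<exists>M\<in>Q. \<forall>Z\<in>Q. M <= Z --> Z = M"
 proof (rule subset_Zorn_nonempty)
  show "Q ~= {}" using R by (auto simp: Q_def)
  show "\<Union>K  \<in>Q" if "K ~= {}" "subset.chain Q K" for K using iso_graph_Union_chain[OF that[unfolded Q_def]] that
   unfolding Q_def subset_chain_def by blast
 qed
 then obtain M where M: "iso_graph M" "R <= M" and max: "!!Z. iso_graph Z ==> M <= Z ==> Z = M"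
  unfolding Q_def by (metis (no_types, lifting) mem_Collect_eq order_trans)
 have "x : Domain M" for x
 proof -
  have "algebraic_over (Domain M) x" by (rule algebraic_over_mono[OF dom]) (use M(2) in blast)
  from iso_graph_extend_Domain[OF M(1) this] show ?thesis using max by metis
 qed
 moreover have "x : Range M" for x
 proof -
  have "algebraic_over (Domain (M\<inverse>)) x"
   using algebraic_over_mono[OF ran] M(2) by (metis Domain_converse Range_mono)
  from iso_graph_extend_Domain[OF iso_graph_converse[OF M(1)] this]
  obtain Z where Z: "iso_graph Z" "M\<inverse> <= Z" "x : Domain Z" .
  have "Z\<inverse> = M" by (rule max[OF iso_graph_converse[OF Z(1)]]) (use Z(2) in auto)
  with Z(3) show ?thesis by blast
 qed
 ultimately obtain \<sigma> where "\<sigma> : field_auts" "!!x y. (x, y) : M \<longleftrightarrow> \<sigma> x = y"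
  using iso_graph_total[OF M(1)] by (metis UNIV_eq_I)
 thus ?thesis using that M(2) by blast
qed

section \<open>Automorphisms over a subfield\<close>

definition subfld :: "'w::field set => bool" where "subfld M \<longleftrightarrow> 1 : M & (\<forall>x\<in>M. - x : M & inverse x : M) &
   (\<forall>x\<in>M. \<forall>y\<in>M. x + y : M & x * y : M)"

definition Aut :: "'w::field set => ('w => 'w) set" where "Aut M = {\<sigma> : field_auts. \<forall>x\<in>M. \<sigma> x = x}"

lemma subfld_D:
 assumes "subfld M"
 shows "1 : M" "0 : M" "x : M ==> - x : M" "x : M ==> inverse x : M"
  "x : M ==> y : M ==> x + y : M" "x : M ==> y : M ==> x * y : M"
  "x : M ==> y : M ==> x - y : M" "x : M ==> y : M ==> x / y : M" "x : M ==> x ^ n : M"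
proof -
 note * = assms[unfolded subfld_def]
 show 1: "1 : M" "x : M ==> - x : M" "x : M ==> inverse x : M"
  "x : M ==> y : M ==> x + y : M" "x : M ==> y : M ==> x * y : M" for x y using * by auto
 show "0 : M" using 1(4)[OF 1(1) 1(2)[OF 1(1)]] by simp
 show "x : M ==> y : M ==> x - y : M" using 1(4)[OF _ 1(2), of x y] by simp
 show "x : M ==> y : M ==> x / y : M" using 1(5)[OF _ 1(3), of x y] by (simp add: field_class.field_divide_inverse)
 show "x : M ==> x ^ n : M" by (induction n) (auto intro: 1)
qed

lemma subfld_iso_graph: "subfld M ==> iso_graph (Id_on M)" by (auto simp: iso_graph_def subfld_def)

lemma subfld_sum: "subfld M ==> (!!i. i : I ==> f i : M) ==> sum f I : M"
 by (induction I rule: infinite_finite_induct) (auto intro: subfld_D)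

lemma subfld_prod: "subfld M ==> (!!i. i : I ==> f i : M) ==> prod f I : M"
 by (induction I rule: infinite_finite_induct) (auto intro: subfld_D)

lemma aut_add: "\<sigma> : field_auts ==> \<sigma> (x + y) = \<sigma> x + \<sigma> y" and aut_mult: "\<sigma> : field_auts ==> \<sigma> (x * y) = \<sigma> x * \<sigma> y"
 and aut_bij: "\<sigma> : field_auts ==> bij \<sigma>" by (auto simp: field_auts_def)

context
 fixes \<sigma> :: "'w::field => 'w"
 assumes \<sigma>: "\<sigma> : field_auts"
begin

lemma aut_eq_iff: "\<sigma> x = \<sigma> y \<longleftrightarrow> x = y" using aut_bij[OF \<sigma>] by (simp add: bij_def inj_eq)

lemma aut_0: "\<sigma> 0 = 0" using aut_add[OF \<sigma>, of 0 0] by (metis add_0 add_cancel_right_right)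

lemma aut_0_iff: "\<sigma> x = 0 \<longleftrightarrow> x = 0" using aut_eq_iff[of x 0] aut_0 by simp

lemma aut_1: "\<sigma> 1 = 1" using aut_mult[OF \<sigma>, of 1 1] aut_0_iff[of 1] by simp

lemma aut_minus: "\<sigma> (- x) = - \<sigma> x"
 using aut_add[OF \<sigma>, of x "-x"] aut_0 by (simp add: eq_neg_iff_add_eq_0 add.commute)

lemma aut_diff: "\<sigma> (x - y) = \<sigma> x - \<sigma> y" using aut_add[OF \<sigma>, of x "-y"] aut_minus by simp

lemma aut_inverse: "\<sigma> (inverse x) = inverse (\<sigma> x)"
proof (cases "x = 0")
 case False
 hence "\<sigma> x * \<sigma> (inverse x) = 1" using aut_mult[OF \<sigma>, of x "inverse x"] aut_1 by simp
 thus ?thesis by (metis inverse_unique)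
qed (simp add: aut_0)

lemma aut_divide: "\<sigma> (x / y) = \<sigma> x / \<sigma> y"
 by (simp add: field_class.field_divide_inverse aut_mult[OF \<sigma>] aut_inverse)

lemma aut_power: "\<sigma> (x ^ n) = \<sigma> x ^ n" by (induction n) (simp_all add: aut_1 aut_mult[OF \<sigma>])

lemma aut_sum: "\<sigma> (sum f I) = (\<Sum>i\<in>I. \<sigma> (f i))"
 by (induction I rule: infinite_finite_induct) (simp_all add: aut_0 aut_add[OF \<sigma>])

lemma aut_prod: "\<sigma> (prod f I) = (\<Prod>i\<in>I. \<sigma> (f i))"
 by (induction I rule: infinite_finite_induct) (simp_all add: aut_1 aut_mult[OF \<sigma>])

lemma aut_poly: "\<sigma> (poly p x) = poly (map_poly \<sigma> p) (\<sigma> x)" by (induction p)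
  (simp_all add: aut_0 aut_add[OF \<sigma>] aut_mult[OF \<sigma>] map_poly_pCons)

lemma aut_inv: "iv \<sigma> : field_auts"
proof -
 have b: "bij \<sigma>" using \<sigma> by (rule aut_bij)
 have s: "\<sigma> (iv \<sigma> x) = x" for x using b by (simp add: bij_def surj_f_inv_f)
 have "iv \<sigma> (x + y) = iv \<sigma> x + iv \<sigma> y" "iv \<sigma> (x * y) = iv \<sigma> x * iv \<sigma> y" for x y by (rule aut_eq_iff[THEN iffD1],
    simp add: aut_add[OF \<sigma>] aut_mult[OF \<sigma>] s)+
 thus ?thesis using b by (simp add: field_auts_def bij_imp_bij_inv)
qed

lemma aut_f_inv: "\<sigma> (iv \<sigma> x) = x" using aut_bij[OF \<sigma>] by (simp add: bij_def surj_f_inv_f)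

lemma aut_inv_f: "iv \<sigma> (\<sigma> x) = x" using aut_bij[OF \<sigma>] by (simp add: bij_def inv_f_f)

lemma aut_inv_eq_iff: "iv \<sigma> x = y \<longleftrightarrow> x = \<sigma> y" using aut_f_inv aut_inv_f by metis

lemma aut_o_inv: "\<sigma> o iv \<sigma> = id" "iv \<sigma> o \<sigma> = id" by (auto simp: fun_eq_iff aut_f_inv aut_inv_f)

lemma aut_mem_image_iff: "x : \<sigma> ` V \<longleftrightarrow> iv \<sigma> x : V" using aut_f_inv aut_inv_f by (metis image_iff)

end

lemmas aut = aut_add aut_mult aut_power aut_0 aut_1 aut_divide

lemma aut_id: "id : field_auts" by (simp add: field_auts_def)

lemma aut_comp: "\<sigma> : field_auts ==> \<tau> : field_auts ==> \<sigma> o \<tau> : field_auts"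
 by (auto simp: field_auts_def intro: bij_comp)

lemma AutD: "\<sigma> : Aut M ==> \<sigma> : field_auts" "\<sigma> : Aut M ==> x : M ==> \<sigma> x = x" by (auto simp: Aut_def)

lemma Aut_id: "id : Aut M" by (simp add: Aut_def aut_id)

lemma Aut_comp: "\<sigma> : Aut M ==> \<tau> : Aut M ==> \<sigma> o \<tau> : Aut M" by (simp add: Aut_def aut_comp)

lemma Aut_inv: "\<sigma> : Aut M ==> iv \<sigma> : Aut M" by (simp add: Aut_def aut_inv aut_inv_eq_iff)

lemma inv_into_comp:
 assumes "\<sigma> : field_auts" "\<tau> : field_auts"
 shows "iv (\<sigma> o \<tau>) = iv \<tau> o iv \<sigma>" using assms by (simp add: o_inv_distrib aut_bij)

lemma inv_into_inv_into: "\<sigma> : field_auts ==> iv (iv \<sigma>) = \<sigma>" by (simp add: aut_bij inv_inv_eq)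

lemma Aut_orbit_finite:
 assumes "algebraic_over M x"
 shows "finite {\<sigma> x | \<sigma>. \<sigma> : Aut M}"
proof -
 obtain p where p: "p : polys_over M" "p ~= 0" "poly p x = 0" using assms by (auto simp: algebraic_over_def)
 have "\<sigma> x : {y. poly p y = 0}" if "\<sigma> : Aut M" for \<sigma>
 proof -
  have "map_poly \<sigma> p = p" using p(1) AutD[OF that] aut_0[OF AutD(1)[OF that]]
   by (auto simp: poly_eq_iff coeff_map_poly polys_over_def)
  thus ?thesis using aut_poly[OF AutD(1)[OF that], of p x] p(3) aut_0[OF AutD(1)[OF that]] by simp
 qed
 hence "{\<sigma> x | \<sigma>. \<sigma> : Aut M} <= {y. poly p y = 0}" by auto
 thus ?thesis using poly_roots_finite[OF p(2)] by (rule finite_subset)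
qed

lemma coeff_pcompose_square:
 fixes p :: "'a::comm_ring_1 poly"
 shows "coeff (pcompose p (monom 1 2)) (2 * i) = coeff p i" by (induction p arbitrary: i)
  (auto simp: pcompose_pCons coeff_pCons coeff_monom_mult numeral_2_eq_2 split: nat.splits)

lemma pcompose_power: "pcompose (p ^ n) q = pcompose p q ^ n" for p q :: "'a::comm_ring_1 poly"
 by (induction n) (simp_all add: pcompose_mult pcompose_1)

text \<open>In characteristic two (X + x)^(2r) = (X^2 + x^2)^r, so an even exponent is halved at the
  price of squaring \<open>x\<close>. For an odd exponent r the coefficient of X^(r-1) is r x =
  x.\<close>

lemma linear_power_coeffs_imp_power_mem:
 fixes x :: "'w::field"
 assumes M: "subfld M" and two: "(1::'w) + 1 = 0" and r: "r > 0" and c: "!!i. coeff ([:x, 1:] ^ r) i : M"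
 shows "\<exists>j. x ^ (2 ^ j) : M" using r c
proof (induction r arbitrary: x rule: less_induct)
 case (less r)
 show ?case
 proof (cases "even r")
  case True
  then obtain r' where r': "r = 2 * r'" by blast
  have "[:x, 1:] ^ 2 = [:x^2, 0, 1:]" using two by (simp add: sqr flip: distrib_right mult_2)
  also have "... = pcompose [:x^2, 1:] (monom 1 2)" by (simp add: pcompose_pCons monom_altdef sqr)
  finally have "[:x, 1:] ^ r = pcompose ([:x^2, 1:] ^ r') (monom 1 2)"
   by (simp add: r' power_mult pcompose_power)
  hence "coeff ([:x^2, 1:] ^ r') i = coeff ([:x, 1:] ^ r) (2 * i)" for i by (simp add: coeff_pcompose_square)
  with less.prems less.IH[of r' "x^2"] r' obtain j where "(x^2) ^ (2^j) : M" by auto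
  hence "x ^ (2 ^ Suc j) : M" by (simp flip: power_mult)
  thus ?thesis by blast
 next
  case False
  then obtain r' where r': "r = Suc (2 * r')" by (auto elim: oddE)
  have "of_nat r = (1::'w)" using two by (simp add: r')
  hence "coeff ([:x, 1:] ^ r) (r - 1) = x"
   using less.prems(1) by (subst coeff_linear_poly_power) (auto simp: r' binomial_symmetric[of "2*r'"])
  thus ?thesis using less.prems(2) by (metis power_0 power_one_right)
 qed
qed

lemma conjugate_exists:
 fixes x y :: "'w::alg_closed_field"
 assumes M: "subfld M" and alg: "!!x. algebraic_over M x"
  and m: "min_pair (Id_on M) x (m, m)" and y: "poly m y = 0"
 shows "\<exists>\<sigma>\<in>Aut M. \<sigma> x = y"
proof -
 note R = subfld_iso_graph[OF M]
 have "Id_on M <= adjoin_graph (Id_on M) x y" by (rule adjoin_graph_supset[OF R])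
 hence *: "M <= Domain (adjoin_graph (Id_on M) x y)" "M <= Range (adjoin_graph (Id_on M) x y)" by blast+
 obtain \<sigma> where \<sigma>: "\<sigma> : field_auts" "!!u v. (u, v) : adjoin_graph (Id_on M) x y ==> \<sigma> u = v"
  using iso_graph_extend_automorphism[OF iso_graph_adjoin[OF R m y]]
   algebraic_over_mono[OF alg *(1)] algebraic_over_mono[OF alg *(2)] by metis
 have "\<sigma> : Aut M" using \<sigma> \<open>Id_on M <= _\<close> by (auto simp: Aut_def)
 moreover have "\<sigma> x = y" by (rule \<sigma>(2)[OF adjoin_graph_mem[OF R]])
 ultimately show ?thesis by blast
qed

text \<open>Every root of the minimal polynomial is a conjugate of \<open>x\<close>, so this
  polynomial is a constant times a power of X + x. Only a power of \<open>x\<close> can be expected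
  in \<open>M\<close>: automorphisms do not see purely inseparable extensions.\<close>

theorem fixed_by_Aut:
 fixes x :: "'w::alg_closed_field"
 assumes M: "subfld M" and alg: "!!x. algebraic_over M x" and two: "(1::'w) + 1 = 0"
  and fixed: "!!\<sigma>. \<sigma> : Aut M ==> \<sigma> x = x"
 shows "\<exists>j. x ^ (2 ^ j) : M"
proof -
 note R = subfld_iso_graph[OF M]
 have "algebraic_over (Domain (Id_on M)) x" using alg by simp
 from min_pair_exists[OF R this] obtain m n where mn: "min_pair (Id_on M) x (m, n)" .
 have "m = n" using mn by (auto simp: min_pair_def[OF R] gpoly_def Id_on_iff poly_eq_iff)
 with mn have m: "min_pair (Id_on M) x (m, m)" by simp
 hence mD: "!!i. coeff m i : M" "m ~= 0" "poly m x = 0" by (auto simp: min_pair_def[OF R] gpoly_def)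
 have root: "y = x" if "poly m y = 0" for y using conjugate_exists[OF M alg m that] fixed by auto
 obtain Ax where Ax: "size Ax = degree m" "m = smult (lead_coeff m) (\<Prod>y\<in>#Ax. [:-y, 1:])"
  using alg_closed_imp_factorization[OF mD(2)] by blast
 have "\<forall>y\<in>#Ax. y = x"
 proof
  fix y assume "y \<in># Ax"
  hence "poly (\<Prod>y\<in>#Ax. [:-y, 1:]) y = 0" by (auto simp: poly_prod_mset)
  thus "y = x" using root Ax(2) by (metis mult_zero_right poly_smult)
 qed
 hence "Ax = replicate_mset (degree m) x" using set_mset_subset_singletonD[of Ax x] Ax(1) by auto
 hence "m = smult (lead_coeff m) ([:- x, 1:] ^ degree m)" using Ax(2) by simp
 moreover have mx: "- x = x" using two
  by (metis add.inverse_unique mult.left_neutral distrib_right mult_zero_left)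
 ultimately have m_eq: "m = smult (lead_coeff m) ([:x, 1:] ^ degree m)" by (simp only: mx)
 have "degree m > 0"
 proof (rule ccontr)
  assume "~ degree m > 0"
  then obtain c where "m = [:c:]" by (auto elim: degree_eq_zeroE)
  with mD(2,3) show False by simp
 qed
 moreover have "coeff ([:x, 1:] ^ degree m) i = coeff m i / lead_coeff m" for i
  using m_eq mD(2) by (metis coeff_smult leading_coeff_0_iff nonzero_mult_div_cancel_left)
 ultimately show ?thesis using linear_power_coeffs_imp_power_mem[OF M two] mD(1) subfld_D(8)[OF M] by metis
qed

section \<open>Places of the function field\<close>

type_synonym 'f acf = "'f poly fract alg_closure"

section \<open>Constants and the evaluation of polynomials with constant coefficients\<close>

lemma cst_add: "cst (a + b) = cst a + cst b" and cst_mult: "cst (a * b) = cst a * cst b"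
 and cst_minus: "cst (- a) = - cst a" and cst_diff: "cst (a - b) = cst a - cst b" and cst_0 [simp]: "cst 0 = 0"
 and cst_1 [simp]: "cst 1 = 1"
 by (simp_all add: const_ac_def Zero_fract_def One_fract_def pCons_one mult.commute
   flip: to_ac_add to_ac_mult to_ac_minus to_ac_diff to_ac_0 to_ac_1)

lemma cst_eq_iff [simp]: "cst a = cst b \<longleftrightarrow> a = b" by (simp add: const_ac_def eq_fract)

lemma cst_eq_0_iff [simp]: "cst a = 0 \<longleftrightarrow> a = 0" using cst_eq_iff[of a 0] by (simp del: cst_eq_iff)

lemma cst_eq_1_iff [simp]: "cst a = 1 \<longleftrightarrow> a = 1" using cst_eq_iff[of a 1] by (simp del: cst_eq_iff)

lemma cst_power: "cst (a ^ n) = cst a ^ n" by (induction n) (simp_all add: cst_mult)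

lemma cst_inverse: "cst (inverse a) = inverse (cst a)"
 by (cases "a = 0") (simp_all, metis cst_mult cst_1 inverse_unique right_inverse)

lemma cst_divide: "cst (a / b) = cst a / cst b"
 by (simp add: field_class.field_divide_inverse cst_mult cst_inverse)

lemma cst_sum: "cst (sum f I) = (\<Sum>i\<in>I. cst (f i))"
 by (induction I rule: infinite_finite_induct) (simp_all add: cst_add)

definition ceval :: "'f::field poly => 'f acf => 'f acf" where "ceval p x = poly (map_poly cst p) x"

lemma ceval_0 [simp]: "ceval 0 x = 0" and ceval_pCons [simp]: "ceval (pCons a p) x = cst a + x * ceval p x"
 by (simp_all add: ceval_def map_poly_pCons)

lemma ceval_1 [simp]: "ceval 1 x = 1" by (simp add: one_pCons)

lemma ceval_add: "ceval (p + q) x = ceval p x + ceval q x"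
proof (induction p arbitrary: q)
 case (pCons a p)
 thus ?case by (cases q) (simp add: cst_add algebra_simps)
qed simp

lemma ceval_smult: "ceval (smult a p) x = cst a * ceval p x"
 by (induction p) (simp_all add: cst_mult algebra_simps)

lemma ceval_mult: "ceval (p * q) x = ceval p x * ceval q x"
 by (induction p) (simp_all add: ceval_add ceval_smult algebra_simps)

lemma ceval_minus: "ceval (- p) x = - ceval p x" by (induction p) (simp_all add: cst_minus)

lemma ceval_diff: "ceval (p - q) x = ceval p x - ceval q x"
 using ceval_add[of p "-q"] by (simp add: ceval_minus)

lemma ceval_power: "ceval (p ^ n) x = ceval p x ^ n" by (induction n) (simp_all add: ceval_mult)

lemma ceval_monom: "ceval (monom a n) x = cst a * x ^ n" by (simp add: ceval_def map_poly_monom poly_monom)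

lemma ceval_sum: "ceval (sum f I) x = (\<Sum>i\<in>I. ceval (f i) x)"
 by (induction I rule: infinite_finite_induct) (simp_all add: ceval_add)

lemma ceval_pcompose: "ceval (pcompose p q) x = ceval p (ceval q x)"
 by (induction p) (simp_all add: pcompose_pCons ceval_add ceval_mult)

lemma ceval_const: "ceval p (cst a) = cst (poly p a)" by (induction p) (simp_all add: cst_add cst_mult)

lemma ceval_t: "ceval p t_ac = to_ac (Fract p 1)"
proof (induction p)
 case (pCons a p)
 have "ceval (pCons a p) t_ac = to_ac (Fract [:a:] 1 + Fract [:0, 1:] 1 * Fract p 1)"
  unfolding ceval_pCons pCons.IH by (simp only: const_ac_def t_ac_def to_ac_add to_ac_mult)
 thus ?case by simp
qed (simp add: Zero_fract_def flip: to_ac_0)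

lemma ceval_t_eq_0_iff: "ceval p t_ac = 0 \<longleftrightarrow> p = 0" by (simp add: ceval_t Zero_fract_def eq_fract flip: to_ac_0)

lemma t_ac_not_const: "t_ac ~= cst c" using ceval_t_eq_0_iff[of "[:-c, 1:]"] by (simp add: cst_minus)

lemma range_to_ac: "range to_ac = {ceval p t_ac / ceval q t_ac | p q. q ~= (0 :: 'f::field poly)}"
proof (intro equalityI subsetI)
 fix x :: "'f acf" assume "x : range to_ac"
 then obtain f where "x = to_ac f" by blast
 moreover obtain p q where "f = Fract p q" "q ~= 0" by (cases f)
 ultimately have "x = ceval p t_ac / ceval q t_ac" by (simp add: ceval_t flip: to_ac_divide)
 with \<open>q ~= 0\<close> show "x : {ceval p t_ac / ceval q t_ac | p q. q ~= 0}" by blast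
next
 fix x :: "'f acf" assume "x : {ceval p t_ac / ceval q t_ac | p q. q ~= 0}"
 thus "x : range to_ac" by (auto simp: ceval_t simp flip: to_ac_divide)
qed

lemma subfld_range_to_ac: "subfld (range to_ac)" unfolding subfld_def by (auto simp flip: to_ac_add to_ac_mult to_ac_minus to_ac_inverse)

lemma cst_in_range: "cst c : range to_ac" by (simp add: const_ac_def)

lemma algebraic_over_range_to_ac: "range to_ac <= M ==> algebraic_over M x"
proof -
 assume M: "range to_ac <= M"
 obtain p where p: "p ~= 0" "poly (map_poly to_ac p) x = 0" by (rule alg_closure_algebraic[of x])
 have "map_poly to_ac p : polys_over M" using M by (auto simp: polys_over_def coeff_map_poly)
 moreover have "map_poly to_ac p ~= 0" using p(1) by (simp add: map_poly_eq_0_iff)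
 ultimately show ?thesis using p(2) by (auto simp: algebraic_over_def)
qed

lemma gal_geom_eq: "gal_geom = Aut (range to_ac)" by (auto simp: gal_geom_def Aut_def)

text \<open>A nontrivial equation of \<open>x\<close> with coefficients in 'f[\<tau>]. Without
  denominators it survives translations and inversion of \<tau>, which move the parameter t to a
  local parameter of the projective line at any given point.\<close>

definition poly_rel :: "'f::field acf => 'f acf => bool" where "poly_rel \<tau> x \<longleftrightarrow>
   (\<exists>n c. (\<exists>i\<le>n. c i ~= 0) & (\<Sum>i\<le>n. ceval (c i) \<tau> * x ^ i) = 0)"

lemma common_denominator: "\<exists>d c. d ~= 0 & (\<forall>i. coeff (p :: 'a::idom fract poly) i * Fract d 1 = Fract (c i) 1)"
proof (induction p)
 case 0
 thus ?case by (intro exI[of _ 1] exI[of _ "%_. 0"]) (auto simp: Zero_fract_def)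
next
 case (pCons a p)
 then obtain d c where dc: "d ~= 0" "!!i. coeff p i * Fract d 1 = Fract (c i) 1" by blast
 obtain u w where a: "a = Fract u w" "w ~= 0" by (cases a)
 have "coeff (pCons a p) i * Fract (d * w) 1 = Fract ((case i of 0 => u * d | Suc j => c j * w)) 1" for i
 proof (cases i)
  case 0
  thus ?thesis using a by (simp add: eq_fract)
 next
  case (Suc j)
  have "coeff p j * Fract (d * w) 1 = coeff p j * Fract d 1 * Fract w 1" by simp
  also have "... = Fract (c j * w) 1" by (subst dc(2)) simp
  finally show ?thesis using Suc by simp
 qed
 with dc(1) a(2) show ?case
  by (intro exI[of _ "d * w"] exI[of _ "%i. case i of 0 => u * d | Suc j => c j * w"]) auto
qed

lemma poly_rel_t: "poly_rel t_ac (x :: 'f::field acf)"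
proof -
 obtain p where p: "p ~= 0" "poly (map_poly to_ac p) x = 0" by (rule alg_closure_algebraic[of x])
 obtain d c where dc: "d ~= 0" "!!i. coeff p i * Fract d 1 = Fract (c i) 1" using common_denominator by blast
 have c: "ceval (c i) t_ac = to_ac (coeff p i) * ceval d t_ac" for i
  by (simp add: ceval_t flip: to_ac_mult dc(2))
 have "degree (map_poly to_ac p) = degree p" by (rule map_poly_degree_eq) (use p in simp)
 hence "(\<Sum>i\<le>degree p. ceval (c i) t_ac * x ^ i) = poly (map_poly to_ac p) x * ceval d t_ac"
  unfolding poly_altdef sum_distrib_right by (intro sum.cong) (auto simp: c coeff_map_poly)
 moreover have "c (degree p) ~= 0" using c[of "degree p"] p(1) dc(1) by (auto simp: ceval_t_eq_0_iff)
 ultimately show ?thesis using p(2) unfolding poly_rel_def by auto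
qed

lemma poly_rel_translate:
 assumes "poly_rel \<tau> x"
 shows "poly_rel (\<tau> - cst a) x"
proof -
 obtain n c where *: "\<exists>i\<le>n. c i ~= 0" "(\<Sum>i\<le>n. ceval (c i) \<tau> * x ^ i) = 0"
  using assms by (auto simp: poly_rel_def)
 have "ceval (pcompose (c i) [:a, 1:]) (\<tau> - cst a) = ceval (c i) \<tau>" for i by (simp add: ceval_pcompose)
 moreover have "pcompose (c i) [:a, 1:] = 0 \<longleftrightarrow> c i = 0" for i by (rule pcompose_eq_0_iff) simp
 ultimately show ?thesis
  using * unfolding poly_rel_def by (intro exI[of _ n] exI[of _ "%i. pcompose (c i) [:a, 1:]"]) auto
qed

lemma ceval_reflect:
 assumes "\<tau> ~= 0" "degree p <= N"
 shows "ceval p \<tau> = \<tau> ^ N * ceval (monom 1 (N - degree p) * reflect_poly p) (inverse \<tau>)"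
proof -
 have d: "degree (map_poly cst p) = degree p" by (cases "p = 0") (auto intro: map_poly_degree_eq)
 have "ceval (reflect_poly p) (inverse \<tau>) = inverse \<tau> ^ degree p * ceval p \<tau>"
 proof -
  have "map_poly cst (reflect_poly p) = reflect_poly (map_poly cst p)"
   by (rule poly_eqI) (auto simp: coeff_map_poly coeff_reflect_poly d)
  thus ?thesis unfolding ceval_def using assms(1) d by (simp add: poly_reflect_poly_nz)
 qed
 hence "ceval (monom 1 (N - degree p) * reflect_poly p) (inverse \<tau>) =
   inverse \<tau> ^ (N - degree p) * inverse \<tau> ^ degree p * ceval p \<tau>" by (simp add: ceval_mult ceval_monom)
 also have "inverse \<tau> ^ (N - degree p) * inverse \<tau> ^ degree p = inverse \<tau> ^ N"
  using assms(2) by (simp flip: power_add)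
 finally show ?thesis using assms(1) by (simp add: power_inverse)
qed

lemma poly_rel_inverse:
 assumes "poly_rel \<tau> x" "\<tau> ~= 0"
 shows "poly_rel (inverse \<tau>) x"
proof -
 obtain n c where *: "\<exists>i\<le>n. c i ~= 0" "(\<Sum>i\<le>n. ceval (c i) \<tau> * x ^ i) = 0"
  using assms by (auto simp: poly_rel_def)
 define N where "N = Max ((%i. degree (c i)) ` {..n})"
 have N: "degree (c i) <= N" if "i <= n" for i unfolding N_def using that by (intro Max_ge) auto
 define d where "d i = monom 1 (N - degree (c i)) * reflect_poly (c i)" for i
 have "(\<Sum>i\<le>n. ceval (c i) \<tau> * x ^ i) = \<tau> ^ N * (\<Sum>i\<le>n. ceval (d i) (inverse \<tau>) * x ^ i)"
  unfolding sum_distrib_left d_def by (intro sum.cong) (auto simp: ceval_reflect[OF assms(2) N])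
 hence "(\<Sum>i\<le>n. ceval (d i) (inverse \<tau>) * x ^ i) = 0" using *(2) assms(2) by simp
 moreover have "d i ~= 0" if "c i ~= 0" for i using that by (simp add: d_def monom_eq_0_iff)
 ultimately show ?thesis using *(1) unfolding poly_rel_def by blast
qed

text \<open>Factors \<tau> are divided out as long as all coefficients vanish at 0; the result stays
  nonzero when reduced modulo \<tau>.\<close>

lemma poly_rel_primitive:
 assumes "poly_rel \<tau> x" "\<tau> ~= 0"
 shows "\<exists>n c. (\<exists>i\<le>n. poly (c i) 0 ~= 0) & (\<Sum>i\<le>n. ceval (c i) \<tau> * x ^ i) = 0"
proof -
 obtain n c i where *: "i <= n" "c i ~= 0" "(\<Sum>i\<le>n. ceval (c i) \<tau> * x ^ i) = 0"
  using assms by (auto simp: poly_rel_def)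
 thus ?thesis
 proof (induction "degree (c i)" arbitrary: c rule: less_induct)
  case less
  show ?case
  proof (cases "\<exists>i\<le>n. poly (c i) 0 ~= 0")
   case True
   thus ?thesis using less.prems by blast
  next
   case False
   hence "\<forall>i\<le>n. \<exists>d. c i = [:0, 1:] * d" using poly_eq_0_iff_dvd by (metis dvdE minus_zero)
   then obtain d where d: "c j = [:0, 1:] * d j" if "j <= n" for j by metis
   have "(\<Sum>j\<le>n. ceval (c j) \<tau> * x ^ j) = \<tau> * (\<Sum>j\<le>n. ceval (d j) \<tau> * x ^ j)"
    unfolding sum_distrib_left by (intro sum.cong) (auto simp: d)
   hence "(\<Sum>j\<le>n. ceval (d j) \<tau> * x ^ j) = 0" using less.prems(3) assms(2) by simp
   moreover have "d i ~= 0" "degree (d i) < degree (c i)"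
    using less.prems(1,2) d[of i] by (auto simp: degree_pCons_eq)
   ultimately show ?thesis using less.hyps less.prems(1) by blast
  qed
 qed
qed

section \<open>Valuation rings: ideal, units and residues\<close>

context
 fixes V :: "'f::field acf set"
 assumes V: "is_place V"
begin

lemma place_const: "cst c : V" and place_add: "x : V ==> y : V ==> x + y : V"
 and place_mult: "x : V ==> y : V ==> x * y : V" and place_total: "x : V \<or> inverse x : V"
 and place_proper: "V ~= UNIV" using V by (auto simp: is_place_def)

lemma place_0: "0 : V" and place_1: "1 : V" using place_const[of 0] place_const[of 1] by simp_all

lemma place_minus: "x : V ==> - x : V" using place_mult[OF place_const[of "-1"], of x] by (simp add: cst_minus)

lemma place_diff: "x : V ==> y : V ==> x - y : V" using place_add[OF _ place_minus] by fastforce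

lemma place_power: "x : V ==> x ^ n : V" by (induction n) (auto intro: place_1 place_mult)

lemma place_ceval: "x : V ==> ceval p x : V"
 by (induction p) (auto intro: place_0 place_add place_mult place_const)

lemma mi_subset: "x : mi V ==> x : V" by (simp add: place_ideal_def)

lemma mi_0: "0 : mi V" by (simp add: place_ideal_def place_0)

lemma mi_mult:
 assumes "x : mi V" "y : V"
 shows "x * y : mi V"
proof (rule ccontr)
 assume *: "x * y \<notin> mi V"
 have "x * y : V" using assms place_mult mi_subset by blast
 with * have nz: "x ~= 0" "y ~= 0" "inverse (x * y) : V" by (auto simp: place_ideal_def)
 hence "inverse x : V" using place_mult assms(2) nz by (force simp: field_simps)
 thus False using assms(1) nz(1) by (simp add: place_ideal_def)
qed

lemma mi_add:
 assumes "x : mi V" "y : mi V"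
 shows "x + y : mi V"
proof -
 have *: "x + y : mi V" if "x : mi V" "y : mi V" "x / y : V" "y ~= 0" for x y
  using mi_mult[OF that(2) place_add[OF that(3) place_1]] that(4) by (simp add: field_simps)
 consider "x = 0" | "y = 0" | "x ~= 0" "y ~= 0" by blast
 thus ?thesis
 proof cases
  case 3
  show ?thesis using place_total[of "x / y"] *[OF assms] *[OF assms(2,1)] 3 by (auto simp: add.commute)
 qed (use assms in auto)
qed

lemma mi_minus: "x : mi V ==> - x : mi V" using mi_mult[of x "-1"] place_minus[OF place_1] by simp

lemma mi_diff: "x : mi V ==> y : mi V ==> x - y : mi V" using mi_add[OF _ mi_minus] by fastforce

lemma mi_sum: "(!!i. i : I ==> f i : mi V) ==> sum f I : mi V"
 by (induction I rule: infinite_finite_induct) (auto intro: mi_0 mi_add)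

lemma place_unit: "x : V ==> x \<notin> mi V ==> x ~= 0 & inverse x : V" by (simp add: place_ideal_def)

lemma place_not_mem: "x \<notin> V ==> inverse x : mi V" using place_total[of x] by (auto simp: place_ideal_def)

lemma const_in_mi_iff: "cst c : mi V \<longleftrightarrow> c = 0"
 using place_const[of c] place_const[of "inverse c"] by (auto simp: place_ideal_def cst_inverse)

lemma one_not_in_mi: "1 \<notin> mi V" using const_in_mi_iff[of 1] by simp

lemma mi_mult_iff:
 assumes "x : V" "y : V"
 shows "x * y : mi V \<longleftrightarrow> x : mi V \<or> y : mi V"
proof
 assume xy: "x * y : mi V"
 show "x : mi V \<or> y : mi V"
 proof (rule ccontr)
  assume "~ ?thesis"
  hence "x ~= 0" "y ~= 0" "inverse x : V" "inverse y : V" using place_unit assms by auto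
  hence "x * y * (inverse x * inverse y) : mi V" using mi_mult[OF xy place_mult] by blast
  thus False using \<open>x ~= 0\<close> \<open>y ~= 0\<close> one_not_in_mi by (simp add: field_simps)
 qed
qed (use mi_mult[of x y] mi_mult[of y x] assms in \<open>auto simp: mult.commute\<close>)

lemma mi_power_iff: "x : V ==> n > 0 ==> x ^ n : mi V \<longleftrightarrow> x : mi V"
proof (induction n)
 case (Suc n)
 thus ?case using one_not_in_mi mi_mult_iff[OF Suc.prems(1) place_power[OF Suc.prems(1)]]
  by (cases "n = 0") auto
qed simp

lemma place_power_iff: "n > 0 ==> x ^ n : V \<longleftrightarrow> x : V"
proof
 assume n: "n > 0" and x: "x ^ n : V"
 show "x : V"
 proof (rule ccontr)
  assume "x \<notin> V"
  hence "inverse x : mi V" by (rule place_not_mem)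
  hence "inverse x ^ n * x ^ n : mi V" using mi_power_iff[OF mi_subset n] mi_mult x by simp
  moreover have "inverse x ^ n * x ^ n = 1"
  proof -
   have "x ~= 0" using \<open>x \<notin> V\<close> place_0 by auto
   hence "inverse x * x = 1" by simp
   thus ?thesis by (simp only: power_one flip: power_mult_distrib)
  qed
  ultimately show False using one_not_in_mi by simp
 qed
qed (rule place_power)

lemma place_congr_one_prod: "(!!i. i : I ==> f i : V & f i - 1 : mi V) ==> prod f I : V & prod f I - 1 : mi V"
proof (induction I rule: infinite_finite_induct)
 case (insert i I)
 hence *: "f i : V" "f i - 1 : mi V" "prod f I : V" "prod f I - 1 : mi V" by auto
 have "(f i - 1) * prod f I + (prod f I - 1) : mi V" using * by (intro mi_add mi_mult)
 moreover have "(f i - 1) * prod f I + (prod f I - 1) = f i * prod f I - 1" by (simp add: left_diff_distrib)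
 ultimately have "f i * prod f I - 1 : mi V" by simp
 thus ?case using insert(1,2) *(1,3) place_mult by simp
qed (simp_all add: place_1 mi_0)

text \<open>A valuation ring is integrally closed: if \<open>x\<close> is not in \<open>V\<close>,
  dividing an equation for \<open>x\<close> by its top power puts the leading coefficient, a unit of
  \<open>V\<close>, into the ideal. So a place containing \<open>M\<close> would be
  everything.\<close>

lemma place_subfield_not_subset:
 assumes M: "subfld M" "!!x. algebraic_over M x"
 shows "~ M <= V"
proof
 assume MV: "M <= V"
 have "x : V" for x
 proof (rule ccontr)
  assume x: "x \<notin> V"
  hence ix: "inverse x : mi V" "x ~= 0" using place_not_mem place_0 by auto
  obtain p where p: "p : polys_over M" "p ~= 0" "poly p x = 0" using M(2) unfolding algebraic_over_def by blast
  have c: "coeff p i : M" for i using p(1) by (simp add: polys_over_def)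
  have "poly p x * inverse x ^ degree p = (\<Sum>i\<le>degree p. coeff p i * inverse x ^ (degree p - i))"
   unfolding poly_altdef sum_distrib_right
   by (intro sum.cong refl) (use ix(2) in \<open>simp add: power_inverse power_diff field_simps\<close>)
  also have "... = lead_coeff p + (\<Sum>i<degree p. coeff p i * inverse x ^ (degree p - i))"
   by (simp add: lessThan_Suc_atMost[symmetric] add.commute)
  finally have *: "lead_coeff p = - (\<Sum>i<degree p. coeff p i * inverse x ^ (degree p - i))"
   using p(3) by (simp add: eq_neg_iff_add_eq_0)
  have "(\<Sum>i<degree p. coeff p i * inverse x ^ (degree p - i)) : mi V"
  proof (rule mi_sum)
   fix i assume "i : {..<degree p}"
   hence "inverse x ^ (degree p - i) : mi V" using mi_power_iff[OF mi_subset[OF ix(1)]] ix(1) by simp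
   thus "coeff p i * inverse x ^ (degree p - i) : mi V" using mi_mult c MV by (metis mult.commute subsetD)
  qed
  hence "lead_coeff p : mi V" using * mi_minus by simp
  moreover have "inverse (lead_coeff p) : V" using c MV subfld_D(4)[OF M(1)] by blast
  ultimately show False using p(2) by (simp add: place_ideal_def)
 qed
 thus False using place_proper by blast
qed

end

lemma place_ceval_unit:
 fixes V :: "'f::alg_closed_field acf set"
 assumes V: "is_place V" and x: "x : V" and nc: "!!c. x - cst c \<notin> mi V" and p: "p ~= 0"
 shows "ceval p x \<notin> mi V"
proof -
 obtain A where A: "p = smult (lead_coeff p) (\<Prod>y\<in>#A. [:-y, 1:])"
  using alg_closed_imp_factorization[OF p] by blast
 have "ceval (\<Prod>y\<in>#A. [:-y, 1:]) x \<notin> mi V"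
 proof (induction A)
  case empty
  thus ?case using one_not_in_mi[OF V] by simp
 next
  case (add y A)
  have "ceval [:-y, 1:] x \<notin> mi V" using nc[of y] by (simp add: cst_minus)
  thus ?case using add mi_mult_iff[OF V place_ceval[OF V x] place_ceval[OF V x]]
   by (simp only: ceval_mult image_mset_add_mset prod_mset.add_mset) blast
 qed
 moreover have "cst (lead_coeff p) \<notin> mi V" using const_in_mi_iff[OF V] p by simp
 ultimately show ?thesis using A mi_mult_iff[OF V place_const[OF V] place_ceval[OF V x]] by (metis ceval_smult)
qed

text \<open>The residue field is algebraic over 'f, hence equal to it: a primitive relation of
  \<open>x\<close> over a parameter \<tau> in the ideal reduces to a nonzero polynomial over 'f that
  kills the residue of \<open>x\<close>.\<close>

theorem place_residue_exists:
 fixes V :: "'f::alg_closed_field acf set"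
 assumes V: "is_place V" and x: "x : V"
 shows "\<exists>c. x - cst c : mi V"
proof -
 \<comment> \<open>A local parameter of the projective line below \<open>V\<close>: t - c at an
   affine point and 1 / t at infinity.\<close>
 have "\<exists>\<tau>. \<tau> : mi V & \<tau> ~= 0 & (\<forall>y. poly_rel \<tau> y)"
 proof (cases "t_ac : V")
  case True
  \<comment> \<open>Otherwise every nonzero polynomial in t is a unit at \<open>V\<close>, and
    \<open>V\<close> contains all of 'f(t).\<close>
  have "\<exists>c. t_ac - cst c : mi V"
  proof (rule ccontr)
   assume nc: "~ ?thesis"
   have "ceval p t_ac / ceval q t_ac : V" if "q ~= 0" for p q
    using place_unit[OF V place_ceval[OF V True] place_ceval_unit[OF V True _ that]] nc
     place_mult[OF V place_ceval[OF V True]] by (simp add: field_class.field_divide_inverse)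
   thus False using place_subfield_not_subset[OF V subfld_range_to_ac algebraic_over_range_to_ac] by (auto simp: range_to_ac)
  qed
  then obtain c where "t_ac - cst c : mi V" by blast
  thus ?thesis using poly_rel_translate[OF poly_rel_t] t_ac_not_const by (intro exI[of _ "t_ac - cst c"]) auto
 next
  case False
  moreover have "t_ac ~= 0" using t_ac_not_const[of 0] by simp
  ultimately show ?thesis
   using place_not_mem[OF V False] poly_rel_inverse[OF poly_rel_t] by (intro exI[of _ "inverse t_ac"]) auto
 qed
 then obtain \<tau> where \<tau>: "\<tau> : mi V" "\<tau> ~= 0" "poly_rel \<tau> x" by blast
 from poly_rel_primitive[OF \<tau>(3,2)] obtain n c i where
  *: "i <= n" "poly (c i) 0 ~= 0" "(\<Sum>i\<le>n. ceval (c i) \<tau> * x ^ i) = 0" by blast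
 define D where "D = (\<Sum>i\<le>n. monom (poly (c i) 0) i)"
 have "coeff D i = poly (c i) 0" using *(1) by (simp add: D_def coeff_sum)
 hence "D ~= 0" using *(2) by auto
 have "ceval p \<tau> - cst (poly p 0) : mi V" for p using mi_mult[OF V \<tau>(1) place_ceval[OF V mi_subset[OF V \<tau>(1)]]]
  by (cases p) simp
 hence "(\<Sum>i\<le>n. (ceval (c i) \<tau> - cst (poly (c i) 0)) * x ^ i) : mi V"
  by (intro mi_sum[OF V] mi_mult[OF V] place_power[OF V x])
 moreover have "(\<Sum>i\<le>n. (ceval (c i) \<tau> - cst (poly (c i) 0)) * x ^ i) = - ceval D x"
  using *(3) by (simp add: left_diff_distrib sum_subtractf D_def ceval_sum ceval_monom)
 ultimately have "ceval D x : mi V" using mi_minus[OF V] by fastforce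
 thus ?thesis using place_ceval_unit[OF V x _ \<open>D ~= 0\<close>] by blast
qed

lemma place_residue_unique:
 assumes V: "is_place V" and "x - cst c : mi V" "x - cst d : mi V"
 shows "c = d" using mi_diff[OF V assms(3,2)] const_in_mi_iff[OF V, of "c - d"] by (simp add: cst_diff)

lemma mi_image:
 assumes "\<sigma> : field_auts"
 shows "mi (\<sigma> ` V) = \<sigma> ` mi V"
proof -
 have *: "x : mi (\<sigma> ` V) \<longleftrightarrow> iv \<sigma> x : mi V" for x using aut_inv[OF assms]
  by (simp add: place_ideal_def aut_mem_image_iff[OF assms] aut_inverse aut_0_iff)
 show ?thesis by (rule Set.set_eqI) (simp only: * aut_mem_image_iff[OF assms])
qed

lemma is_place_image:
 assumes \<sigma>: "\<sigma> : field_auts" and V: "is_place V" and c: "\<sigma> ` range cst = range cst"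
 shows "is_place (\<sigma> ` V)"
proof -
 note i = aut_inv[OF \<sigma>]
 have "iv \<sigma> (cst a) : V" for a
 proof -
  have "cst a : \<sigma> ` range cst" using c by simp
  then obtain b where "cst a = \<sigma> (cst b)" by blast
  thus ?thesis using place_const[OF V] by (simp add: aut_inv_f[OF \<sigma>])
 qed
 moreover have "\<sigma> ` V ~= UNIV"
  using place_proper[OF V] aut_inv_f[OF \<sigma>] by (metis UNIV_eq_I UNIV_I aut_mem_image_iff[OF \<sigma>])
 ultimately show ?thesis using place_add[OF V] place_mult[OF V] place_total[OF V]
  by (auto simp: is_place_def aut_mem_image_iff[OF \<sigma>] aut[OF i] aut_inverse[OF i] simp del: image_iff)
qed

lemma is_place_image_over:
 assumes "\<sigma> : Aut M" "range cst <= M" "is_place V"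
 shows "is_place (\<sigma> ` V)"
proof -
 have "\<sigma> ` range cst = range cst" using assms(2) AutD(2)[OF assms(1)] by (force simp: image_iff)
 thus ?thesis using is_place_image[OF AutD(1)[OF assms(1)] assms(3)] by blast
qed

lemma place_prod:
 assumes "is_place V"
 shows "(!!i. i : I ==> f i : V) ==> prod f I : V"
 by (induction I rule: infinite_finite_induct) (auto intro: place_1 place_mult assms)

section \<open>Approximation at finitely many places\<close>

lemma alg_closed_field_infinite: "infinite (UNIV :: 'f::alg_closed_field set)"
proof
 assume fin: "finite (UNIV :: 'f set)"
 define p where "p = (\<Prod>a\<in>(UNIV::'f set). [:-a, 1:]) + 1"
 have "poly p x = 1" for x using prod_zero_iff[OF fin, of "%a. x - a"] by (simp add: p_def poly_prod)
 moreover have "degree (\<Prod>a\<in>(UNIV::'f set). [:-a, 1:]) = card (UNIV :: 'f set)"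
  by (subst degree_prod_eq_sum_degree) auto
 hence "degree p > 0" using fin unfolding p_def by (subst degree_add_eq_left) (auto simp: card_gt_0_iff)
 ultimately show False using has_root[of p] by auto
qed

text \<open>Some \<open>x\<close> in \<open>N\<close> lies in exactly one of \<open>U\<close> and
  \<open>W\<close>. The inverse of x - c, for a suitable constant c, has no pole in \<open>P\<close>
  and different residues at \<open>U\<close> and \<open>W\<close>; an affine function of it takes
  the residues 1 and 0.\<close>

lemma places_separate:
 fixes U W :: "'f::alg_closed_field acf set"
 assumes fin: "finite P" and P: "!!V. V : P ==> is_place V"
  and UW: "U : P" "W : P" "U \<inter> N ~= W \<inter> N" and N: "subfld N" "range cst <= N"
 shows "\<exists>e\<in>N. (\<forall>V\<in>P. e : V) & e - 1 : mi U & e : mi W"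
proof -
 note PU = P[OF UW(1)] and PW = P[OF UW(2)]
 have inN: "cst c : N" for c using N(2) by blast
 obtain x where x: "x : N" "x : U \<longleftrightarrow> x \<notin> W" using UW(3) by blast
 \<comment> \<open>The finitely many constants to be avoided: the residues of \<open>x\<close> at
   the places of \<open>P\<close>.\<close>
 define B where "B = {c. \<exists>V\<in>P. x - cst c : mi V}"
 have "finite B"
 proof -
  have "B <= (%V. THE c. x - cst c : mi V) ` P"
  proof
   fix c assume "c : B"
   then obtain V where V: "V : P" "x - cst c : mi V" by (auto simp: B_def)
   hence "(THE c. x - cst c : mi V) = c" using place_residue_unique[OF P] by blast
   thus "c : (%V. THE c. x - cst c : mi V) ` P" using V by force
  qed
  thus ?thesis using fin finite_subset by blast
 qed
 then obtain c where c: "c \<notin> B" using ex_new_if_finite[OF alg_closed_field_infinite] by blast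
 define y where "y = inverse (x - cst c)"
 have yN: "y : N" unfolding y_def using x(1) inN N(1) by (intro subfld_D)
 have nc: "x - cst c \<notin> mi V" if "V : P" for V using c that by (auto simp: B_def)
 have xc: "x - cst c : V \<longleftrightarrow> x : V" if "V : P" for V
  using place_add[OF P[OF that] _ place_const[OF P[OF that]], of "x - cst c" c]
   place_diff[OF P[OF that] _ place_const[OF P[OF that]], of x c] by auto
 have yV: "y : V" if "V : P" for V using place_unit[OF P[OF that], of "x - cst c"] nc[OF that]
   mi_subset[OF P[OF that] place_not_mem[OF P[OF that], of "x - cst c"]] by (auto simp: y_def)
 have ym: "y : mi V \<longleftrightarrow> x \<notin> V" if "V : P" for V
 proof
  show "y : mi V" if "x \<notin> V"
   using place_not_mem[OF P[OF \<open>V : P\<close>], of "x - cst c"] xc[OF \<open>V : P\<close>] that by (simp add: y_def)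
  show "x \<notin> V" if "y : mi V"
  proof
   assume "x : V"
   hence *: "x - cst c : V" using xc[OF \<open>V : P\<close>] by simp
   thus False using place_unit[OF P[OF \<open>V : P\<close>] *] nc[OF \<open>V : P\<close>] that * by (simp add: place_ideal_def y_def)
  qed
 qed
 obtain u where u: "y - cst u : mi U" using place_residue_exists[OF PU yV[OF UW(1)]] by blast
 obtain w where w: "y - cst w : mi W" using place_residue_exists[OF PW yV[OF UW(2)]] by blast
 have "u ~= w"
 proof
  assume "u = w"
  have "u = 0 \<longleftrightarrow> y : mi U" using place_residue_unique[OF PU u, of 0] u by auto
  moreover have "w = 0 \<longleftrightarrow> y : mi W" using place_residue_unique[OF PW w, of 0] w by auto
  ultimately show False using ym[OF UW(1)] ym[OF UW(2)] x(2) \<open>u = w\<close> by blast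
 qed
 define e where "e = (y - cst w) * cst (inverse (u - w))"
 have "e - 1 = (y - cst u) * cst (inverse (u - w))"  using \<open>u ~= w\<close> unfolding e_def cst_inverse cst_diff by (simp add: divide_simps)
 hence "e - 1 : mi U" using mi_mult[OF PU u place_const[OF PU]] by simp
 moreover have "e : mi W" unfolding e_def by (rule mi_mult[OF PW w place_const[OF PW]])
 moreover have "e : V" if "V : P" for V unfolding e_def by (intro place_mult place_diff place_const yV P that)
 moreover have "e : N" unfolding e_def by (intro subfld_D N yN inN)
 ultimately show ?thesis by blast
qed

lemma places_separate_sets:
 fixes P Q :: "'f::alg_closed_field acf set set"
 assumes fin: "finite P" "finite Q" and PQ: "!!V. V : P \<union> Q ==> is_place V"
  and ne: "!!U W. U : P ==> W : Q ==> U \<inter> N ~= W \<inter> N" and N: "subfld N" "range cst <= N"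
 shows "\<exists>e\<in>N. (\<forall>U\<in>P. e : U & e - 1 : mi U) & (\<forall>W\<in>Q. e : mi W)"
proof -
 have "\<forall>U\<in>P. \<forall>W\<in>Q. \<exists>e. e : N & (\<forall>V\<in>P\<union>Q. e : V) & e - 1 : mi U & e : mi W"
 proof (intro ballI)
  fix U W assume "U : P" "W : Q"
  hence "\<exists>e\<in>N. (\<forall>V\<in>P\<union>Q. e : V) & e - 1 : mi U & e : mi W"
   using fin ne by (intro places_separate[of "P \<union> Q"] PQ N) auto
  thus "\<exists>e. e : N & (\<forall>V\<in>P\<union>Q. e : V) & e - 1 : mi U & e : mi W" by (simp add: Bex_def)
 qed
 note ex = this
 define f where "f U W = (SOME e. e : N & (\<forall>V\<in>P\<union>Q. e : V) & e - 1 : mi U & e : mi W)" for U W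
 have "f U W : N & (\<forall>V\<in>P\<union>Q. f U W : V) & f U W - 1 : mi U & f U W : mi W" if "U : P" "W : Q" for U W
  unfolding f_def by (rule someI_ex) (use ex that in blast)
 hence f: "!!U W. U : P ==> W : Q ==> f U W : N" "!!U W V. U : P ==> W : Q ==> V : P \<union> Q ==> f U W : V"
  "!!U W. U : P ==> W : Q ==> f U W - 1 : mi U" "!!U W. U : P ==> W : Q ==> f U W : mi W" by simp_all
 have prodm: "prod h I : mi V" if "V : P \<union> Q" "finite I" "!!i. i : I ==> h i : V" "i : I" "h i : mi V"
  for h V i and I :: "'f acf set set"
  using mi_mult[OF PQ[OF that(1)] that(5) place_prod[OF PQ[OF that(1)], of "I - {i}" h]] that(2,3,4)
  by (simp add: prod.remove[OF that(2,4)])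
 define a where "a U = (\<Prod>W\<in>Q. f U W)" for U
 have a: "a U : N" "a U : V" "a U - 1 : mi U" "!!W. W : Q ==> a U : mi W" if "U : P" "V : P \<union> Q" for U V
 proof -
  show "a U : N" unfolding a_def by (intro subfld_prod[OF N(1)] f that)
  show "a U : V" unfolding a_def by (rule place_prod[OF PQ[OF that(2)]]) (use that f in blast)
  show "a U - 1 : mi U" unfolding a_def using place_congr_one_prod[OF PQ, of U Q "f U"] that f by blast
  show "a U : mi W" if "W : Q" for W
   unfolding a_def by (rule prodm[of W _ _ W]) (use fin f that \<open>U : P\<close> in auto)
 qed
 \<comment> \<open>Each \<open>a U\<close> is 1 at \<open>U\<close> and 0 on all of
   \<open>Q\<close>; this combination is 1 on all of \<open>P\<close> and still 0 on
   \<open>Q\<close>.\<close>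
 define e where "e = 1 - (\<Prod>U\<in>P. 1 - a U)"
 have "e : N" unfolding e_def
  by (intro subfld_D(7)[OF N(1)] subfld_prod[OF N(1)] subfld_D(1)[OF N(1)]) (use a in blast)
 moreover have "e : U & e - 1 : mi U" if U: "U : P" for U
 proof -
  have "1 - a U : mi U" using mi_minus[OF PQ a(3)[OF U]] U by fastforce
  hence *: "(\<Prod>U\<in>P. 1 - a U) : mi U"
   using U by (intro prodm[of U P _ U]) (use fin a in \<open>auto intro!: place_diff place_1 PQ\<close>)
  have PU: "is_place U" using U PQ by blast
  have "e - 1 : mi U" using mi_minus[OF PU *] by (simp add: e_def)
  moreover have "e : U" unfolding e_def using place_diff[OF PU place_1[OF PU] mi_subset[OF PU *]] .
  ultimately show ?thesis by blast
 qed
 moreover have "e : mi W" if W: "W : Q" for W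
 proof -
  have PW: "is_place W" using W PQ by blast
  have "(1 - a U) : W & (1 - a U) - 1 : mi W" if "U : P" for U using place_diff[OF PW place_1[OF PW] a(2)[OF that, of W]] mi_minus[OF PW a(4)[OF that _ W]] W by auto
  hence "(\<Prod>U\<in>P. 1 - a U) - 1 : mi W" using place_congr_one_prod[OF PW, of P "%U. 1 - a U"] by blast
  hence "- ((\<Prod>U\<in>P. 1 - a U) - 1) : mi W" by (rule mi_minus[OF PW])
  thus ?thesis by (simp add: e_def)
 qed
 ultimately show ?thesis by blast
qed

section \<open>Normal extensions and the conjugacy of places\<close>

definition fix_field :: "'w::field set => 'w set => 'w set" where
 "fix_field M S = {x. \<forall>\<sigma>\<in>Aut M. (\<forall>z\<in>S. \<sigma> z = z) --> \<sigma> x = x}"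

lemma fix_field: "subfld (fix_field M S)" "M <= fix_field M S" "S <= fix_field M S"
proof -
 have F: "\<sigma> : field_auts" if "\<sigma> : Aut M" for \<sigma> using that by (rule AutD(1))
 show "subfld (fix_field M S)" unfolding subfld_def fix_field_def
  by (auto simp: aut_1 aut_minus aut_inverse aut_add aut_mult F)
qed (auto simp: fix_field_def Aut_def)

lemma fix_field_agree:
 assumes \<sigma>: "\<sigma> : Aut M" and \<tau>: "\<tau> : Aut M" and eq: "\<forall>z\<in>S. \<sigma> z = \<tau> z" and x: "x : fix_field M S"
 shows "\<sigma> x = \<tau> x"
proof -
 note i = aut_inv_eq_iff[OF AutD(1)[OF \<tau>]]
 have "iv \<tau> o \<sigma> : Aut M" "\<forall>z\<in>S. (iv \<tau> o \<sigma>) z = z" using Aut_comp[OF Aut_inv[OF \<tau>] \<sigma>] eq by (simp_all add: i)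
 hence "(iv \<tau> o \<sigma>) x = x" using x unfolding fix_field_def by blast
 thus ?thesis by (simp add: i)
qed

lemma Aut_finite_reps:
 fixes M :: "'w::field set"
 assumes alg: "!!x. algebraic_over M x" and fin: "finite S"
 obtains R where "finite R" "R <= Aut M" "\<forall>\<sigma>\<in>Aut M. \<exists>\<tau>\<in>R. \<forall>x\<in>S. \<sigma> x = \<tau> x"
  "\<forall>\<sigma>\<in>R. \<forall>\<tau>\<in>R. (\<forall>x\<in>S. \<sigma> x = \<tau> x) --> \<sigma> = \<tau>"
proof -
 define rs where "rs \<sigma> = restrict \<sigma> S" for \<sigma> :: "'w => 'w"
 have rs_eq: "rs \<sigma> = rs \<tau> \<longleftrightarrow> (\<forall>x\<in>S. \<sigma> x = \<tau> x)" for \<sigma> \<tau> by (auto simp: rs_def fun_eq_iff)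
 have "rs ` Aut M <= (\<Pi>\<^sub>E x\<in>S. {\<sigma> x | \<sigma>. \<sigma> : Aut M})" by (auto simp: rs_def)
 moreover have "finite (\<Pi>\<^sub>E x\<in>S. {\<sigma> x | \<sigma>. \<sigma> : Aut M})"
  by (rule finite_PiE[OF fin]) (rule Aut_orbit_finite[OF alg])
 ultimately have "finite (rs ` Aut M)" by (rule finite_subset)
 moreover obtain R where R: "R <= Aut M" "inj_on rs R" "rs ` Aut M = rs ` R"
  using subset_image_inj[of "rs ` Aut M" rs "Aut M"] by (metis subset_refl)
 ultimately have "finite R" by (simp add: finite_image_iff)
 have "\<exists>\<tau>\<in>R. \<forall>x\<in>S. \<sigma> x = \<tau> x" if "\<sigma> : Aut M" for \<sigma>
 proof -
  have "rs \<sigma> : rs ` R" unfolding R(3)[symmetric] using that by (rule imageI)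
  then obtain \<tau> where "rs \<sigma> = rs \<tau>" "\<tau> : R" by (rule imageE)
  thus ?thesis unfolding rs_eq by blast
 qed
 moreover have "\<sigma> = \<tau>" if "\<sigma> : R" "\<tau> : R" "\<forall>x\<in>S. \<sigma> x = \<tau> x" for \<sigma> \<tau>
  using inj_onD[OF R(2), of \<sigma> \<tau>] that by (simp add: rs_eq)
 ultimately show ?thesis using that[OF \<open>finite R\<close> R(1)] by blast
qed

text \<open>\<open>N\<close> is the fixed field of the pointwise stabiliser of the orbit of
  \<open>y\<close>. It may exceed the normal closure by inseparable elements, but it is stable under
  \<open>Aut M\<close> and only finitely many maps arise on it.\<close>

lemma normal_closure_exists:
 fixes y :: "'w::field"
 assumes alg: "!!x. algebraic_over M x" obtains N T where "subfld N" "M <= N" "y : N" "\<forall>\<sigma>\<in>Aut M. \<forall>x\<in>N. \<sigma> x : N"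
  "finite T" "T <= Aut M" "\<forall>\<sigma>\<in>Aut M. \<exists>\<tau>\<in>T. \<forall>x\<in>N. \<sigma> x = \<tau> x"
proof -
 define Y where "Y = {\<sigma> y | \<sigma>. \<sigma> : Aut M}"
 have finY: "finite Y" unfolding Y_def by (rule Aut_orbit_finite[OF alg])
 have yY: "y : Y" unfolding Y_def using Aut_id[of M] by (metis (mono_tags, lifting) id_apply mem_Collect_eq)
 have YY: "\<sigma> z : Y" if "\<sigma> : Aut M" "z : Y" for \<sigma> z
 proof -
  from that(2) obtain \<tau> where "z = \<tau> y" "\<tau> : Aut M" by (auto simp: Y_def)
  hence "\<sigma> z = (\<sigma> o \<tau>) y" "\<sigma> o \<tau> : Aut M" using Aut_comp[OF that(1)] by auto
  thus ?thesis unfolding Y_def by blast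
 qed
 have "\<sigma> x : fix_field M Y" if \<sigma>: "\<sigma> : Aut M" and x: "x : fix_field M Y" for \<sigma> x
  unfolding fix_field_def mem_Collect_eq
 proof (intro ballI impI)
  fix \<tau> assume \<tau>: "\<tau> : Aut M" "\<forall>z\<in>Y. \<tau> z = z"
  have "(\<tau> o \<sigma>) x = \<sigma> x" by (rule fix_field_agree[OF Aut_comp[OF \<tau>(1) \<sigma>] \<sigma> _ x]) (use YY \<sigma> \<tau>(2) in simp)
  thus "\<tau> (\<sigma> x) = \<sigma> x" by simp
 qed
 moreover obtain T where T: "finite T" "T <= Aut M" "\<forall>\<sigma>\<in>Aut M. \<exists>\<tau>\<in>T. \<forall>x\<in>Y. \<sigma> x = \<tau> x"
  by (rule Aut_finite_reps[OF alg finY])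
 moreover have "\<exists>\<tau>\<in>T. \<forall>x\<in>fix_field M Y. \<sigma> x = \<tau> x" if \<sigma>: "\<sigma> : Aut M" for \<sigma>
 proof -
  obtain \<tau> where "\<tau> : T" "\<forall>x\<in>Y. \<sigma> x = \<tau> x" using bspec[OF T(3) \<sigma>] by (rule bexE)
  thus ?thesis using fix_field_agree[OF \<sigma> subsetD[OF T(2)]] by blast
 qed
 ultimately show ?thesis by (intro that[of "fix_field M Y" T] fix_field subsetD[OF fix_field(3) yY] ballI)
qed

text \<open>The norm argument: if no conjugate of \<open>V\<close> agrees with \<open>V'\<close> on
  \<open>N\<close>, approximation gives an \<open>e\<close> in \<open>N\<close> that is 1 at the
  conjugates of \<open>V\<close> and 0 at those of \<open>V'\<close>. A power of the product of the
  conjugates of \<open>e\<close> lies in \<open>M\<close> and distinguishes the two places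
  there.\<close>

lemma places_conjugate_step:
 fixes V V' :: "'f::alg_closed_field acf set"
 assumes M: "subfld M" "range to_ac <= M" and two: "(1::'f acf) + 1 = 0"
  and V: "is_place V" "is_place V'" "V \<inter> M = V' \<inter> M"
 obtains N \<tau> where "subfld N" "M <= N" "y : N" "\<tau> : Aut M" "\<tau> ` V \<inter> N = V' \<inter> N"
proof -
 have alg: "algebraic_over M x" for x by (rule algebraic_over_range_to_ac[OF M(2)])
 have cM: "range cst <= M" using M(2) cst_in_range by blast
 obtain N T where N: "subfld N" "M <= N" "y : N" "\<forall>\<sigma>\<in>Aut M. \<forall>x\<in>N. \<sigma> x : N"
  and T: "finite T" "T <= Aut M" "\<forall>\<sigma>\<in>Aut M. \<exists>\<tau>\<in>T. \<forall>x\<in>N. \<sigma> x = \<tau> x" using normal_closure_exists[OF alg, of y] .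
 have "\<exists>\<tau>\<in>Aut M. \<tau> ` V \<inter> N = V' \<inter> N"
 proof (rule ccontr)
  assume no: "~ ?thesis"
  define P where "P = (%\<tau>. iv \<tau> ` V) ` T"
  define Q where "Q = (%\<tau>. iv \<tau> ` V') ` T"
  have PQ: "is_place U" if "U : P \<union> Q" for U
   using that is_place_image_over[OF Aut_inv cM] V(1,2) T(2) unfolding P_def Q_def by blast
  have ne: "U \<inter> N ~= W \<inter> N" if UW: "U : P" "W : Q" for U W
  proof
   assume eq: "U \<inter> N = W \<inter> N"
   obtain \<tau> \<tau>' where \<tau>: "\<tau> : Aut M" "U = iv \<tau> ` V" "\<tau>' : Aut M" "W = iv \<tau>' ` V'"
    using UW T(2) unfolding P_def Q_def by blast
   note F = AutD(1)[OF \<tau>(1)] AutD(1)[OF \<tau>(3)]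
   have U: "x : U \<longleftrightarrow> \<tau> x : V" and W: "x : W \<longleftrightarrow> \<tau>' x : V'" for x
    using \<tau>(2,4) aut_mem_image_iff[OF aut_inv] inv_into_inv_into F by metis+
   define \<rho> where "\<rho> = \<tau>' o iv \<tau>"
   have \<rho>: "\<rho> : Aut M" unfolding \<rho>_def by (intro Aut_comp Aut_inv \<tau>)
   have "x : \<rho> ` V \<longleftrightarrow> x : V'" if "x : N" for x
   proof -
    have inv: "iv \<rho> x = \<tau> (iv \<tau>' x)"
     unfolding \<rho>_def using inv_into_comp[OF F(2) aut_inv[OF F(1)]] inv_into_inv_into[OF F(1)] by simp
    have "x : \<rho> ` V \<longleftrightarrow> iv \<tau>' x : U" using aut_mem_image_iff[OF AutD(1)[OF \<rho>]] inv U by simp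
    also have "... \<longleftrightarrow> iv \<tau>' x : W" using eq bspec[OF bspec[OF N(4) Aut_inv[OF \<tau>(3)]] that] by blast
    also have "... \<longleftrightarrow> x : V'" using W aut_f_inv[OF F(2)] by simp
    finally show ?thesis .
   qed
   hence "\<rho> ` V \<inter> N = V' \<inter> N" by blast
   with \<rho> no show False by blast
  qed
  have "finite P" "finite Q" "range cst <= N" using T(1) cM N(2) by (auto simp: P_def Q_def)
  hence "\<exists>e\<in>N. (\<forall>U\<in>P. e : U & e - 1 : mi U) & (\<forall>W\<in>Q. e : mi W)" by (intro places_separate_sets PQ ne N(1)) auto
  then obtain e where e: "e : N" "!!U. U : P ==> e : U & e - 1 : mi U" "!!W. W : Q ==> e : mi W" by blast
  define E where "E = {\<sigma> e | \<sigma>. \<sigma> : Aut M}"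
  have finE: "finite E" unfolding E_def by (rule Aut_orbit_finite[OF alg])
  have eE: "e : E" unfolding E_def using Aut_id[of M] by (metis (mono_tags, lifting) id_apply mem_Collect_eq)
  have mem: "z : V & z - 1 : mi V & z : mi V'" if "z : E" for z
  proof -
   from that obtain \<sigma> where "\<sigma> : Aut M" "z = \<sigma> e" by (auto simp: E_def)
   then obtain \<tau> where \<tau>: "\<tau> : T" "z = \<tau> e" using T(3) e(1) by blast
   have F: "\<tau> : field_auts" using \<tau>(1) T(2) AutD(1) by blast
   have 1: "e : iv \<tau> ` V" "e - 1 : iv \<tau> ` mi V"
    using e(2)[of "iv \<tau> ` V"] \<tau>(1) mi_image[OF aut_inv[OF F]] unfolding P_def by auto
   have 2: "e : iv \<tau> ` mi V'" using e(3)[of "iv \<tau> ` V'"] \<tau>(1) mi_image[OF aut_inv[OF F]] unfolding Q_def by auto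
   have *: "x : iv \<tau> ` Z \<longleftrightarrow> \<tau> x : Z" for x Z
    using aut_mem_image_iff[OF aut_inv[OF F]] inv_into_inv_into[OF F] by simp
   show ?thesis using 1 2 \<tau>(2) unfolding * by (simp add: aut_diff[OF F] aut_1[OF F])
  qed
  \<comment> \<open>The product over the set of conjugates is fixed by \<open>Aut M\<close>, so a
    2-power of it lies in \<open>M\<close>.\<close>
  define n where "n = prod (%z. z) E"
  have "\<sigma> n = n" if \<sigma>: "\<sigma> : Aut M" for \<sigma>
  proof -
   have inj: "inj_on \<sigma> E" using aut_eq_iff[OF AutD(1)[OF \<sigma>]] by (simp add: inj_on_def)
   have "\<sigma> ` E <= E"
   proof
    fix z assume "z : \<sigma> ` E"
    then obtain \<tau> where "z = (\<sigma> o \<tau>) e" "\<tau> : Aut M" by (auto simp: E_def)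
    thus "z : E" unfolding E_def using Aut_comp[OF \<sigma>] by blast
   qed
   hence "\<sigma> ` E = E" using endo_inj_surj[OF finE _ inj] by blast
   thus ?thesis unfolding n_def aut_prod[OF AutD(1)[OF \<sigma>]] using prod.reindex[OF inj, of "%z. z"] by simp
  qed
  hence "\<exists>j. n ^ (2 ^ j) : M" by (rule fixed_by_Aut[OF M(1) alg two])
  then obtain j where j: "n ^ (2 ^ j) : M" by blast
  define w where "w = n ^ (2 ^ j)"
  have n1: "n : V & n - 1 : mi V" unfolding n_def by (rule place_congr_one_prod[OF V(1)]) (use mem in blast)
  have "prod (%z. z) (E - {e}) : V'" using mem mi_subset[OF V(2)] by (intro place_prod[OF V(2)]) auto
  hence "n : mi V'" unfolding n_def prod.remove[OF finE eE] using mem[OF eE] by (intro mi_mult[OF V(2)]) auto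
  hence w': "w : mi V'" unfolding w_def using mi_power_iff[OF V(2) mi_subset[OF V(2)]] by simp
  have "w : V & w - 1 : mi V"
   using place_congr_one_prod[OF V(1), of "{..<2 ^ j :: nat}" "%_. n"] n1 by (simp add: w_def)
  hence "w : V" "w \<notin> mi V" using mi_diff[OF V(1), of w "w - 1"] one_not_in_mi[OF V(1)] by auto
  hence "w ~= 0" "inverse w : V" using place_unit[OF V(1)] by auto
  moreover have "inverse w : M" using j subfld_D(4)[OF M(1)] by (simp add: w_def)
  ultimately have "inverse w : V'" using V(3) by blast
  thus False using w' \<open>w ~= 0\<close> by (simp add: place_ideal_def)
 qed
 thus ?thesis using that N(1,2,3) by blast
qed

text \<open>Zorn's lemma on partial isomorphisms compatible with \<open>V\<close> and
  \<open>V'\<close> takes the place of a limit over finite extensions. To enlarge a maximal one by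
  \<open>y\<close>, it is extended to an automorphism, which is then corrected over its range by the
  previous step.\<close>

theorem places_conjugate:
 fixes V V' :: "'f::alg_closed_field acf set"
 assumes M: "subfld M" "range to_ac <= M" and two: "(1::'f acf) + 1 = 0"
  and V: "is_place V" "is_place V'" "V \<inter> M = V' \<inter> M" obtains \<sigma> where "\<sigma> : Aut M" "\<sigma> ` V = V'"
proof -
 define P where "P R \<longleftrightarrow> Id_on M <= R & (\<forall>(x, z)  \<in>R. x : V \<longleftrightarrow> z : V')" for R
 define Q where "Q = {R. iso_graph R & P R}"
 have cM: "range cst <= M" using M(2) cst_in_range by blast
 have "\<exists>R\<in>Q. \<forall>Z\<in>Q. R <= Z --> Z = R"
 proof (rule subset_Zorn_nonempty)
  show "Q ~= {}" using V(3) subfld_iso_graph[OF M(1)] by (auto simp: Q_def P_def)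
  fix K assume K: "K ~= {}" "subset.chain Q K"
  have KQ: "K <= Q" using K(2) by (simp add: subset_chain_def)
  have "P (\<Union>K)" unfolding P_def using K(1) KQ unfolding Q_def P_def by blast
  thus "\<Union>K  \<in>Q" unfolding Q_def using iso_graph_Union_chain[OF K(1) K(2)[unfolded Q_def]] by blast
 qed
 then obtain R where RQ: "R : Q" and max: "!!Z. Z : Q ==> R <= Z ==> Z = R" by metis
 hence R: "iso_graph R" "Id_on M <= R" "!!x z. (x, z) : R ==> x : V \<longleftrightarrow> z : V'" by (auto simp: Q_def P_def)
 have dom: "M <= Domain R" "M <= Range R" using R(2) by blast+
 have "algebraic_over (Domain R) x" "algebraic_over (Range R) x" for x
  by (rule algebraic_over_range_to_ac, use dom M(2) in auto)+
 then obtain \<sigma> where \<sigma>: "\<sigma> : field_auts" "!!x y. (x, y) : R ==> \<sigma> x = y"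
  using iso_graph_extend_automorphism[OF R(1)] by metis
 have \<sigma>M: "\<sigma> : Aut M" using \<sigma> R(2) by (auto simp: Aut_def)
 define M1 where "M1 = Range R"
 have M1: "subfld M1" unfolding subfld_def
 proof (intro conjI ballI)
  show "1 : M1" using iso_graph_1[OF R(1)] by (auto simp: M1_def)
  fix z assume "z : M1"
  then obtain x where x: "(x, z) : R" by (auto simp: M1_def)
  show "- z : M1" "inverse z : M1"
   using iso_graph_uminus[OF R(1) x] iso_graph_inverse[OF R(1) x] by (auto simp: M1_def)
  fix z' assume "z' : M1"
  then obtain x' where x': "(x', z') : R" by (auto simp: M1_def)
  show "z + z' : M1" "z * z' : M1"
   using iso_graph_add[OF R(1) x x'] iso_graph_mult[OF R(1) x x'] by (auto simp: M1_def)
 qed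
 have M1': "range to_ac <= M1" using M(2) dom(2) by (auto simp: M1_def)
 have V1: "\<sigma> ` V \<inter> M1 = V' \<inter> M1"
 proof -
  have "z : \<sigma> ` V \<longleftrightarrow> z : V'" if "z : M1" for z
  proof -
   obtain x where x: "(x, z) : R" using \<open>z : M1\<close> by (auto simp: M1_def)
   hence "iv \<sigma> z = x" using \<sigma> by (simp add: aut_inv_eq_iff)
   thus ?thesis using R(3)[OF x] by (simp add: aut_mem_image_iff[OF \<sigma>(1)])
  qed
  thus ?thesis by blast
 qed
 have ran: "y : Range R" for y
 proof -
  obtain N \<tau> where N: "subfld N" "M1 <= N" "y : N" "\<tau> : Aut M1" "\<tau> ` (\<sigma> ` V) \<inter> N = V' \<inter> N"
   using places_conjugate_step[OF M1 M1' two is_place_image_over[OF \<sigma>M cM V(1)] V(2) V1] .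
  define \<rho> where "\<rho> = \<tau> o \<sigma>"
  have \<rho>: "\<rho> : field_auts" unfolding \<rho>_def by (intro aut_comp AutD(1)[OF N(4)] \<sigma>)
  \<comment> \<open>The values are restricted to \<open>N\<close>, since \<rho> is known to match
    the places only there.\<close>
  define R' where "R' = {(x, \<rho> x) | x. \<rho> x : N}"
  have "iso_graph R'" unfolding iso_graph_def R'_def using subfld_D[OF N(1)]
   by (auto simp: aut[OF \<rho>] aut_minus[OF \<rho>] aut_inverse[OF \<rho>] aut[OF \<rho>])
  moreover have RR: "R <= R'" using \<sigma>(2) AutD(2)[OF N(4)] N(2) by (force simp: M1_def \<rho>_def R'_def)
  moreover have "x : V \<longleftrightarrow> \<rho> x : V'" if "\<rho> x : N" for x
  proof -
   have "\<rho> x : \<rho> ` V \<longleftrightarrow> \<rho> x : V'" using N(5) that by (auto simp: \<rho>_def image_comp)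
   thus ?thesis by (simp add: aut_mem_image_iff[OF \<rho>] aut_inv_f[OF \<rho>])
  qed
  ultimately have "R' : Q" using R(2) by (auto simp: Q_def P_def R'_def)
  hence "R' = R" using max RR by blast
  moreover have "(iv \<rho> y, y) : R'" using N(3) aut_f_inv[OF \<rho>, of y] by (auto simp: R'_def)
  ultimately show ?thesis by blast
 qed
 have "x : V \<longleftrightarrow> \<sigma> x : V'" for x
 proof -
  obtain x' where x': "(x', \<sigma> x) : R" using ran[of "\<sigma> x"] by blast
  thus ?thesis using \<sigma> aut_eq_iff R(3) x' by fastforce
 qed
 hence "y : \<sigma> ` V \<longleftrightarrow> y : V'" for y by (simp add: aut_mem_image_iff[OF \<sigma>(1)] aut_f_inv[OF \<sigma>(1)])
 thus ?thesis using that \<sigma>M by blast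
qed

section \<open>The function field of an elliptic curve in characteristic two\<close>

lemma char2_simps:
 fixes x y :: "'a::comm_ring_1"
 assumes "(1::'a) + 1 = 0"
 shows "x + x = 0" "x + (x + y) = y" "- x = x" "x - y = x + y" "(2::'a) = 0" "(3::'a) = 1" "(4::'a) = 0"
proof -
 show 2: "(2::'a) = 0" using assms by (metis one_add_one)
 show 1: "x + x = 0" for x :: 'a using 2 by (metis mult_2 mult_zero_left)
 show "x + (x + y) = y" using 1 by (simp flip: add.assoc)
 show 3: "- x = x" for x :: 'a using 1 by (metis add.inverse_unique)
 show "x - y = x + y" using 3[of y] by (metis diff_conv_add_uminus)
 have "(3::'a) = 2 + 1" "(4::'a) = 2 + 2" by simp_all
 thus "(3::'a) = 1" "(4::'a) = 0" using 2 by simp_all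
qed

lemma const_char2: "(1::'f::field) + 1 = 0 ==> (1::'f acf) + 1 = 0" by (metis cst_0 cst_1 cst_add)

definition rat_field :: "'f::field acf => 'f acf set" where
 "rat_field x = {ceval p x / ceval q x | p q. ceval q x ~= 0}"

lemma subfield_rat_field: "subfld (rat_field x)" unfolding subfld_def
proof (intro conjI ballI)
 have "ceval 1 x / ceval 1 x : rat_field x" unfolding rat_field_def by fastforce
 thus "1 : rat_field x" by simp
 fix u assume "u : rat_field x"
 then obtain p q where u: "u = ceval p x / ceval q x" "ceval q x ~= 0" by (auto simp: rat_field_def)
 have "- u = ceval (- p) x / ceval q x" using u by (simp add: ceval_minus)
 thus "- u : rat_field x" using u(2) by (auto simp: rat_field_def)
 show "inverse u : rat_field x"
 proof (cases "u = 0")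
  case True
  thus ?thesis using \<open>u : rat_field x\<close> by simp
 next
  case False
  thus ?thesis using u by (auto simp: rat_field_def)
 qed
 fix w assume "w : rat_field x"
 then obtain p' q' where w: "w = ceval p' x / ceval q' x" "ceval q' x ~= 0" by (auto simp: rat_field_def)
 have "u + w = ceval (p * q' + p' * q) x / ceval (q * q') x" "u * w = ceval (p * p') x / ceval (q * q') x"
  "ceval (q * q') x ~= 0" using u w by (simp_all add: ceval_add ceval_mult add_frac_eq)
 thus "u + w : rat_field x" "u * w : rat_field x" unfolding rat_field_def by blast+
qed

lemma ceval_in_rat_field: "ceval p x : rat_field x"
proof -
 have "ceval p x = ceval p x / ceval 1 x" "ceval 1 x ~= 0" by simp_all
 thus ?thesis unfolding rat_field_def by blast
qed

lemma rat_field_self: "x : rat_field x" using ceval_in_rat_field[of "[:0, 1:]" x] by simp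

lemma rat_field_t: "rat_field t_ac = range to_ac" by (simp add: rat_field_def range_to_ac ceval_t_eq_0_iff)

lemma rat_field_subset: "y : rat_field x ==> rat_field y <= rat_field x"
proof -
 assume y: "y : rat_field x"
 note S = subfld_D[OF subfield_rat_field[of x]]
 have c: "cst c : rat_field x" for c using ceval_in_rat_field[of "[:c:]" x] by simp
 have "ceval p y : rat_field x" for p by (induction p) (auto intro: S c y)
 thus ?thesis by (auto simp: rat_field_def[of y] intro: S)
qed

text \<open>The isomorphism from 'f(x) to 'f(y) extends because the whole field is algebraic over
  both: each of them contains t.\<close>

lemma transcendental_automorphism:
 fixes x y :: "'f::alg_closed_field acf"
 assumes x: "!!p. ceval p x = 0 ==> p = 0" and y: "!!p. ceval p y = 0 ==> p = 0"
  and tx: "t_ac : rat_field x" and ty: "t_ac : rat_field y"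
 obtains \<sigma> where "\<sigma> : field_auts" "!!c. \<sigma> (cst c) = cst c" "\<sigma> x = y"
proof -
 define R where "R = {(ceval p x / ceval q x, ceval p y / ceval q y) | p q. q ~= 0}"
 have RI: "(ceval p x / ceval q x, ceval p y / ceval q y) : R" if "q ~= 0" for p q
  unfolding R_def using that by blast
 have nz: "ceval q x ~= 0" "ceval q y ~= 0" if "q ~= 0" for q using x y that by blast+
 have R: "iso_graph R" unfolding iso_graph_def
 proof (intro conjI allI impI)
  show "(1, 1) : R" using RI[of 1 1] by simp
  show "w = 0" if "(0, w) : R" for w using that unfolding R_def by (auto dest: x)
  fix u w assume "(u, w) : R"
  then obtain p q where u: "u = ceval p x / ceval q x" "w = ceval p y / ceval q y" "q ~= 0" by (auto simp: R_def)
  show "(- u, - w) : R" using RI[OF u(3), of "- p"] u by (simp add: ceval_minus)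
  show "(inverse u, inverse w) : R" using RI[OF u(3), of p] u RI[of p q] by force
  fix u' w' assume "(u', w') : R"
  then obtain p' q' where u': "u' = ceval p' x / ceval q' x" "w' = ceval p' y / ceval q' y" "q' ~= 0"
   by (auto simp: R_def)
  have "q * q' ~= 0" using u u' by simp
  from RI[OF this, of "p * q' + p' * q"] RI[OF this, of "p * p'"]
  show "(u + u', w + w') : R" "(u * u', w * w') : R"
   using u u' nz by (simp_all add: ceval_add ceval_mult add_frac_eq)
 qed
 have "rat_field x <= Domain R" "rat_field y <= Range R"
 proof -
  show "rat_field x <= Domain R"
  proof
   fix u assume "u : rat_field x"
   then obtain p q where "u = ceval p x / ceval q x" "ceval q x ~= 0" by (auto simp: rat_field_def)
   thus "u : Domain R" using RI[of q p] by (cases "q = 0") auto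
  qed
  show "rat_field y <= Range R"
  proof
   fix u assume "u : rat_field y"
   then obtain p q where "u = ceval p y / ceval q y" "ceval q y ~= 0" by (auto simp: rat_field_def)
   thus "u : Range R" using RI[of q p] by (cases "q = 0") auto
  qed
 qed
 moreover have "range to_ac <= rat_field x" "range to_ac <= rat_field y"
  using rat_field_subset[OF tx] rat_field_subset[OF ty] by (simp_all add: rat_field_t)
 ultimately have "algebraic_over (Domain R) w" "algebraic_over (Range R) w" for w
  by (meson algebraic_over_range_to_ac order_trans)+
 then obtain \<sigma> where \<sigma>: "\<sigma> : field_auts" "!!u w. (u, w) : R ==> \<sigma> u = w"
  using iso_graph_extend_automorphism[OF R] by metis
 show ?thesis
 proof (rule that[OF \<sigma>(1)])
  show "\<sigma> (cst c) = cst c" for c using \<sigma>(2)[OF RI[of 1 "[:c:]"]] by simp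
  show "\<sigma> x = y" using \<sigma>(2)[OF RI[of 1 "[:0, 1:]"]] by simp
 qed
qed

lemma root_of_const_poly:
 fixes x :: "'f::alg_closed_field acf"
 assumes "ceval p x = 0" "p ~= 0"
 shows "\<exists>c. x = cst c & poly p c = 0"
proof -
 obtain A where A: "p = smult (lead_coeff p) (\<Prod>y\<in>#A. [:-y, 1:])"
  using alg_closed_imp_factorization[OF assms(2)] by blast
 have *: "\<exists>c\<in>#A. x = cst c" if "ceval (\<Prod>y\<in>#A. [:-y, 1:]) x = 0" using that
 proof (induction A)
  case (add y A)
  have "ceval [:-y, 1:] x = x - cst y" by (simp add: cst_minus)
  thus ?case using add by (simp only: ceval_mult image_mset_add_mset prod_mset.add_mset) auto
 qed simp
 have "ceval (\<Prod>y\<in>#A. [:-y, 1:]) x = 0"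
  using assms A by (metis ceval_smult cst_eq_0_iff leading_coeff_0_iff mult_eq_0_iff)
 then obtain c where "x = cst c" using * by blast
 thus ?thesis using assms(1) by (auto simp: ceval_const)
qed

lemma degree_linear_mult: "p ~= 0 ==> degree ([:a, 1:] * p) = Suc (degree p)" for p :: "'a::idom poly"
 by (subst degree_mult_eq) auto

text \<open>Two Artin-Schreier steps of degree two over 'f(t), together the cyclic covering of order
  four; \<open>a\<close> and \<open>b\<close> allow for an affine change of the parameter t.\<close>

locale ell =
 fixes s z :: "'f::alg_closed_field acf" and a b :: 'f
 assumes char2: "(1::'f) + 1 = 0" and a_nz: "a ~= 0" and s_eq: "s\<^sup>2 + s = cst a * t_ac + cst b"
  and z_eq: "z\<^sup>2 + z = s ^ 3 + s\<^sup>2"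
begin

lemmas cf = char2_simps[OF char2]
lemmas cw = char2_simps[OF const_char2[OF char2]]
lemma s_transcendental: "ceval p s = 0 ==> p = 0"
proof (rule ccontr)
 assume "ceval p s = 0" "p ~= 0"
 then obtain c where "s = cst c" using root_of_const_poly by blast
 hence "t_ac = cst ((c\<^sup>2 + c - b) / a)" using s_eq a_nz by (simp add: cst_add cst_diff cst_power algebra_simps cst_divide field_simps)
 thus False using t_ac_not_const by blast
qed

lemma s_transcendental': "ceval p s = 0 \<longleftrightarrow> p = 0" using s_transcendental by auto

lemma ceval_s_inj: "ceval p s = ceval q s \<longleftrightarrow> p = q" using s_transcendental'[of "p - q"] by (simp add: ceval_diff)

lemma t_in_rat_field_s: "t_ac : rat_field s"
proof -
 have "cst a * t_ac = s\<^sup>2 + s - cst b" using s_eq by simp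
 hence "t_ac = ceval (smult (1/a) [:-b, 1, 1:]) s" using a_nz by (simp add: cst_divide cst_minus sqr field_simps)
 thus ?thesis using ceval_in_rat_field by metis
qed

definition fn :: "'f poly => 'f poly => 'f acf" where "fn A B = ceval A s + ceval B s * z"

definition wp :: "'f poly" where "wp = [:0, 0, 1, 1:]"

lemma ceval_wp: "ceval wp x = x ^ 3 + x\<^sup>2" and poly_wp: "poly wp u = u ^ 3 + u\<^sup>2"
 and degree_wp: "degree wp = 3" and wp_nz: "wp ~= 0" by (simp_all add: wp_def sqr power3_eq_cube algebra_simps)

lemma z_sq: "z * z = z + s ^ 3 + s\<^sup>2" using z_eq by (metis add.assoc add.commute cw(2) sqr)

text \<open>The norm of A + B z to 'f[s]; the conjugate of z is z + 1.\<close>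

definition nrm :: "'f poly => 'f poly => 'f poly" where "nrm A B = A\<^sup>2 + A * B + B\<^sup>2 * wp"

lemma fn_nrm: "fn A B * fn (A + B) B = ceval (nrm A B) s"
proof -
 define u v where "u = ceval A s" and "v = ceval B s"
 have "(u + v * z) * (u + v + v * z) = u\<^sup>2 + u * v + v\<^sup>2 * z + v\<^sup>2 * (z * z) + 2 * (u * v * z)"
  by (simp add: algebra_simps sqr)
 also have "... = u\<^sup>2 + u * v + v\<^sup>2 * (s ^ 3 + s\<^sup>2) + 2 * (u * v * z + v\<^sup>2 * z)"
  unfolding z_sq by (simp add: algebra_simps)
 finally show ?thesis by (simp add: fn_def nrm_def ceval_add ceval_mult ceval_power ceval_wp u_def v_def cw)
qed

text \<open>A^2 and B^2 (s^3 + s^2) have degrees of different parity and cannot cancel. The degree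
  is the pole order at infinity, where s and z have poles of order 2 and 3.\<close>

lemma degree_nrm:
 assumes "A ~= 0 \<or> B ~= 0"
 shows "nrm A B ~= 0" "B ~= 0 ==> degree (nrm A B) >= 3 + 2 * degree B" "degree (nrm A B) >= 2 * degree A"
proof -
 have "nrm A B ~= 0 & (B ~= 0 --> degree (nrm A B) >= 3 + 2 * degree B) & degree (nrm A B) >= 2 * degree A"
 proof (cases "A = 0 \<or> B = 0")
  case True
  thus ?thesis using assms wp_nz by (auto simp: nrm_def degree_mult_eq degree_power_eq degree_wp)
 next
  case False
  have dB: "degree (B\<^sup>2 * wp) = 2 * degree B + 3"
   using False wp_nz by (simp add: degree_mult_eq degree_power_eq degree_wp)
  have dA: "degree (A\<^sup>2) = 2 * degree A" using False by (simp add: degree_power_eq)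
  have dAB: "degree (A * B) = degree A + degree B" using False by (simp add: degree_mult_eq)
  show ?thesis
  proof (cases "degree A > Suc (degree B)")
   case True
   have "degree (A\<^sup>2 + (A * B + B\<^sup>2 * wp)) = degree (A\<^sup>2)"
    by (rule degree_add_eq_left) (use True dA dB dAB in \<open>auto intro!: degree_add_less\<close>)
   thus ?thesis using True by (auto simp: nrm_def dA add.assoc)
  next
   case F: False
   have "degree (A\<^sup>2 + A * B) < degree (B\<^sup>2 * wp)" by (rule degree_add_less) (use F dA dB dAB in auto)
   hence "degree (nrm A B) = 2 * degree B + 3" unfolding nrm_def using degree_add_eq_right dB by metis
   thus ?thesis using F by auto
  qed
 qed
 thus "nrm A B ~= 0" "B ~= 0 ==> degree (nrm A B) >= 3 + 2 * degree B" "degree (nrm A B) >= 2 * degree A" by auto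
qed

lemma fn_eq_0_iff: "fn A B = 0 \<longleftrightarrow> A = 0 & B = 0"
proof
 assume "fn A B = 0"
 thus "A = 0 & B = 0" using fn_nrm[of A B] s_transcendental' degree_nrm(1) by auto
qed (simp add: fn_def)

lemma fn_add: "fn A B + fn A' B' = fn (A + A') (B + B')" by (simp add: fn_def ceval_add algebra_simps)

lemma fn_minus: "- fn A B = fn (- A) (- B)" by (simp add: fn_def ceval_minus)

lemma fn_inj: "fn A B = fn A' B' \<longleftrightarrow> A = A' & B = B'"
proof -
 have "fn A B - fn A' B' = fn (A - A') (B - B')" using fn_add[of A B "- A'" "- B'"] by (simp flip: fn_minus)
 thus ?thesis using fn_eq_0_iff[of "A - A'" "B - B'"] by (metis eq_iff_diff_eq_0)
qed

lemma fn_mult: "fn A B * fn A' B' = fn (A * A' + B * B' * wp) (A * B' + A' * B + B * B')"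
proof -
 have "fn A B * fn A' B' = ceval A s * ceval A' s + (ceval A s * ceval B' s + ceval A' s * ceval B s) * z
   + ceval B s * ceval B' s * (z * z)" by (simp add: fn_def algebra_simps)
 thus ?thesis unfolding z_sq by (simp add: fn_def ceval_add ceval_mult ceval_wp algebra_simps)
qed

lemma fn_const: "fn [:c:] 0 = cst c" and fn_ceval: "fn C 0 = ceval C s"
 and fn_smult: "fn A B * ceval C s = fn (A * C) (B * C)"
 by (simp_all add: fn_def ceval_mult algebra_simps)

definition Lf :: "'f acf set" where "Lf = {fn A B / ceval C s | A B C. C ~= 0}"

lemma Lf_I: "C ~= 0 ==> fn A B / ceval C s : Lf" unfolding Lf_def by blast

lemma fn_in_Lf: "fn A B : Lf" using Lf_I[of 1 A B] by simp

lemma subfield_Lf: "subfld Lf" unfolding subfld_def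
proof (intro conjI ballI)
 show "1 : Lf" using fn_in_Lf[of 1 0] by (simp add: fn_ceval)
 fix u assume "u : Lf"
 then obtain A B C where u: "u = fn A B / ceval C s" "C ~= 0" by (auto simp: Lf_def)
 show "- u : Lf" using Lf_I[OF u(2), of "-A" "-B"] u by (simp flip: fn_minus)
 show "inverse u : Lf"
 proof (cases "u = 0")
  case True
  thus ?thesis using \<open>u : Lf\<close> by simp
 next
  case False
  hence nz: "fn A B ~= 0" "A ~= 0 \<or> B ~= 0" using u by (auto simp: fn_eq_0_iff)
  hence N: "nrm A B ~= 0" using degree_nrm(1) by blast
  hence "fn (A + B) B ~= 0" using s_transcendental fn_nrm[of A B] by auto
  hence "inverse u = (fn (A + B) B * ceval C s) / ceval (nrm A B) s" using u(1) unfolding fn_nrm[symmetric] by simp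
  thus ?thesis using Lf_I[OF N] by (simp add: fn_smult)
 qed
 fix w assume "w : Lf"
 then obtain A' B' C' where w: "w = fn A' B' / ceval C' s" "C' ~= 0" by (auto simp: Lf_def)
 have nz: "ceval C s ~= 0" "ceval C' s ~= 0" "C * C' ~= 0" using u w by (auto simp: s_transcendental')
 show "u + w : Lf" using u w nz Lf_I[OF nz(3)] by (simp add: ceval_mult add_frac_eq fn_smult fn_add)
 show "u * w : Lf" using u w Lf_I[OF nz(3)] by (simp add: ceval_mult fn_mult)
qed

lemma s_in_Lf: "s : Lf" and z_in_Lf: "z : Lf" and const_in_Lf: "cst c : Lf"
 using fn_in_Lf[of "[:0, 1:]" 0] fn_in_Lf[of 0 1] fn_in_Lf[of "[:c:]" 0] by (simp_all add: fn_def)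

lemma rat_field_s_subset_Lf: "rat_field s <= Lf"
 using Lf_I[of _ _ 0] by (auto simp: rat_field_def fn_ceval s_transcendental')

lemma range_to_ac_subset_rat_field_s: "range to_ac <= rat_field s"
 using rat_field_subset[OF t_in_rat_field_s] by (simp add: rat_field_t)

lemma range_to_ac_subset_Lf: "range to_ac <= Lf"
 using rat_field_s_subset_Lf range_to_ac_subset_rat_field_s by blast

section \<open>Orders of vanishing\<close>

definition Ec :: "('f \<times> 'f) set" where "Ec = {(x, y). y\<^sup>2 + y = x ^ 3 + x\<^sup>2}"

definition ev :: "'f poly => 'f poly => 'f \<times> 'f => 'f" where "ev A B P = poly A (fst P) + poly B (fst P) * snd P"

text \<open>\<open>s - cst (fst P)\<close> is a uniformiser at every affine point, since the
  derivative of y^2 + y with respect to y is 1. So the order is the exponent of this single function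
  up to factors that are regular and nonzero at \<open>P\<close>; \<open>powi\<close> admits
  poles.\<close>

definition has_ord :: "'f \<times> 'f => 'f acf => int => bool" where
 "has_ord P f n \<longleftrightarrow> (\<exists>A B A' B'. ev A B P ~= 0 & ev A' B' P ~= 0 &
   f * fn A' B' = (s - cst (fst P)) powi n * fn A B)"

lemma s_minus_const_nz: "s - cst x ~= 0" using s_transcendental[of "[:-x, 1:]"] by (auto simp: cst_minus)

lemma ev_nz_fn_nz: "ev A B P ~= 0 ==> fn A B ~= 0" by (auto simp: ev_def fn_eq_0_iff)

lemma ev_mult:
 assumes "P : Ec"
 shows "ev (A * A' + B * B' * wp) (A * B' + A' * B + B * B') P = ev A B P * ev A' B' P"
proof -
 obtain x y where P: "P = (x, y)" by fastforce
 have y2: "y * y = y + x ^ 3 + x\<^sup>2" using assms P by (auto simp: Ec_def) (metis add.assoc add.commute cf(2) sqr)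
 have "ev A B P * ev A' B' P = poly A x * poly A' x + (poly A x * poly B' x + poly A' x * poly B x) * y
   + poly B x * poly B' x * (y * y)" by (simp add: ev_def P algebra_simps)
 thus ?thesis unfolding y2 by (simp add: ev_def P poly_wp algebra_simps)
qed

lemma has_ord_nz: "has_ord P f n ==> f ~= 0"
proof
 assume "has_ord P f n" "f = 0"
 then obtain A B where "ev A B P ~= 0" "(s - cst (fst P)) powi n * fn A B = 0" by (auto simp: has_ord_def)
 thus False using ev_nz_fn_nz s_minus_const_nz by (metis mult_eq_0_iff power_int_eq_0_iff)
qed

lemma has_ord_mult:
 assumes "P : Ec" "has_ord P f n" "has_ord P g m"
 shows "has_ord P (f * g) (n + m)"
proof -
 obtain A B A' B' where 1: "ev A B P ~= 0" "ev A' B' P ~= 0"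
  "f * fn A' B' = (s - cst (fst P)) powi n * fn A B" using assms(2) by (auto simp: has_ord_def)
 obtain C D C' D' where 2: "ev C D P ~= 0" "ev C' D' P ~= 0"
  "g * fn C' D' = (s - cst (fst P)) powi m * fn C D" using assms(3) by (auto simp: has_ord_def)
 have "(f * g) * (fn A' B' * fn C' D') = (f * fn A' B') * (g * fn C' D')" by simp
 also have "... = (s - cst (fst P)) powi (n + m) * (fn A B * fn C D)"
  unfolding 1(3) 2(3) using s_minus_const_nz by (simp add: power_int_add mult_ac)
 finally show ?thesis unfolding has_ord_def fn_mult using ev_mult[OF assms(1)] 1 2 by (metis mult_eq_0_iff)
qed

lemma has_ord_inverse: "has_ord P f n ==> has_ord P (inverse f) (- n)"
proof -
 assume f: "has_ord P f n"
 then obtain A B A' B' where 1: "ev A B P ~= 0" "ev A' B' P ~= 0"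
  "f * fn A' B' = (s - cst (fst P)) powi n * fn A B" by (auto simp: has_ord_def)
 have "inverse f * fn A B = (s - cst (fst P)) powi (- n) * fn A' B'"
  using 1(3) has_ord_nz[OF f] s_minus_const_nz[of "fst P"] by (simp add: power_int_minus field_simps)
 thus ?thesis unfolding has_ord_def using 1 by blast
qed

lemma has_ord_1: "has_ord P 1 0" unfolding has_ord_def by (intro exI[of _ 1] exI[of _ 0]) (simp add: ev_def)

lemma has_ord_0_iff_ev: "ev A B P ~= 0 ==> has_ord P (fn A B) 0"
 unfolding has_ord_def by (intro exI[of _ A] exI[of _ B] exI[of _ 1] exI[of _ 0]) (simp add: ev_def fn_ceval)

text \<open>Division reduces this to the function 1: a positive order of it would make both
  coefficients of a function A + B z divisible by s - x_P although its value at \<open>P\<close> is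
  nonzero.\<close>

lemma has_ord_unique:
 assumes P: "P : Ec" and "has_ord P f n" "has_ord P f m"
 shows "n = m"
proof -
 have *: "k = 0" if k: "has_ord P 1 (int k)" for k
 proof (rule ccontr)
  assume "k ~= 0"
  obtain A B A' B' where 1: "ev A B P ~= 0" "ev A' B' P ~= 0"
   "fn A' B' = (s - cst (fst P)) ^ k * fn A B" using k by (auto simp: has_ord_def)
  have "fn A' B' = fn (A * [:- fst P, 1:] ^ k) (B * [:- fst P, 1:] ^ k)" using 1(3) by (simp add: ceval_power cst_minus fn_smult[symmetric] mult.commute)
  thus False using \<open>k ~= 0\<close> 1(2) by (simp add: fn_inj ev_def power_0_left)
 qed
 have "has_ord P 1 (n - m)" "has_ord P 1 (m - n)" using has_ord_mult[OF P assms(2) has_ord_inverse[OF assms(3)]] has_ord_mult[OF P assms(3) has_ord_inverse[OF assms(2)]] has_ord_nz assms(2) by auto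
 thus ?thesis using *[of "nat (n - m)"] *[of "nat (m - n)"] by (cases "n >= m") auto
qed

lemma has_ord_ceval:
 assumes "C ~= 0"
 shows "has_ord P (ceval C s) (int (order (fst P) C))"
proof -
 obtain D where D: "C = [:- fst P, 1:] ^ order (fst P) C * D" "~ [:- fst P, 1:] dvd D"
  using order_decomp[OF assms] by blast
 have "ev D 0 P ~= 0" using D(2) by (simp add: ev_def poly_eq_0_iff_dvd)
 moreover have "ceval C s * fn 1 0 = (s - cst (fst P)) powi int (order (fst P) C) * fn D 0"
  by (subst D(1)) (simp add: fn_ceval ceval_mult ceval_power cst_minus)
 moreover have "ev 1 0 P ~= 0" by (simp add: ev_def)
 ultimately show ?thesis unfolding has_ord_def by blast
qed

lemma ev_conj: "ev A B P * ev (A + B) B P = poly (nrm A B) (fst P)" if "P : Ec"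
proof -
 obtain x y where P: "P = (x, y)" by fastforce
 have y2: "y * y = y + x ^ 3 + x\<^sup>2" using that P by (auto simp: Ec_def) (metis add.assoc add.commute cf(2) sqr)
 have "ev A B P * ev (A + B) B P = (poly A x)\<^sup>2 + poly A x * poly B x + (poly B x)\<^sup>2 * y + (poly B x)\<^sup>2 * (y * y)
   + 2 * (poly A x * poly B x * y)" by (simp add: ev_def P algebra_simps sqr)
 thus ?thesis unfolding y2 by (simp add: nrm_def P poly_wp cf algebra_simps)
qed

text \<open>The conjugate of A + B z has the value B(x_P) at \<open>P\<close> and is a unit there,
  so the order of the norm belongs entirely to A + B z.\<close>

lemma has_ord_fn_primitive:
 assumes P: "P : Ec" and 0: "ev A B P = 0" and nz: "poly B (fst P) ~= 0"
 shows "has_ord P (fn A B) (int (order (fst P) (nrm A B)))"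
proof -
 have "B ~= 0" using nz by auto
 hence N: "nrm A B ~= 0" using degree_nrm(1) by blast
 have "ev (A + B) B P = ev A B P + poly B (fst P)" by (simp add: ev_def)
 hence e: "ev (A + B) B P ~= 0" using 0 nz by simp
 have "fn A B = ceval (nrm A B) s * inverse (fn (A + B) B)" using ev_nz_fn_nz[OF e] by (simp flip: fn_nrm)
 thus ?thesis using has_ord_mult[OF P has_ord_ceval[OF N] has_ord_inverse[OF has_ord_0_iff_ev[OF e]]] by simp
qed

lemma has_ord_fn_exists:
 assumes P: "P : Ec" and "fn A B ~= 0"
 shows "\<exists>n. has_ord P (fn A B) (int n)" using assms(2)
proof (induction "degree A + degree B" arbitrary: A B rule: less_induct)
 case less
 show ?case
 proof (cases "poly A (fst P) = 0 & poly B (fst P) = 0")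
  case True
  then obtain A' B' where AB: "A = [:- fst P, 1:] * A'" "B = [:- fst P, 1:] * B'"
   using poly_eq_0_iff_dvd by (metis dvdE)
  hence nz: "A' ~= 0 \<or> B' ~= 0" "fn A' B' ~= 0" using less.prems by (auto simp: fn_eq_0_iff)
  hence "degree A' + degree B' < degree A + degree B" unfolding AB
   by (cases "A' = 0"; cases "B' = 0") (simp_all only: degree_linear_mult, auto)
  then obtain n where n: "has_ord P (fn A' B') (int n)" using less.hyps nz by blast
  have "fn A B = ceval [:- fst P, 1:] s * fn A' B'"
   unfolding AB using fn_smult[of A' B' "[:- fst P, 1:]"] by (simp only: mult.commute)
  moreover have "has_ord P (ceval [:- fst P, 1:] s) (int (order (fst P) [:- fst P, 1:]))"
   by (rule has_ord_ceval) simp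
  ultimately have "has_ord P (fn A B) (int (order (fst P) [:- fst P, 1:]) + int n)"
   using has_ord_mult[OF P _ n] by simp
  thus ?thesis by (metis of_nat_add)
 next
  case False
  show ?thesis
  proof (cases "ev A B P = 0")
   case True
   thus ?thesis using False has_ord_fn_primitive[OF P True] by (force simp: ev_def)
  next
   case nz: False
   thus ?thesis using has_ord_0_iff_ev[OF nz] by (intro exI[of _ 0]) simp
  qed
 qed
qed

lemma has_ord_exists:
 assumes P: "P : Ec" and f: "f : Lf" "f ~= 0"
 shows "\<exists>n. has_ord P f n"
proof -
 obtain A B C where *: "f = fn A B / ceval C s" "C ~= 0" using f(1) by (auto simp: Lf_def)
 hence "fn A B ~= 0" using f(2) by auto
 thus ?thesis using has_ord_fn_exists[OF P] has_ord_mult[OF P _ has_ord_inverse[OF has_ord_ceval[OF *(2)]]] *(1)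
  by (metis field_class.field_divide_inverse)
qed

definition ordE :: "'f \<times> 'f => 'f acf => int" where "ordE P f = (THE n. has_ord P f n)"

lemma ordE_eqI: "P : Ec ==> has_ord P f n ==> ordE P f = n" unfolding ordE_def using has_ord_unique by blast

lemma has_ord_ordE: "P : Ec ==> f : Lf ==> f ~= 0 ==> has_ord P f (ordE P f)" using has_ord_exists ordE_eqI by metis

lemma ordE_mult:
 assumes "P : Ec" "f : Lf" "f ~= 0" "g : Lf" "g ~= 0"
 shows "ordE P (f * g) = ordE P f + ordE P g"
 using has_ord_mult[OF assms(1) has_ord_ordE[OF assms(1-3)] has_ord_ordE[OF assms(1,4,5)]]
 by (rule ordE_eqI[OF assms(1)])

lemma ordE_inverse: "P : Ec ==> f : Lf ==> f ~= 0 ==> ordE P (inverse f) = - ordE P f"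
 using has_ord_inverse[OF has_ord_ordE] ordE_eqI by blast

lemma ordE_1: "P : Ec ==> ordE P 1 = 0" using has_ord_1 ordE_eqI by blast

lemma ordE_power: "P : Ec ==> f : Lf ==> f ~= 0 ==> ordE P (f ^ n) = int n * ordE P f"
 by (induction n) (simp_all add: ordE_1 ordE_mult subfld_D(9)[OF subfield_Lf] algebra_simps)

lemma Lf_powi: "f : Lf ==> f powi n : Lf" by (simp add: power_int_def subfld_D(4,9)[OF subfield_Lf])

lemma ordE_ceval: "P : Ec ==> C ~= 0 ==> ordE P (ceval C s) = int (order (fst P) C)"
 by (rule ordE_eqI[OF _ has_ord_ceval])

lemma ordE_fn_nonneg: "P : Ec ==> fn A B ~= 0 ==> ordE P (fn A B) >= 0"
 using has_ord_fn_exists[of P A B] ordE_eqI by fastforce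

lemma ordE_fn_pos_iff:
 assumes "P : Ec" "fn A B ~= 0"
 shows "ordE P (fn A B) > 0 \<longleftrightarrow> ev A B P = 0"
proof
 show "ev A B P = 0" if "ordE P (fn A B) > 0"
  using ordE_eqI[OF assms(1) has_ord_0_iff_ev[of A B P]] that by (cases "ev A B P = 0") auto
 assume 0: "ev A B P = 0"
 have "ordE P (fn A B) ~= 0"
 proof
  assume "ordE P (fn A B) = 0"
  hence "has_ord P (fn A B) 0" using has_ord_ordE[OF assms(1) fn_in_Lf assms(2)] by simp
  then obtain C D C' D' where "ev C D P ~= 0" "ev C' D' P ~= 0" "fn A B * fn C' D' = fn C D"
   by (auto simp: has_ord_def)
  thus False using ev_mult[OF assms(1), of A C' B D'] 0 by (simp add: fn_mult fn_inj)
 qed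
 thus "ordE P (fn A B) > 0" using ordE_fn_nonneg[OF assms] by simp
qed

lemma Ec_exists: "\<exists>y. (x, y) : Ec"
proof -
 have "\<exists>y. poly [:- (x ^ 3 + x\<^sup>2), 1, 1:] y = 0" by (rule has_root) simp
 then obtain y where "y + y * y = x ^ 3 + x\<^sup>2" by (auto simp: algebra_simps)
 thus ?thesis by (auto simp: Ec_def sqr add.commute)
qed

lemma Ec_neg: "(x, y) : Ec \<longleftrightarrow> (x, y + 1) : Ec" by (simp add: Ec_def sq_simps cf)

text \<open>The coordinate ring is integrally closed. At a root x of the denominator the numerator
  vanishes at both points above x, which forces A(x) = B(x) = 0, and the factor s - x
  cancels.\<close>

lemma regular_imp_fn:
 assumes "f : Lf" "f ~= 0" "!!P. P : Ec ==> ordE P f >= 0"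
 shows "\<exists>A B. f = fn A B"
proof -
 obtain A B C where "f = fn A B / ceval C s" "C ~= 0" using assms(1) by (auto simp: Lf_def)
 thus ?thesis
 proof (induction "degree C" arbitrary: A B C rule: less_induct)
  case less
  show ?case
  proof (cases "degree C = 0")
   case True
   then obtain c where c: "C = [:c:]" by (auto elim: degree_eq_zeroE)
   hence "f = fn A B * ceval [:1/c:] s" using less.prems by (simp add: cst_divide)
   thus ?thesis by (simp only: fn_smult) blast
  next
   case False
   then obtain x where x: "poly C x = 0" using has_root by blast
   obtain y where y: "(x, y) : Ec" using Ec_exists by blast
   have nz: "fn A B ~= 0" using less.prems assms(2) by auto
   have 0: "ev A B P = 0" if P: "P : Ec" "fst P = x" for P
   proof -
    have "ordE P f = ordE P (fn A B) - int (order x C)" using fn_in_Lf[of C 0] less.prems P nz ordE_mult[OF P(1) fn_in_Lf nz subfld_D(4)[OF subfield_Lf]] by (simp add: fn_ceval field_class.field_divide_inverse ordE_inverse ordE_ceval s_transcendental')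
    moreover have "order x C > 0" using x less.prems(2) by (simp add: order_gt_0_iff)
    ultimately have "ordE P (fn A B) > 0" using assms(3)[OF P(1)] by simp
    thus ?thesis using ordE_fn_pos_iff[OF P(1) nz] by simp
   qed
   have y': "(x, y + 1) : Ec" using y Ec_neg by simp
   have "ev A B (x, y + 1) = ev A B (x, y) + poly B x" by (simp add: ev_def algebra_simps)
   hence "poly B x = 0" using 0[OF y] 0[OF y'] by simp
   moreover from this have "poly A x = 0" using 0[OF y] by (simp add: ev_def)
   ultimately have AB: "poly B x = 0" "poly A x = 0" by simp_all
   then obtain A' B' C' where *: "A = [:-x, 1:] * A'" "B = [:-x, 1:] * B'" "C = [:-x, 1:] * C'"
    using x AB by (metis dvdE poly_eq_0_iff_dvd)
   have C': "C' ~= 0" using less.prems * by auto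
   hence "degree C' < degree C" unfolding *(3) using degree_linear_mult[of C' "-x"] by linarith
   moreover have "f = fn A' B' / ceval C' s"
   proof -
    have "fn A B = fn A' B' * ceval [:-x, 1:] s" unfolding *(1,2) fn_smult by (simp only: mult.commute)
    moreover have "ceval C s = ceval C' s * ceval [:-x, 1:] s" unfolding *(3) ceval_mult by (simp only: mult.commute)
    moreover have "ceval [:-x, 1:] s ~= 0" using s_transcendental by fastforce
    ultimately show ?thesis using less.prems(1) by simp
   qed
   ultimately show ?thesis using less.hyps C' by blast
  qed
 qed
qed

text \<open>The norm has no zeros and is therefore constant; the degree bound then leaves neither z
  nor s.\<close>

lemma unit_imp_const:
 assumes "f : Lf" "f ~= 0" "!!P. P : Ec ==> ordE P f = 0"
 shows "\<exists>c. f = cst c"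
proof -
 obtain A B where AB: "f = fn A B" using regular_imp_fn[OF assms(1,2)] assms(3) by force
 hence nz: "A ~= 0 \<or> B ~= 0" using assms(2) by (auto simp: fn_eq_0_iff)
 have ev: "ev A B P ~= 0" if "P : Ec" for P
  using assms(2) assms(3)[OF that] ordE_fn_pos_iff[OF that, of A B] AB by simp
 have "poly (nrm A B) x ~= 0" for x
 proof -
  obtain y where y: "(x, y) : Ec" using Ec_exists by blast
  have "ev (A + B) B (x, y) = ev A B (x, y + 1)" by (simp add: ev_def algebra_simps)
  thus ?thesis using ev_conj[OF y, of A B] ev[OF y] ev[of "(x, y + 1)"] y Ec_neg by auto
 qed
 hence "degree (nrm A B) = 0" using has_root by blast
 hence "B = 0" "degree A = 0" using degree_nrm[OF nz] by force+
 thus ?thesis using AB by (metis degree_eq_zeroE fn_const)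
qed

end

section \<open>Divisors and the group of points\<close>

lemma map_poly_hom_mult:
 fixes h :: "'a::comm_semiring_0 => 'b::comm_semiring_0"
 assumes "h 0 = 0" "!!x y. h (x + y) = h x + h y" "!!x y. h (x * y) = h x * h y"
 shows "poly (map_poly h p) (h x) = h (poly p x)" by (induction p) (simp_all add: assms map_poly_pCons)

context ell
begin

text \<open>One computation for the rotation, the shifts and the Frobenius on constants. The image
  of the point (x, y) is the point where \<sigma> s and \<sigma> z take the values \<theta> x and
  \<theta> y.\<close>

lemma has_ord_aut:
 assumes \<sigma>: "\<sigma> : field_auts" "!!c. \<sigma> (cst c) = cst (\<theta> c)"
  and s': "\<sigma> s = s + cst a'" and z': "\<sigma> z = z + cst b' * s + cst d'"
 shows "has_ord (x, y) f n ==> has_ord (\<theta> x + a', \<theta> y + b' * (\<theta> x + a') + d') (\<sigma> f) n" (is "_ ==> has_ord ?P _ _")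
  and "f : Lf ==> \<sigma> f : Lf"
proof -
 have "cst (\<theta> 0) = 0" "cst (\<theta> (u + w)) = cst (\<theta> u + \<theta> w)" "cst (\<theta> (u * w)) = cst (\<theta> u * \<theta> w)" for u w
  by (simp_all add: aut[OF \<sigma>(1)] cst_add cst_mult flip: \<sigma>(2))
 hence \<theta>: "\<theta> 0 = 0" "\<theta> (u + w) = \<theta> u + \<theta> w" "\<theta> (u * w) = \<theta> u * \<theta> w" for u w by simp_all
 have \<theta>0: "\<theta> u = 0 \<longleftrightarrow> u = 0" for u using aut_0_iff[OF \<sigma>(1), of "cst u"] \<sigma>(2) by simp
 define tr where "tr C = pcompose (map_poly \<theta> C) [:a', 1:]" for C
 have \<sigma>c: "\<sigma> (ceval C s) = ceval (tr C) s" for C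
 proof -
  have "map_poly \<sigma> (map_poly cst C) = map_poly cst (map_poly \<theta> C)"
   by (rule poly_eqI) (simp add: coeff_map_poly aut_0[OF \<sigma>(1)] \<theta> \<sigma>(2))
  hence "\<sigma> (ceval C s) = ceval (map_poly \<theta> C) (\<sigma> s)" by (simp add: ceval_def aut_poly[OF \<sigma>(1)])
  thus ?thesis by (simp add: tr_def ceval_pcompose s' add.commute)
 qed
 have \<sigma>fn: "\<sigma> (fn A B) = fn (tr A + tr B * [:d', b':]) (tr B)" for A B
  by (simp add: fn_def aut[OF \<sigma>(1)] \<sigma>c z' ceval_add ceval_mult) (simp add: algebra_simps ceval_smult)
 have ptr: "poly (tr C) (\<theta> x + a') = \<theta> (poly C x)" for C x
 proof -
  have "poly (tr C) (\<theta> x + a') = poly (map_poly \<theta> C) (\<theta> x + (a' + a'))"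
   by (simp add: tr_def poly_pcompose algebra_simps)
  thus ?thesis using map_poly_hom_mult[of \<theta> C x] \<theta> by (simp only: cf(1) add_0_right)
 qed
 have evtr: "ev (tr A + tr B * [:d', b':]) (tr B) (\<theta> x + a', \<theta> y + b' * (\<theta> x + a') + d') = \<theta> (ev A B (x, y))" for A B x y
 proof -
  let ?u = "\<theta> x + a'" and ?B = "\<theta> (poly B x)"
  have "ev (tr A + tr B * [:d', b':]) (tr B) (?u, \<theta> y + b' * ?u + d')
   = \<theta> (poly A x) + ?B * \<theta> y + ((?B * (d' + ?u * b')) + (?B * (d' + ?u * b')))"
   by (simp add: ev_def ptr) (simp add: algebra_simps)
  also have "... = \<theta> (poly A x) + ?B * \<theta> y" by (simp only: cf(1) add_0_right)
  also have "... = \<theta> (ev A B (x, y))" by (simp add: ev_def \<theta>)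
  finally show ?thesis .
 qed
 show "has_ord ?P (\<sigma> f) n" if f: "has_ord (x, y) f n" for f n
 proof -
  obtain A B A' B' where 1: "ev A B (x, y) ~= 0" "ev A' B' (x, y) ~= 0"
   "f * fn A' B' = (s - cst x) powi n * fn A B" using f by (auto simp: has_ord_def)
  have "\<sigma> (s - cst x) = s - cst (\<theta> x + a')" by (simp add: aut_add[OF \<sigma>(1)] \<sigma>(2) s' cst_add cw(4) add_ac)
  hence "\<sigma> ((s - cst x) powi n) = (s - cst (\<theta> x + a')) powi n"
   by (simp add: power_int_def aut_power[OF \<sigma>(1)] aut_inverse[OF \<sigma>(1)])
  hence "\<sigma> f * fn (tr A' + tr B' * [:d', b':]) (tr B') =
    (s - cst (fst ?P)) powi n * fn (tr A + tr B * [:d', b':]) (tr B)"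
   using arg_cong[OF 1(3), of \<sigma>] by (simp add: aut_mult[OF \<sigma>(1)] \<sigma>fn)
  thus ?thesis unfolding has_ord_def using evtr \<theta>0 1 by metis
 qed
 show "\<sigma> f : Lf" if "f : Lf" for f
 proof -
  from that obtain A B C where *: "f = fn A B / ceval C s" "C ~= 0" by (auto simp: Lf_def)
  have "ceval C s ~= 0" using *(2) s_transcendental by blast
  hence "\<sigma> (ceval C s) ~= 0" by (simp only: aut_0_iff[OF \<sigma>(1)] not_False_eq_True)
  hence "tr C ~= 0" unfolding \<sigma>c by auto
  thus ?thesis using *(1) Lf_I by (simp add: aut_divide[OF \<sigma>(1)] \<sigma>c \<sigma>fn)
 qed
qed

definition negE :: "'f \<times> 'f => 'f \<times> 'f" where "negE P = (fst P, snd P + 1)"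
text \<open>The zero of \<open>\<gamma> f\<close> if \<open>f\<close> vanishes at \<open>P\<close>
  and \<gamma> is the rotation s |-> s + 1, z |-> z + s + 1 of functions. On points this is the
  inverse of the substitution, hence the missing + 1 in the second coordinate.\<close>

definition rotE :: "'f \<times> 'f => 'f \<times> 'f" where "rotE P = (fst P + 1, snd P + fst P)"
definition frobE :: "'f \<times> 'f => 'f \<times> 'f" where "frobE P = ((fst P)\<^sup>2, (snd P)\<^sup>2)"

lemma add_eq_0_char2: "u + w = 0 \<longleftrightarrow> u = (w::'f)" by (metis add_right_cancel cf(1))

lemma sq_add: "(u + w)\<^sup>2 = u\<^sup>2 + (w::'f)\<^sup>2" by (simp add: sq_simps cf)

lemma cube_add_1: "(u + 1) ^ 3 = u ^ 3 + u\<^sup>2 + u + (1::'f)" by (simp add: sqr power3_eq_cube algebra_simps cf)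

lemma negE_Ec: "P : Ec ==> negE P : Ec" using Ec_neg by (cases P) (simp add: negE_def)

lemma frobE_Ec: "P : Ec ==> frobE P : Ec"
proof -
 assume "P : Ec"
 then obtain x y where P: "P = (x, y)" "y\<^sup>2 + y = x ^ 3 + x\<^sup>2" by (auto simp: Ec_def)
 show ?thesis using arg_cong[OF P(2), of "%u. u\<^sup>2"] by (simp add: sq_add frobE_def Ec_def P(1))
qed

lemma rotE_Ec: "P : Ec ==> rotE P : Ec"
proof -
 assume "P : Ec"
 then obtain x y where P: "P = (x, y)" "y\<^sup>2 + y = x ^ 3 + x\<^sup>2" by (auto simp: Ec_def)
 have "(y + x)\<^sup>2 + (y + x) = (y\<^sup>2 + y) + (x\<^sup>2 + x)" by (simp add: sq_add)
 also have "... = (x + 1) ^ 3 + (x + 1)\<^sup>2" unfolding P(2) cube_add_1 sq_add by (simp add: cf add_ac)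
 finally show ?thesis by (simp add: rotE_def Ec_def P(1))
qed

lemma rotE_rotE: "rotE (rotE P) = negE P" by (cases P) (simp add: rotE_def negE_def cf add_ac)

lemma frobE_rotE: "frobE (rotE P) = rotE (frobE P)" by (simp add: frobE_def rotE_def sq_add)

lemma negE_negE: "negE (negE P) = P" by (cases P) (simp add: negE_def cf add.assoc)

lemma negE_neq: "negE P ~= P" by (cases P) (simp add: negE_def)

text \<open>An automorphism with s |-> s + 1 sends z to z + s or to z + s + 1; in the first case its
  inverse is as required.\<close>

lemma rotation_exists: obtains \<gamma> where "\<gamma> : gal_geom" "\<gamma> s = s + 1" "\<gamma> z = z + s + 1"
proof -
 have s1: "ceval p (s + 1) = ceval (pcompose p [:1, 1:]) s" for p by (simp add: ceval_pcompose add.commute)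
 have "p = 0" if "ceval p (s + 1) = 0" for p
  using s_transcendental[of "pcompose p [:1, 1:]"] that pcompose_eq_0[of p "[:1, 1:]"] by (simp add: s1)
 moreover have "t_ac : rat_field (s + 1)"
 proof -
  have "s = ceval [:- 1, 1:] (s + 1)" by (simp add: cst_minus)
  hence "s : rat_field (s + 1)" by (metis ceval_in_rat_field)
  thus ?thesis using rat_field_subset t_in_rat_field_s by blast
 qed
 ultimately obtain \<sigma> where \<sigma>: "\<sigma> : field_auts" "!!c. \<sigma> (cst c) = cst c" "\<sigma> s = s + 1"
  using transcendental_automorphism[OF s_transcendental _ t_in_rat_field_s] by metis
 have "\<sigma> (s\<^sup>2 + s) = s\<^sup>2 + s"
 proof -
  have "(s + 1)\<^sup>2 + (s + 1) = s\<^sup>2 + s" by (simp add: sq_simps cw)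
  thus ?thesis by (simp only: aut[OF \<sigma>(1)] \<sigma>(3))
 qed
 hence t: "\<sigma> t_ac = t_ac" using a_nz unfolding s_eq by (simp add: aut[OF \<sigma>(1)] \<sigma>(2))
 have fix_ceval: "\<sigma> (ceval p t_ac) = ceval p t_ac" for p by (induction p) (simp_all add: aut[OF \<sigma>(1)] \<sigma>(2) t)
 have G: "\<sigma> : Aut (range to_ac)"
  unfolding Aut_def range_to_ac using \<sigma>(1) fix_ceval by (auto simp: aut_divide[OF \<sigma>(1)])
 have "(\<sigma> z)\<^sup>2 + \<sigma> z = (s + 1) ^ 3 + (s + 1)\<^sup>2" using arg_cong[OF z_eq, of \<sigma>] by (simp add: aut[OF \<sigma>(1)] \<sigma>(3))
 also have "... = (s ^ 3 + s\<^sup>2) + (s\<^sup>2 + s) + (2 * s\<^sup>2 + 4 * s + 2)"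
  by (simp add: sqr power3_eq_cube algebra_simps)
 also have "... = (z\<^sup>2 + z) + (s\<^sup>2 + s)" unfolding z_eq by (simp add: cw)
 finally have "(\<sigma> z)\<^sup>2 + \<sigma> z = (z\<^sup>2 + z) + (s\<^sup>2 + s)" .
 hence "(\<sigma> z + z + s) * (\<sigma> z + z + s + 1) = 0" by (simp add: sq_simps cw)
 then consider "\<sigma> z = z + s" | "\<sigma> z = z + s + 1"
 proof -
  assume *: "(\<sigma> z + z + s) * (\<sigma> z + z + s + 1) = 0"
  have "u + w = 0 ==> u = w" for u w :: "'f acf" by (metis add_right_cancel cw(1))
  hence "\<sigma> z = z + s \<or> \<sigma> z = z + s + 1" using * by (metis add.assoc mult_eq_0_iff)
  thus ?thesis using that by blast
 qed
 thus ?thesis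
 proof cases
  case 1
  let ?\<tau> = "iv \<sigma>"
  have "?\<tau> s = s + 1" "?\<tau> z = z + s + 1" using aut_inv_eq_iff[OF \<sigma>(1)] by (auto simp: aut[OF \<sigma>(1)] \<sigma>(3) 1 cw add_ac)
  thus ?thesis using that Aut_inv[OF G] by (simp add: gal_geom_eq)
 next
  case 2
  thus ?thesis using that \<sigma>(3) G by (simp add: gal_geom_eq)
 qed
qed

lemma gal_geom_const: "\<sigma> : gal_geom ==> \<sigma> (cst c) = cst c" by (simp add: gal_geom_def const_ac_def)

lemma ordE_rotation:
 assumes "\<gamma> : gal_geom" "\<gamma> s = s + 1" "\<gamma> z = z + s + 1" and P: "P : Ec" and f: "f : Lf" "f ~= 0"
 shows "\<gamma> f : Lf" "ordE (rotE P) (\<gamma> f) = ordE P f"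
proof -
 have F: "\<gamma> : field_auts" using assms(1) by (simp add: gal_geom_def)
 note H = has_ord_aut[OF F, of "%c. c" 1 1 1]
 show "\<gamma> f : Lf" by (rule H(2)[OF _ _ _ f(1)]) (use assms in \<open>simp_all add: gal_geom_const\<close>)
 obtain x y where xy: "P = (x, y)" by fastforce
 have "has_ord (x + 1, y + 1 * (x + 1) + 1) (\<gamma> f) (ordE P f)"
  by (rule H(1)) (use assms has_ord_ordE[OF P f] xy in \<open>simp_all add: gal_geom_const\<close>)
 moreover have "(x + 1, y + 1 * (x + 1) + 1) = rotE P" using cf by (simp add: rotE_def xy)
 ultimately show "ordE (rotE P) (\<gamma> f) = ordE P f" using ordE_eqI[OF rotE_Ec[OF P]] by simp
qed

lemma ordE_frobenius:
 assumes \<sigma>: "\<sigma> : field_auts" "!!c. \<sigma> (cst c) = cst (c ^ (2 ^ m))" "\<sigma> s = s" "\<sigma> z = z"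
  and P: "P : Ec" and f: "f : Lf" "f ~= 0"
 shows "\<sigma> f : Lf" "ordE ((frobE ^^ m) P) (\<sigma> f) = ordE P f"
proof -
 note H = has_ord_aut[OF \<sigma>(1), of "%c. c ^ (2 ^ m)" 0 0 0]
 show "\<sigma> f : Lf" by (rule H(2)[OF _ _ _ f(1)]) (use \<sigma> in simp_all)
 obtain x y where xy: "P = (x, y)" by fastforce
 have "has_ord (x ^ (2 ^ m) + 0, y ^ (2 ^ m) + 0 * (x ^ (2 ^ m) + 0) + 0) (\<sigma> f) (ordE P f)"
  by (rule H(1)) (use \<sigma> has_ord_ordE[OF P f] xy in simp_all)
 moreover have "(frobE ^^ k) P = (x ^ (2 ^ k), y ^ (2 ^ k))" for k
  by (induction k) (simp_all add: xy frobE_def mult.commute flip: power_mult)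
 moreover have "(frobE ^^ k) P : Ec" for k by (induction k) (use P frobE_Ec in auto)
 ultimately show "ordE ((frobE ^^ m) P) (\<sigma> f) = ordE P f" using ordE_eqI by fastforce
qed

lemma conj_fn:
 assumes "\<gamma> : gal_geom" "\<gamma> s = s + 1" "\<gamma> z = z + s + 1"
 shows "\<gamma> (\<gamma> s) = s" "\<gamma> (\<gamma> z) = z + 1" "\<gamma> (\<gamma> (fn A B)) = fn (A + B) B"
proof -
 have F: "\<gamma> : field_auts" using assms(1) by (simp add: gal_geom_def)
 show 1: "\<gamma> (\<gamma> s) = s" "\<gamma> (\<gamma> z) = z + 1" by (simp_all add: assms aut[OF F] cw)
 have F2: "\<gamma> o \<gamma> : field_auts" by (intro aut_comp F)
 have c: "(\<gamma> o \<gamma>) (ceval p s) = ceval p s" for p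
  by (induction p) (simp_all add: aut[OF F2, simplified] 1 gal_geom_const[OF assms(1)])
 show "\<gamma> (\<gamma> (fn A B)) = fn (A + B) B"
  using c[of A] c[of B] 1 by (simp add: fn_def aut[OF F] ceval_add algebra_simps)
qed

text \<open>Divisors record affine points only, the multiplicity at infinity being determined by
  degree zero. Divisors modulo \<open>Prin\<close> are thus the classes of degree zero, with the
  point at infinity as origin.\<close>

definition Prin :: "('f \<times> 'f \<Rightarrow>\<^sub>0 int) => bool" where "Prin D \<longleftrightarrow> supp D <= Ec &
   (\<exists>f\<in>Lf. f ~= 0 & (\<forall>P\<in>Ec. ordE P f = mlt D P))"

lemma PrinI: "supp D <= Ec ==> f : Lf ==> f ~= 0 ==> (!!P. P : Ec ==> ordE P f = mlt D P) ==> Prin D"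
 unfolding Prin_def by blast

lemma PrinE:
 assumes "Prin D" obtains f where "f : Lf" "f ~= 0" "!!P. P : Ec ==> ordE P f = mlt D P" "supp D <= Ec"
 using assms unfolding Prin_def by blast

lemma Prin_0: "Prin 0" by (rule PrinI[of _ 1]) (auto simp: ordE_1 subfld_D(1)[OF subfield_Lf])

lemma Prin_add: "Prin D ==> Prin D' ==> Prin (D + D')"
proof (elim PrinE)
 fix f g assume fg: "f : Lf" "f ~= 0" "g : Lf" "g ~= 0" "!!P. P : Ec ==> ordE P f = mlt D P" "supp D <= Ec"
  "!!P. P : Ec ==> ordE P g = mlt D' P" "supp D' <= Ec"
 show "Prin (D + D')" by (rule PrinI[of _ "f * g"])
   (use fg Poly_Mapping.keys_add[of D D'] subfld_D(6)[OF subfield_Lf] in \<open>auto simp: ordE_mult lookup_add\<close>)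
qed

lemma Prin_minus: "Prin D ==> Prin (- D)"
proof (elim PrinE)
 fix f assume f: "f : Lf" "f ~= 0" "!!P. P : Ec ==> ordE P f = mlt D P" "supp D <= Ec"
 show "Prin (- D)"
  by (rule PrinI[of _ "inverse f"]) (use f subfld_D(4)[OF subfield_Lf] in \<open>auto simp: ordE_inverse\<close>)
qed

lemma Prin_diff: "Prin D ==> Prin D' ==> Prin (D - D')" using Prin_add[OF _ Prin_minus, of D D'] by simp

lemma Prin_cmul: "Prin D ==> Prin (mul n D)"
 by (rule frag_closure_minus_cmul[of Prin]) (auto intro: Prin_0 Prin_diff)

lemma Prin_minus_iff: "Prin (- D) \<longleftrightarrow> Prin D" using Prin_minus by fastforce

lemma order_linear: "order x [:- y, 1:] = (if x = y then 1 else 0)" for x y :: 'f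
 using order_power_n_n[of y 1] by (auto intro: order_0I)

lemma Prin_vertical:
 assumes P: "P : Ec"
 shows "Prin (frag_of P + frag_of (negE P))"
proof (rule PrinI[of _ "ceval [:- fst P, 1:] s"])
 show "supp (frag_of P + frag_of (negE P)) <= Ec"
  by (rule order_trans[OF Poly_Mapping.keys_add]) (use P negE_Ec[OF P] in simp)
 show "ceval [:- fst P, 1:] s : Lf" using fn_in_Lf[of "[:- fst P, 1:]" 0] by (simp only: fn_ceval)
 show "ceval [:- fst P, 1:] s ~= 0" unfolding s_transcendental' by simp
 fix Q assume Q: "Q : Ec"
 have 1: "fst P = fst Q \<longleftrightarrow> Q = P \<or> Q = negE P"
 proof
  assume *: "fst P = fst Q"
  obtain x y y' where PQ: "P = (x, y)" "Q = (x, y')" using * by (metis prod.collapse)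
  have "y\<^sup>2 + y = y'\<^sup>2 + y'" using P Q by (simp add: Ec_def PQ)
  hence "(y + y') * (y + y' + 1) = 0" by (simp add: sq_simps cf) (metis add.assoc add.commute cf(1) cf(2))
  then consider "y + y' = 0" | "y + y' + 1 = 0" by auto
  thus "Q = P \<or> Q = negE P"
  proof cases
   case 1 thus ?thesis using PQ by (simp add: add_eq_0_char2)
  next
   case 2
   hence "y' + (y + 1) = 0" by (simp add: add_ac)
   thus ?thesis using PQ by (simp only: add_eq_0_char2) (simp add: negE_def)
  qed
 qed (auto simp: negE_def)
 show "ordE Q (ceval [:- fst P, 1:] s) = mlt (frag_of P + frag_of (negE P)) Q"
  using ordE_ceval[OF Q, of "[:- fst P, 1:]"] 1 negE_neq[of P] by (auto simp: order_linear lookup_add)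
qed

text \<open>z + \<kappa> s + \<mu> vanishes exactly at the points of the curve on the line. Its
  order there is that of its norm, a cubic in s, because the coefficient of z is 1.\<close>

lemma Prin_line:
 assumes N: "nrm [:\<mu>, \<kappa>:] 1 = [:- x1, 1:] * [:- x2, 1:] * [:- x3, 1:]"
 shows "Prin (frag_of (x1, \<kappa> * x1 + \<mu>) + frag_of (x2, \<kappa> * x2 + \<mu>) + frag_of (x3, \<kappa> * x3 + \<mu>))"
  and "(x1, \<kappa> * x1 + \<mu>) : Ec" "(x2, \<kappa> * x2 + \<mu>) : Ec" "(x3, \<kappa> * x3 + \<mu>) : Ec"
proof -
 have Ec: "(x, \<kappa> * x + \<mu>) : Ec \<longleftrightarrow> poly (nrm [:\<mu>, \<kappa>:] 1) x = 0" for x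
 proof -
  have "poly (nrm [:\<mu>, \<kappa>:] 1) x = ((\<kappa> * x + \<mu>)\<^sup>2 + (\<kappa> * x + \<mu>)) + (x ^ 3 + x\<^sup>2)"
   by (simp add: nrm_def poly_wp algebra_simps)
  thus ?thesis by (simp add: Ec_def add_eq_0_char2)
 qed
 show E: "(x1, \<kappa> * x1 + \<mu>) : Ec" "(x2, \<kappa> * x2 + \<mu>) : Ec" "(x3, \<kappa> * x3 + \<mu>) : Ec"
  unfolding Ec N by (simp_all only: poly_mult) simp_all
 let ?D = "frag_of (x1, \<kappa> * x1 + \<mu>) + frag_of (x2, \<kappa> * x2 + \<mu>) + frag_of (x3, \<kappa> * x3 + \<mu>)"
 show "Prin ?D"
 proof (rule PrinI[of _ "fn [:\<mu>, \<kappa>:] 1"])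
  have "supp ?D <= {(x1, \<kappa> * x1 + \<mu>), (x2, \<kappa> * x2 + \<mu>), (x3, \<kappa> * x3 + \<mu>)}"
   by (intro order_trans[OF Poly_Mapping.keys_add] Un_least) auto
  thus "supp ?D <= Ec" using E by blast
  show nz: "fn [:\<mu>, \<kappa>:] 1 ~= 0" by (simp add: fn_eq_0_iff)
  fix Q assume Q: "Q : Ec"
  obtain x y where xy: "Q = (x, y)" by fastforce
  have ev: "ev [:\<mu>, \<kappa>:] 1 Q = 0 \<longleftrightarrow> y = \<kappa> * x + \<mu>"
  proof -
   have "ev [:\<mu>, \<kappa>:] 1 Q = y + (\<kappa> * x + \<mu>)" by (simp add: ev_def xy)
   thus ?thesis by (simp only: add_eq_0_char2)
  qed
  show "ordE Q (fn [:\<mu>, \<kappa>:] 1) = mlt ?D Q"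
  proof (cases "y = \<kappa> * x + \<mu>")
   case True
   have "ordE Q (fn [:\<mu>, \<kappa>:] 1) = int (order x (nrm [:\<mu>, \<kappa>:] 1))"
    using ordE_eqI[OF Q has_ord_fn_primitive[OF Q]] ev True xy by simp
   also have "order x (nrm [:\<mu>, \<kappa>:] 1) = (if x = x1 then 1 else 0) + (if x = x2 then 1 else 0) + (if x = x3 then 1 else 0)"
    unfolding N by (subst order_mult, simp, subst order_mult, simp) (simp only: order_linear)
   finally show ?thesis using True xy by (simp add: lookup_add)
  next
   case False
   thus ?thesis using ordE_eqI[OF Q has_ord_0_iff_ev] ev False xy by (auto simp: lookup_add)
  qed
 qed (rule fn_in_Lf)
qed

lemma Prin_frobenius_rotation:
 assumes P: "P : Ec"
 shows "Prin (frag_of P + frag_of (frobE P) + frag_of (rotE P))"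
proof -
 obtain x y where xy: "P = (x, y)" "y\<^sup>2 + y = x ^ 3 + x\<^sup>2" using P by (auto simp: Ec_def)
 have y2: "y * y = y + (x ^ 3 + x\<^sup>2)" using xy(2) by (metis add.commute cf(2) sqr)
 \<comment> \<open>With slope x the three roots have the sum x^2 + 1; two of them are x and x + 1,
   so the third is x^2.\<close>
 have "nrm [:y + x\<^sup>2, x:] 1 = [:- x, 1:] * [:- (x\<^sup>2), 1:] * [:- (x + 1), 1:]"
 proof -
  have 1: "nrm [:y + x\<^sup>2, x:] 1 = [:(y * y + y) + x ^ 4 + x\<^sup>2, x, x\<^sup>2 + 1, 1:]" by (simp add: nrm_def wp_def algebra_simps cf eval_nat_numeral)
  have 2: "[:- x, 1:] * [:- (x\<^sup>2), 1:] * [:- (x + 1), 1:] = [:x ^ 4 + x ^ 3, x, x\<^sup>2 + 1, 1:]" by (simp add: cf algebra_simps eval_nat_numeral)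
  have 3: "(y * y + y) + x ^ 4 + x\<^sup>2 = x ^ 4 + x ^ 3" unfolding y2 by (simp add: cf)
  show ?thesis unfolding 1 2 3 ..
 qed
 from Prin_line(1)[OF this]
 have "Prin (frag_of (x, x * x + (y + x\<^sup>2)) + frag_of (x\<^sup>2, x * x\<^sup>2 + (y + x\<^sup>2)) + frag_of (x + 1, x * (x + 1) + (y + x\<^sup>2)))" .
 moreover have "x * x + (y + x\<^sup>2) = y" by (simp add: sqr cf)
 moreover have "x * x\<^sup>2 + (y + x\<^sup>2) = y\<^sup>2" using y2 by (simp add: sqr power3_eq_cube)
 moreover have "x * (x + 1) + (y + x\<^sup>2) = y + x" by (simp add: sq_simps cf)
 ultimately show ?thesis by (simp add: xy(1) frobE_def rotE_def)
qed

end

section \<open>Linear equivalence, and Frobenius in terms of the rotation\<close>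

definition push :: "('p => 'p) => ('p \<Rightarrow>\<^sub>0 int) => ('p \<Rightarrow>\<^sub>0 int)" where "push \<pi> = frag_extend (%P. frag_of (\<pi> P))"

lemma push_of [simp]: "push \<pi> (frag_of P) = frag_of (\<pi> P)" by (simp add: push_def)

lemma push_0 [simp]: "push \<pi> 0 = 0" and push_diff: "push \<pi> (D - D') = push \<pi> D - push \<pi> D'"
 by (simp_all add: push_def frag_extend_diff)

lemma push_comp: "push \<pi> (push \<rho> D) = push (\<pi> o \<rho>) D"
 using frag_extend_compose[of "%P. frag_of (\<pi> P)" \<rho> D] by (simp add: push_def comp_def)

lemma push_ident: "push (%P. P) D = D" using frag_expansion[of D] by (simp add: push_def)

lemma push_keys:
 assumes "supp D <= S" "!!P. P : S ==> \<pi> P : S"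
 shows "supp (push \<pi> D) <= S" unfolding push_def by (rule order_trans[OF keys_frag_extend]) (use assms in auto)

lemma push_lookup:
 assumes "inj \<pi>"
 shows "mlt (push \<pi> D) (\<pi> P) = mlt D P"
proof -
 have "supp D <= UNIV" by simp
 thus ?thesis by (induction D rule: frag_induction) (use assms in \<open>auto simp: push_diff lookup_minus inj_eq\<close>)
qed

lemma frag_cmul_2: "mul 2 D = D + D" using frag_cmul_distrib[of 1 1 D] by simp

context ell
begin

abbreviation divs :: "('f \<times> 'f \<Rightarrow>\<^sub>0 int) set" where "divs \<equiv> {D. supp D <= Ec}"

definition lin_eq :: "('f \<times> 'f \<Rightarrow>\<^sub>0 int) => ('f \<times> 'f \<Rightarrow>\<^sub>0 int) => bool" (infix "\<approx>" 50) where
 "D \<approx> D' \<longleftrightarrow> Prin (D - D')"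

lemma lin_eq_refl: "D \<approx> D" by (simp add: lin_eq_def Prin_0)
lemma lin_eq_sym: "D \<approx> D' ==> D' \<approx> D" using Prin_minus[of "D - D'"] by (simp add: lin_eq_def)
lemma lin_eq_trans [trans]: "D \<approx> D' ==> D' \<approx> D'' ==> D \<approx> D''"
 using Prin_add[of "D - D'" "D' - D''"] by (simp add: lin_eq_def)
lemma lin_eq_add: "D \<approx> D' ==> E \<approx> E' ==> D + E \<approx> D' + E'"
 using Prin_add[of "D - D'" "E - E'"] by (simp add: lin_eq_def algebra_simps)
lemma lin_eq_diff: "D \<approx> D' ==> E \<approx> E' ==> D - E \<approx> D' - E'"
 using Prin_diff[of "D - D'" "E - E'"] by (simp add: lin_eq_def algebra_simps)
lemma lin_eq_minus: "D \<approx> D' ==> - D \<approx> - D'" using lin_eq_diff[OF lin_eq_refl[of 0]] by simp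
lemma lin_eq_cmul: "D \<approx> D' ==> mul n D \<approx> mul n D'"
proof -
 have "mul n (D - D') = mul n D - mul n D'"
  by (rule poly_mapping_eqI) (simp add: lookup_minus right_diff_distrib)
 thus "D \<approx> D' ==> ?thesis" using Prin_cmul[of "D - D'" n] by (simp add: lin_eq_def)
qed

lemma divs_closed: "0 : divs" "P : Ec ==> frag_of P : divs" "D : divs ==> - D : divs"
 "D : divs ==> D' : divs ==> D + D' : divs" "D : divs ==> D' : divs ==> D - D' : divs" "D : divs ==> mul n D : divs"
 using Poly_Mapping.keys_add[of D D'] keys_diff[of D D'] keys_cmul[of n D] by auto

lemma pushs: "D : divs ==> push negE D : divs" "D : divs ==> push rotE D : divs"
 "D : divs ==> push frobE D : divs" "D : divs ==> push (frobE ^^ k) D : divs"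
proof -
 have k: "(frobE ^^ k) P : Ec" if "P : Ec" for P by (induction k) (use that frobE_Ec in auto)
 show "D : divs ==> push negE D : divs" "D : divs ==> push rotE D : divs"
  "D : divs ==> push frobE D : divs" "D : divs ==> push (frobE ^^ k) D : divs"
  using push_keys[of D Ec] negE_Ec rotE_Ec frobE_Ec k by simp_all
qed

lemma push_neg:
 assumes "D : divs"
 shows "push negE D \<approx> - D"
proof -
 have "supp D <= Ec" using assms by simp
 hence "Prin (D + push negE D)"
 proof (induction D rule: frag_induction)
  case (diff a b)
  thus ?case using Prin_diff[OF diff] by (simp add: push_diff algebra_simps)
 qed (simp_all add: Prin_0 Prin_vertical)
 thus ?thesis by (simp add: lin_eq_def add.commute)
qed

lemma push_frob:
 assumes "D : divs"
 shows "push frobE D \<approx> - D - push rotE D"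
proof -
 have "supp D <= Ec" using assms by simp
 hence "Prin (D + push frobE D + push rotE D)"
 proof (induction D rule: frag_induction)
  case (diff a b)
  thus ?case using Prin_diff[OF diff] by (simp add: push_diff algebra_simps)
 qed (simp_all add: Prin_0 Prin_frobenius_rotation)
 thus ?thesis by (simp add: lin_eq_def algebra_simps)
qed

lemma push_rot_rot: "D : divs ==> push rotE (push rotE D) \<approx> - D"
proof -
 have "rotE o rotE = negE" by (simp add: fun_eq_iff rotE_rotE)
 thus "D : divs ==> ?thesis" using push_neg by (simp add: push_comp)
qed

lemma push_frob_rot: "push frobE (push rotE D) = push rotE (push frobE D)"
proof -
 have "frobE o rotE = rotE o frobE" by (simp add: fun_eq_iff frobE_rotE)
 thus ?thesis by (simp add: push_comp)
qed

lemma push_frob_Suc: "push (\<pi> ^^ Suc k) D = push \<pi> (push (\<pi> ^^ k) D)" by (simp only: push_comp funpow.simps)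

lemma push_frobs_rot: "push (frobE ^^ k) (push rotE D) = push rotE (push (frobE ^^ k) D)"
proof (induction k)
 case 0
 show ?case by (simp add: push_ident id_def)
next
 case (Suc k)
 thus ?case by (simp only: push_frob_Suc push_frob_rot)
qed

text \<open>(-1 - i)^2 = 2 i, with the rotation in the role of i.\<close>

lemma push_frob_sq: "D : divs ==> push frobE (push frobE D) \<approx> mul 2 (push rotE D)"
proof -
 assume D: "D : divs"
 let ?r = "push rotE D"
 note R = pushs(2)[OF D]
 have "push frobE (push frobE D) \<approx> - push frobE D - push rotE (push frobE D)"
  by (rule push_frob[OF pushs(3)[OF D]])
 also have "- push frobE D - push rotE (push frobE D) \<approx> - (- D - ?r) - (- ?r - push rotE ?r)"
  unfolding push_frob_rot[symmetric] by (intro lin_eq_diff lin_eq_minus push_frob[OF D] push_frob[OF R])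
 also have "- (- D - ?r) - (- ?r - push rotE ?r) \<approx> - (- D - ?r) - (- ?r - (- D))"
  by (intro lin_eq_diff lin_eq_refl push_rot_rot[OF D])
 also have "- (- D - ?r) - (- ?r - (- D)) = mul 2 ?r" by (simp add: frag_cmul_2)
 finally show ?thesis .
qed

lemma push_frob_4:
 assumes D: "D : divs"
 shows "push (frobE ^^ 4) D \<approx> mul (-4) D"
proof -
 let ?r = "push rotE D"
 note R = pushs(2)[OF D]
 have "frobE ^^ 4 = (frobE o frobE) o (frobE o frobE)" by (simp add: eval_nat_numeral comp_assoc)
 hence "push (frobE ^^ 4) D = push frobE (push frobE (push frobE (push frobE D)))"
  by (simp only: push_comp comp_assoc)
 also have "... \<approx> mul 2 (push rotE (push frobE (push frobE D)))" by (rule push_frob_sq) (intro pushs D)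
 also have "push rotE (push frobE (push frobE D)) = push frobE (push frobE ?r)" by (simp add: push_frob_rot)
 also have "mul 2 (push frobE (push frobE ?r)) \<approx> mul 2 (mul 2 (push rotE ?r))"
  by (intro lin_eq_cmul push_frob_sq R)
 also have "... \<approx> mul 2 (mul 2 (- D))" by (intro lin_eq_cmul push_rot_rot D)
 also have "mul 2 (mul 2 (- D)) = mul (-4) D" by (rule poly_mapping_eqI) simp
 finally show ?thesis .
qed

text \<open>The eighth power of Frobenius acts as (-4)^2. The points over the field with 256^m
  elements are therefore the torsion points killed by 16^m - 1.\<close>

lemma push_frob_8:
 assumes D: "D : divs"
 shows "push (frobE ^^ 8) D \<approx> mul 16 D"
proof -
 have "push (frobE ^^ 8) D = push (frobE ^^ 4) (push (frobE ^^ 4) D)"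
  unfolding push_comp by (simp flip: funpow_add)
 also have "... \<approx> mul (-4) (push (frobE ^^ 4) D)" by (intro push_frob_4 pushs D)
 also have "... \<approx> mul (-4) (mul (-4) D)" by (intro lin_eq_cmul push_frob_4 D)
 finally show ?thesis by simp
qed

lemma push_frob_8_power:
 assumes D: "D : divs"
 shows "push (frobE ^^ (8 * m)) D \<approx> mul (16 ^ m) D"
proof (induction m)
 case 0
 show ?case by (simp add: lin_eq_refl push_ident id_def)
next
 case (Suc m)
 have "push (frobE ^^ (8 * Suc m)) D = push (frobE ^^ 8) (push (frobE ^^ (8 * m)) D)"
  unfolding push_comp by (simp flip: funpow_add)
 also have "... \<approx> mul 16 (push (frobE ^^ (8 * m)) D)" by (intro push_frob_8 pushs D)
 also have "... \<approx> mul 16 (mul (16 ^ m) D)" by (intro lin_eq_cmul Suc.IH)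
 finally show ?case by simp
qed

text \<open>\<open>gi m\<close> is the Gaussian integer \<open>(-1 - i)^m\<close>, as Frobenius acts on divisor classes like \<open>-1 - i\<close>
  if \<open>i\<close> acts by the rotation.\<close>

primrec gi :: "nat => int \<times> int" where "gi 0 = (1, 0)"
| "gi (Suc m) = (- fst (gi m) + snd (gi m), - fst (gi m) - snd (gi m))"

lemma push_frobs:
 assumes D: "D : divs"
 shows "push (frobE ^^ m) D \<approx> mul (fst (gi m)) D + mul (snd (gi m)) (push rotE D)" using D
proof (induction m arbitrary: D)
 case 0
 show ?case by (simp add: lin_eq_refl push_ident id_def)
next
 case (Suc m)
 let ?r = "push rotE D" and ?x = "fst (gi m)" and ?y = "snd (gi m)"
 note R = pushs(2)[OF Suc.prems]
 have "push (frobE ^^ Suc m) D = push frobE (push (frobE ^^ m) D)" by (simp add: push_comp)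
 also have "... \<approx> - push (frobE ^^ m) D - push (frobE ^^ m) ?r"
  unfolding push_frobs_rot by (rule push_frob[OF pushs(4)[OF Suc.prems]])
 also have "... \<approx> - (mul ?x D + mul ?y ?r) - (mul ?x ?r + mul ?y (push rotE ?r))"
  by (intro lin_eq_diff lin_eq_minus Suc.IH R Suc.prems)
 also have "... \<approx> - (mul ?x D + mul ?y ?r) - (mul ?x ?r + mul ?y (- D))"
  by (intro lin_eq_diff lin_eq_add lin_eq_cmul lin_eq_refl push_rot_rot Suc.prems)
 also have "- (mul ?x D + mul ?y ?r) - (mul ?x ?r + mul ?y (- D))
  = mul (fst (gi (Suc m))) D + mul (snd (gi (Suc m))) ?r"
  by (rule poly_mapping_eqI) (simp add: lookup_minus lookup_add algebra_simps)
 finally show ?case .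
qed

section \<open>Divisor classes and points\<close>

lemma Ec_same_fst:
 assumes "P : Ec" "Q : Ec"
 shows "fst P = fst Q \<longleftrightarrow> Q = P \<or> Q = negE P"
proof
 assume *: "fst P = fst Q"
 obtain x y y' where PQ: "P = (x, y)" "Q = (x, y')" using * by (metis prod.collapse)
 have "y\<^sup>2 + y = y'\<^sup>2 + y'" using assms by (simp add: Ec_def PQ)
 hence "(y + y') * (y + y' + 1) = 0" by (simp add: sq_simps cf) (metis add.assoc add.commute cf(1) cf(2))
 hence "y + y' = 0 \<or> y' + (y + 1) = 0" by (auto simp: add_ac)
 thus "Q = P \<or> Q = negE P" unfolding add_eq_0_char2 by (auto simp: PQ negE_def)
qed (auto simp: negE_def)

text \<open>The norm of \<open>f\<close> has the divisor of \<open>C\<close> and hence degree at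
  most 2, while a nonzero coefficient of z would give degree at least 3. So \<open>f\<close> is a
  polynomial in s; this is where the genus enters.\<close>

lemma regular_small_degree:
 assumes f: "f : Lf" "f ~= 0" "!!P. P : Ec ==> ordE P f >= 0"
  and C: "C ~= 0" "degree C <= 2" and le: "!!P. P : Ec ==> ordE P f + ordE (negE P) f = int (order (fst P) C)"
  and P: "P : Ec"
 shows "ordE (negE P) f = ordE P f"
proof -
 \<comment> \<open>The square of the rotation is the conjugation z |-> z + 1, so it yields the
   orders of the conjugate of \<open>f\<close>.\<close>
 obtain \<gamma> where \<gamma>: "\<gamma> : gal_geom" "\<gamma> s = s + 1" "\<gamma> z = z + s + 1" by (rule rotation_exists)
 obtain A B where AB: "f = fn A B" using regular_imp_fn[OF f] by blast
 hence nz: "A ~= 0 \<or> B ~= 0" using f(2) by (auto simp: fn_eq_0_iff)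
 note N = degree_nrm[OF nz]
 have F: "\<gamma> : field_auts" using \<gamma>(1) by (simp add: gal_geom_def)
 have g: "\<gamma> f : Lf" "\<gamma> f ~= 0" using ordE_rotation(1)[OF \<gamma> P f(1,2)] f(2) aut_0_iff[OF F] by auto
 have ordN: "order (fst Q) (nrm A B) = order (fst Q) C" if Q: "Q : Ec" for Q
 proof -
  have 1: "ordE Q (fn (A + B) B) = ordE (negE Q) f" if "Q : Ec" for Q using ordE_rotation[OF \<gamma> rotE_Ec[OF Q] g] ordE_rotation(2)[OF \<gamma> Q f(1,2)] rotE_rotE ordE_rotation[OF \<gamma> rotE_Ec[OF negE_Ec[OF that]] g] ordE_rotation(2)[OF \<gamma> negE_Ec[OF that] f(1,2)] negE_negE conj_fn(3)[OF \<gamma>] AB by simp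
  have "fn (A + B) B ~= 0" using nz by (auto simp: fn_eq_0_iff)
  thus ?thesis using ordE_mult[OF Q fn_in_Lf _ fn_in_Lf, of A B "A + B" B] f(2) 1[OF Q] le[OF Q] AB ordE_ceval[OF Q N(1)] by (simp add: fn_nrm)
 qed
 have "\<exists>c. ceval (nrm A B) s / ceval C s = cst c"
 proof (rule unit_imp_const)
  have L: "ceval D s : Lf" for D using fn_in_Lf[of D 0] by (simp add: fn_ceval)
  have nz: "ceval (nrm A B) s ~= 0" "ceval C s ~= 0" using N(1) C(1) s_transcendental by blast+
  show "ceval (nrm A B) s / ceval C s : Lf" by (intro subfld_D(8)[OF subfield_Lf] L)
  show "ceval (nrm A B) s / ceval C s ~= 0" using nz by simp
  show "ordE Q (ceval (nrm A B) s / ceval C s) = 0" if "Q : Ec" for Q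
   using ordN[OF that] nz L subfld_D(4)[OF subfield_Lf] N(1) C(1)
   by (simp add: field_class.field_divide_inverse ordE_mult[OF that] ordE_inverse[OF that] ordE_ceval[OF that])
 qed
 then obtain c where c: "ceval (nrm A B) s / ceval C s = cst c" by blast
 moreover have "ceval C s ~= 0" using C(1) s_transcendental by blast
 ultimately have "ceval (nrm A B) s = ceval (smult c C) s" by (simp add: ceval_smult field_simps)
 hence "degree (nrm A B) <= 2" using ceval_s_inj C(2) degree_smult_le order_trans by simp
 hence "B = 0" using N(2) by force
 thus ?thesis using AB nz ordE_ceval P negE_Ec[OF P] by (simp add: fn_ceval negE_def)
qed

lemma not_Prin_point:
 assumes "P : Ec"
 shows "~ Prin (frag_of P)"
proof
 assume "Prin (frag_of P)"
 then obtain f where f: "f : Lf" "f ~= 0" "!!Q. Q : Ec ==> ordE Q f = mlt (frag_of P) Q" by (metis PrinE)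
 have "ordE (negE P) f = ordE P f"
 proof (rule regular_small_degree[of _ "[:- fst P, 1:]"])
  show "ordE Q f + ordE (negE Q) f = int (order (fst Q) [:- fst P, 1:])" if Q: "Q : Ec" for Q
   using f(3)[OF Q] f(3)[OF negE_Ec[OF Q]] Ec_same_fst[OF Q assms] negE_neq[of Q] by (auto simp: order_linear)
 qed (use f assms in auto)
 thus False using f(3) assms negE_Ec[OF assms] negE_neq[of P] by simp
qed

lemma Prin_two_points:
 assumes P: "P : Ec" and P': "P' : Ec" and prin: "Prin (frag_of P + frag_of P')"
 shows "P' = negE P"
proof -
 obtain f where f: "f : Lf" "f ~= 0" "!!Q. Q : Ec ==> ordE Q f = mlt (frag_of P + frag_of P') Q"
  using prin by (metis PrinE)
 hence f': "!!Q. Q : Ec ==> ordE Q f = (if Q = P then 1 else 0) + (if Q = P' then 1 else 0)"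
  by (simp add: lookup_add)
 have "ordE (negE P) f = ordE P f"
 proof (rule regular_small_degree[of _ "[:- fst P, 1:] * [:- fst P', 1:]"])
  show "degree ([:- fst P, 1:] * [:- fst P', 1:]) <= 2" by (subst degree_mult_eq) auto
  show "[:- fst P, 1:] * [:- fst P', 1:] ~= 0" by (subst mult_eq_0_iff) auto
  show "ordE Q f + ordE (negE Q) f = int (order (fst Q) ([:- fst P, 1:] * [:- fst P', 1:]))" if Q: "Q : Ec" for Q
  proof -
   have "order (fst Q) ([:- fst P, 1:] * [:- fst P', 1:]) = (if fst Q = fst P then 1 else 0) + (if fst Q = fst P' then 1 else 0)"
    by (subst order_mult) (subst mult_eq_0_iff, simp, simp only: order_linear)
   thus ?thesis
    using f'[OF Q] f'[OF negE_Ec[OF Q]] Ec_same_fst[OF Q P] Ec_same_fst[OF Q P'] negE_neq[of Q] by auto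
  qed
 qed (use f' f P in auto)
 thus ?thesis using f'[OF P] f'[OF negE_Ec[OF P]] negE_neq[of P] by (auto split: if_splits)
qed

text \<open>\<open>None\<close> is the point at infinity, which represents the zero class.\<close>

definition pts :: "('f \<times> 'f) option set" where "pts = insert None (Some ` Ec)"

definition dv :: "('f \<times> 'f) option => ('f \<times> 'f \<Rightarrow>\<^sub>0 int)" where "dv R = (case R of None => 0 | Some P => frag_of P)"

lemma dv_simps [simp]: "dv None = 0" "dv (Some P) = frag_of P" by (simp_all add: dv_def)

lemma dv_in_divs: "R : pts ==> dv R : divs" by (auto simp: pts_def)

lemma dv_unique:
 assumes "R : pts" "R' : pts" "dv R \<approx> dv R'"
 shows "R = R'"
proof -
 have *: "P = P'" if "P : Ec" "P' : Ec" "frag_of P \<approx> frag_of P'" for P P'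
 proof -
  have "Prin (frag_of P + frag_of (negE P'))" using that Prin_add Prin_vertical unfolding lin_eq_def by fastforce
  thus ?thesis using Prin_two_points[OF that(1) negE_Ec[OF that(2)]] negE_negE by metis
 qed
 consider "R = None" "R' = None" | P where "R = Some P" "P : Ec" "R' = None"
  | P where "R' = Some P" "P : Ec" "R = None"
  | P P' where "R = Some P" "R' = Some P'" "P : Ec" "P' : Ec" using assms(1,2) by (auto simp: pts_def)
 thus ?thesis
 proof cases
  case 2
  thus ?thesis using assms(3) not_Prin_point by (simp add: lin_eq_def)
 next
  case 3
  thus ?thesis using assms(3) not_Prin_point Prin_minus_iff by (simp add: lin_eq_def)
 next
  case 4
  thus ?thesis using * assms(3) by simp
 qed simp
qed

lemma chord:
 assumes P: "P : Ec" and Q: "Q : Ec"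
 shows "\<exists>R\<in>pts. frag_of P + frag_of Q \<approx> dv R"
proof -
 consider "Q = negE P" | "Q = P" | "fst P ~= fst Q" using Ec_same_fst[OF P Q] by blast
 thus ?thesis
 proof cases
  case 1
  thus ?thesis using Prin_vertical[OF P] by (auto simp: lin_eq_def pts_def)
 next
  case 2
  \<comment> \<open>Doubling without a tangent: \<open>P\<close> is the rotation of
    \<open>?Q\<close>, and twice that rotation is the square of Frobenius applied to
    \<open>?Q\<close>.\<close>
  let ?Q = "negE (rotE P)"
  have Q: "?Q : Ec" by (intro negE_Ec rotE_Ec P)
  have "rotE ?Q = P" using cf by (cases P) (simp add: negE_def rotE_def add_ac)
  hence "frag_of P + frag_of P \<approx> frag_of (frobE (frobE ?Q))" using push_frob_sq[of "frag_of ?Q"] Q lin_eq_sym by (simp add: frag_cmul_2)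
  thus ?thesis using 2 frobE_Ec Q unfolding pts_def by (metis dv_simps(2) image_eqI insertCI)
 next
  case 3
  obtain x1 y1 x2 y2 where PQ: "P = (x1, y1)" "Q = (x2, y2)" by fastforce
  have ne: "x1 ~= x2" using 3 PQ by simp
  define \<kappa> where "\<kappa> = (y1 - y2) / (x1 - x2)"
  define \<mu> where "\<mu> = y1 - \<kappa> * x1"
  have y: "y1 = \<kappa> * x1 + \<mu>" "y2 = \<kappa> * x2 + \<mu>"
  proof -
   show "y1 = \<kappa> * x1 + \<mu>" by (simp add: \<mu>_def)
   have "\<kappa> * (x1 - x2) = y1 - y2" using ne by (simp add: \<kappa>_def)
   thus "y2 = \<kappa> * x2 + \<mu>" by (simp add: \<mu>_def algebra_simps)
  qed
  let ?N = "nrm [:\<mu>, \<kappa>:] 1"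
  have root: "poly ?N x = 0" if "(x, \<kappa> * x + \<mu>) : Ec" for x   using that by (simp add: nrm_def poly_wp algebra_simps Ec_def cf)
  have r1: "poly ?N x1 = 0" and r2: "poly ?N x2 = 0" using P Q PQ y root by auto
  have N_eq: "?N = [:\<mu>\<^sup>2 + \<mu>, 2 * \<mu> * \<kappa> + \<kappa>, \<kappa>\<^sup>2 + 1, 1:]" by (simp add: nrm_def wp_def sqr)
  \<comment> \<open>Splitting off the two known roots from the monic cubic leaves a linear factor,
    which gives the third point of the chord.\<close>
  obtain q where q: "?N = [:- x1, 1:] * q" using r1 poly_eq_0_iff_dvd by (metis dvdE)
  hence "poly q x2 = 0" using r2 ne by simp
  then obtain r where r: "q = [:- x2, 1:] * r" using poly_eq_0_iff_dvd by (metis dvdE)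
  have r0: "r ~= 0" "q ~= 0" using q r N_eq by auto
  have "degree ?N = 3" "lead_coeff ?N = 1" unfolding N_eq by simp_all
  moreover have "degree ?N = Suc (degree q)" unfolding q by (rule degree_linear_mult[OF r0(2)])
  moreover have "degree q = Suc (degree r)" using r0 degree_linear_mult r by metis
  moreover have "lead_coeff ?N = lead_coeff r" unfolding q r by (simp only: lead_coeff_mult) simp
  ultimately have "degree r = 1" "lead_coeff r = 1" by simp_all
  hence c: "r = [:coeff r 0, 1:]" by (intro poly_eqI) (auto simp: coeff_pCons coeff_eq_0 split: nat.splits)
  have N: "?N = [:- x1, 1:] * [:- x2, 1:] * [:- (- coeff r 0), 1:]"
   using q r c by (simp only: mult.assoc minus_minus)
  note L = Prin_line[OF N]
  let ?R = "(- coeff r 0, \<kappa> * (- coeff r 0) + \<mu>)"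
  have "frag_of P + frag_of Q \<approx> - frag_of ?R" using L(1) PQ y by (simp add: lin_eq_def)
  also have "... \<approx> frag_of (negE ?R)" using Prin_minus[OF Prin_vertical[OF L(4)]] by (simp add: lin_eq_def)
  finally have "frag_of P + frag_of Q \<approx> dv (Some (negE ?R))" by simp
  moreover have "Some (negE ?R) : pts" using negE_Ec[OF L(4)] by (simp add: pts_def)
  ultimately show ?thesis by blast
 qed
qed

lemma dv_exists:
 assumes "D : divs"
 shows "\<exists>R\<in>pts. D \<approx> dv R"
proof -
 have add: "\<exists>T\<in>pts. dv R + dv S \<approx> dv T" if RS: "R : pts" "S : pts" for R S
 proof (cases R)
  case None
  thus ?thesis using RS(2) lin_eq_refl by (intro bexI[of _ S]) auto
 next
  case R: (Some P)
  show ?thesis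
  proof (cases S)
   case None
   thus ?thesis using RS(1) lin_eq_refl by (intro bexI[of _ R]) auto
  next
   case S: (Some Q)
   thus ?thesis using R RS chord S by (auto simp: pts_def)
  qed
 qed
 have minus: "\<exists>T\<in>pts. - dv R \<approx> dv T" if "R : pts" for R
 proof (cases R)
  case None
  thus ?thesis using that lin_eq_refl[of 0] by (intro bexI[of _ None]) auto
 next
  case (Some P)
  hence P: "P : Ec" using that by (auto simp: pts_def)
  have "- dv R \<approx> dv (Some (negE P))" using Prin_minus[OF Prin_vertical[OF P]] Some by (simp add: lin_eq_def)
  moreover have "Some (negE P) : pts" using negE_Ec[OF P] by (simp add: pts_def)
  ultimately show ?thesis by blast
 qed
 have "supp D <= Ec" using assms by simp
 thus ?thesis
 proof (induction D rule: frag_induction)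
  case zero
  thus ?case using lin_eq_refl[of 0] by (intro bexI[of _ None]) (auto simp: pts_def)
 next
  case (one P)
  thus ?case using lin_eq_refl by (intro bexI[of _ "Some P"]) (auto simp: pts_def)
 next
  case (diff a b)
  then obtain R S where RS: "R : pts" "S : pts" "a \<approx> dv R" "b \<approx> dv S" by blast
  obtain S' where S': "S' : pts" "- dv S \<approx> dv S'" using minus[OF RS(2)] by blast
  obtain T where T: "T : pts" "dv R + dv S' \<approx> dv T" using add[OF RS(1) S'(1)] by blast
  have "a - b \<approx> dv R - dv S" by (intro lin_eq_diff RS)
  also have "... = dv R + (- dv S)" by simp
  also have "... \<approx> dv R + dv S'" by (intro lin_eq_add lin_eq_refl S')
  also note T(2)
  finally show ?case using T(1) by blast
 qed
qed

end

section \<open>Counting points\<close>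

lemma char2_power_add:
 fixes x y :: "'a::comm_ring_1"
 assumes "(1::'a) + 1 = 0"
 shows "(x + y) ^ (2 ^ i) = x ^ (2 ^ i) + y ^ (2 ^ i)"
proof (induction i)
 case (Suc i)
 have "(u + w)\<^sup>2 = u\<^sup>2 + w\<^sup>2" for u w :: 'a by (simp add: sq_simps char2_simps[OF assms])
 moreover have "u ^ (2 ^ Suc i) = (u ^ (2 ^ i))\<^sup>2" for u :: 'a by (simp add: mult.commute flip: power_mult)
 ultimately show ?case using Suc by simp
qed simp

lemma char2_power_sum:
 fixes f :: "'b => 'a::comm_ring_1"
 assumes "(1::'a) + 1 = 0"
 shows "(sum f I) ^ (2 ^ i) = (\<Sum>j\<in>I. f j ^ (2 ^ i))"
 by (induction I rule: infinite_finite_induct) (simp_all add: char2_power_add[OF assms] power_0_left)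

lemma card_roots_separable:
 fixes p :: "'f::alg_closed_field poly"
 assumes p: "p ~= 0" and sep: "!!x. poly p x = 0 ==> poly (pderiv p) x ~= 0"
 shows "card {x. poly p x = 0} = degree p" "finite {x. poly p x = 0}"
proof -
 show fin: "finite {x. poly p x = 0}" by (rule poly_roots_finite[OF p])
 obtain A where A: "size A = degree p" "p = smult (lead_coeff p) (\<Prod>y\<in>#A. [:-y, 1:])"
  using alg_closed_imp_factorization[OF p] by blast
 have roots: "set_mset A = {x. poly p x = 0}"
 proof -
  have "poly p x = lead_coeff p * (\<Prod>y\<in>#A. x - y)" for x by (subst A(2)) (simp add: poly_prod_mset)
  thus ?thesis using p by auto
 qed
 have "count A x = 1" if x: "x \<in># A" for x
 proof (rule ccontr)
  assume "count A x ~= 1"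
  then obtain B where "A = add_mset x (add_mset x B)"
   using x by (metis One_nat_def count_add_mset count_inI mset_add)
  hence "p = [:-x, 1:] * ([:-x, 1:] * smult (lead_coeff p) (\<Prod>y\<in>#B. [:-y, 1:]))" by (subst A(2)) simp
  then obtain q where q: "p = [:-x, 1:] * ([:-x, 1:] * q)" by blast
  have "poly (pderiv p) x = 0" unfolding q by (simp only: pderiv_mult poly_add poly_mult) simp
  moreover have "poly p x = 0" unfolding q by simp
  ultimately show False using sep by blast
 qed
 thus "card {x. poly p x = 0} = degree p" using A(1) roots by (simp add: size_multiset_overloaded_eq)
qed

lemma GF_two_power:
 assumes two: "(1::'f::alg_closed_field) + 1 = 0" and M: "M > 0"
 shows "finite (GF (2 ^ M) :: 'f set)" "card (GF (2 ^ M) :: 'f set) = 2 ^ M"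
proof -
 define p :: "'f poly" where "p = monom 1 (2 ^ M) + [:0, - 1:]"
 have gt: "(2::nat) ^ M > 1" using M by (intro one_less_power) auto
 have deg: "degree p = 2 ^ M"
  unfolding p_def using gt by (subst degree_add_eq_left) (auto simp: degree_monom_eq)
 hence "p ~= 0" by auto
 have "pderiv p = [:-1:]" using char2_simps(5)[OF two] M by (simp add: p_def pderiv_add pderiv_monom pderiv_pCons)
 hence "card {x. poly p x = 0} = degree p" "finite {x. poly p x = 0}"
  by (intro card_roots_separable \<open>p ~= 0\<close>; simp)+
 moreover have "{x. poly p x = 0} = GF (2 ^ M)" by (auto simp: p_def GF_def poly_monom)
 ultimately show "finite (GF (2 ^ M) :: 'f set)" "card (GF (2 ^ M) :: 'f set) = 2 ^ M" using deg by simp_all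
qed

context
 fixes M :: nat
 assumes two: "(1::'f::alg_closed_field) + 1 = 0" and M: "M > 0"
begin

private lemmas c2 = char2_simps[OF two]

abbreviation (input) KM :: "'f set" where "KM \<equiv> GF (2 ^ M)"

private lemmas K2 = GF_two_power[OF two M]

lemma sum_eq_0_iff2: "u + w = 0 \<longleftrightarrow> u = (w::'f)" by (metis add_right_cancel c2(1))

lemma subfield_GF: "subfld KM" unfolding subfld_def GF_def
 by (auto simp: char2_power_add[OF two] power_mult_distrib c2(3) power_inverse)

definition ftr :: "'f => 'f" where "ftr x = (\<Sum>i<M. x ^ (2 ^ i))"

lemma ftr_add: "ftr (x + y) = ftr x + ftr y" by (simp add: ftr_def char2_power_add[OF two] sum.distrib)

lemma ftr_artin_schreier: "ftr (y\<^sup>2 + y) = y ^ (2 ^ M) + y"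
proof -
 have "(\<Sum>i<k. (y\<^sup>2 + y) ^ (2 ^ i)) = y ^ (2 ^ k) + y" for k
  by (induction k) (simp_all add: char2_power_add[OF two] c2 add_ac flip: power_mult)
 thus ?thesis by (simp add: ftr_def)
qed

lemma ftr_square: "x : KM ==> ftr (x\<^sup>2) = ftr x"
 using ftr_artin_schreier[of x] ftr_add[of "x\<^sup>2" x] by (simp add: GF_def c2) (metis add_right_cancel c2(1))

lemma ftr_values: "x : KM ==> ftr x = 0 \<or> ftr x = 1"
proof -
 assume x: "x : KM"
 have "ftr x * (ftr x - 1) = 0" using char2_power_sum[OF two, of "%i. x ^ (2 ^ i)" "{..<M}" 1] ftr_square[OF x] by (simp add: ftr_def mult.commute sq_simps)
 thus ?thesis by auto
qed

text \<open>As a polynomial the trace has degree 2^(M-1), less than the number of elements of the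
  field.\<close>

lemma ftr_nontrivial: "\<exists>x\<in>KM. ftr x = 1"
proof (rule ccontr)
 assume no: "~ ?thesis"
 define p :: "'f poly" where "p = (\<Sum>i<M. monom 1 (2 ^ i))"
 have "coeff p (2 ^ (M - 1)) = (\<Sum>i<M. if i = M - 1 then 1 else 0)"
  unfolding p_def by (auto simp: coeff_sum intro!: sum.cong)
 hence p0: "p ~= 0" using M by auto
 have "degree p <= 2 ^ (M - 1)"
  unfolding p_def using M by (intro degree_sum_le) (auto simp: degree_monom_eq intro!: power_increasing)
 moreover have "(2::nat) ^ (M - 1) < 2 ^ M" using M by (intro power_strict_increasing) auto
 ultimately have "degree p < 2 ^ M" by linarith
 hence "degree p < card KM" using K2 by simp
 moreover have "KM <= {x. poly p x = 0}" using no ftr_values by (auto simp: p_def poly_sum poly_monom ftr_def)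
 hence "card KM <= card {x. poly p x = 0}" by (rule card_mono[OF poly_roots_finite[OF p0]])
 hence "card KM <= degree p" using card_poly_roots_bound[OF p0] by linarith
 ultimately show False by simp
qed

text \<open>The additive character (-1)^Tr with integer values.\<close>

definition sgf :: "'f => int" where "sgf x = (if ftr x = 0 then 1 else -1)"

lemma sgf_add: "x : KM ==> y : KM ==> sgf (x + y) = sgf x * sgf y"
 using ftr_values[of x] ftr_values[of y] two by (auto simp: sgf_def ftr_add)

lemma sgf_sum:
 assumes c: "c : KM"
 shows "(\<Sum>x\<in>KM. sgf (c * x)) = (if c = 0 then 2 ^ M else 0)"
proof (cases "c = 0")
 case True
 show ?thesis using M True K2 by (simp add: ftr_def power_0_left sgf_def)
next
 case False
 note S = subfld_D[OF subfield_GF]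
 obtain x1 where x1: "x1 : KM" "ftr x1 = 1" using ftr_nontrivial by blast
 define x0 where "x0 = x1 / c"
 have x0: "x0 : KM" "c * x0 = x1" using S(8)[OF x1(1) c] False by (simp_all add: x0_def)
 have bij: "bij_betw (%x. x + x0) (KM) (KM)"
  by (rule bij_betw_byWitness[where f' = "%x. x + x0"]) (use S(5) x0 in \<open>auto simp: add.assoc c2\<close>)
 have "(\<Sum>x\<in>KM. sgf (c * x)) = (\<Sum>x\<in>KM. sgf (c * (x + x0)))" by (rule sum.reindex_bij_betw[OF bij, symmetric])
 also have "... = (\<Sum>x\<in>KM. sgf (c * x) * sgf x1)"
  by (rule sum.cong) (use S(6)[OF c] x0 x1 in \<open>auto simp: distrib_left sgf_add\<close>)
 also have "... = - (\<Sum>x\<in>KM. sgf (c * x))" using x1(2) by (simp add: sgf_def sum_negf)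
 finally show ?thesis using False by simp
qed

text \<open>The two solutions y and y + 1 in 'f lie in the finite field exactly if y^(2^M) + y,
  which is the trace of \<open>w\<close>, vanishes.\<close>

lemma artin_schreier_count:
 assumes w: "w : KM"
 shows "int (card {y : KM. y\<^sup>2 + y = w}) = 1 + sgf w"
proof -
 have "\<exists>y. poly [:- w, 1, 1:] y = 0" by (rule has_root) simp
 then obtain y where y: "y\<^sup>2 + y = w" by (auto simp: sq_simps)
 have all: "y'\<^sup>2 + y' = w \<longleftrightarrow> y' = y \<or> y' = y + 1" for y'
 proof
  assume "y'\<^sup>2 + y' = w"
  moreover have "(y' + y) * (y' + y + 1) = (y'\<^sup>2 + y') + (y\<^sup>2 + y) + 2 * (y * y')" by (simp add: sq_simps)
  ultimately have "(y' + y) * (y' + y + 1) = 0" using y by (simp add: c2)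
  hence "y' + y = 0 \<or> y' + (y + 1) = 0" by (simp add: add.assoc)
  thus "y' = y \<or> y' = y + 1" by (metis add_right_cancel c2(1))
 qed (use y in \<open>auto simp: sq_simps c2\<close>)
 have mem: "y' : KM \<longleftrightarrow> ftr w = 0" if "y'\<^sup>2 + y' = w" for y'  using ftr_artin_schreier[of y'] that by (simp add: GF_def sum_eq_0_iff2)
 have y1: "(y + 1)\<^sup>2 + (y + 1) = w" using all by blast
 show ?thesis
 proof (cases "ftr w = 0")
  case True
  hence "{y : KM. y\<^sup>2 + y = w} = {y, y + 1}" using mem[OF y] mem[OF y1] unfolding all by auto
  thus ?thesis using True by (simp add: sgf_def)
 next
  case False
  hence e: "{y : KM. y\<^sup>2 + y = w} = {}" using mem by auto
  show ?thesis unfolding e using False by (simp add: sgf_def)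
 qed
qed

lemma curve_count_sum: "int (card {(x, y). x : KM & y : KM & y\<^sup>2 + y = x ^ 3 + x\<^sup>2}) =
   2 ^ M + (\<Sum>x\<in>KM. sgf (x ^ 3 + x\<^sup>2))"
proof -
 note S = subfld_D[OF subfield_GF]
 have "{(x, y). x : KM & y : KM & y\<^sup>2 + y = x ^ 3 + x\<^sup>2} =
   Sigma (KM) (%x. {y : KM. y\<^sup>2 + y = x ^ 3 + x\<^sup>2})" by auto
 hence "card {(x, y). x : KM & y : KM & y\<^sup>2 + y = x ^ 3 + x\<^sup>2} =
   card (Sigma (KM) (%x. {y : KM. y\<^sup>2 + y = x ^ 3 + x\<^sup>2}))" by (rule arg_cong)
 also have "... = (\<Sum>x\<in>KM. card {y : KM. y\<^sup>2 + y = x ^ 3 + x\<^sup>2})" by (rule card_SigmaI) (use K2(1) in auto)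
 finally have "int (card {(x, y). x : KM & y : KM & y\<^sup>2 + y = x ^ 3 + x\<^sup>2}) =
   (\<Sum>x\<in>KM. int (card {y : KM. y\<^sup>2 + y = x ^ 3 + x\<^sup>2}))" by simp
 also have "... = (\<Sum>x\<in>KM. 1 + sgf (x ^ 3 + x\<^sup>2))" by (intro sum.cong refl artin_schreier_count S)
 finally show ?thesis using K2(2) by (simp add: sum.distrib)
qed

text \<open>With g(x) = x^3 + x^2 one has g(x) + g(x + t) = g(t) + x^2 t + x t^2. Since Tr(x t^2) =
  Tr(x^2 t^4), the dependence on x is through the character of (t + t^4) x^2; orthogonality leaves
  the four t with t^4 = t, and there g(t) has trace 0.\<close>

lemma sgf_sum_squared:
 assumes M8: "8 dvd M"
 shows "(\<Sum>x\<in>KM. sgf (x ^ 3 + x\<^sup>2))\<^sup>2 = 4 * 2 ^ M"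
proof -
 note S = subfld_D[OF subfield_GF]
 let ?K = "KM"
 define g :: "'f => 'f" where "g x = x ^ 3 + x\<^sup>2" for x
 have gK: "g x : ?K" if "x : ?K" for x unfolding g_def using S(5)[OF S(9)[OF that] S(9)[OF that]] .
 have g_add: "g x + g (x + t) = g t + (x\<^sup>2 * t + x * t\<^sup>2)" for x t
 proof -
  have "g x + g (x + t) = g t + (x\<^sup>2 * t + x * t\<^sup>2) + 2 * (x ^ 3 + x\<^sup>2 + x\<^sup>2 * t + x * t\<^sup>2 + x * t)"
   by (simp add: g_def sqr power3_eq_cube algebra_simps)
  thus ?thesis by (simp only: c2(5) mult_zero_left add_0_right)
 qed
 have sh: "sgf (g x) * sgf (g (x + t)) = sgf (g t) * sgf ((t + t ^ 4) * x\<^sup>2)" if x: "x : ?K" and t: "t : ?K" for x t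
 proof -
  have "ftr (x\<^sup>2 * t + x * t\<^sup>2) = ftr (x\<^sup>2 * t) + ftr ((x * t\<^sup>2)\<^sup>2)"
   unfolding ftr_add using ftr_square[OF S(6)[OF x S(9)[OF t]]] by simp
  also have "... = ftr (x\<^sup>2 * t + (x * t\<^sup>2)\<^sup>2)" by (simp add: ftr_add)
  also have "x\<^sup>2 * t + (x * t\<^sup>2)\<^sup>2 = (t + t ^ 4) * x\<^sup>2"
   by (simp add: power_mult_distrib algebra_simps flip: power_mult)
  finally have "sgf (x\<^sup>2 * t + x * t\<^sup>2) = sgf ((t + t ^ 4) * x\<^sup>2)" by (simp add: sgf_def)
  moreover have "sgf (g x) * sgf (g (x + t)) = sgf (g t) * sgf (x\<^sup>2 * t + x * t\<^sup>2)"
   using sgf_add[OF gK[OF x] gK[OF S(5)[OF x t]]] sgf_add[OF gK[OF t], of "x\<^sup>2 * t + x * t\<^sup>2"]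
    g_add[of x t] S(5,6,9) x t by simp
  ultimately show ?thesis by simp
 qed
 have sqbij: "bij_betw (%x. x\<^sup>2) ?K ?K"
 proof -
  have "inj_on (%x. x\<^sup>2) ?K"
  proof (rule inj_onI)
   fix x y :: 'f assume "x\<^sup>2 = y\<^sup>2"
   hence "(x + y)\<^sup>2 = 0" using char2_power_add[OF two, of x y 1] by (simp add: c2)
   thus "x = y" by (metis add_right_cancel c2(1) power_eq_0_iff)
  qed
  moreover have "(%x. x\<^sup>2) ` ?K <= ?K" using S(9) by auto
  ultimately show ?thesis using endo_inj_surj[OF K2(1)] by (simp add: bij_betw_def)
 qed
 have transl: "bij_betw (%t. x + t) ?K ?K" if "x : ?K" for x
  by (rule bij_betw_byWitness[where f' = "%t. x + t"]) (use S(5) that in \<open>auto simp: c2 simp flip: add.assoc\<close>)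
 have "(\<Sum>x\<in>?K. sgf (g x))\<^sup>2 = (\<Sum>x\<in>?K. \<Sum>y\<in>?K. sgf (g x) * sgf (g y))" by (simp add: sqr sum_product)
 also have "... = (\<Sum>x\<in>?K. \<Sum>t\<in>?K. sgf (g x) * sgf (g (x + t)))"
  by (intro sum.cong refl sum.reindex_bij_betw[OF transl, symmetric])
 also have "... = (\<Sum>x\<in>?K. \<Sum>t\<in>?K. sgf (g t) * sgf ((t + t ^ 4) * x\<^sup>2))" by (intro sum.cong refl sh)
 also have "... = (\<Sum>t\<in>?K. sgf (g t) * (\<Sum>x\<in>?K. sgf ((t + t ^ 4) * x\<^sup>2)))"
  by (subst sum.swap) (simp add: sum_distrib_left)
 also have "... = (\<Sum>t\<in>?K. sgf (g t) * (\<Sum>x\<in>?K. sgf ((t + t ^ 4) * x)))"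
  by (intro sum.cong refl arg_cong2[of _ _ _ _ "(*)"] sum.reindex_bij_betw[OF sqbij])
 also have "... = (\<Sum>t\<in>?K. sgf (g t) * (if t + t ^ 4 = 0 then 2 ^ M else 0))"
  by (intro sum.cong refl arg_cong2[of _ _ _ _ "(*)"] sgf_sum S)
 also have "... = (\<Sum>t\<in>?K \<inter> {t. t + t ^ 4 = 0}. sgf (g t) * 2 ^ M)"
  by (subst sum.inter_restrict[OF K2(1)]) (auto intro: sum.cong)
 also have "?K \<inter> {t. t + t ^ 4 = 0} = GF 4"
 proof -
  obtain m where m: "M = 2 * m" using M8 by (metis dvdE mult.assoc num_double numeral_times_numeral)
  have "t ^ (4 ^ k) = t" if "t ^ 4 = t" for t :: 'f and k by (induction k) (simp_all add: that power_mult)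
  hence "t : ?K" if "t ^ 4 = t" for t using that m by (simp add: GF_def power_mult)
  moreover have "t + t ^ 4 = 0 \<longleftrightarrow> t ^ 4 = t" for t :: 'f by (metis add_left_cancel c2(1))
  ultimately show ?thesis by (auto simp: GF_def)
 qed
 also have "(\<Sum>t\<in>GF 4. sgf (g t) * 2 ^ M) = (\<Sum>t\<in>(GF 4 :: 'f set). 2 ^ M)"
 proof (rule sum.cong)
  fix t :: 'f assume "t : GF 4"
  hence t: "t ^ 4 = t" by (simp add: GF_def)
  have "g t ^ 4 = (t ^ 3) ^ 4 + (t\<^sup>2) ^ 4"
   using char2_power_add[OF two, of "t ^ 3" "t\<^sup>2" 2] by (simp add: g_def)
  also have "... = (t ^ 4) ^ 3 + (t ^ 4)\<^sup>2" by (simp flip: power_mult)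
  finally have u4: "g t ^ 4 = g t" unfolding t by (simp add: g_def)
  have "g t ^ (4 ^ k) = g t" for k by (induction k) (simp_all add: u4 power_mult)
  hence p: "g t ^ (2 ^ (2 * k)) = g t" for k by (simp add: power_mult)
  have "(\<Sum>i<2 * k. g t ^ (2 ^ i)) = of_nat k * (g t + (g t)\<^sup>2)" for k
  proof (induction k)
   case (Suc k)
   have "g t ^ (2 ^ Suc (2 * k)) = (g t ^ (2 ^ (2 * k)))\<^sup>2" by (simp add: mult.commute flip: power_mult)
   hence "g t ^ (2 ^ Suc (2 * k)) = (g t)\<^sup>2" unfolding p .
   thus ?case using Suc p[of k] by (simp add: algebra_simps)
  qed simp
  note sum2 = this
  \<comment> \<open>Four divides \<open>M\<close>, so the trace of an element of the field with four
    elements is an even multiple and vanishes.\<close>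
  obtain m where mm: "M = 2 * (2 * m)" using M8 by (metis dvdE mult.assoc num_double numeral_times_numeral)
  have "ftr (g t) = of_nat (2 * m) * (g t + (g t)\<^sup>2)" unfolding ftr_def unfolding mm by (rule sum2)
  hence "ftr (g t) = 0" by (simp add: c2(5))
  thus "sgf (g t) * 2 ^ M = 2 ^ M" by (simp add: sgf_def)
 qed simp
 also have "... = int (card (GF 4 :: 'f set)) * 2 ^ M" by simp
 finally show ?thesis using GF_two_power(2)[OF two, of 2] by (simp add: g_def)
qed

end

section \<open>The group of points, its torsion, and a tower of l-power torsion points\<close>

lemma exists_power_cong_1:
 fixes n a :: nat
 assumes "n > 0" "coprime a n" obtains k where "k > 0" "n dvd a ^ k - 1"
proof -
 have "~ inj (%k. a ^ k mod n)"
 proof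
  assume "inj (%k. a ^ k mod n)"
  moreover have "range (%k. a ^ k mod n) <= {..<n}" using assms(1) by auto
  ultimately show False using finite_imageD[of "%k. a ^ k mod n" UNIV] finite_subset by blast
 qed
 then obtain i j where ij: "i < j" "a ^ i mod n = a ^ j mod n" unfolding inj_def by (metis linorder_neqE_nat)
 hence "n dvd a ^ j - a ^ i" by (metis mod_eq_dvd_iff_nat dvd_refl diff_is_0_eq dvd_0_right linear)
 also have "a ^ j - a ^ i = a ^ i * (a ^ (j - i) - 1)"
  using ij(1) by (simp add: diff_mult_distrib2 flip: power_add)
 finally have "n dvd a ^ (j - i) - 1" using assms(2) by (simp add: coprime_dvd_mult_right_iff coprime_commute)
 thus ?thesis using that[of "j - i"] ij(1) by simp
qed

context ell
begin

text \<open>The unique point in the class of \<open>D\<close>; the group law on points is read off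
  from divisors through it.\<close>

definition red :: "('f \<times> 'f \<Rightarrow>\<^sub>0 int) => ('f \<times> 'f) option" where "red D = (THE R. R : pts & D \<approx> dv R)"

lemma red_eqI: "R : pts ==> D \<approx> dv R ==> red D = R"
 unfolding red_def using dv_unique lin_eq_sym lin_eq_trans by (intro the_equality) blast+

lemma red_mem: "D : divs ==> red D : pts" and red_eq: "D : divs ==> D \<approx> dv (red D)"
 using dv_exists red_eqI by metis+

definition Jac :: "('f \<times> 'f) option monoid" where
 "Jac = \<lparr>carrier = pts, monoid.mult = (%R S. red (dv R + dv S)), one = None\<rparr>"

lemma Jac_simps [simp]: "carrier Jac = pts" "R \<otimes>\<^bsub>Jac\<^esub> S = red (dv R + dv S)" "\<one>\<^bsub>Jac\<^esub> = None"
 by (simp_all add: Jac_def)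

lemma None_pts: "None : pts" by (simp add: pts_def)

lemma comm_group_Jac: "comm_group Jac"
proof (rule comm_groupI)
 fix R S T assume R: "R : carrier Jac" and S: "S : carrier Jac" and T: "T : carrier Jac"
 hence D: "dv R : divs" "dv S : divs" "dv T : divs" using dv_in_divs by auto
 show "R \<otimes>\<^bsub>Jac\<^esub> S : carrier Jac" using red_mem divs_closed(4) D by simp
 show "R \<otimes>\<^bsub>Jac\<^esub> S = S \<otimes>\<^bsub>Jac\<^esub> R" by (simp add: add.commute)
 show "\<one>\<^bsub>Jac\<^esub> \<otimes>\<^bsub>Jac\<^esub> R = R" using R lin_eq_refl by (simp add: red_eqI)
 have 1: "dv (red (dv R + dv S)) + dv T \<approx> dv R + dv S + dv T"
  by (intro lin_eq_add lin_eq_refl lin_eq_sym[OF red_eq] divs_closed(4) D)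
 have 2: "dv R + dv (red (dv S + dv T)) \<approx> dv R + (dv S + dv T)"
  by (intro lin_eq_add lin_eq_refl lin_eq_sym[OF red_eq] divs_closed(4) D)
 have 3: "dv R + dv S + dv T \<approx> dv (red (dv R + dv S + dv T))" by (intro red_eq divs_closed(4) D)
 have mem: "red (dv R + dv S + dv T) : pts" by (intro red_mem divs_closed(4) D)
 show "(R \<otimes>\<^bsub>Jac\<^esub> S) \<otimes>\<^bsub>Jac\<^esub> T = R \<otimes>\<^bsub>Jac\<^esub> (S \<otimes>\<^bsub>Jac\<^esub> T)" using red_eqI[OF mem lin_eq_trans[OF 1 3]] red_eqI[OF mem lin_eq_trans[OF 2[unfolded add.assoc[symmetric]] 3]] by simp
 have m: "- dv R : divs" using divs_closed(3) D by blast
 show "\<exists>Q\<in>carrier Jac. Q \<otimes>\<^bsub>Jac\<^esub> R = \<one>\<^bsub>Jac\<^esub>"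
 proof (rule bexI)
  have "dv (red (- dv R)) + dv R \<approx> - dv R + dv R" by (intro lin_eq_add lin_eq_refl lin_eq_sym[OF red_eq] m)
  thus "red (- dv R) \<otimes>\<^bsub>Jac\<^esub> R = \<one>\<^bsub>Jac\<^esub>" using red_eqI[OF None_pts] by simp
 qed (use red_mem m in simp)
qed (simp add: None_pts)

lemma Jac_pow: "R : pts ==> R [^]\<^bsub>Jac\<^esub> (n::nat) = red (mul (int n) (dv R))"
proof (induction n)
 case 0
 show ?case using red_eqI[OF None_pts, of 0] lin_eq_refl[of 0] by simp
next
 case (Suc n)
 note D = dv_in_divs[OF Suc.prems]
 have *: "mul (int (Suc n)) (dv R) = mul (int n) (dv R) + dv R"
  using frag_cmul_distrib[of "int n" 1 "dv R"] by (simp add: add.commute)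
 have "dv (red (mul (int n) (dv R))) + dv R \<approx> mul (int n) (dv R) + dv R"
  by (intro lin_eq_add lin_eq_refl lin_eq_sym[OF red_eq] divs_closed(6) D)
 also have "... \<approx> dv (red (mul (int (Suc n)) (dv R)))" unfolding * by (intro red_eq divs_closed D)
 finally have "red (dv (red (mul (int n) (dv R))) + dv R) = red (mul (int (Suc n)) (dv R))"
  by (intro red_eqI red_mem divs_closed(6) D)
 thus ?case using Suc by simp
qed

definition tors :: "nat => ('f \<times> 'f) option set" where "tors n = {R : pts. mul (int n) (dv R) \<approx> 0}"

lemma tors_pow: "R : tors n \<longleftrightarrow> R : pts & R [^]\<^bsub>Jac\<^esub> n = \<one>\<^bsub>Jac\<^esub>"
 using red_eqI[OF None_pts] red_eq[OF divs_closed(6)[OF dv_in_divs]]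
 by (auto simp: tors_def Jac_pow) (metis dv_simps(1))

lemma tors_subgroup: "subgroup (tors n) Jac"
proof -
 interpret comm_group Jac by (rule comm_group_Jac)
 show ?thesis
 proof (rule subgroupI)
  show "tors n ~= {}" using None_pts lin_eq_refl[of 0] by (auto simp: tors_def)
  show "tors n <= carrier Jac" by (auto simp: tors_def)
  show "inv\<^bsub>Jac\<^esub> R : tors n" if "R : tors n" for R
   using that unfolding tors_pow by (metis Jac_simps(1) inv_closed inv_one nat_pow_inv)
  show "R \<otimes>\<^bsub>Jac\<^esub> S : tors n" if "R : tors n" "S : tors n" for R S
   using that unfolding tors_pow by (metis Jac_simps(1) m_closed nat_pow_distrib r_one one_closed)
 qed
qed

lemma tors_mono: "n dvd m ==> tors n <= tors m"
proof
 fix R assume "n dvd m" "R : tors n"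
 then obtain k where k: "m = k * n" by (metis dvdE mult.commute)
 have "mul (int k) (mul (int n) (dv R)) \<approx> mul (int k) 0"
  using \<open>R : tors n\<close> by (intro lin_eq_cmul) (simp add: tors_def)
 thus "R : tors m" using \<open>R : tors n\<close> by (simp add: tors_def k)
qed

lemma coprime_lin_eq_0:
 assumes "coprime n m" "mul n D \<approx> 0" "mul m D \<approx> 0"
 shows "D \<approx> 0"
proof -
 obtain u w where uw: "u * n + w * m = 1" using assms(1) bezout_int[of n m] by auto
 have "mul u (mul n D) + mul w (mul m D) \<approx> mul u 0 + mul w 0" by (intro lin_eq_add lin_eq_cmul assms)
 moreover have "mul u (mul n D) + mul w (mul m D) = D" using frag_cmul_distrib[of "u * n" "w * m" D] uw by simp
 ultimately show ?thesis by simp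
qed

lemma tors_frobenius:
 "tors (16 ^ m - 1) = insert None (Some ` {(x, y). x : GF (2 ^ (8 * m)) & y : GF (2 ^ (8 * m)) & y\<^sup>2 + y = x ^ 3 + x\<^sup>2})"
proof -
 have fr: "(frobE ^^ k) (x, y) = (x ^ (2 ^ k), y ^ (2 ^ k))" for k x y
  by (induction k) (simp_all add: frobE_def mult.commute flip: power_mult)
 have "Some P : tors (16 ^ m - 1) \<longleftrightarrow> (frobE ^^ (8 * m)) P = P" if P: "P : Ec" for P
 proof -
  let ?Q = "(frobE ^^ (8 * m)) P"
  have "(frobE ^^ k) P : Ec" for k by (induction k) (use P frobE_Ec in auto)
  hence Q: "?Q : Ec" .
  have 1: "frag_of ?Q \<approx> mul (16 ^ m) (frag_of P)" using push_frob_8_power[of "frag_of P" m] P by simp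
  have 2: "mul (int (16 ^ m - 1)) (frag_of P) = mul (16 ^ m) (frag_of P) - frag_of P" using frag_cmul_diff_distrib[of "16 ^ m" 1 "frag_of P"] by simp
  have "Some P : tors (16 ^ m - 1) \<longleftrightarrow> mul (16 ^ m) (frag_of P) \<approx> frag_of P"
  proof -
   have "Some P : pts" using P by (simp add: pts_def)
   moreover have "mul (int (16 ^ m - 1)) (dv (Some P)) \<approx> 0 \<longleftrightarrow> mul (16 ^ m) (frag_of P) \<approx> frag_of P"
    unfolding dv_simps 2 lin_eq_def by simp
   ultimately show ?thesis unfolding tors_def by blast
  qed
  also have "... \<longleftrightarrow> frag_of ?Q \<approx> frag_of P" using 1 lin_eq_trans lin_eq_sym by blast
  also have "... \<longleftrightarrow> ?Q = P" using dv_unique[of "Some ?Q" "Some P"] P Q lin_eq_refl by (auto simp: pts_def)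
  finally show ?thesis .
 qed
 hence "tors (16 ^ m - 1) = insert None (Some ` {P : Ec. (frobE ^^ (8 * m)) P = P})"
  using lin_eq_refl[of 0] by (auto simp: tors_def pts_def)
 also have "{P : Ec. (frobE ^^ (8 * m)) P = P} =
   {(x, y). x : GF (2 ^ (8 * m)) & y : GF (2 ^ (8 * m)) & y\<^sup>2 + y = x ^ 3 + x\<^sup>2}"
  by (auto simp: Ec_def GF_def fr)
 finally show ?thesis .
qed

text \<open>The character sum leaves (16^m + 1)^2 or (16^m - 1)^2 as the number of points. In the
  first case Sylow's theorem would give a nonzero point killed by a prime r dividing 16^m + 1; but r
  is odd, hence prime to 16^m - 1, which kills the whole group.\<close>

lemma card_tors_16:
 assumes m: "m > 0"
 shows "finite (tors (16 ^ m - 1))" "card (tors (16 ^ m - 1)) = (16 ^ m - 1)\<^sup>2"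
proof -
 let ?C = "{(x, y). x : (GF (2 ^ (8 * m)) :: 'f set) & y : GF (2 ^ (8 * m)) & y\<^sup>2 + y = x ^ 3 + x\<^sup>2}"
 let ?S = "\<Sum>x\<in>(GF (2 ^ (8 * m)) :: 'f set). sgf (8 * m) (x ^ 3 + x\<^sup>2)"
 have m8: "8 * m > 0" using m by simp
 have "?C <= GF (2 ^ (8 * m)) \<times> GF (2 ^ (8 * m))" by auto
 hence finC: "finite ?C" using GF_two_power(1)[OF char2 m8] finite_subset by blast
 thus fin: "finite (tors (16 ^ m - 1))" unfolding tors_frobenius by simp
 have Q: "(2::int) ^ (8 * m) = (16 ^ m)\<^sup>2"
 proof -
  have "(2::int) ^ (8 * m) = 256 ^ m" by (simp add: power_mult)
  moreover have "((16::int) ^ m)\<^sup>2 = 256 ^ m" by (simp add: sqr flip: power_mult_distrib)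
  ultimately show ?thesis by simp
 qed
 have "?S\<^sup>2 = (2 * 16 ^ m)\<^sup>2" using sgf_sum_squared[OF char2 m8] unfolding Q by simp
 hence S: "?S = 2 * 16 ^ m \<or> ?S = - (2 * 16 ^ m)" by (simp only: power2_eq_iff)
 have "card (tors (16 ^ m - 1)) = Suc (card ?C)"
  unfolding tors_frobenius by (subst card_insert_disjoint) (auto simp: finC card_image)
 hence N: "int (card (tors (16 ^ m - 1))) = (16 ^ m)\<^sup>2 + ?S + 1"
  using curve_count_sum[OF char2 m8] unfolding Q by simp
 have "?S = - (2 * 16 ^ m)"
 proof (rule ccontr)
  assume "?S ~= - (2 * 16 ^ m)"
  hence "int (card (tors (16 ^ m - 1))) = (16 ^ m + 1)\<^sup>2" using S N by (simp add: sq_simps)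
  also have "... = int ((16 ^ m + 1)\<^sup>2)" by simp
  finally have ord: "card (tors (16 ^ m - 1)) = (16 ^ m + 1)\<^sup>2" by (simp only: of_nat_eq_iff)
  obtain r where r: "Factorial_Ring.prime r" "r dvd (16 ^ m + 1 :: nat)"
   using prime_factor_nat[of "16 ^ m + 1"] m by auto
  let ?G = "Jac\<lparr>carrier := tors (16 ^ m - 1)\<rparr>"
  interpret J: comm_group Jac by (rule comm_group_Jac)
  have G: "group ?G" using J.subgroup_imp_group[OF tors_subgroup] .
  obtain k where k: "16 ^ m + 1 = r * k" using r(2) by auto
  have "Coset.order ?G = r ^ 1 * (k * (16 ^ m + 1))"
  proof -
   have "Coset.order ?G = card (tors (16 ^ m - 1))" by (simp add: Coset.order_def)
   also have "... = (16 ^ m + 1) * (16 ^ m + 1)" unfolding ord sqr ..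
   also have "... = (r * k) * (16 ^ m + 1)" unfolding k ..
   finally show ?thesis by (simp only: power_one_right mult.assoc)
  qed
  from sylow_thm[OF r(1) G this] obtain H where H: "subgroup H ?G" "card H = r ^ 1" using fin by auto
  have HJ: "subgroup H Jac" using J.incl_subgroup[OF tors_subgroup H(1)] .
  have "~ H <= {None}"
  proof
   assume "H <= {None}"
   hence "card H <= card {None :: ('f \<times> 'f) option}" by (intro card_mono) auto
   thus False using H(2) prime_gt_1_nat[OF r(1)] by simp
  qed
  then obtain h where h: "h : H" "h ~= None" by blast
  have hJ: "h : pts" "h : tors (16 ^ m - 1)" using h(1) subgroup.subset[OF HJ] subgroup.subset[OF H(1)] by auto
  interpret HG: group "Jac\<lparr>carrier := H\<rparr>" using J.subgroup_imp_group[OF HJ] .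
  have "h [^]\<^bsub>Jac\<lparr>carrier := H\<rparr>\<^esub> r = \<one>\<^bsub>Jac\<^esub>"
   using HG.pow_order_eq_1[of h] h(1) H(2) by (simp add: Coset.order_def)
  hence "h : tors r" using hJ tors_pow by (simp only: J.nat_pow_consistent[symmetric])
  have "coprime r (16 ^ m - 1)"
  proof (rule prime_imp_coprime[OF r(1)])
   show "~ r dvd 16 ^ m - 1"
   proof
    assume "r dvd 16 ^ m - 1"
    hence "r dvd (16 ^ m + 1) - (16 ^ m - 1)" using r(2) dvd_diff_nat by blast
    hence "r dvd 2" by simp
    hence "r = 2" using r(1) by (metis primes_dvd_imp_eq two_is_prime_nat)
    moreover have "odd ((16::nat) ^ m + 1)" using m by simp
    ultimately show False using r(2) by simp
   qed
  qed
  hence "coprime (int r) (int (16 ^ m - 1))" by (simp only: coprime_int_iff)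
  moreover have "mul (int r) (dv h) \<approx> 0" using \<open>h : tors r\<close> unfolding tors_def by blast
  moreover have "mul (int (16 ^ m - 1)) (dv h) \<approx> 0" using hJ(2) unfolding tors_def by blast
  ultimately have "dv h \<approx> 0" by (rule coprime_lin_eq_0)
  thus False using dv_unique[OF hJ(1) None_pts] h(2) by simp
 qed
 hence "int (card (tors (16 ^ m - 1))) = (16 ^ m - 1)\<^sup>2" using N by (simp add: sq_simps)
 also have "(16 ^ m - 1)\<^sup>2 = int ((16 ^ m - 1)\<^sup>2)" by simp
 finally show "card (tors (16 ^ m - 1)) = (16 ^ m - 1)\<^sup>2" by (simp only: of_nat_eq_iff)
qed

definition infinitely_divisible :: "nat => ('f \<times> 'f) option => bool" where
 "infinitely_divisible l R \<longleftrightarrow> (\<forall>n. \<exists>S\<in>pts. mul (int l ^ n) (dv S) \<approx> dv R)"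

context
 fixes l :: nat
 assumes l: "Factorial_Ring.prime l" "odd l"
begin

text \<open>Some 16^m - 1 is divisible by l^j. Its torsion group is finite, and a subgroup of order
  l^j in it, given by Sylow's theorem, is killed by l^j.\<close>

lemma tors_l_large: "finite (tors (l ^ j))" "\<exists>K. l ^ j <= card (tors (l ^ K))"
proof -
 have "coprime (16::nat) (l ^ j)"
 proof -
  have "coprime (2 ^ 4) (l ^ j)" unfolding coprime_power_left_iff coprime_power_right_iff using l(2) by simp
  thus ?thesis by simp
 qed
 then obtain m where m: "m > 0" "l ^ j dvd 16 ^ m - 1"
  using exists_power_cong_1[of "l ^ j" 16] l(1) prime_gt_0_nat by auto
 note C = card_tors_16[OF m(1)]
 show "finite (tors (l ^ j))" using tors_mono[OF m(2)] C(1) finite_subset by blast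
 let ?M = "(16::nat) ^ m - 1"
 have M0: "?M > 0" using one_less_power[of "16::nat" m] m(1) by simp
 obtain k where k: "?M = l ^ j * k" using m(2) by auto
 let ?G = "Jac\<lparr>carrier := tors ?M\<rparr>"
 interpret J: comm_group Jac by (rule comm_group_Jac)
 have G: "group ?G" using J.subgroup_imp_group[OF tors_subgroup] .
 have "Coset.order ?G = l ^ j * (k * ?M)"
 proof -
  have "Coset.order ?G = card (tors ?M)" by (simp add: Coset.order_def)
  also have "... = ?M * ?M" unfolding C(2) sqr ..
  also have "... = (l ^ j * k) * ?M" unfolding k ..
  finally show ?thesis by (simp only: mult.assoc)
 qed
 from sylow_thm[OF l(1) G this] C(1) obtain H where H: "subgroup H ?G" "card H = l ^ j" by auto
 have HJ: "subgroup H Jac" using J.incl_subgroup[OF tors_subgroup H(1)] .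
 interpret HG: group "Jac\<lparr>carrier := H\<rparr>" using J.subgroup_imp_group[OF HJ] .
 have "H <= tors (l ^ j)"
 proof
  fix h assume h: "h : H"
  hence "h [^]\<^bsub>Jac\<lparr>carrier := H\<rparr>\<^esub> (l ^ j) = \<one>\<^bsub>Jac\<^esub>"
   using HG.pow_order_eq_1[of h] H(2) by (simp add: Coset.order_def)
  hence "h [^]\<^bsub>Jac\<^esub> (l ^ j) = \<one>\<^bsub>Jac\<^esub>" by (simp only: J.nat_pow_consistent[symmetric])
  moreover have "h : pts" using h subgroup.subset[OF HJ] by auto
  ultimately show "h : tors (l ^ j)" using tors_pow by blast
 qed
 thus "\<exists>K. l ^ j <= card (tors (l ^ K))" using card_mono[OF \<open>finite (tors (l ^ j))\<close>] H(2) by metis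
qed

text \<open>If all nonzero points of order l had bounded divisibility, no point could have exact
  order l^k for large k, because its multiple by l^(k-1) has order l. Then one l^N would kill all
  l-power torsion, against \<open>tors_l_large\<close>.\<close>

lemma infinitely_divisible_exists: "\<exists>R\<in>tors l. R ~= None & infinitely_divisible l R"
proof (rule ccontr)
 assume no: "~ ?thesis"
 define T where "T = tors l - {None}"
 have finT: "finite T" using tors_l_large(1)[of 1] by (simp add: T_def)
 have "\<forall>R\<in>T. \<exists>n. ~ (\<exists>S\<in>pts. mul (int l ^ n) (dv S) \<approx> dv R)"
  using no unfolding T_def infinitely_divisible_def by blast
 then obtain f where f: "!!R. R : T ==> ~ (\<exists>S\<in>pts. mul (int l ^ f R) (dv S) \<approx> dv R)" by metis
 define N where "N = Suc (Max (insert 0 (f ` T)))"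
 have fN: "f R < N" if "R : T" for R unfolding N_def using finT that by (simp add: less_Suc_eq_le)
 have "S : tors (l ^ N)" if S: "S : tors (l ^ K)" for S K
 proof (rule ccontr)
  assume nS: "S \<notin> tors (l ^ N)"
  have Sp: "S : pts" using S by (simp add: tors_def)
  define k where "k = (LEAST k. S : tors (l ^ k))"
  have k: "S : tors (l ^ k)" unfolding k_def by (rule LeastI) (rule S)
  have "k > N" using nS tors_mono[OF le_imp_power_dvd[of k N l]] k by (meson not_le subsetD)
  hence k1: "S \<notin> tors (l ^ (k - 1))" unfolding k_def by (intro not_less_Least) simp
  have kk: "k = Suc (k - 1)" using \<open>k > N\<close> by simp
  define D where "D = mul (int l ^ (k - 1)) (dv S)"
  have D: "D : divs" unfolding D_def by (intro divs_closed(6) dv_in_divs Sp)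
  define R where "R = red D"
  have R: "R : pts" "D \<approx> dv R" unfolding R_def using red_mem red_eq D by auto
  have "mul (int l) D \<approx> 0"
  proof -
   have "int l * int l ^ (k - 1) = int l ^ k" using kk by (metis power_Suc)
   thus ?thesis using k by (simp add: D_def tors_def)
  qed
  hence "mul (int l) (dv R) \<approx> 0" using lin_eq_cmul[OF lin_eq_sym[OF R(2)]] lin_eq_trans by blast
  moreover have "R ~= None"
  proof
   assume "R = None"
   thus False using R(2) k1 Sp by (simp add: tors_def D_def)
  qed
  ultimately have RT: "R : T" using R(1) by (simp add: T_def tors_def)
  have fk: "f R <= k - 1" using fN[OF RT] \<open>k > N\<close> by simp
  define S' where "S' = red (mul (int l ^ (k - 1 - f R)) (dv S))"
  have E: "mul (int l ^ (k - 1 - f R)) (dv S) : divs" by (intro divs_closed(6) dv_in_divs Sp)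
  have "mul (int l ^ f R) (dv S') \<approx> mul (int l ^ f R) (mul (int l ^ (k - 1 - f R)) (dv S))"
   unfolding S'_def by (intro lin_eq_cmul lin_eq_sym[OF red_eq[OF E]])
  also have "... = D"
  proof -
   have "f R + (k - 1 - f R) = k - 1" using fk by simp
   thus ?thesis unfolding D_def frag_cmul_cmul power_add[symmetric] by simp
  qed
  also note R(2)
  finally show False using f[OF RT] red_mem[OF E] by (auto simp: S'_def)
 qed
 hence sub: "tors (l ^ K) <= tors (l ^ N)" for K by blast
 define c where "c = card (tors (l ^ N))"
 obtain K where "l ^ c <= card (tors (l ^ K))" using tors_l_large(2) by blast
 also have "... <= c" unfolding c_def by (rule card_mono[OF tors_l_large(1) sub])
 finally have "l ^ c <= c" .
 moreover have "c < l ^ c" using prime_gt_1_nat[OF l(1)] by (intro power_gt_expt) simp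
 ultimately show False by simp
qed

text \<open>Only finitely many points have the l-fold \<open>R\<close>, and for every n one of them
  is divisible by l^n. By the pigeonhole principle one and the same point serves infinitely many n,
  hence all.\<close>

lemma infinitely_divisible_step:
 assumes R: "R : pts" "infinitely_divisible l R"
 shows "\<exists>S\<in>pts. mul (int l) (dv S) \<approx> dv R & infinitely_divisible l S"
proof -
 define F where "F = {U : pts. mul (int l) (dv U) \<approx> dv R}"
 have finF: "finite F"
 proof (cases "F = {}")
  case False
  then obtain U0 where U0: "U0 : F" by blast
  hence D0: "dv U0 : divs" using dv_in_divs by (simp add: F_def)
  have "inj_on (%U. red (dv U - dv U0)) F"
  proof (rule inj_onI)
   fix U U' assume *: "U : F" "U' : F" "red (dv U - dv U0) = red (dv U' - dv U0)"
   have D: "dv U - dv U0 : divs" "dv U' - dv U0 : divs" using * D0 dv_in_divs divs_closed(5) by (auto simp: F_def)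
   hence "dv U - dv U0 \<approx> dv U' - dv U0" using *(3) red_eq lin_eq_trans lin_eq_sym by metis
   hence "dv U - dv U0 + dv U0 \<approx> dv U' - dv U0 + dv U0" by (intro lin_eq_add lin_eq_refl)
   thus "U = U'" using dv_unique * by (simp add: F_def)
  qed
  moreover have "(%U. red (dv U - dv U0)) ` F <= tors (l ^ 1)"
  proof
   fix T assume "T : (%U. red (dv U - dv U0)) ` F"
   then obtain U where U: "U : F" "T = red (dv U - dv U0)" by blast
   have D: "dv U - dv U0 : divs" using U D0 dv_in_divs divs_closed(5) by (auto simp: F_def)
   have "mul (int l) (dv T) \<approx> mul (int l) (dv U - dv U0)"
    unfolding U(2) by (intro lin_eq_cmul lin_eq_sym[OF red_eq[OF D]])
   also have "mul (int l) (dv U - dv U0) = mul (int l) (dv U) - mul (int l) (dv U0)"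
    by (rule poly_mapping_eqI) (simp add: lookup_minus right_diff_distrib)
   also have "... \<approx> dv R - dv R" using U(1) U0 by (intro lin_eq_diff) (simp_all add: F_def)
   finally show "T : tors (l ^ 1)" using red_mem[OF D] U(2) by (simp add: tors_def)
  qed
  ultimately show ?thesis using tors_l_large(1) by (metis finite_imageD finite_subset)
 qed simp
 have "\<forall>n. \<exists>S. S : pts & mul (int l ^ Suc n) (dv S) \<approx> dv R"
  using R(2) unfolding infinitely_divisible_def by blast
 then obtain S where S: "!!n. S n : pts" "!!n. mul (int l ^ Suc n) (dv (S n)) \<approx> dv R" by metis
 have E: "mul (int l ^ k) (dv (S n)) : divs" for k n by (intro divs_closed(6) dv_in_divs S)
 define U where "U n = red (mul (int l ^ n) (dv (S n)))" for n
 have U: "U n : pts" "mul (int l ^ n) (dv (S n)) \<approx> dv (U n)" for n unfolding U_def by (intro red_mem red_eq E)+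
 have "U n : F" for n
 proof -
  have "mul (int l) (dv (U n)) \<approx> mul (int l) (mul (int l ^ n) (dv (S n)))"
   by (intro lin_eq_cmul lin_eq_sym[OF U(2)])
  also have "... = mul (int l ^ Suc n) (dv (S n))" by simp
  also note S(2)
  finally show ?thesis using U(1) by (simp add: F_def)
 qed
 hence "finite (range U)" using finF finite_subset by (metis image_subsetI)
 then obtain V where V: "V : range U" "infinite {n. U n = V}" using pigeonhole_infinite[of UNIV U] by auto
 have "infinitely_divisible l V" unfolding infinitely_divisible_def
 proof
  fix k
  obtain n where n: "n >= k" "U n = V" using V(2) by (metis (mono_tags, lifting) infinite_nat_iff_unbounded_le mem_Collect_eq)
  have "mul (int l ^ k) (dv (red (mul (int l ^ (n - k)) (dv (S n))))) \<approx>
    mul (int l ^ k) (mul (int l ^ (n - k)) (dv (S n)))" by (intro lin_eq_cmul lin_eq_sym[OF red_eq[OF E]])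
  also have "... = mul (int l ^ n) (dv (S n))" using n(1) by (simp flip: power_add)
  also note U(2)[of n, unfolded n(2)]
  finally show "\<exists>S\<in>pts. mul (int l ^ k) (dv S) \<approx> dv V" using red_mem[OF E] by blast
 qed
 thus ?thesis using V(1) \<open>!!n. U n : F\<close> by (auto simp: F_def)
qed

text \<open>A nonzero element of the l-adic Tate module of the curve.\<close>

theorem torsion_tower: obtains R where "!!n. R n : pts" "R 0 = None" "R 1 ~= None"
  "!!n. mul (int l) (dv (R (Suc n))) \<approx> dv (R n)"
proof -
 obtain R0 where R0: "R0 : tors l" "R0 ~= None" "infinitely_divisible l R0"
  using infinitely_divisible_exists by blast
 have "\<exists>f. \<forall>n. (f n : pts & infinitely_divisible l (f n) & (n = 0 --> f n = R0)) &
   mul (int l) (dv (f (Suc n))) \<approx> dv (f n)"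
 proof (rule dependent_nat_choice)
  show "\<exists>x. x : pts & infinitely_divisible l x & (0 = (0::nat) --> x = R0)" using R0 by (auto simp: tors_def)
  fix x n assume "x : pts & infinitely_divisible l x & (n = (0::nat) --> x = R0)"
  thus "\<exists>y. (y : pts & infinitely_divisible l y & (Suc n = 0 --> y = R0)) & mul (int l) (dv y) \<approx> dv x"
   using infinitely_divisible_step[of x] by auto
 qed
 then obtain f where f: "!!n. f n : pts" "f 0 = R0" "!!n. mul (int l) (dv (f (Suc n))) \<approx> dv (f n)" by blast
 show ?thesis
 proof (rule that[of "%n. case n of 0 => None | Suc k => f k"])
  show "mul (int l) (dv (case Suc n of 0 => None | Suc k => f k)) \<approx> dv (case n of 0 => None | Suc k => f k)" for n
   using f R0(1) by (cases n) (auto simp: tors_def)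
 qed (use f R0(2) None_pts in \<open>auto split: nat.splits\<close>)
qed

end

end

section \<open>Kummer theory on the curve\<close>

lemma dedekind_independence:
 fixes a :: "('w => 'w::field) => 'w"
 assumes "finite R" and M: "!!x y. x : M ==> y : M ==> x * y : M"
  and mult: "!!r x y. r : R ==> x : M ==> y : M ==> r (x * y) = r x * r y"
  and dist: "!!r r'. r : R ==> r' : R ==> r ~= r' ==> \<exists>x\<in>M. r x ~= r' x" and nz: "!!r. r : R ==> \<exists>x\<in>M. r x ~= 0"
  and rel: "!!x. x : M ==> (\<Sum>r\<in>R. a r * r x) = 0"
 shows "\<forall>r\<in>R. a r = 0" using assms(1) mult dist nz rel
proof (induction R arbitrary: a rule: finite_induct)
 case (insert r0 R)
 have "a r1 = 0" if r1: "r1 : R" for r1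
 proof -
  obtain y where y: "y : M" "r0 y ~= r1 y" using insert.prems(2)[of r0 r1] r1 insert.hyps by auto
  have "(\<Sum>r\<in>R. (a r * (r y - r0 y)) * r x) = 0" if x: "x : M" for x
  proof -
   have 1: "a r0 * r0 (y * x) + (\<Sum>r\<in>R. a r * r (y * x)) = 0"
    using insert.prems(4)[OF M[OF y(1) x]] insert.hyps by simp
   have 2: "a r0 * r0 x + (\<Sum>r\<in>R. a r * r x) = 0" using insert.prems(4)[OF x] insert.hyps by simp
   have "(\<Sum>r\<in>R. (a r * (r y - r0 y)) * r x) = (\<Sum>r\<in>R. a r * r (y * x)) - r0 y * (\<Sum>r\<in>R. a r * r x)"
    unfolding sum_distrib_left sum_subtractf[symmetric]
    by (intro sum.cong refl) (use insert.prems(1) y(1) x in \<open>simp add: algebra_simps\<close>)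
   also have "... = - a r0 * r0 (y * x) - r0 y * (- a r0 * r0 x)"
   proof -
    have "(\<Sum>r\<in>R. a r * r (y * x)) = - a r0 * r0 (y * x)" "(\<Sum>r\<in>R. a r * r x) = - a r0 * r0 x"
     using 1 2 by (metis add.inverse_unique mult_minus_left)+
    thus ?thesis by (simp only:)
   qed
   also have "... = 0" using insert.prems(1)[of r0 y x] y(1) x by (simp add: algebra_simps)
   finally show ?thesis .
  qed
  hence "\<forall>r\<in>R. a r * (r y - r0 y) = 0" using insert.prems(1-3) by (intro insert.IH) auto
  thus ?thesis using r1 y(2) by auto
 qed
 moreover have "a r0 = 0"
 proof -
  obtain x where x: "x : M" "r0 x ~= 0" using insert.prems(3)[of r0] by blast
  have "a r0 * r0 x = 0" using insert.prems(4)[OF x(1)] insert.hyps calculation by simp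
  thus ?thesis using x(2) by simp
 qed
 ultimately show ?case by blast
qed simp

text \<open>The sums below are eigenvectors for \<open>\<chi>\<close>, since \<open>\<chi>\<close> and the action on the fixed field \<open>N\<close> of the
  stabiliser of \<open>S\<close> factor through the finite set \<open>R\<close>.\<close>

lemma eigen_sums:
 fixes \<chi> :: "('f::field acf => 'f acf) => 'f"
 assumes M: "range to_ac <= M" and hom: "!!\<sigma> \<tau>. \<sigma> : Aut M ==> \<tau> : Aut M ==> \<chi> (\<sigma> o \<tau>) = \<chi> \<sigma> * \<chi> \<tau>"
  and nz: "!!\<sigma>. \<sigma> : Aut M ==> \<chi> \<sigma> ~= 0" and S: "finite S" "!!\<sigma>. \<sigma> : Aut M ==> \<forall>x\<in>S. \<sigma> x = x ==> \<chi> \<sigma> = 1"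
 obtains R N where "finite R" "R <= Aut M" "subfld N" "M <= N" "S <= N"
  "!!\<sigma>. \<sigma> : Aut M ==> \<exists>r\<in>R. \<chi> \<sigma> = \<chi> r & (\<forall>x\<in>N. \<sigma> x = r x)" "!!r r'. r : R ==> r' : R ==> \<forall>x\<in>S. r x = r' x ==> r = r'"
  "!!y \<sigma>. y : N ==> \<sigma> : Aut M ==> \<sigma> (\<Sum>r\<in>R. cst (inverse (\<chi> r)) * r y) =
    cst (\<chi> \<sigma>) * (\<Sum>r\<in>R. cst (inverse (\<chi> r)) * r y)"
proof -
 have alg: "algebraic_over M x" for x by (rule algebraic_over_range_to_ac[OF M])
 have const: "\<sigma> (cst c) = cst c" if "\<sigma> : Aut M" for \<sigma> c using AutD(2)[OF that] M cst_in_range by blast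
 let ?N = "fix_field M S"
 obtain R where R: "finite R" "R <= Aut M" and R3: "\<forall>\<sigma>\<in>Aut M. \<exists>\<tau>\<in>R. \<forall>x\<in>S. \<sigma> x = \<tau> x"
  and R4: "\<forall>\<sigma>\<in>R. \<forall>\<tau>\<in>R. (\<forall>x\<in>S. \<sigma> x = \<tau> x) --> \<sigma> = \<tau>" by (rule Aut_finite_reps[OF alg S(1)])
 have agree: "\<chi> \<sigma> = \<chi> \<tau> & (\<forall>x\<in>?N. \<sigma> x = \<tau> x)"
  if \<sigma>: "\<sigma> : Aut M" and \<tau>: "\<tau> : Aut M" and eq: "\<forall>x\<in>S. \<sigma> x = \<tau> x" for \<sigma> \<tau>
 proof -
  note F = AutD(1)[OF \<tau>]
  have h: "iv \<tau> o \<sigma> : Aut M" by (rule Aut_comp[OF Aut_inv[OF \<tau>] \<sigma>])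
  have "\<forall>x\<in>S. (iv \<tau> o \<sigma>) x = x" using eq by (simp add: aut_inv_f[OF F])
  moreover have "\<tau> o (iv \<tau> o \<sigma>) = \<sigma>" by (simp add: fun_eq_iff aut_f_inv[OF F])
  ultimately have "\<chi> \<sigma> = \<chi> \<tau>" using hom[OF \<tau> h] S(2)[OF h] by simp
  thus ?thesis using fix_field_agree[OF \<sigma> \<tau> eq] by blast
 qed
 have reps: "\<exists>r\<in>R. \<chi> \<sigma> = \<chi> r & (\<forall>x\<in>?N. \<sigma> x = r x)" if "\<sigma> : Aut M" for \<sigma>
 proof -
  obtain r where "r : R" "\<forall>x\<in>S. \<sigma> x = r x" using R3 \<open>\<sigma> : Aut M\<close> by blast
  thus ?thesis using agree[OF \<open>\<sigma> : Aut M\<close> subsetD[OF R(2)]] by blast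
 qed
 have "\<sigma> (\<Sum>r\<in>R. cst (inverse (\<chi> r)) * r y) = cst (\<chi> \<sigma>) * (\<Sum>r\<in>R. cst (inverse (\<chi> r)) * r y)"
  if y: "y : ?N" and \<sigma>: "\<sigma> : Aut M" for y \<sigma>
 proof -
  note F = AutD(1)[OF \<sigma>]
  have "\<forall>r\<in>R. \<exists>r'. r' : R & \<chi> (\<sigma> o r) = \<chi> r' & (\<forall>x\<in>?N. (\<sigma> o r) x = r' x)"
   using reps Aut_comp[OF \<sigma>] R(2) by blast
  then obtain p where p: "!!r. r : R ==> p r : R & \<chi> (\<sigma> o r) = \<chi> (p r) & (\<forall>x\<in>?N. (\<sigma> o r) x = p r x)" by metis
  have "inj_on p R"
  proof (rule inj_onI)
   fix r r' assume rr: "r : R" "r' : R" "p r = p r'"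
   hence "\<sigma> (r x) = \<sigma> (r' x)" if "x : S" for x using p[OF rr(1)] p[OF rr(2)] subsetD[OF fix_field(3) that] by simp
   thus "r = r'" using bspec[OF bspec[OF R4 rr(1)] rr(2)] aut_eq_iff[OF F] by simp
  qed
  moreover have "p ` R <= R" using p by blast
  ultimately have bij: "bij_betw p R R" using endo_inj_surj[OF R(1)] by (simp add: bij_betw_def)
  have "\<sigma> (\<Sum>r\<in>R. cst (inverse (\<chi> r)) * r y) = (\<Sum>r\<in>R. cst (inverse (\<chi> r)) * \<sigma> (r y))"
   by (simp add: aut_sum[OF F] aut_mult[OF F] const[OF \<sigma>])
  also have "... = (\<Sum>r\<in>R. cst (\<chi> \<sigma>) * (cst (inverse (\<chi> (p r))) * p r y))"
  proof (rule sum.cong)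
   fix r assume r: "r : R"
   hence rM: "r : Aut M" using R(2) by blast
   have "\<sigma> (r y) = p r y" "\<chi> (p r) = \<chi> \<sigma> * \<chi> r" using p[OF r] y hom[OF \<sigma> rM] by auto
   thus "cst (inverse (\<chi> r)) * \<sigma> (r y) = cst (\<chi> \<sigma>) * (cst (inverse (\<chi> (p r))) * p r y)"
    using nz[OF \<sigma>] nz[OF rM] by (simp add: cst_mult cst_inverse)
  qed simp
  also have "... = cst (\<chi> \<sigma>) * (\<Sum>r\<in>R. cst (inverse (\<chi> r)) * r y)"
   using sum.reindex_bij_betw[OF bij, of "%r. cst (inverse (\<chi> r)) * r y"] by (simp add: sum_distrib_left[symmetric])
  finally show ?thesis .
 qed
 thus ?thesis using that[OF R fix_field reps] R4 by blast
qed

text \<open>Hilbert 90: by Dedekind independence one of the eigen sums is nonzero. The exponent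
  \<open>d\<close> exists because \<chi> takes only finitely many values.\<close>

theorem kummer_generator:
 fixes \<chi> :: "('f::field acf => 'f acf) => 'f"
 assumes M: "range to_ac <= M" and hom: "!!\<sigma> \<tau>. \<sigma> : Aut M ==> \<tau> : Aut M ==> \<chi> (\<sigma> o \<tau>) = \<chi> \<sigma> * \<chi> \<tau>"
  and nz: "!!\<sigma>. \<sigma> : Aut M ==> \<chi> \<sigma> ~= 0" and S: "finite S" "!!\<sigma>. \<sigma> : Aut M ==> \<forall>x\<in>S. \<sigma> x = x ==> \<chi> \<sigma> = 1"
 obtains g d where "g ~= 0" "!!\<sigma>. \<sigma> : Aut M ==> \<sigma> g = cst (\<chi> \<sigma>) * g" "d > 0" "!!\<sigma>. \<sigma> : Aut M ==> \<chi> \<sigma> ^ d = 1"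
proof -
 obtain R N where R: "finite R" "R <= Aut M" and N: "subfld N" "M <= N" "S <= N"
  and reps: "!!\<sigma>. \<sigma> : Aut M ==> \<exists>r\<in>R. \<chi> \<sigma> = \<chi> r & (\<forall>x\<in>N. \<sigma> x = r x)"
  and dist: "!!r r'. r : R ==> r' : R ==> \<forall>x\<in>S. r x = r' x ==> r = r'"
  and eig: "!!y \<sigma>. y : N ==> \<sigma> : Aut M ==> \<sigma> (\<Sum>r\<in>R. cst (inverse (\<chi> r)) * r y) =
    cst (\<chi> \<sigma>) * (\<Sum>r\<in>R. cst (inverse (\<chi> r)) * r y)" by (rule eigen_sums[OF M hom nz S]) (assumption | blast)+
 have RF: "r : field_auts" if "r : R" for r using that R(2) AutD(1) by blast
 obtain r0 where r0: "r0 : R" using reps Aut_id by blast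
 have "\<exists>y\<in>N. (\<Sum>r\<in>R. cst (inverse (\<chi> r)) * r y) ~= 0"
 proof (rule ccontr)
  assume no: "~ ?thesis"
  have "\<forall>r\<in>R. cst (inverse (\<chi> r)) = 0"
  proof (rule dedekind_independence[OF R(1), where M=N and a = "%r. cst (inverse (\<chi> r))"])
   show "r (x * y) = r x * r y" if "r : R" for r x y using RF[OF that] by (rule aut_mult)
   show "\<exists>x\<in>N. r x ~= r' x" if "r : R" "r' : R" "r ~= r'" for r r' using dist[OF that(1,2)] that(3) N(3) by blast
   show "\<exists>x\<in>N. r x ~= 0" if "r : R" for r
    using aut_1[OF RF[OF that]] subfld_D(1)[OF N(1)] by (intro bexI[of _ 1]) auto
   show "(\<Sum>r\<in>R. cst (inverse (\<chi> r)) * r x) = 0" if "x : N" for x using no that by blast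
  qed (rule subfld_D(6)[OF N(1)])
  thus False using r0 nz R(2) by auto
 qed
 then obtain y where y: "y : N" "(\<Sum>r\<in>R. cst (inverse (\<chi> r)) * r y) ~= 0" by blast
 \<comment> \<open>Multiplication by a value of \<chi> permutes the finite set of values; comparing
   the products over this set gives the exponent.\<close>
 let ?C = "\<chi> ` R"
 have "\<chi> \<sigma> ^ card ?C = 1" if \<sigma>: "\<sigma> : Aut M" for \<sigma>
 proof -
  have "\<chi> \<sigma> * c : ?C" if "c : ?C" for c using that reps[OF Aut_comp[OF \<sigma>]] hom[OF \<sigma>] R(2) by fastforce
  moreover have "inj_on ((*) (\<chi> \<sigma>)) ?C" using nz[OF \<sigma>] by (auto intro: inj_onI)
  moreover have "finite ?C" using R(1) by simp
  ultimately have "bij_betw ((*) (\<chi> \<sigma>)) ?C ?C" unfolding bij_betw_def by (simp add: endo_inj_surj image_subsetI)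
  hence "(\<Prod>c\<in>?C. \<chi> \<sigma> * c) = \<Prod>?C" by (rule prod.reindex_bij_betw)
  moreover have "\<Prod>?C ~= 0" using nz R by auto
  ultimately show ?thesis by (simp add: prod.distrib)
 qed
 thus ?thesis using that[OF y(2) eig[OF y(1)], of "card ?C"] R(1) r0 by (auto simp: card_gt_0_iff)
qed

lemma char2_power_eq_1:
 assumes "(1::'f::field) + 1 = 0" "x ^ (2 ^ j) = (1::'f)"
 shows "x = 1"
proof -
 have "(x + 1) ^ (2 ^ j) = 0" using assms char2_power_add[OF assms(1), of x 1 j] by simp
 hence "x + 1 = 0" by simp
 thus ?thesis by (metis add_right_cancel assms(1))
qed

lemma odd_exponent:
 assumes "(1::'f::field) + 1 = 0" and "d > 0" obtains e where "odd e" "!!x :: 'f. x ^ d = 1 ==> x ^ e = 1"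
proof -
 have "\<exists>j e. d = 2 ^ j * e & odd e" using assms(2)
 proof (induction d rule: less_induct)
  case (less d)
  show ?case
  proof (cases "odd d")
   case True
   thus ?thesis by (intro exI[of _ 0] exI[of _ d]) simp
  next
   case False
   then obtain d' where d': "d = 2 * d'" by (auto elim: evenE)
   then obtain j e where "d' = 2 ^ j * e" "odd e" using less.IH[of d'] less.prems by auto
   thus ?thesis using d' by (intro exI[of _ "Suc j"] exI[of _ e]) simp
  qed
 qed
 then obtain j e where "d = 2 ^ j * e" "odd e" by blast
 thus ?thesis using that char2_power_eq_1[OF assms(1)] by (metis mult.commute power_mult)
qed

section \<open>The Galois group of the curve and the places above its points\<close>

context ell
begin

definition NN :: "('f acf => 'f acf) set" where "NN = Aut Lf"

lemma NN_iff: "\<nu> : NN \<longleftrightarrow> \<nu> : field_auts & (\<forall>c. \<nu> (cst c) = cst c) & \<nu> s = s & \<nu> z = z"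
proof
 assume "\<nu> : NN"
 thus "\<nu> : field_auts & (\<forall>c. \<nu> (cst c) = cst c) & \<nu> s = s & \<nu> z = z"
  unfolding NN_def using AutD[of \<nu> Lf] s_in_Lf z_in_Lf const_in_Lf by blast
next
 assume *: "\<nu> : field_auts & (\<forall>c. \<nu> (cst c) = cst c) & \<nu> s = s & \<nu> z = z"
 hence F: "\<nu> : field_auts" by blast
 have c: "\<nu> (ceval p s) = ceval p s" for p by (induction p) (use * in \<open>simp_all add: aut[OF F]\<close>)
 show "\<nu> : NN" unfolding NN_def Aut_def Lf_def using * by (auto simp: aut_divide[OF F] fn_def aut[OF F] c)
qed

lemma NN_gal_iff: "\<nu> : NN \<longleftrightarrow> \<nu> : gal_geom & \<nu> s = s & \<nu> z = z"
proof
 assume n: "\<nu> : NN"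
 hence "\<nu> : gal_geom" unfolding NN_def gal_geom_eq Aut_def using range_to_ac_subset_Lf by blast
 thus "\<nu> : gal_geom & \<nu> s = s & \<nu> z = z" using n NN_iff by blast
next
 assume "\<nu> : gal_geom & \<nu> s = s & \<nu> z = z"
 thus "\<nu> : NN" using NN_iff gal_geom_const by (auto simp: gal_geom_def)
qed

lemma NN_aut: "\<nu> : NN ==> \<nu> : field_auts" and NN_const: "\<nu> : NN ==> \<nu> (cst c) = cst c" by (simp_all add: NN_iff)

lemma NN_Lf: "\<nu> : NN ==> f : Lf ==> \<nu> f = f" and NN_id: "id : NN"
 and NN_comp: "\<nu> : NN ==> \<mu> : NN ==> \<nu> o \<mu> : NN" and NN_inv: "\<nu> : NN ==> iv \<nu> : NN"
 unfolding NN_def by (rule AutD(2), assumption+) (rule Aut_id, rule Aut_comp, assumption+, rule Aut_inv, assumption)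

lemma fixed_by_NN: "(!!\<nu>. \<nu> : NN ==> \<nu> x = x) ==> \<exists>j. x ^ (2 ^ j) : Lf" unfolding NN_def
 by (rule fixed_by_Aut[OF subfield_Lf algebraic_over_range_to_ac[OF range_to_ac_subset_Lf] const_char2[OF char2]])

definition place_at :: "'f acf set => 'f \<times> 'f => bool" where "place_at V P \<longleftrightarrow> is_place V & t_ac : V & P : Ec &
   s - cst (fst P) : mi V & z - cst (snd P) : mi V"

lemma t_eq: "t_ac = ceval (smult (1/a) [:-b, 1, 1:]) s"
proof -
 have *: "ceval [:-b, 1, 1:] s = s\<^sup>2 + s - cst b" by (simp add: cst_minus sq_simps)
 have "cst a * t_ac = s\<^sup>2 + s - cst b" by (simp only: s_eq add_diff_cancel_right')
 moreover have "t_ac = cst (1/a) * (cst a * t_ac)" using a_nz by (simp add: cst_mult[symmetric])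
 ultimately have "t_ac = cst (1/a) * (s\<^sup>2 + s - cst b)" by (simp only:)
 thus ?thesis unfolding ceval_smult * .
qed

text \<open>s is integral over 'f[t], so it has no poles over the affine line.\<close>

lemma s_mem_place_iff: "is_place V ==> s : V \<longleftrightarrow> t_ac : V"
proof
 assume V: "is_place V"
 show "s : V ==> t_ac : V" by (subst t_eq) (rule place_ceval[OF V])
 assume t: "t_ac : V"
 show "s : V"
 proof (rule ccontr)
  assume ns: "s \<notin> V"
  hence i: "inverse s : mi V" "s ~= 0" using place_not_mem[OF V] place_0[OF V] by auto
  have "s\<^sup>2 + s : V" unfolding s_eq by (intro place_add[OF V] place_mult[OF V] place_const[OF V] t)
  hence "inverse s * (s\<^sup>2 + s) : V" by (rule place_mult[OF V mi_subset[OF V i(1)]])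
  moreover have "inverse s * (s\<^sup>2 + s) = s + 1" using i(2) by (simp add: field_simps sqr)
  ultimately have "s + 1 - 1 : V" using place_diff[OF V _ place_1[OF V]] by (simp only:)
  thus False using ns by simp
 qed
qed

lemma z_mem_place:
 assumes V: "is_place V" "s : V"
 shows "z : V"
proof (rule ccontr)
 assume nz: "z \<notin> V"
 hence i: "inverse z : mi V" "z ~= 0" using place_not_mem[OF V(1)] place_0[OF V(1)] by auto
 have "z\<^sup>2 + z : V" unfolding z_eq by (intro place_add[OF V(1)] place_power[OF V])
 hence "inverse z * (z\<^sup>2 + z) : V" by (rule place_mult[OF V(1) mi_subset[OF V(1) i(1)]])
 moreover have "inverse z * (z\<^sup>2 + z) = z + 1" using i(2) by (simp add: field_simps sqr)
 ultimately have "z + 1 - 1 : V" using place_diff[OF V(1) _ place_1[OF V(1)]] by (simp only:)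
 thus False using nz by simp
qed

lemma place_ceval_residue:
 assumes V: "is_place V" and x: "u - cst x : mi V"
 shows "ceval p u - cst (poly p x) : mi V"
proof -
 have "poly (p - [:poly p x:]) x = 0" by simp
 then obtain q where q: "p - [:poly p x:] = [:- x, 1:] * q" using poly_eq_0_iff_dvd by (metis dvdE)
 have "(u - cst x) * ceval q u : mi V" using place_add[OF V mi_subset[OF V x] place_const[OF V, of x]] mi_mult[OF V x place_ceval[OF V]] by simp
 moreover have "ceval (p - [:poly p x:]) u = (u - cst x) * ceval q u"
  unfolding q ceval_mult by (simp add: cst_minus)
 ultimately show ?thesis by (simp add: ceval_diff)
qed

lemma place_fn_residue:
 assumes "place_at V P"
 shows "fn A B - cst (ev A B P) : mi V"
proof -
 have V: "is_place V" and x: "s - cst (fst P) : mi V" and y: "z - cst (snd P) : mi V"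
  using assms by (simp_all add: place_at_def)
 have "z : V" using place_add[OF V mi_subset[OF V y] place_const[OF V, of "snd P"]] by simp
 hence "(ceval A s - cst (poly A (fst P))) + ((ceval B s - cst (poly B (fst P))) * z
   + (z - cst (snd P)) * cst (poly B (fst P))) : mi V"
  by (intro mi_add[OF V] mi_mult[OF V] place_ceval_residue[OF V x] y place_const[OF V])
 thus ?thesis by (simp add: fn_def ev_def cst_add cst_mult algebra_simps)
qed

lemma place_at_exists:
 fixes V :: "'f acf set"
 assumes V: "is_place V" "t_ac : V"
 shows "\<exists>P. place_at V P"
proof -
 have sV: "s : V" "z : V" using s_mem_place_iff[OF V(1)] V(2) z_mem_place[OF V(1)] by auto
 obtain x where x: "s - cst x : mi V" using place_residue_exists[OF V(1) sV(1)] by blast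
 obtain y where y: "z - cst y : mi V" using place_residue_exists[OF V(1) sV(2)] by blast
 have "y\<^sup>2 + y = x ^ 3 + x\<^sup>2" using place_ceval_residue[OF V(1) y, of "[:0, 1, 1:]"] place_ceval_residue[OF V(1) x, of wp] place_residue_unique[OF V(1)] z_eq by (simp add: ceval_wp poly_wp sq_simps)
 thus ?thesis using V x y by (intro exI[of _ "(x, y)"]) (simp add: place_at_def Ec_def)
qed

text \<open>An automorphism over the constants with s |-> 1 / (s - x_P) carries the given place over
  infinity to one where s has the residue x_P. The residue of z is then right or off by 1, and the
  square of the rotation corrects it.\<close>

lemma place_at_over_point:
 fixes V :: "'f acf set"
 assumes V: "is_place V" "t_ac \<notin> V" and P: "P : Ec"
 shows "\<exists>W. place_at W P"
proof -
 let ?x = "fst P"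
 define w where "w = inverse (s - cst ?x)"
 have sx: "s - cst ?x ~= 0" by (rule s_minus_const_nz)
 have "p = 0" if pw: "ceval p w = 0" for p
 proof (rule ccontr)
  assume "p ~= 0"
  then obtain c where c: "w = cst c" using root_of_const_poly[OF pw \<open>p ~= 0\<close>] by blast
  have "s - cst ?x = cst (inverse c)" by (metis c cst_inverse inverse_inverse_eq w_def)
  hence "s - cst (?x + inverse c) = 0" by (simp only: cst_add diff_diff_add[symmetric] diff_self)
  thus False using s_minus_const_nz by blast
 qed
 moreover have "t_ac : rat_field w"
 proof -
  note S = subfld_D[OF subfield_rat_field[of w]]
  have "s = inverse w + cst ?x" using sx by (simp add: w_def)
  hence "s : rat_field w" using S(5)[OF S(4)[OF rat_field_self] ] ceval_in_rat_field[of "[:?x:]" w] by simp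
  thus ?thesis using rat_field_subset t_in_rat_field_s by blast
 qed
 ultimately obtain \<sigma> where \<sigma>: "\<sigma> : field_auts" "!!c. \<sigma> (cst c) = cst c" "\<sigma> s = w"
  using transcendental_automorphism[OF s_transcendental _ t_in_rat_field_s] by metis
 have cst: "\<tau> ` range cst = range cst" if "!!c. \<tau> (cst c) = cst c" for \<tau> :: "'f acf => 'f acf"
  using that by (auto simp: image_iff)
 have W: "is_place (\<sigma> ` V)" by (rule is_place_image[OF \<sigma>(1) V(1) cst[OF \<sigma>(2)]])
 have "inverse s : mi V" using place_not_mem[OF V(1)] s_mem_place_iff[OF V(1)] V(2) by blast
 hence "\<sigma> (inverse s) : mi (\<sigma> ` V)" using mi_image[OF \<sigma>(1)] by blast
 hence sW: "s - cst ?x : mi (\<sigma> ` V)" by (simp add: aut_inverse[OF \<sigma>(1)] \<sigma>(3) w_def)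
 hence "s : \<sigma> ` V" using place_add[OF W mi_subset[OF W sW] place_const[OF W, of ?x]] by simp
 then obtain Q where Q: "place_at (\<sigma> ` V) Q" using place_at_exists[OF W] s_mem_place_iff[OF W] by blast
 hence "fst Q = ?x" using place_residue_unique[OF W sW, of "fst Q"] by (simp add: place_at_def)
 hence "P = Q \<or> P = negE Q" using Ec_same_fst[of Q P] Q P by (auto simp: place_at_def)
 thus ?thesis
 proof
  assume PQ: "P = negE Q"
  obtain \<gamma> where \<gamma>: "\<gamma> : gal_geom" "\<gamma> s = s + 1" "\<gamma> z = z + s + 1" by (rule rotation_exists)
  define \<kappa> where "\<kappa> = \<gamma> o \<gamma>"
  have \<kappa>: "\<kappa> : field_auts" "\<kappa> s = s" "\<kappa> z = z + 1" "!!c. \<kappa> (cst c) = cst c"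
   using \<gamma>(1) conj_fn[OF \<gamma>] gal_geom_const[OF \<gamma>(1)] by (auto simp: \<kappa>_def gal_geom_def intro: aut_comp)
  let ?W = "\<kappa> ` (\<sigma> ` V)"
  have W': "is_place ?W" by (rule is_place_image[OF \<kappa>(1) W cst[OF \<kappa>(4)]])
  have "\<kappa> (s - cst (fst Q)) : mi ?W" "\<kappa> (z - cst (snd Q)) : mi ?W"
   using Q mi_image[OF \<kappa>(1)] by (auto simp: place_at_def)
  moreover have "\<kappa> (s - cst (fst Q)) = s - cst (fst P)" "\<kappa> (z - cst (snd Q)) = z - cst (snd P)"
   by (simp_all add: PQ negE_def aut_add[OF \<kappa>(1)] \<kappa>(2-4) cst_add cw(4) add_ac)
  ultimately have sz: "s - cst (fst P) : mi ?W" "z - cst (snd P) : mi ?W" by simp_all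
  moreover have "s : ?W" using place_add[OF W' mi_subset[OF W' sz(1)] place_const[OF W', of "fst P"]] by simp
  ultimately have "place_at ?W P" using P W' s_mem_place_iff[OF W'] by (simp add: place_at_def)
  thus ?thesis by blast
 qed (use Q in blast)
qed

text \<open>Links the algebraic order at \<open>P\<close> to any place over \<open>P\<close>:
  functions that are regular and nonzero at \<open>P\<close> are units at the place.\<close>

lemma place_unit_iff_ord:
 assumes V: "place_at V P" and f: "f : Lf" "f ~= 0"
 obtains u where "f = (s - cst (fst P)) powi ordE P f * u" "u : V" "inverse u : V" "u ~= 0"
proof -
 have pl: "is_place V" and P: "P : Ec" using V by (simp_all add: place_at_def)
 have unit: "fn A B : V & inverse (fn A B) : V" if "ev A B P ~= 0" for A B
 proof -
  have *: "fn A B - cst (ev A B P) : mi V" by (rule place_fn_residue[OF V])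
  have "fn A B : V" using place_add[OF pl mi_subset[OF pl *] place_const[OF pl, of "ev A B P"]] by simp
  moreover have "fn A B \<notin> mi V" using place_residue_unique[OF pl *, of 0] that by auto
  ultimately show ?thesis using place_unit[OF pl] by blast
 qed
 obtain A B A' B' where 1: "ev A B P ~= 0" "ev A' B' P ~= 0"
  "f * fn A' B' = (s - cst (fst P)) powi ordE P f * fn A B"
  using has_ord_ordE[OF P f] by (auto simp: has_ord_def)
 have nz: "fn A B ~= 0" "fn A' B' ~= 0" using 1 ev_nz_fn_nz by blast+
 show ?thesis
 proof (rule that[of "fn A B / fn A' B'"])
  show "f = (s - cst (fst P)) powi ordE P f * (fn A B / fn A' B')" using 1(3) nz by (simp add: field_simps)
  show "fn A B / fn A' B' : V" "inverse (fn A B / fn A' B') : V"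
   using unit[OF 1(1)] unit[OF 1(2)] place_mult[OF pl] by (simp_all add: field_class.field_divide_inverse)
 qed (use nz in simp)
qed

lemma place_at_powi_unit:
 assumes V: "place_at V P" and u: "(s - cst (fst P)) powi n * u = 1" "u : V" "inverse u : V"
 shows "n = 0"
proof -
 have pl: "is_place V" and m: "s - cst (fst P) : mi V" using V by (simp_all add: place_at_def)
 have *: "k = 0" if "(s - cst (fst P)) ^ k * w = 1" "w : V" for k w
 proof (rule ccontr)
  assume "k ~= 0"
  hence "(s - cst (fst P)) ^ k : mi V" using mi_power_iff[OF pl mi_subset[OF pl m]] m by simp
  thus False using mi_mult[OF pl _ that(2)] that(1) one_not_in_mi[OF pl] by metis
 qed
 show ?thesis
 proof (cases "n >= 0")
  case True
  thus ?thesis using *[of "nat n" u] u by (simp add: power_int_def)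
 next
  case False
  have "u ~= 0" using u(1) by auto
  thus ?thesis using u(1) False s_minus_const_nz[of "fst P"] *[of "nat (-n)" "inverse u"] u(3) by (simp add: power_int_def field_simps)
 qed
qed

end

context ell
begin

lemma ordE_unit:
 assumes W: "place_at W P" and u: "u : Lf" "u ~= 0" "u : W" "inverse u : W"
 shows "ordE P u = 0"
proof -
 have pl: "is_place W" using W by (simp add: place_at_def)
 obtain w where w: "u = (s - cst (fst P)) powi ordE P u * w" "w : W" "inverse w : W" "w ~= 0"
  by (rule place_unit_iff_ord[OF W u(1,2)])
 have "(s - cst (fst P)) powi ordE P u * (w * inverse u) = u * inverse u"
  by (subst (3) w(1)) (simp only: mult.assoc)
 hence "(s - cst (fst P)) powi ordE P u * (w * inverse u) = 1" using u(2) by simp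
 moreover have "w * inverse u : W" by (rule place_mult[OF pl w(2) u(4)])
 moreover have "inverse (w * inverse u) : W" using place_mult[OF pl u(3) w(3)] by (simp add: mult.commute)
 ultimately show ?thesis by (rule place_at_powi_unit[OF W])
qed

text \<open>The sum \<open>\<Sum> \<chi>(\<nu>) \<nu>(e)\<close> over representatives of \<open>NN\<close> modulo the kernel of \<open>\<chi>\<close> is a unit at \<open>W\<close>
  if \<open>e\<close> is \<open>1\<close> at \<open>W\<close> and \<open>0\<close> at its conjugates; multiplied by \<open>g\<close> it becomes invariant.\<close>

lemma order_divisible:
 assumes g: "g ~= 0" "!!\<nu>. \<nu> : NN ==> \<nu> g = cst (\<chi> \<nu>) * g" and d: "g ^ d : Lf" "odd d"
  and W: "place_at W P" and triv: "!!\<nu>. \<nu> : NN ==> \<nu> ` W = W ==> \<chi> \<nu> = 1"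
 shows "int d dvd ordE P (g ^ d)"
proof -
 have pl: "is_place W" and P: "P : Ec" using W by (simp_all add: place_at_def)
 have nz: "\<chi> \<nu> ~= 0" if "\<nu> : NN" for \<nu>
 proof
  assume "\<chi> \<nu> = 0"
  hence "\<nu> g = 0" unfolding g(2)[OF that] by simp
  thus False using g(1) aut_0_iff[OF NN_aut[OF that]] by blast
 qed
 have hom: "\<chi> (\<nu> o \<mu>) = \<chi> \<nu> * \<chi> \<mu>" if "\<nu> : NN" "\<mu> : NN" for \<nu> \<mu>
 proof -
  have "cst (\<chi> (\<nu> o \<mu>)) * g = \<nu> (\<mu> g)" using g(2)[OF NN_comp[OF that]] by simp
  also have "... = cst (\<chi> \<mu>) * (cst (\<chi> \<nu>) * g)"
   by (simp add: g(2) that aut_mult[OF NN_aut[OF that(1)]] NN_const[OF that(1)])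
  finally have "cst (\<chi> (\<nu> o \<mu>)) = cst (\<chi> \<nu> * \<chi> \<mu>)" using g(1) by (simp add: cst_mult mult.commute)
  thus ?thesis by simp
 qed
 have \<chi>1: "\<chi> \<nu> = 1" if "\<nu> : NN" "\<nu> g = g" for \<nu>
  using g(1) trans[OF sym[OF g(2)[OF that(1)]] that(2)] by (simp only: mult_cancel_right2 cst_eq_1_iff) simp
 obtain R N where R: "finite R" "R <= NN" and N: "subfld N" "Lf <= N" "g : N"
  and reps: "!!\<nu>. \<nu> : NN ==> \<exists>r\<in>R. \<forall>x\<in>N. \<nu> x = r x" and dist: "!!r r'. r : R ==> r' : R ==> r g = r' g ==> r = r'"
  and eig: "!!y \<nu>. y : N ==> \<nu> : NN ==> \<nu> (\<Sum>r\<in>R. cst (\<chi> r) * r y) = cst (inverse (\<chi> \<nu>)) * (\<Sum>r\<in>R. cst (\<chi> r) * r y)"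
 proof (rule eigen_sums[of Lf "%\<nu>. inverse (\<chi> \<nu>)" "{g}", folded NN_def])
  fix R N assume *: "finite R" "R <= NN" "subfld N" "Lf <= N" "{g} <= N"
   "!!\<nu>. \<nu> : NN ==> \<exists>r\<in>R. inverse (\<chi> \<nu>) = inverse (\<chi> r) & (\<forall>x\<in>N. \<nu> x = r x)"
   "!!r r'. r : R ==> r' : R ==> \<forall>x\<in>{g}. r x = r' x ==> r = r'"
   "!!y \<nu>. y : N ==> \<nu> : NN ==> \<nu> (\<Sum>r\<in>R. cst (inverse (inverse (\<chi> r))) * r y) =
    cst (inverse (\<chi> \<nu>)) * (\<Sum>r\<in>R. cst (inverse (inverse (\<chi> r))) * r y)"
  show thesis
  proof (rule that[OF *(1-4)])
   show "g : N" using *(5) by simp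
   show "\<exists>r\<in>R. \<forall>x\<in>N. \<nu> x = r x" if "\<nu> : NN" for \<nu> using *(6)[OF that] by blast
   show "r = r'" if "r : R" "r' : R" "r g = r' g" for r r' using *(7)[OF that(1,2)] that(3) by simp
   show "\<nu> (\<Sum>r\<in>R. cst (\<chi> r) * r y) = cst (inverse (\<chi> \<nu>)) * (\<Sum>r\<in>R. cst (\<chi> r) * r y)"
    if "y : N" "\<nu> : NN" for y \<nu> using *(8)[OF that] by (simp only: inverse_inverse_eq)
  qed
 next
  show "inverse (\<chi> \<nu>) = 1" if "\<nu> : NN" "\<forall>x\<in>{g}. \<nu> x = x" for \<nu> using \<chi>1[OF that(1)] bspec[OF that(2), of g] by simp
 qed (simp_all add: range_to_ac_subset_Lf hom nz)
 obtain r0 where r0: "r0 : R" "\<forall>x\<in>N. id x = r0 x" using reps[OF NN_id] by (rule bexE)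
 have r0N: "r0 x = x" if "x : N" for x using bspec[OF r0(2) that] by (metis id_apply)
 have RN: "r : NN" if "r : R" for r using that R(2) by blast
 have r1: "\<chi> r ~= 1" if "r : R - {r0}" for r using dist[of r r0] g(2)[OF RN[of r]] r0N[OF N(3)] that r0(1) by auto
 define Q where "Q = (%r. iv r ` W) ` (R - {r0})"
 have plQ: "is_place (iv r ` W)" if "r : R" for r
  using NN_inv[OF RN[OF that]] pl const_in_Lf by (intro is_place_image_over[of _ Lf]) (auto simp: NN_def)
 \<comment> \<open>If the two places agreed on \<open>N\<close>, an automorphism h over
   \<open>N\<close> would make r o h preserve \<open>W\<close>. Then \<chi> is 1 on r o h and on h,
   hence on r, against the choice of r.\<close>
 have ne: "W \<inter> N ~= iv r ` W \<inter> N" if r: "r : R - {r0}" for r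
 proof
  assume eq: "W \<inter> N = iv r ` W \<inter> N"
  have rR: "r : R" using r by simp
  obtain h where h: "h : Aut N" "h ` W = iv r ` W"
   using places_conjugate[OF N(1) order_trans[OF range_to_ac_subset_Lf N(2)] const_char2[OF char2] pl plQ[OF rR] eq] .
  have hN: "h : NN" using h(1) N(2) unfolding NN_def Aut_def by blast
  have "(r o h) ` W = r ` (iv r ` W)" by (simp only: image_comp[symmetric] h(2))
  also have "... = W" by (simp add: image_image aut_f_inv[OF NN_aut[OF RN[OF rR]]])
  finally have "\<chi> (r o h) = 1" by (rule triv[OF NN_comp[OF RN[OF rR] hN]])
  moreover have "\<chi> h = 1" by (rule \<chi>1[OF hN AutD(2)[OF h(1) N(3)]])
  ultimately show False using hom[OF RN[OF rR] hN] r1[OF r] by simp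
 qed
 have "\<exists>e\<in>N. (\<forall>U\<in>{W}. e : U & e - 1 : mi U) & (\<forall>U\<in>Q. e : mi U)"
 proof (rule places_separate_sets)
  show "finite Q" using R(1) by (simp add: Q_def)
  show "range cst <= N" using N(2) const_in_Lf by blast
  show "U \<inter> N ~= U' \<inter> N" if "U : {W}" "U' : Q" for U U' using that ne by (auto simp: Q_def)
  show "is_place U" if "U : {W} \<union> Q" for U using that plQ pl by (auto simp: Q_def)
 qed (use N in auto)
 then obtain e where e: "e : N" "e - 1 : mi W" "!!U. U : Q ==> e : mi U" by blast
 define h where "h = (\<Sum>r\<in>R. cst (\<chi> r) * r e)"
 have e_ideal: "r e : mi W" if r: "r : R - {r0}" for r
 proof -
  have F: "r : field_auts" using r NN_aut RN by blast
  show ?thesis using e(3) r by (force simp: Q_def mi_image[OF aut_inv[OF F]] aut_f_inv[OF F])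
 qed
 have "\<chi> r0 = 1" by (rule \<chi>1[OF RN[OF r0(1)] r0N[OF N(3)]])
 hence "h - 1 = (e - 1) + (\<Sum>r\<in>R - {r0}. r e * cst (\<chi> r))" using sum.remove[OF R(1) r0(1), of "%r. cst (\<chi> r) * r e"] r0N[OF e(1)] by (simp add: h_def mult.commute)
 hence h1: "h - 1 : mi W"
  by (simp only:) (intro mi_add[OF pl e(2)] mi_sum[OF pl] mi_mult[OF pl e_ideal place_const[OF pl]])
 have hW: "h : W" using place_add[OF pl mi_subset[OF pl h1] place_1[OF pl]] by simp
 have hu: "h ~= 0" "inverse h : W" using mi_diff[OF pl _ h1, of h] one_not_in_mi[OF pl] place_unit[OF pl hW] by auto
 have "\<nu> (g * h) = g * h" if \<nu>: "\<nu> : NN" for \<nu> using eig[OF e(1) \<nu>, folded h_def] g(2)[OF \<nu>] nz[OF \<nu>]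
  by (simp add: aut_mult[OF NN_aut[OF \<nu>]] cst_inverse)
 then obtain j where j: "(g * h) ^ (2 ^ j) : Lf" using fixed_by_NN by blast
 define f where "f = (g * h) ^ (2 ^ j)"
 define u where "u = h ^ (d * 2 ^ j)"
 have fu: "f ^ d = u * (g ^ d) ^ (2 ^ j)"
  by (simp add: f_def u_def power_mult_distrib power_mult[symmetric] mult_ac)
 have f: "f : Lf" "f ~= 0" using j g(1) hu(1) by (simp_all add: f_def)
 have uW: "u : W" "inverse u : W" "u ~= 0"
  using place_power[OF pl hW] place_power[OF pl hu(2)] hu(1) by (simp_all add: u_def power_inverse)
 have "u = f ^ d / (g ^ d) ^ (2 ^ j)" using fu g(1) by simp
 hence uL: "u : Lf" using subfld_D(8,9)[OF subfield_Lf] f(1) d(1) by metis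
 have "int d * ordE P f = ordE P u + 2 ^ j * ordE P (g ^ d)"
  using arg_cong[OF fu, of "ordE P"] f uL uW(3) d(1) g(1) subfld_D(9)[OF subfield_Lf]
  by (simp add: ordE_mult[OF P] ordE_power[OF P])
 \<comment> \<open>The unit u has order 0; since d is odd, the exponent 2^j caused by inseparability
   can be cancelled.\<close>
 hence "int d dvd 2 ^ j * ordE P (g ^ d)" using ordE_unit[OF W uL uW(3,1,2)] by (metis add_0 dvd_triv_left)
 moreover have "coprime (int d) (2 ^ j)" using d(2) by simp
 ultimately show ?thesis by (simp add: coprime_dvd_mult_right_iff)
qed

section \<open>Divisors of radicals\<close>

lemma finite_zeros_fn:
 assumes "fn A B ~= 0"
 shows "finite {P : Ec. ordE P (fn A B) ~= 0}"
proof -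
 have nz: "nrm A B ~= 0" using degree_nrm(1)[of A B] assms fn_eq_0_iff by auto
 have "{P : Ec. ordE P (fn A B) ~= 0} <= (\<Union>x\<in>{x. poly (nrm A B) x = 0}. {P : Ec. fst P = x})"
 proof
  fix P assume *: "P : {P : Ec. ordE P (fn A B) ~= 0}"
  hence P: "P : Ec" by simp
  have "ev A B P = 0" using * ordE_fn_nonneg[OF P assms] ordE_fn_pos_iff[OF P assms] by simp
  thus "P : (\<Union>x\<in>{x. poly (nrm A B) x = 0}. {P : Ec. fst P = x})" using ev_conj[OF P, of A B] P by simp
 qed
 moreover have "finite {P : Ec. fst P = x}" for x
 proof -
  obtain y where y: "(x, y) : Ec" using Ec_exists by blast
  have "{P : Ec. fst P = x} <= {(x, y), negE (x, y)}" using Ec_same_fst[OF y] by auto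
  thus ?thesis by (rule finite_subset) simp
 qed
 ultimately show ?thesis using poly_roots_finite[OF nz] by (meson finite_UN finite_subset)
qed

lemma divisor_exists:
 assumes f: "f : Lf" "f ~= 0"
 shows "finite {P : Ec. ordE P f ~= 0}"
proof -
 obtain A B C where 1: "f = fn A B / ceval C s" "C ~= 0" using f(1) by (auto simp: Lf_def)
 have nz: "fn A B ~= 0" "fn C 0 ~= 0" using 1 f(2) by (auto simp: fn_ceval)
 have "ordE P f = ordE P (fn A B) - ordE P (fn C 0)" if "P : Ec" for P
  using that nz fn_in_Lf subfld_D(4)[OF subfield_Lf]
  by (simp add: 1(1) field_class.field_divide_inverse ordE_mult ordE_inverse flip: fn_ceval)
 hence "{P : Ec. ordE P f ~= 0} <= {P : Ec. ordE P (fn A B) ~= 0} \<union> {P : Ec. ordE P (fn C 0) ~= 0}" by auto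
 thus ?thesis using finite_zeros_fn[OF nz(1)] finite_zeros_fn[OF nz(2)] by (meson finite_UnI finite_subset)
qed

text \<open>\<open>g\<close> is a radical over \<open>Lf\<close>, and D is its divisor in the sense
  that some power g^n has the divisor n D. This gives divisors to radicals without leaving the
  curve.\<close>

definition root_div :: "'f acf => ('f \<times> 'f \<Rightarrow>\<^sub>0 int) => bool" where "root_div g D \<longleftrightarrow> g ~= 0 & D : divs &
   (\<exists>n>0. g ^ n : Lf & (\<forall>P\<in>Ec. ordE P (g ^ n) = int n * mlt D P))"

lemma root_divI:
 assumes g: "g ~= 0" "g ^ d : Lf" "d > 0" and dvd: "!!P. P : Ec ==> int d dvd ordE P (g ^ d)"
 shows "\<exists>D. root_div g D"
proof -
 define \<phi> where "\<phi> P = (if P : Ec then ordE P (g ^ d) div int d else 0)" for P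
 define D where "D = Poly_Mapping.Abs_poly_mapping \<phi>"
 have "{P. \<phi> P ~= 0} <= {P : Ec. ordE P (g ^ d) ~= 0}" by (auto simp: \<phi>_def)
 hence "finite {P. \<phi> P ~= 0}" using divisor_exists[OF g(2)] g(1) by (meson finite_subset power_not_zero)
 hence look: "mlt D = \<phi>" by (simp add: D_def)
 have "supp D <= Ec" by (auto simp: look \<phi>_def Poly_Mapping.in_keys_iff split: if_splits)
 moreover have "\<forall>P\<in>Ec. ordE P (g ^ d) = int d * mlt D P" using dvd by (simp add: look \<phi>_def)
 ultimately have "root_div g D" unfolding root_div_def using g by auto
 thus ?thesis ..
qed

lemma root_div_mult:
 assumes "root_div g D" "root_div h E"
 shows "root_div (g * h) (D + E)"
proof -
 obtain n m where n: "n > 0" "g ^ n : Lf" "!!P. P : Ec ==> ordE P (g ^ n) = int n * mlt D P"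
  and m: "m > 0" "h ^ m : Lf" "!!P. P : Ec ==> ordE P (h ^ m) = int m * mlt E P"
  using assms by (auto simp: root_div_def)
 have nz: "g ~= 0" "h ~= 0" and D: "D : divs" "E : divs" using assms by (auto simp: root_div_def)
 have eq: "(g * h) ^ (n * m) = (g ^ n) ^ m * (h ^ m) ^ n"
  by (simp add: power_mult_distrib power_mult[symmetric] mult.commute)
 have pm: "(g ^ n) ^ m : Lf" "(h ^ m) ^ n : Lf" using n(2) m(2) subfld_D(9)[OF subfield_Lf] by blast+
 have "ordE P ((g * h) ^ (n * m)) = int (n * m) * mlt (D + E) P" if P: "P : Ec" for P
 proof -
  have "ordE P ((g * h) ^ (n * m)) = ordE P ((g ^ n) ^ m) + ordE P ((h ^ m) ^ n)"
   unfolding eq using nz by (intro ordE_mult[OF P pm(1) _ pm(2)]) auto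
  also have "... = int m * ordE P (g ^ n) + int n * ordE P (h ^ m)"
   using ordE_power[OF P n(2), of m] ordE_power[OF P m(2), of n] nz by simp
  also have "... = int (n * m) * mlt (D + E) P" by (simp add: n(3)[OF P] m(3)[OF P] lookup_add algebra_simps)
  finally show ?thesis .
 qed
 moreover have "(g * h) ^ (n * m) : Lf" unfolding eq by (rule subfld_D(6)[OF subfield_Lf pm])
 moreover have "n * m > 0" using n(1) m(1) by simp
 moreover have "D + E : divs" by (rule divs_closed(4)[OF D])
 ultimately show ?thesis using nz unfolding root_div_def by (metis mult_eq_0_iff)
qed

lemma root_div_inverse:
 assumes "root_div g D"
 shows "root_div (inverse g) (- D)"
proof -
 obtain n where n: "n > 0" "g ^ n : Lf" "!!P. P : Ec ==> ordE P (g ^ n) = int n * mlt D P"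
  and nz: "g ~= 0" and D: "D : divs" using assms by (auto simp: root_div_def)
 have "ordE P (inverse g ^ n) = int n * mlt (- D) P" if P: "P : Ec" for P
  using ordE_inverse[OF P n(2)] nz n(3)[OF P] by (simp add: power_inverse)
 moreover have "inverse g ^ n : Lf" using subfld_D(4)[OF subfield_Lf n(2)] by (simp add: power_inverse)
 ultimately show ?thesis using n(1) nz divs_closed(3)[OF D] unfolding root_div_def by auto
qed

lemma root_div_Prin: "Prin D ==> \<exists>h\<in>Lf. root_div h D"
proof -
 assume "Prin D"
 then obtain h where h: "h : Lf" "h ~= 0" "!!P. P : Ec ==> ordE P h = mlt D P"
  "supp D <= Ec" by (auto simp: Prin_def)
 thus ?thesis using h(1) unfolding root_div_def by (auto intro!: exI[of _ 1])
qed

lemma root_div_Lf: "root_div f D ==> f : Lf ==> Prin D"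
 unfolding root_div_def by (auto intro!: PrinI simp: ordE_power)

lemma root_div_0_const: "root_div g 0 ==> \<exists>c. g = cst c"
proof -
 assume "root_div g 0"
 then obtain n where n: "n > 0" "g ^ n : Lf" "!!P. P : Ec ==> ordE P (g ^ n) = 0" "g ~= 0"
  by (auto simp: root_div_def)
 then obtain c where c: "g ^ n = cst c" using unit_imp_const[of "g ^ n"] by auto
 have "ceval (monom 1 n - [:c:]) g = 0" by (simp add: ceval_diff ceval_monom c)
 moreover have "monom 1 n - [:c:] ~= (0 :: 'f poly)"
 proof
  assume "monom 1 n - [:c:] = (0 :: 'f poly)"
  hence "coeff (monom 1 n - [:c:]) n = (0 :: 'f)" by simp
  thus False using n(1) by (simp add: coeff_pCons split: nat.splits)
 qed
 ultimately show ?thesis using root_of_const_poly by blast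
qed

text \<open>Dividing by a function with the same divisor leaves a constant. This is how linear
  equivalence of divisors becomes triviality of Kummer characters.\<close>

lemma root_div_Prin_Lf:
 assumes g: "root_div g D" and D: "Prin D"
 shows "g : Lf"
proof -
 obtain h where h: "h : Lf" "root_div h D" using root_div_Prin[OF D] by blast
 have "root_div (g * inverse h) (D + - D)" by (rule root_div_mult[OF g root_div_inverse[OF h(2)]])
 then obtain c where c: "g * inverse h = cst c" using root_div_0_const[of "g * inverse h"] by auto
 have "g = cst c * h" using h(2) c by (simp add: root_div_def field_simps)
 thus ?thesis using subfld_D(6)[OF subfield_Lf const_in_Lf h(1)] by simp
qed

lemma root_div_power: "root_div g D ==> root_div (g ^ n) (mul (int n) D)"
proof (induction n)
 case 0
 have "root_div 1 0" unfolding root_div_def using ordE_1 subfld_D(1)[OF subfield_Lf] by (auto intro!: exI[of _ 1])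
 thus ?case by simp
next
 case (Suc n)
 have "mul (int (Suc n)) D = D + mul (int n) D" by (simp add: frag_cmul_distrib)
 thus ?case using root_div_mult[OF Suc.prems Suc.IH[OF Suc.prems]] by simp
qed

lemma root_div_powi: "root_div g D ==> root_div (g powi n) (mul n D)"
proof (cases "n >= 0")
 case True
 assume "root_div g D"
 thus ?thesis using root_div_power[of g D "nat n"] True by (simp add: power_int_def)
next
 case False
 assume "root_div g D"
 hence "root_div (inverse (g ^ nat (- n))) (- mul (int (nat (- n))) D)"
  by (intro root_div_inverse root_div_power)
 moreover have "- mul (int (nat (- n))) D = mul n D" using False by simp
 ultimately show ?thesis using False by (simp add: power_int_def power_inverse)
qed

lemma root_div_root:
 assumes "root_div (g ^ n) (mul (int n) D)" "n > 0" "D : divs"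
 shows "root_div g D"
proof -
 obtain k where k: "k > 0" "(g ^ n) ^ k : Lf"
  "!!P. P : Ec ==> ordE P ((g ^ n) ^ k) = int k * mlt (mul (int n) D) P" "g ^ n ~= 0"
  using assms(1) by (auto simp: root_div_def)
 thus ?thesis using assms(2,3) unfolding root_div_def by (intro conjI exI[of _ "n * k"]) (auto simp: power_mult)
qed

lemma root_div_image:
 assumes \<sigma>: "\<sigma> : field_auts" and g: "root_div g D" and \<pi>: "bij \<pi>" "!!P. \<pi> P : Ec \<longleftrightarrow> P : Ec"
  and ord: "!!f P. f : Lf ==> f ~= 0 ==> P : Ec ==> \<sigma> f : Lf & ordE (\<pi> P) (\<sigma> f) = ordE P f"
 shows "root_div (\<sigma> g) (push \<pi> D)"
proof -
 obtain n where n: "n > 0" "g ^ n : Lf" "!!P. P : Ec ==> ordE P (g ^ n) = int n * mlt D P"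
  and nz: "g ~= 0" and D: "supp D <= Ec" using g by (auto simp: root_div_def)
 have Ec0: "(0, 0) : Ec" by (simp add: Ec_def)
 have "ordE P (\<sigma> g ^ n) = int n * mlt (push \<pi> D) P" if P: "P : Ec" for P
 proof -
  obtain Q where Q: "P = \<pi> Q" using \<pi>(1) by (metis bij_pointE)
  have QE: "Q : Ec" using P \<pi>(2) Q by simp
  have "ordE P (\<sigma> (g ^ n)) = ordE Q (g ^ n)" unfolding Q using ord[OF n(2) _ QE] nz by simp
  thus ?thesis using n(3)[OF QE] push_lookup[OF bij_is_inj[OF \<pi>(1)], of D Q] Q by (simp add: aut_power[OF \<sigma>])
 qed
 moreover have "\<sigma> g ^ n : Lf" using ord[OF n(2) _ Ec0] nz by (simp add: aut_power[OF \<sigma>])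
 moreover have "supp (push \<pi> D) <= Ec" using push_keys[OF D] \<pi>(2) by simp
 moreover have "\<sigma> g ~= 0" using nz by (simp add: aut_0_iff[OF \<sigma>])
 ultimately show ?thesis using n(1) unfolding root_div_def by auto
qed

end

section \<open>Characters of \<open>'k\<close> and \<open>l\<close>-adic logarithms of sequences of roots of unity\<close>

lemma root_exists: "n > 0 ==> \<exists>y. y ^ n = (x :: 'f::alg_closed_field)"
proof -
 assume "n > 0"
 hence "coeff (monom 1 n - [:x:]) n = 1" by (simp add: coeff_pCons split: nat.splits)
 hence "degree (monom 1 n - [:x:]) >= n" by (intro le_degree) simp
 then obtain y where "poly (monom 1 n - [:x:]) y = 0" using has_root[of "monom 1 n - [:x:]"] \<open>n > 0\<close> by auto
 thus ?thesis by (auto simp: poly_monom)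
qed

locale ladic =
 fixes l :: nat and v :: "'k::{field_char_0, alg_closed_field} => real"
 assumes prime_l: "Factorial_Ring.prime l" and odd_l: "odd l" and Qlbar: "is_Qlbar l v"
begin

lemma v_nonneg: "v x >= 0" and v_0_iff: "v x = 0 \<longleftrightarrow> x = 0" and v_mult: "v (x * y) = v x * v y"
 and v_add: "v (x + y) <= max (v x) (v y)" and v_l: "v (of_nat l) = 1 / real l"
 using Qlbar by (simp_all add: is_Qlbar_def)

lemma v_complete:
 fixes s :: "nat => 'k"
 assumes "!!n. s n : \<rat>" "!!\<epsilon>. \<epsilon> > 0 ==> \<exists>N. \<forall>m\<ge>N. \<forall>n\<ge>N. v (s m - s n) < \<epsilon>"
 shows "\<exists>x. \<forall>\<epsilon>>0. \<exists>N. \<forall>n\<ge>N. v (s n - x) < \<epsilon>" using Qlbar assms unfolding is_Qlbar_def by blast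

lemma l_gt_1: "l > 1" using prime_l by (rule prime_gt_1_nat)

lemma v_0: "v 0 = 0" and v_1: "v 1 = 1" and v_minus: "v (- x) = v x"
proof -
 show "v 0 = 0" by (simp add: v_0_iff)
 have "v 1 * v 1 = v 1" using v_mult[of 1 1] by simp
 moreover have "v 1 ~= 0" by (simp add: v_0_iff)
 ultimately show 1: "v 1 = 1" by simp
 have "v (- 1) * v (- 1) = 1" using v_mult[of "-1" "-1"] 1 by simp
 hence "v (- 1) = 1" using v_nonneg[of "-1"] by (metis abs_of_nonneg abs_square_eq_1 sqr)
 thus "v (- x) = v x" using v_mult[of "-1" x] by simp
qed

lemma v_diff: "v (x - y) <= max (v x) (v y)" using v_add[of x "- y"] by (simp add: v_minus)

lemma v_diff_commute: "v (x - y) = v (y - x)" using v_minus[of "x - y"] by simp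

lemma v_of_nat: "v (of_nat n) <= 1"
proof (induction n)
 case (Suc n)
 thus ?case using v_add[of 1 "of_nat n"] by (simp add: v_1)
qed (simp add: v_0)

lemma v_of_int: "v (of_int n) <= 1"
 using v_of_nat[of "nat \<bar>n\<bar>"] by (cases "n >= 0") (auto simp: v_minus[symmetric, of "of_int n"])

lemma v_power: "v (x ^ n) = v x ^ n" by (induction n) (simp_all add: v_1 v_mult)

lemma v_of_int_unit:
 assumes "~ int l dvd n"
 shows "v (of_int n) = 1"
proof -
 have "coprime (int l) n" using assms prime_l by (simp add: prime_imp_coprime)
 then obtain x y where "int l * x + n * y = 1" using bezout_int[of "int l" n] by (metis coprime_imp_gcd_eq_1 mult.commute)
 hence "of_int (int l * x + n * y) = (1 :: 'k)" by (metis of_int_1)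
 hence "1 <= max (v (of_nat l * of_int x)) (v (of_int n * of_int y))"
  using v_add[of "of_nat l * of_int x" "of_int n * of_int y"] by (simp add: v_1)
 moreover have "v (of_nat l * of_int x) < 1"
 proof -
  have "v (of_nat l * of_int x) <= 1 / real l * 1"
   unfolding v_mult v_l by (rule mult_left_mono[OF v_of_int]) simp
  also have "... < 1" using l_gt_1 by simp
  finally show ?thesis .
 qed
 moreover have "v (of_int n * of_int y) <= v (of_int n)"
  unfolding v_mult using mult_left_mono[OF v_of_int v_nonneg] by simp
 ultimately have "1 <= v (of_int n)" by linarith
 thus ?thesis using v_of_int[of n] by linarith
qed

lemma v_of_int_le_iff: "v (of_int n) <= 1 / real l ^ k \<longleftrightarrow> int l ^ k dvd n"
proof (induction k arbitrary: n)
 case 0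
 thus ?case by (simp add: v_of_int)
next
 case (Suc k)
 show ?case
 proof (cases "int l dvd n")
  case True
  then obtain m where m: "n = int l * m" by blast
  have "v (of_int n) = v (of_int m) / real l" by (simp add: m v_mult v_l)
  moreover have "v (of_int m) / real l <= 1 / real l ^ Suc k \<longleftrightarrow> v (of_int m) <= 1 / real l ^ k"
   using l_gt_1 by (simp add: field_simps)
  moreover have "int l ^ Suc k dvd n \<longleftrightarrow> int l ^ k dvd m" using l_gt_1 by (simp add: m)
  ultimately show ?thesis using Suc by simp
 next
  case False
  hence "~ int l ^ Suc k dvd n" by (metis dvd_mult_left power_Suc)
  moreover have "real l ^ Suc k > 1" using l_gt_1 by (intro one_less_power) auto
  ultimately show ?thesis using v_of_int_unit[OF False] by simp
 qed
qed

lemma v_eq_0I: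
 assumes "!!n. v x <= 1 / real l ^ n"
 shows "x = 0"
proof (rule ccontr)
 assume "x ~= 0"
 hence "v x > 0" using v_nonneg[of x] v_0_iff[of x] by linarith
 moreover have "1 / real l < 1" using l_gt_1 by simp
 ultimately obtain n where "(1 / real l) ^ n < v x" using real_arch_pow_inv by blast
 thus False using assms[of n] by (simp add: power_one_over)
qed

lemma primitive_root_exists:
 assumes char2: "(1 :: 'f::alg_closed_field) + 1 = 0"
 obtains \<omega> :: "'f::alg_closed_field" where "\<omega> ^ l = 1" "\<omega> ~= 1" "!!n. \<omega> ^ n = 1 \<longleftrightarrow> l dvd n" "!!x. x ^ l = 1 ==> \<exists>k. x = \<omega> ^ k"
proof -
 define p where "p = (\<Sum>i<l. monom (1::'f) i)"
 have "coeff p (l - 1) = 1" using l_gt_1 by (simp add: p_def coeff_sum)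
 hence "degree p >= l - 1" by (intro le_degree) simp
 hence "degree p > 0" using l_gt_1 by simp
 then obtain \<omega> where "poly p \<omega> = 0" using has_root by blast
 hence 0: "(\<Sum>i<l. \<omega> ^ i) = 0" by (simp add: p_def poly_sum poly_monom)
 \<comment> \<open>\<open>l\<close> is odd, so 1 is not a root of 1 + X + ... + X^(l-1).\<close>
 have "(of_nat l :: 'f) = 1"
 proof -
  obtain k where "l = 2 * k + 1" using odd_l by (rule oddE)
  moreover have "(2 :: 'f) = 0" using char2 by simp
  ultimately show ?thesis by simp
 qed
 hence n1: "\<omega> ~= 1" using 0 by auto
 have pow: "\<omega> ^ l = 1" using 0 by (metis diff_zero mult_zero_right power_diff_1_eq eq_iff_diff_eq_0)
 have dvd: "\<omega> ^ n = 1 \<longleftrightarrow> l dvd n" for n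
 proof
  assume "l dvd n"
  thus "\<omega> ^ n = 1" using pow by (metis dvdE power_mult power_one)
 next
  assume n: "\<omega> ^ n = 1"
  show "l dvd n"
  proof (rule ccontr)
   assume "~ l dvd n"
   hence co: "coprime n l" using prime_l by (metis coprime_commute prime_imp_coprime)
   have "n ~= 0" using \<open>~ l dvd n\<close> by (intro notI) simp
   then obtain x y where "n * x = l * y + 1" using bezout_nat[of n l] co by (auto simp: coprime_iff_gcd_eq_1)
   hence "\<omega> ^ (n * x) = \<omega> ^ (l * y) * \<omega>" by simp
   thus False using n pow n1 by (simp add: power_mult)
  qed
 qed
 have "\<exists>k. x = \<omega> ^ k" if x: "x ^ l = 1" for x
 proof -
  have inj: "inj_on (%k. \<omega> ^ k) {..<l}"
  proof (rule linorder_inj_onI)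
   fix i j assume ij: "i < j" "i : {..<l}" "j : {..<l}"
   have w0: "\<omega> ~= 0" using pow l_gt_1 by (auto simp: power_0_left)
   have "~ l dvd j - i" using ij by (auto dest: dvd_imp_le)
   hence "\<omega> ^ (j - i) ~= 1" by (simp add: dvd)
   moreover have "\<omega> ^ j = \<omega> ^ i * \<omega> ^ (j - i)" using ij by (simp flip: power_add)
   ultimately show "\<omega> ^ i ~= \<omega> ^ j" using w0 by simp
  qed (simp add: linorder_linear)
  let ?r = "{x :: 'f. poly (monom 1 l - 1) x = 0}"
  have nz: "monom 1 l - 1 ~= (0 :: 'f poly)" using l_gt_1 by (simp add: monom_eq_1_iff)
  have "degree (monom 1 l - 1 :: 'f poly) <= l" by (intro degree_diff_le) (auto simp: degree_monom_eq)
  hence "card ?r <= l" using card_poly_roots_bound[OF nz] by linarith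
  moreover have "(%k. \<omega> ^ k) ` {..<l} <= ?r"
   using pow by (auto simp: poly_monom) (metis mult.commute power_mult power_one)
  moreover have "card ((%k. \<omega> ^ k) ` {..<l}) = l" using card_image[OF inj] by simp
  ultimately have "(%k. \<omega> ^ k) ` {..<l} = ?r" using poly_roots_finite[OF nz] by (metis card_seteq)
  moreover have "x : ?r" using x by (simp add: poly_monom)
  ultimately show ?thesis by blast
 qed
 thus ?thesis using that n1 pow dvd by blast
qed

text \<open>The l-adic Tate module of the roots of unity, written multiplicatively.\<close>

definition tate :: "(nat => 'f::field) set" where "tate = {x. x 0 = 1 & (\<forall>n. x (Suc n) ^ l = x n)}"

text \<open>A basis \<zeta> identifies \<open>tate\<close> with the l-adic integers: if x n is the
  k_n-th power of \<zeta> n, the k_n form a Cauchy sequence, and L x is its limit in 'k. The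
  precision l^-n corresponds to the n-th component.\<close>

lemma ladic_log_exists:
 assumes char2: "(1 :: 'f::alg_closed_field) + 1 = 0" obtains L :: "(nat => 'f::alg_closed_field) => 'k" where
  "\<forall>x\<in>tate. \<forall>y\<in>tate. L (%n. x n * y n) = L x + L y"
  "\<forall>x\<in>tate. L x = 0 --> (\<forall>n. x n = 1)" "\<forall>x\<in>tate. \<forall>n. x n = 1 --> v (L x) <= 1 / real l ^ n"
proof -
 obtain \<omega> :: 'f where \<omega>: "\<omega> ^ l = 1" "\<omega> ~= 1" "!!n. \<omega> ^ n = 1 \<longleftrightarrow> l dvd n" "!!x. x ^ l = 1 ==> \<exists>k. x = \<omega> ^ k"
  using primitive_root_exists[OF char2] by metis
 \<comment> \<open>The first root must be chosen as \<omega>, since an arbitrary l-th root of 1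
   could be 1; afterwards any l-th root keeps the exact order l^n.\<close>
 define \<zeta> where "\<zeta> = rec_nat 1 (%n y. if n = 0 then \<omega> else SOME z. z ^ l = y)"
 have \<zeta>0: "\<zeta> 0 = 1" and \<zeta>1: "\<zeta> (Suc 0) = \<omega>" by (simp_all add: \<zeta>_def)
 have \<zeta>S: "\<zeta> (Suc n) ^ l = \<zeta> n" for n using \<omega>(1) \<zeta>0 \<zeta>1 someI_ex[OF root_exists[of l "\<zeta> n"]] l_gt_1 by (simp add: \<zeta>_def)
 have \<zeta>pow: "\<zeta> (n + 1) ^ (l ^ n) = \<omega>" for n
 proof (induction n)
  case (Suc n)
  thus ?case using \<zeta>S[of "Suc n"] by (simp add: power_mult)
 qed (simp add: \<zeta>1)
 have \<zeta>nz: "\<zeta> n ~= 0" for n using \<zeta>S[of n] \<zeta>pow[of n] l_gt_1 \<omega>(1) by (auto simp: power_0_left)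
 have \<zeta>1_iff: "\<zeta> n ^ k = 1 \<longleftrightarrow> l ^ n dvd k" for n k
 proof (induction n arbitrary: k)
  case 0
  thus ?case by (simp add: \<zeta>0)
 next
  case (Suc n)
  show ?case
  proof (cases "l dvd k")
   case True
   then obtain m where m: "k = l * m" by blast
   thus ?thesis using Suc[of m] \<zeta>S[of n] l_gt_1 by (simp add: power_mult)
  next
   case False
   hence "\<omega> ^ k ~= 1" by (simp add: \<omega>(3))
   moreover have "(\<zeta> (Suc n) ^ k) ^ (l ^ n) = (\<zeta> (Suc n) ^ (l ^ n)) ^ k" by (simp only: power_mult[symmetric] mult.commute)
   ultimately have "(\<zeta> (Suc n) ^ k) ^ (l ^ n) ~= 1" using \<zeta>pow[of n] by simp
   moreover have "~ l ^ Suc n dvd k" using False by (metis dvd_mult_left power_Suc)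
   ultimately show ?thesis by auto
  qed
 qed
 have \<zeta>eq: "\<zeta> n ^ j = \<zeta> n ^ k ==> int l ^ n dvd int j - int k" for n j k
 proof (induction j k rule: linorder_wlog)
  case (le j k)
  have "j + (k - j) = k" using le(1) by simp
  hence "\<zeta> n ^ j * 1 = \<zeta> n ^ j * \<zeta> n ^ (k - j)" using le(2) by (metis mult_1_right power_add)
  hence "\<zeta> n ^ (k - j) = 1" using \<zeta>nz[of n] by simp
  hence "int (l ^ n) dvd int (k - j)" by (auto simp: \<zeta>1_iff)
  thus ?case using le(1) by (simp add: of_nat_diff dvd_diff_commute)
 next
  case (sym j k)
  thus ?case by (simp add: dvd_diff_commute)
 qed
 have gen: "\<exists>k. x n = \<zeta> n ^ k" if x: "x : tate" for x n
 proof (induction n)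
  case 0
  thus ?case using x by (auto simp: tate_def \<zeta>0)
 next
  case (Suc n)
  then obtain k where k: "x n = \<zeta> n ^ k" by blast
  have "(\<zeta> (Suc n) ^ k) ^ l = (\<zeta> (Suc n) ^ l) ^ k" by (simp only: power_mult[symmetric] mult.commute)
  hence "(x (Suc n) / \<zeta> (Suc n) ^ k) ^ l = x n / \<zeta> n ^ k" using x \<zeta>S[of n] by (simp add: tate_def power_divide)
  also have "... = 1" using k \<zeta>nz[of n] by simp
  finally obtain j where "x (Suc n) / \<zeta> (Suc n) ^ k = \<omega> ^ j" using \<omega>(4) by blast
  hence "x (Suc n) = \<omega> ^ j * \<zeta> (Suc n) ^ k" using \<zeta>nz[of "Suc n"] by (simp add: field_simps)
  hence "x (Suc n) = \<zeta> (Suc n) ^ (l ^ n * j) * \<zeta> (Suc n) ^ k" unfolding power_mult using \<zeta>pow[of n] by simp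
  thus ?case by (metis power_add)
 qed
 \<comment> \<open>Every exponent of x n has to approximate the limit up to l^-n, so the limit does
   not depend on the exponents chosen.\<close>
 define P where "P x c \<longleftrightarrow> (\<forall>n k. x n = \<zeta> n ^ k --> v (c - of_nat k) <= 1 / real l ^ n)" for x c
 define L where "L x = (SOME c. P x c)" for x
 have "\<exists>c. P x c" if x: "x : tate" for x
 proof -
  define f where "f n = (SOME k. x n = \<zeta> n ^ k)" for n
  have f: "x n = \<zeta> n ^ f n" for n unfolding f_def by (rule someI_ex[OF gen[OF x]])
  have step: "v (of_nat (f (Suc n)) - of_nat (f n)) <= 1 / real l ^ n" for n
  proof -
   have "\<zeta> n ^ f (Suc n) = x (Suc n) ^ l" using \<zeta>S[of n] f[of "Suc n"] by (metis mult.commute power_mult)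
   also have "... = \<zeta> n ^ f n" using x f[of n] by (simp add: tate_def)
   finally have "int l ^ n dvd int (f (Suc n)) - int (f n)" by (rule \<zeta>eq)
   thus ?thesis using v_of_int_le_iff[of "int (f (Suc n)) - int (f n)" n] by simp
  qed
  have close: "v (of_nat (f (n + j)) - of_nat (f n)) <= 1 / real l ^ n" for n j
  proof (induction j)
   case (Suc j)
   have "of_nat (f (n + Suc j)) - of_nat (f n) =
     (of_nat (f (Suc (n + j))) - of_nat (f (n + j))) + (of_nat (f (n + j)) - of_nat (f n) :: 'k)" by simp
   hence "v (of_nat (f (n + Suc j)) - of_nat (f n)) \<le>
     max (v (of_nat (f (Suc (n + j))) - of_nat (f (n + j)))) (v (of_nat (f (n + j)) - of_nat (f n)))"
    by (simp only: v_add)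
   moreover have "1 / real l ^ (n + j) <= 1 / real l ^ n"
    using l_gt_1 by (intro divide_left_mono power_increasing) auto
   ultimately show ?case using step[of "n + j"] Suc by (simp add: le_max_iff_disj) linarith
  qed (simp add: v_0)
  have close': "v (of_nat (f m) - of_nat (f n)) <= 1 / real l ^ n" if "m >= n" for m n
   using close[of n "m - n"] that by simp
  have "\<exists>c. \<forall>\<epsilon>>0. \<exists>N. \<forall>n\<ge>N. v (of_nat (f n) - c) < \<epsilon>"
  proof (rule v_complete)
   show "of_nat (f n) : \<rat>" for n by simp
   fix \<epsilon> :: real assume "\<epsilon> > 0"
   moreover have "1 / real l < 1" using l_gt_1 by simp
   ultimately obtain N where "(1 / real l) ^ N < \<epsilon>" using real_arch_pow_inv by blast
   hence N: "1 / real l ^ N < \<epsilon>" by (simp add: power_one_over)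
   have "v (of_nat (f m) - of_nat (f n)) < \<epsilon>" if "m >= N" "n >= N" for m n
    using v_diff[of "of_nat (f m) - of_nat (f N)" "of_nat (f n) - of_nat (f N)"]
     close'[OF that(1)] close'[OF that(2)] N by simp
   thus "\<exists>N. \<forall>m\<ge>N. \<forall>n\<ge>N. v (of_nat (f m) - of_nat (f n)) < \<epsilon>" by blast
  qed
  then obtain c where c: "!!\<epsilon>. \<epsilon> > 0 ==> \<exists>N. \<forall>n\<ge>N. v (of_nat (f n) - c) < \<epsilon>" by blast
  have "P x c" unfolding P_def
  proof (intro allI impI)
   fix n k assume k: "x n = \<zeta> n ^ k"
   have pos: "1 / real l ^ n > 0" using l_gt_1 by simp
   obtain N where N: "!!m. m >= N ==> v (of_nat (f m) - c) < 1 / real l ^ n" using c[OF pos] by blast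
   define m where "m = max N n"
   have "int l ^ n dvd int (f n) - int k" using k f[of n] by (intro \<zeta>eq) simp
   hence 1: "v (of_nat (f n) - of_nat k) <= 1 / real l ^ n"
    using v_of_int_le_iff[of "int (f n) - int k" n] by simp
   have 2: "v (of_nat (f m) - of_nat (f n)) <= 1 / real l ^ n" by (rule close') (simp add: m_def)
   have 3: "v (c - of_nat (f m)) < 1 / real l ^ n" using N[of m] by (simp add: m_def v_diff_commute)
   show "v (c - of_nat k) <= 1 / real l ^ n" using 1 2 3 v_add[of "c - of_nat (f m)" "(of_nat (f m) - of_nat (f n)) + (of_nat (f n) - of_nat k)"] v_add[of "of_nat (f m) - of_nat (f n)" "of_nat (f n) - of_nat k"] by simp
  qed
  thus ?thesis ..
 qed
 hence "P x (L x)" if "x : tate" for x unfolding L_def using someI_ex that by metis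
 hence L: "v (L x - of_nat k) <= 1 / real l ^ n" if "x : tate" "x n = \<zeta> n ^ k" for x n k
  using that unfolding P_def by blast
 show ?thesis
 proof (rule that[of L]; intro ballI allI impI)
  fix x :: "nat => 'f" assume x: "x : tate"
  show "v (L x) <= 1 / real l ^ n" if "x n = 1" for n using L[OF x, of n 0] that by simp
  show "x n = 1" if "L x = 0" for n
  proof -
   obtain k where k: "x n = \<zeta> n ^ k" using gen[OF x] by blast
   have "int l ^ n dvd int k" using L[OF x k] that v_of_int_le_iff[of "int k" n] by (simp add: v_minus)
   hence "l ^ n dvd k" by (metis int_dvd_int_iff of_nat_power)
   thus ?thesis using k by (simp add: \<zeta>1_iff)
  qed
  fix y :: "nat => 'f" assume y: "y : tate"
  have xy: "(%n. x n * y n) : tate" using x y by (simp add: tate_def power_mult_distrib)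
  have "L (%n. x n * y n) - (L x + L y) = 0"
  proof (rule v_eq_0I)
   fix n
   obtain j k where jk: "x n = \<zeta> n ^ j" "y n = \<zeta> n ^ k" using gen[OF x] gen[OF y] by blast
   have "v ((L (%n. x n * y n) - of_nat (j + k)) - ((L x - of_nat j) + (L y - of_nat k))) <= 1 / real l ^ n" using L[OF xy, of n "j + k"] jk L[OF x jk(1)] L[OF y jk(2)] v_add[of "L x - of_nat j" "L y - of_nat k"] v_diff[of "L (%n. x n * y n) - of_nat (j + k)" "(L x - of_nat j) + (L y - of_nat k)"] by (simp add: power_add)
   moreover have "(L (%n. x n * y n) - of_nat (j + k)) - ((L x - of_nat j) + (L y - of_nat k)) =
     L (%n. x n * y n) - (L x + L y)" by simp
   ultimately show "v (L (%n. x n * y n) - (L x + L y)) <= 1 / real l ^ n" by (simp only:)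
  qed
  thus "L (%n. x n * y n) = L x + L y" by simp
 qed
qed

text \<open>The character \<open>n x + y \<mapsto> \<omega>\<^sup>n\<close>, \<open>v y < v x\<close>, extends to \<open>'k\<close>, one \<open>l\<close>-th part of an element at a time:
  every element has a multiple by a power of \<open>l\<close> in \<open>{y. v y < v x}\<close>.\<close>

lemma separating_character:
 assumes char2: "(1 :: 'f::alg_closed_field) + 1 = 0" and x: "x ~= 0"
 obtains \<pi> :: "'k => 'f::alg_closed_field" where "!!a b. \<pi> (a + b) = \<pi> a * \<pi> b" "!!a. v a < v x ==> \<pi> a = 1" "\<pi> x ~= 1"
proof -
 obtain \<omega> :: 'f where \<omega>: "\<omega> ^ l = 1" "\<omega> ~= 1" using primitive_root_exists[OF char2] by metis
 have \<omega>0: "\<omega> ~= 0" using \<omega>(1) l_gt_1 by (auto simp: power_0_left)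
 \<comment> \<open>The graph of a homomorphism from a subgroup of 'k to the nonzero elements of 'f,
   or empty; closure under differences and quotients encodes the group structure.\<close>
 define HG where "HG G \<longleftrightarrow> (\<forall>a y b w. (a, y) : G --> (b, w) : G --> (a - b, y / w) : G) &
  (\<forall>y. (0, y) : G --> y = 1) & (\<forall>a y. (a, y) : G --> y ~= 0)" for G :: "('k \<times> 'f) set"
 define ext where "ext G y u = {(c + of_int n * y, w * u powi n) | c w n. (c, w) : G}" for G and y :: 'k and u :: 'f
 have ext: "HG (ext G y u)" if G: "HG G" "G ~= {}" and u: "u ~= 0" "!!n w. (of_int n * y, w) : G ==> w = u powi n" for G y u
  unfolding HG_def
 proof (intro conjI allI impI)
  fix a1 y1 b1 w1 assume a: "(a1, y1) : ext G y u" and b: "(b1, w1) : ext G y u"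
  obtain c w n where 1: "a1 = c + of_int n * y" "y1 = w * u powi n" "(c, w) : G" using a by (auto simp: ext_def)
  obtain c' w' n' where 2: "b1 = c' + of_int n' * y" "w1 = w' * u powi n'" "(c', w') : G" using b by (auto simp: ext_def)
  have "a1 - b1 = (c - c') + of_int (n - n') * y" "y1 / w1 = (w / w') * u powi (n - n')"
   using u(1) by (simp_all add: 1 2 algebra_simps power_int_diff)
  moreover have "(c - c', w / w') : G" using G(1) 1(3) 2(3) by (simp add: HG_def)
  ultimately show "(a1 - b1, y1 / w1) : ext G y u" unfolding ext_def by blast
 next
  fix y1 assume "(0, y1) : ext G y u"
  then obtain c w n where *: "c + of_int n * y = 0" "y1 = w * u powi n" "(c, w) : G" by (auto simp: ext_def)
  have d: "(a - b, y / w) : G" if "(a, y) : G" "(b, w) : G" for a b y w using G(1) that by (simp add: HG_def)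
  have "(c - c, w / w) : G" by (rule d[OF *(3,3)])
  hence "((c - c) - c, (w / w) / w) : G" by (rule d[OF _ *(3)])
  moreover have "w ~= 0" using G(1) *(3) by (auto simp: HG_def)
  moreover have "of_int n * y = - c" using *(1) by (simp add: add_eq_0_iff)
  ultimately have "1 / w = u powi n" using u(2) by simp
  show "y1 = 1" using \<open>w ~= 0\<close> by (simp add: *(2) flip: \<open>1 / w = u powi n\<close>)
 qed (use u(1) G(1) in \<open>auto simp: ext_def HG_def\<close>)
 have vx: "v x > 0" using x v_nonneg[of x] v_0_iff[of x] by linarith
 define B where "B = {(b, 1 :: 'f) | b. v b < v x}"
 have "HG B" using v_diff by (fastforce simp: HG_def B_def intro: le_less_trans)
 moreover have B0: "(0, 1) : B" using vx by (simp add: B_def v_0)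
 \<comment> \<open>If n x lies in the ball B, then l divides n and \<omega>^n = 1; so the value
   \<omega> at x is consistent with the value 1 on B.\<close>
 moreover have "w = \<omega> powi n" if "(of_int n * x, w) : B" for n w
 proof -
  have "v (of_int n) ~= 1" using that by (auto simp: B_def v_mult)
  hence "int l dvd n" using v_of_int_unit by blast
  then obtain m where "n = int l * m" by blast
  thus ?thesis using that \<omega>(1) by (simp add: B_def power_int_mult)
 qed
 ultimately have HG0: "HG (ext B x \<omega>)" using \<omega>0 by (intro ext) auto
 define Q where "Q = {G. HG G & ext B x \<omega> <= G}"
 have "\<exists>M\<in>Q. \<forall>G\<in>Q. M <= G --> G = M"
 proof (rule subset_Zorn_nonempty)
  show "Q ~= {}" using HG0 by (auto simp: Q_def)
  fix K assume K: "K ~= {}" "subset.chain Q K"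
  hence KQ: "K <= Q" and ch: "!!G H. G : K ==> H : K ==> G <= H \<or> H <= G" by (auto simp: subset_chain_def)
  have "HG (\<Union>K)" unfolding HG_def
  proof (intro conjI allI impI)
   fix a y b w assume "(a, y) : \<Union>K" "(b, w) : \<Union>K"
   then obtain G where G: "G : K" "(a, y) : G" "(b, w) : G" using ch by blast
   hence "(a - b, y / w) : G" using KQ G by (auto simp: Q_def HG_def)
   thus "(a - b, y / w) : \<Union>K" using G(1) by blast
  qed (use KQ in \<open>auto simp: Q_def HG_def\<close>)
  thus "\<Union>K  \<in>Q" using K(1) KQ unfolding Q_def by blast
 qed
 then obtain M where MQ: "M : Q" "\<forall>G\<in>Q. M <= G --> G = M" by (rule bexE)
 hence M: "HG M" "ext B x \<omega> <= M" by (simp_all add: Q_def)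
 have max: "G = M" if "HG G" "M <= G" for G using MQ(2) that M(2) by (simp add: Q_def)
 have Md: "(a - b, y / w) : M" if "(a, y) : M" "(b, w) : M" for a b y w using M(1) that by (simp add: HG_def)
 have M1: "y = 1" if "(0, y) : M" for y using M(1) that by (simp add: HG_def)
 have Mn: "y ~= 0" if "(a, y) : M" for a y using M(1) that by (simp add: HG_def)
 have MB: "(b + of_int n * x, \<omega> powi n) : M" if "v b < v x" for b n
 proof -
  have "(b + of_int n * x, 1 * \<omega> powi n) : ext B x \<omega>" unfolding ext_def B_def using that by blast
  thus ?thesis using M(2) by auto
 qed
 have M0: "(0, 1) : M" using MB[of 0 0] vx by (simp add: v_0)
 have Mm: "(- a, inverse y) : M" if "(a, y) : M" for a y using Md[OF M0 that] by (simp add: field_class.field_divide_inverse)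
 have Ma: "(a + b, y * w) : M" if "(a, y) : M" "(b, w) : M" for a b y w
  using Md[OF that(1) Mm[OF that(2)]] by (simp add: field_class.field_divide_inverse)
 have Mp: "(of_nat k * a, y ^ k) : M" if "(a, y) : M" for a y k
  by (induction k) (use M0 Ma[OF that] in \<open>auto simp: distrib_right\<close>)
 have Mi: "(of_int k * a, y powi k) : M" if "(a, y) : M" for a y k
  using Mp[OF that, of "nat k"] Mm[OF Mp[OF that, of "nat (- k)"]]
  by (cases "k >= 0") (simp_all add: power_int_def power_inverse)
 \<comment> \<open>A missing y can receive any l-th root of the value at l y: if n y is in the
   domain, l divides n, as otherwise y would be an integral combination of l y and n y.\<close>
 have step: "\<exists>w. (y, w) : M" if w0: "(of_nat l * y, w0) : M" for y w0
 proof (rule ccontr)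
  assume no: "~ ?thesis"
  obtain u where u: "u ^ l = w0" using root_exists[of l w0] l_gt_1 by auto
  have u0: "u ~= 0" using u Mn[OF w0] l_gt_1 by auto
  have "w = u powi n" if nw: "(of_int n * y, w) : M" for n w
  proof -
   have "int l dvd n"
   proof (rule ccontr)
    assume "~ int l dvd n"
    hence "coprime (int l) n" using prime_l by (simp add: prime_imp_coprime)
    then obtain c d where "c * int l + d * n = 1" using bezout_int[of "int l" n] by (metis coprime_imp_gcd_eq_1)
    hence "of_int (c * int l + d * n) * y = y" by simp
    thus False using no Ma[OF Mi[OF w0, of c] Mi[OF nw, of d]] by (auto simp: distrib_right mult.assoc)
   qed
   then obtain m where m: "n = int l * m" by blast
   have "w / w0 powi m = 1" using Md[OF nw Mi[OF w0, of m]] by (intro M1) (simp add: m mult_ac)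
   thus ?thesis by (simp add: m power_int_mult flip: u)
  qed
  hence "HG (ext M y u)" using M0 u0 by (intro ext[OF M(1)]) auto
  moreover have "(c + of_int n * y, w * u powi n) : ext M y u" if "(c, w) : M" for c w n unfolding ext_def using that by blast
  from this[of _ _ 0] this[OF M0, of 1] have "M <= ext M y u" "(y, u) : ext M y u" by auto
  ultimately show False using max no by blast
 qed
 have "\<exists>w. (y, w) : M" for y
 proof -
  have "(1 / real l) < 1" using l_gt_1 by simp
  then obtain N where N: "(1 / real l) ^ N < v x / (v y + 1)"
   using real_arch_pow_inv[of "v x / (v y + 1)" "1 / real l"] vx v_nonneg[of y] by (auto simp: add_nonneg_pos)
  have "v (of_nat l ^ N * y) = (1 / real l) ^ N * v y" by (simp add: v_mult v_power v_l)
  also have "... <= (1 / real l) ^ N * (v y + 1)" by (intro mult_left_mono) auto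
  also have "... < v x" using N v_nonneg[of y] by (simp add: less_divide_eq add_nonneg_pos)
  finally have "\<exists>w. (of_nat l ^ N * y, w) : M" using MB[of _ 0] by auto
  thus ?thesis
  proof (induction N)
   case (Suc N)
   thus ?case using step[of "of_nat l ^ N * y"] by (auto simp: mult.assoc)
  qed simp
 qed
 then obtain \<pi> where \<pi>: "!!y. (y, \<pi> y) : M" by metis
 have uniq: "\<pi> y = w" if "(y, w) : M" for y w using M1[of "w / \<pi> y"] Md[OF that \<pi>[of y]] by simp
 show ?thesis
 proof (rule that[of \<pi>])
  show "\<pi> (y + w) = \<pi> y * \<pi> w" for y w by (rule uniq[OF Ma[OF \<pi> \<pi>]])
  show "\<pi> y = 1" if "v y < v x" for y using uniq[OF MB[OF that, of 0]] by simp
  show "\<pi> x ~= 1" using uniq[OF MB[of 0 1]] vx \<omega>(2) by (simp add: v_0)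
 qed
qed

end

section \<open>Unramified characters of \<open>NN\<close>\<close>

text \<open>Conjugation from the right, so that \<open>cj \<tau>\<close> after
  \<open>cj \<sigma>\<close> is \<open>cj (\<sigma> o \<tau>)\<close>; the Frobenius action on
  cochains has this form.\<close>

definition cj :: "('w => 'w) => ('w => 'w) => 'w => 'w" where "cj \<sigma> \<nu> = iv \<sigma> o \<nu> o \<sigma>"

lemma cj_comp: "\<sigma> : field_auts ==> cj \<sigma> (\<nu> o \<mu>) = cj \<sigma> \<nu> o cj \<sigma> \<mu>" by (simp add: cj_def fun_eq_iff aut_f_inv)

lemma cj_cj: "\<sigma> : field_auts ==> \<tau> : field_auts ==> cj \<tau> (cj \<sigma> \<nu>) = cj (\<sigma> o \<tau>) \<nu>"
 by (simp add: cj_def inv_into_comp comp_assoc)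

lemma cj_aut: "\<sigma> : field_auts ==> \<nu> : field_auts ==> cj \<sigma> \<nu> : field_auts"
 unfolding cj_def by (intro aut_comp aut_inv)

lemma cj_apply: "\<sigma> : field_auts ==> \<sigma> (cj \<sigma> \<nu> x) = \<nu> (\<sigma> x)" by (simp add: cj_def aut_f_inv)

lemma cj_eq: "\<sigma> : field_auts ==> cj \<sigma> \<nu> x = y \<longleftrightarrow> \<nu> (\<sigma> x) = \<sigma> y" by (simp add: cj_def aut_inv_eq_iff)

lemma cj_image: "\<sigma> : field_auts ==> \<nu> ` (\<sigma> ` W) = \<sigma> ` W ==> cj \<sigma> \<nu> ` W = W"
 by (simp only: cj_def image_comp[symmetric]) (simp add: image_image aut_inv_f)

text \<open>One place over infinity is given; places over all affine points are produced from
  it.\<close>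

locale ell_place = ell s z a b for s z :: "'f::alg_closed_field acf" and a b :: 'f +
 fixes V :: "'f acf set"
 assumes V_place: "is_place V" and V_inf: "t_ac \<notin> V"
begin

lemma cj_NN:
 assumes "\<sigma> : field_auts" "!!c. \<sigma> (cst c) : Lf" "\<sigma> s : Lf" "\<sigma> z : Lf" "\<nu> : NN"
 shows "cj \<sigma> \<nu> : NN" unfolding NN_iff using assms cj_aut[OF assms(1) NN_aut[OF assms(5)]] NN_Lf[OF assms(5)]
 by (simp add: cj_eq)

lemma NN_scalar_root:
 assumes \<sigma>: "\<sigma> : field_auts" "!!c. \<sigma> (cst c) = cst (\<theta> c)" and g: "cj \<sigma> \<nu> g = cst x * g"
 shows "\<nu> (\<sigma> g) = cst (\<theta> x) * \<sigma> g" using cj_apply[OF \<sigma>(1), of \<nu> g] by (simp add: g aut_mult[OF \<sigma>(1)] \<sigma>(2))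

definition is_rot :: "('f acf => 'f acf) => bool" where "is_rot \<gamma> \<longleftrightarrow> \<gamma> : gal_geom & \<gamma> s = s + 1 & \<gamma> z = z + s + 1"

definition is_frob :: "nat => ('f acf => 'f acf) => bool" where
 "is_frob m \<psi> \<longleftrightarrow> \<psi> : field_auts & (\<forall>c. \<psi> (cst c) = cst (c ^ (2 ^ m))) & \<psi> s = s & \<psi> z = z"

lemma gal_aut: "\<gamma> : gal_geom ==> \<gamma> : field_auts" by (simp add: gal_geom_def)

lemma cj_rot_NN: "is_rot \<gamma> ==> \<nu> : NN ==> cj \<gamma> \<nu> : NN"
 unfolding is_rot_def using subfld_D(1,5)[OF subfield_Lf] s_in_Lf z_in_Lf
 by (intro cj_NN) (auto simp: gal_geom_const const_in_Lf gal_aut)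

lemma cj_frob_NN: "is_frob m \<psi> ==> \<nu> : NN ==> cj \<psi> \<nu> : NN"
 unfolding is_frob_def by (intro cj_NN) (auto simp: const_in_Lf s_in_Lf z_in_Lf)

lemma root_div_rot:
 assumes \<gamma>: "is_rot \<gamma>" and g: "root_div g D"
 shows "root_div (\<gamma> g) (push rotE D)"
proof (rule root_div_image[OF _ g])
 have g: "\<gamma> : gal_geom" "\<gamma> s = s + 1" "\<gamma> z = z + s + 1" using \<gamma> by (simp_all add: is_rot_def)
 show "\<gamma> : field_auts" using g(1) by (rule gal_aut)
 have 4: "rotE (rotE (rotE (rotE P))) = P" for P by (simp add: rotE_rotE negE_negE)
 show "bij rotE" by (rule o_bij[of "%P. rotE (rotE (rotE P))"]) (simp_all add: fun_eq_iff 4)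
 show "rotE P : Ec \<longleftrightarrow> P : Ec" for P using rotE_Ec 4 by metis
 show "\<gamma> f : Lf & ordE (rotE P) (\<gamma> f) = ordE P f" if "f : Lf" "f ~= 0" "P : Ec" for f P
  using ordE_rotation[OF g that(3,1,2)] by blast
qed

lemma frobE_bij: "bij frobE"
proof -
 have "\<exists>Q. frobE Q = P" for P
 proof -
  obtain x y where "x\<^sup>2 = fst P" "y\<^sup>2 = snd P" using root_exists[of 2] by (metis zero_less_numeral)
  thus ?thesis by (intro exI[of _ "(x, y)"]) (simp add: frobE_def)
 qed
 moreover have "inj frobE"
 proof (rule injI)
  fix P Q assume "frobE P = frobE Q"
  hence "(fst P + fst Q)\<^sup>2 = 0" "(snd P + snd Q)\<^sup>2 = 0" by (simp_all add: frobE_def sq_add cf)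
  thus "P = Q" by (simp add: add_eq_0_char2 prod_eq_iff)
 qed
 ultimately show ?thesis unfolding bij_def surj_def by metis
qed

lemma frobE_Ec_iff: "frobE P : Ec \<longleftrightarrow> P : Ec"
proof
 assume "frobE P : Ec"
 hence "((snd P)\<^sup>2 + snd P + fst P ^ 3 + (fst P)\<^sup>2)\<^sup>2 = 0" by (simp add: Ec_def frobE_def sq_add cf mult.commute)
 hence "(snd P)\<^sup>2 + snd P + (fst P ^ 3 + (fst P)\<^sup>2) = 0" by (simp add: add.assoc)
 thus "P : Ec" by (simp add: Ec_def case_prod_unfold add_eq_0_char2)
qed (rule frobE_Ec)

lemma root_div_frob:
 assumes \<psi>: "is_frob m \<psi>" and g: "root_div g D"
 shows "root_div (\<psi> g) (push (frobE ^^ m) D)"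
proof (rule root_div_image[OF _ g])
 have p: "\<psi> : field_auts" "!!c. \<psi> (cst c) = cst (c ^ (2 ^ m))" "\<psi> s = s" "\<psi> z = z"
  using \<psi> by (auto simp: is_frob_def)
 show "\<psi> : field_auts" by (rule p)
 show "bij (frobE ^^ m)" by (induction m) (simp_all only: funpow.simps bij_id bij_comp frobE_bij)
 show "(frobE ^^ m) P : Ec \<longleftrightarrow> P : Ec" for P by (induction m) (simp_all add: frobE_Ec_iff)
 show "\<psi> f : Lf & ordE ((frobE ^^ m) P) (\<psi> f) = ordE P f" if "f : Lf" "f ~= 0" "P : Ec" for f P
  using ordE_frobenius[OF p that(3,1,2)] by blast
qed

text \<open>The values are constants, so that Kummer theory applies. Triviality is required at the
  places over affine points, which are the points that occur in divisors.\<close>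

definition unr_char :: "(('f acf => 'f acf) => 'f) => bool" where
 "unr_char \<chi> \<longleftrightarrow> (\<forall>\<nu>\<in>NN. \<forall>\<mu>\<in>NN. \<chi> (\<nu> o \<mu>) = \<chi> \<nu> * \<chi> \<mu>) & (\<forall>\<nu>\<in>NN. \<chi> \<nu> ~= 0) &
   (\<exists>S. finite S & (\<forall>\<nu>\<in>NN. (\<forall>x\<in>S. \<nu> x = x) --> \<chi> \<nu> = 1)) & (\<forall>W P. \<forall>\<nu>\<in>NN. place_at W P --> \<nu> ` W = W --> \<chi> \<nu> = 1)"

text \<open>Kummer theory gives an eigenvector g for \<chi>. An odd power of g^(2^j) lies in
  \<open>Lf\<close>, and since \<chi> is unramified, the orders of that power are divisible by the
  odd exponent; so g^(2^j) has a divisor.\<close>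

lemma unr_char_root:
 assumes "unr_char \<chi>"
 shows "\<exists>g D j. root_div g D & (\<forall>\<nu>\<in>NN. \<nu> g = cst (\<chi> \<nu> ^ (2 ^ j)) * g)"
proof -
 have hom: "!!\<nu> \<mu>. \<nu> : NN ==> \<mu> : NN ==> \<chi> (\<nu> o \<mu>) = \<chi> \<nu> * \<chi> \<mu>" and nz: "!!\<nu>. \<nu> : NN ==> \<chi> \<nu> ~= 0"
  and unr: "!!W P \<nu>. \<nu> : NN ==> place_at W P ==> \<nu> ` W = W ==> \<chi> \<nu> = 1"
  using assms[unfolded unr_char_def, THEN conjunct1] assms[unfolded unr_char_def, THEN conjunct2, THEN conjunct1]
   assms[unfolded unr_char_def, THEN conjunct2, THEN conjunct2, THEN conjunct2] by blast+
 obtain S where S: "finite S" "!!\<nu>. \<nu> : NN ==> \<forall>x\<in>S. \<nu> x = x ==> \<chi> \<nu> = 1" using assms unfolding unr_char_def by auto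
 obtain g d where g: "g ~= 0" "!!\<nu>. \<nu> : NN ==> \<nu> g = cst (\<chi> \<nu>) * g" "d > 0" "!!\<nu>. \<nu> : NN ==> \<chi> \<nu> ^ d = 1"
  using kummer_generator[OF range_to_ac_subset_Lf hom[unfolded NN_def] nz[unfolded NN_def] S[unfolded NN_def]]
  unfolding NN_def[symmetric] by metis
 obtain e where e: "odd e" "!!x :: 'f. x ^ d = 1 ==> x ^ e = 1" using odd_exponent[OF char2 g(3)] by blast
 have "\<nu> (g ^ e) = g ^ e" if \<nu>: "\<nu> : NN" for \<nu>
 proof -
  have "\<nu> (g ^ e) = cst (\<chi> \<nu> ^ e) * g ^ e"
   by (simp add: aut_power[OF NN_aut[OF \<nu>]] g(2)[OF \<nu>] power_mult_distrib cst_power)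
  thus ?thesis using e(2)[OF g(4)[OF \<nu>]] by simp
 qed
 then obtain j where j: "(g ^ e) ^ (2 ^ j) : Lf" using fixed_by_NN by blast
 define G where "G = g ^ (2 ^ j)"
 have G: "\<nu> G = cst (\<chi> \<nu> ^ (2 ^ j)) * G" if \<nu>: "\<nu> : NN" for \<nu>
  by (simp add: G_def aut_power[OF NN_aut[OF \<nu>]] g(2)[OF \<nu>] power_mult_distrib cst_power)
 have Gnz: "G ~= 0" using g(1) by (simp add: G_def)
 have Ge: "G ^ e : Lf" using j by (simp add: G_def power_mult[symmetric] mult.commute)
 have "\<exists>D. root_div G D"
 proof (rule root_divI[OF Gnz Ge])
  show "e > 0" using e(1) by (rule odd_pos)
  fix P assume P: "P : Ec"
  obtain W where W: "place_at W P" using place_at_over_point[OF V_place V_inf P] by blast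
  show "int e dvd ordE P (G ^ e)"
  proof (rule order_divisible[where \<chi> = "%\<nu>. \<chi> \<nu> ^ (2 ^ j)", OF Gnz G Ge e(1) W])
   show "\<chi> \<nu> ^ 2 ^ j = 1" if "\<nu> : NN" "\<nu> ` W = W" for \<nu> using unr[OF that(1) W that(2)] by simp
  qed
 qed
 thus ?thesis using G by blast
qed

text \<open>The divisor of g plus its image under the square of the rotation is principal, so g
  times \<gamma> (\<gamma> g) lies in \<open>Lf\<close> and is fixed by \<nu>. The exponent 2^j
  disappears because 2-power roots are unique.\<close>

lemma unr_char_rot_rot:
 assumes \<chi>: "unr_char \<chi>" and \<gamma>: "is_rot \<gamma>" and \<nu>: "\<nu> : NN"
 shows "\<chi> \<nu> * \<chi> (cj \<gamma> (cj \<gamma> \<nu>)) = 1"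
proof -
 obtain g D j where g: "root_div g D" "!!\<nu>. \<nu> : NN ==> \<nu> g = cst (\<chi> \<nu> ^ (2 ^ j)) * g"
  using unr_char_root[OF \<chi>] by blast
 have F: "\<gamma> : field_auts" "!!c. \<gamma> (cst c) = cst (id c)"
  using \<gamma> by (simp_all add: is_rot_def gal_aut gal_geom_const)
 have D: "D : divs" and nz: "g ~= 0" using g(1) by (simp_all add: root_div_def)
 have "root_div (g * \<gamma> (\<gamma> g)) (D + push rotE (push rotE D))" by (intro root_div_mult g(1) root_div_rot \<gamma>)
 moreover have "Prin (D + push rotE (push rotE D))"
  using push_rot_rot[OF D] by (simp add: lin_eq_def add.commute)
 ultimately have "g * \<gamma> (\<gamma> g) : Lf" by (rule root_div_Prin_Lf)
 hence "\<nu> (g * \<gamma> (\<gamma> g)) = g * \<gamma> (\<gamma> g)" by (rule NN_Lf[OF \<nu>])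
 moreover have "\<mu> (\<gamma> g) = cst (\<chi> (cj \<gamma> \<mu>) ^ (2 ^ j)) * \<gamma> g" if "\<mu> : NN" for \<mu>
  using NN_scalar_root[OF F, of \<mu> g, OF g(2)[OF cj_rot_NN[OF \<gamma> that]]] by simp
 hence "\<nu> (\<gamma> (\<gamma> g)) = cst (\<chi> (cj \<gamma> (cj \<gamma> \<nu>)) ^ (2 ^ j)) * \<gamma> (\<gamma> g)"
  using NN_scalar_root[OF F, of \<nu> "\<gamma> g"] cj_rot_NN[OF \<gamma> \<nu>] by simp
 moreover have "\<gamma> (\<gamma> g) ~= 0" using nz by (simp add: aut_0_iff[OF F(1)])
 ultimately have "cst ((\<chi> \<nu> * \<chi> (cj \<gamma> (cj \<gamma> \<nu>))) ^ (2 ^ j)) = 1"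
  using nz by (simp add: aut_mult[OF NN_aut[OF \<nu>]] g(2)[OF \<nu>] power_mult_distrib cst_mult)
 hence "(\<chi> \<nu> * \<chi> (cj \<gamma> (cj \<gamma> \<nu>))) ^ (2 ^ j) = 1" by (simp only: cst_eq_1_iff)
 thus ?thesis by (rule char2_power_eq_1[OF char2])
qed

text \<open>The divisor of \<psi> g is the Frobenius image of D, equivalent to p D plus q times the
  rotated D. So \<psi> g and g^p (\<gamma> g)^q differ by a factor in \<open>Lf\<close>, and \<nu>
  scales both alike. The exponent 2^m on the left is the action of \<psi> on the scalar.\<close>

lemma unr_char_frob:
 assumes \<chi>: "unr_char \<chi>" and \<gamma>: "is_rot \<gamma>" and \<psi>: "is_frob m \<psi>" and \<nu>: "\<nu> : NN"
 shows "\<chi> (cj \<psi> \<nu>) ^ (2 ^ m) = \<chi> \<nu> powi fst (gi m) * \<chi> (cj \<gamma> \<nu>) powi snd (gi m)"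
proof -
 obtain g D j where g: "root_div g D" "!!\<nu>. \<nu> : NN ==> \<nu> g = cst (\<chi> \<nu> ^ (2 ^ j)) * g"
  using unr_char_root[OF \<chi>] by blast
 define p q where "p = fst (gi m)" and "q = snd (gi m)"
 have F: "\<gamma> : field_auts" "!!c. \<gamma> (cst c) = cst (id c)"
  using \<gamma> by (simp_all add: is_rot_def gal_aut gal_geom_const)
 have F': "\<psi> : field_auts" "!!c. \<psi> (cst c) = cst (c ^ (2 ^ m))" using \<psi> by (simp_all add: is_frob_def)
 note N = NN_aut[OF \<nu>]
 have D: "D : divs" and nz: "g ~= 0" using g(1) by (simp_all add: root_div_def)
 define h where "h = g powi p * \<gamma> g powi q"
 have "root_div (\<psi> g * inverse h) (push (frobE ^^ m) D + - (mul p D + mul q (push rotE D)))"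
  unfolding h_def by (intro root_div_mult root_div_inverse root_div_powi g(1) root_div_rot[OF \<gamma>] root_div_frob[OF \<psi>])
 moreover have "Prin (push (frobE ^^ m) D + - (mul p D + mul q (push rotE D)))"
  using push_frobs[OF D, of m] by (simp only: lin_eq_def p_def q_def diff_conv_add_uminus)
 ultimately have "\<psi> g * inverse h : Lf" by (rule root_div_Prin_Lf)
 hence "\<nu> (\<psi> g * inverse h) = \<psi> g * inverse h" by (rule NN_Lf[OF \<nu>])
 hence eq: "\<nu> (\<psi> g) * inverse (\<nu> h) = \<psi> g * inverse h" by (simp add: aut_mult[OF N] aut_inverse[OF N])
 have 1: "\<nu> (\<psi> g) = cst ((\<chi> (cj \<psi> \<nu>) ^ (2 ^ m)) ^ (2 ^ j)) * \<psi> g"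
  using NN_scalar_root[OF F' g(2)[OF cj_frob_NN[OF \<psi> \<nu>]]] by (simp add: power_mult[symmetric] mult.commute)
 have 2: "\<nu> (\<gamma> g) = cst (\<chi> (cj \<gamma> \<nu>) ^ (2 ^ j)) * \<gamma> g"
  using NN_scalar_root[OF F g(2)[OF cj_rot_NN[OF \<gamma> \<nu>]]] by simp
 have powi: "\<nu> (x powi n) = \<nu> x powi n" for x n by (simp add: power_int_def aut_power[OF N] aut_inverse[OF N])
 have cpowi: "cst (x powi n) = cst x powi n" for x n by (simp add: power_int_def cst_power cst_inverse)
 have pp: "(x ^ (2 ^ j)) powi n = (x powi n) ^ (2 ^ j)" for x :: 'f and n
  by (simp add: power_int_def power_inverse mult.commute flip: power_mult)
 define c where "c = \<chi> \<nu> powi p * \<chi> (cj \<gamma> \<nu>) powi q"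
 have 3: "\<nu> h = cst (c ^ (2 ^ j)) * h"
  by (simp add: h_def aut_mult[OF N] powi g(2)[OF \<nu>] 2 power_int_mult_distrib c_def power_mult_distrib
    cst_mult flip: cpowi pp)
 have c0: "c ~= 0" using \<chi> \<nu> cj_rot_NN[OF \<gamma> \<nu>] by (simp add: unr_char_def c_def)
 have "(\<chi> (cj \<psi> \<nu>) ^ (2 ^ m) / c) ^ (2 ^ j) = 1" using eq c0 nz unfolding 1 3 by (simp add: h_def aut_0_iff[OF F(1)] aut_0_iff[OF F'(1)] field_simps)
 hence "\<chi> (cj \<psi> \<nu>) ^ (2 ^ m) / c = 1" by (rule char2_power_eq_1[OF char2])
 thus ?thesis by (simp add: c_def p_def q_def)
qed

end

locale ell_ladic = ell_place s z a b V + ladic l v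
 for s z :: "'f::alg_closed_field acf" and a b :: 'f and V :: "'f acf set"
  and l :: nat and v :: "'k::{field_char_0, alg_closed_field} => real"
begin

text \<open>The second condition is continuity at the identity for the l-adic absolute
  value.\<close>

definition unr_hom :: "(('f acf => 'f acf) => 'k) => bool" where
 "unr_hom C \<longleftrightarrow> (\<forall>\<nu>\<in>NN. \<forall>\<mu>\<in>NN. C (\<nu> o \<mu>) = C \<nu> + C \<mu>) &
   (\<forall>\<epsilon>>0. \<exists>S. finite S & (\<forall>\<nu>\<in>NN. (\<forall>x\<in>S. \<nu> x = x) --> v (C \<nu>) < \<epsilon>)) &
   (\<forall>W P. \<forall>\<nu>\<in>NN. place_at W P --> \<nu> ` W = W --> C \<nu> = 0)"

text \<open>Relations between unramified homomorphisms follow from those for characters with values in \<open>'f\<close>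
  by composing with a character of \<open>'k\<close> that separates both sides.\<close>

lemma unr_hom_character:
 assumes C: "unr_hom C" and x: "x ~= 0"
 obtains \<pi> :: "'k => 'f" where "unr_char (\<pi> o C)" "!!y w. \<pi> (y + w) = \<pi> y * \<pi> w" "\<pi> x ~= 1" "\<pi> 0 = 1"
proof -
 obtain \<pi> :: "'k => 'f" where \<pi>: "!!y w. \<pi> (y + w) = \<pi> y * \<pi> w" "!!y. v y < v x ==> \<pi> y = 1" "\<pi> x ~= 1"
  using separating_character[OF char2 x] by metis
 have vx: "v x > 0" using x v_nonneg[of x] v_0_iff[of x] by linarith
 have \<pi>0: "\<pi> 0 = 1" using \<pi>(2)[of 0] vx by (simp add: v_0)
 have nz: "\<pi> y ~= 0" for y using \<pi>(1)[of y "- y"] \<pi>0 by auto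
 obtain S where "finite S" "!!\<nu>. \<nu> : NN ==> \<forall>x\<in>S. \<nu> x = x ==> v (C \<nu>) < v x"
  using C vx unfolding unr_hom_def by blast
 hence "unr_char (\<pi> o C)" using \<pi>(2) C nz \<pi>(1) \<pi>0 unfolding unr_char_def unr_hom_def by auto
 thus ?thesis using that \<pi>(1,3) \<pi>0 by blast
qed

lemma char_of_int:
 assumes "!!y w. \<pi> (y + w) = \<pi> y * (\<pi> w :: 'f)" "\<pi> 0 = 1"
 shows "\<pi> (of_nat n * y) = \<pi> y ^ n" "\<pi> (- (y :: 'k)) = inverse (\<pi> y)" "\<pi> (of_int j * y) = \<pi> y powi j"
proof -
 show 1: "\<pi> (of_nat n * y) = \<pi> y ^ n" for n by (induction n) (simp_all add: assms distrib_right)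
 show 2: "\<pi> (- y) = inverse (\<pi> y)" for y
  by (rule inverse_unique[symmetric]) (use assms(1)[of y "- y"] assms(2) in simp)
 show "\<pi> (of_int j * y) = \<pi> y powi j"
 proof (cases "j >= 0")
  case True
  thus ?thesis using 1[of "nat j"] by (simp add: power_int_def)
 next
  case False
  hence "of_int j * y = - (of_nat (nat (- j)) * y)" by simp
  hence "\<pi> (of_int j * y) = inverse (\<pi> (of_nat (nat (- j)) * y))" by (simp only: 2)
  thus ?thesis using 1[of "nat (- j)"] False by (simp add: power_int_def power_inverse)
 qed
qed

lemma unr_hom_rot_rot:
 assumes C: "unr_hom C" and \<gamma>: "is_rot \<gamma>" and \<nu>: "\<nu> : NN"
 shows "C (cj \<gamma> (cj \<gamma> \<nu>)) = - C \<nu>"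
proof (rule ccontr)
 assume "~ ?thesis"
 hence x: "C \<nu> + C (cj \<gamma> (cj \<gamma> \<nu>)) ~= 0" by (simp add: add_eq_0_iff)
 obtain \<pi> :: "'k => 'f" where "unr_char (\<pi> o C)" "!!y w. \<pi> (y + w) = \<pi> y * \<pi> w" "\<pi> (C \<nu> + C (cj \<gamma> (cj \<gamma> \<nu>))) ~= 1" "\<pi> 0 = 1"
  using unr_hom_character[OF C x] by metis
 thus False using unr_char_rot_rot[of "\<pi> o C" \<gamma> \<nu>] \<gamma> \<nu> by simp
qed

lemma unr_hom_frob:
 assumes C: "unr_hom C" and \<gamma>: "is_rot \<gamma>" and \<psi>: "is_frob m \<psi>" and \<nu>: "\<nu> : NN"
 shows "2 ^ m * C (cj \<psi> \<nu>) = of_int (fst (gi m)) * C \<nu> + of_int (snd (gi m)) * C (cj \<gamma> \<nu>)"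
proof (rule ccontr)
 let ?r = "of_int (fst (gi m)) * C \<nu> + of_int (snd (gi m)) * C (cj \<gamma> \<nu>)"
 assume "~ ?thesis"
 hence x: "of_nat (2 ^ m) * C (cj \<psi> \<nu>) + - ?r ~= 0"
  by (simp only: diff_conv_add_uminus[symmetric] right_minus_eq of_nat_power of_nat_numeral not_False_eq_True)
 obtain \<pi> :: "'k => 'f" where \<pi>: "unr_char (\<pi> o C)" "!!y w. \<pi> (y + w) = \<pi> y * \<pi> w"
  "\<pi> (of_nat (2 ^ m) * C (cj \<psi> \<nu>) + - ?r) ~= 1" "\<pi> 0 = 1" using unr_hom_character[OF C x] by metis
 note ci = char_of_int[of \<pi>, OF \<pi>(2,4)]
 have nz: "\<pi> (C \<mu>) ~= 0" if "\<mu> : NN" for \<mu> using \<pi>(1) that unfolding unr_char_def o_def by blast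
 have "\<pi> (of_nat (2 ^ m) * C (cj \<psi> \<nu>) + - ?r) =
   \<pi> (C (cj \<psi> \<nu>)) ^ (2 ^ m) * inverse (\<pi> (C \<nu>) powi fst (gi m) * \<pi> (C (cj \<gamma> \<nu>)) powi snd (gi m))"
  by (simp only: \<pi>(2) ci)
 also have "... = 1" using unr_char_frob[OF \<pi>(1) \<gamma> \<psi> \<nu>] nz[OF \<nu>] nz[OF cj_rot_NN[OF \<gamma> \<nu>]] by (simp add: field_simps)
 finally show False using \<pi>(3) by blast
qed

end

context ell
begin

section \<open>The place at infinity\<close>

lemma ceval_at_infinity:
 assumes U: "is_place U" "s \<notin> U" and p: "p ~= 0"
 obtains u where "ceval p s = s ^ degree p * u" "u : U" "inverse u : U" "u ~= 0"
proof -
 have s0: "s ~= 0" using U place_0 by metis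
 have i: "inverse s - cst 0 : mi U" using place_not_mem[OF U] by simp
 define u where "u = ceval (reflect_poly p) (inverse s)"
 have "ceval p s = s ^ degree p * ceval (monom 1 (degree p - degree p) * reflect_poly p) (inverse s)"
  by (rule ceval_reflect[OF s0]) simp
 hence 1: "ceval p s = s ^ degree p * u" by (simp add: u_def)
 have "u - cst (poly (reflect_poly p) 0) : mi U" unfolding u_def by (rule place_ceval_residue[OF U(1) i])
 hence *: "u - cst (lead_coeff p) : mi U" by simp
 have uU: "u : U" using place_add[OF U(1) mi_subset[OF U(1) *] place_const[OF U(1), of "lead_coeff p"]] by simp
 moreover have "u \<notin> mi U" using place_residue_unique[OF U(1) *, of 0] p by auto
 ultimately show ?thesis using that 1 place_unit[OF U(1) uU] by blast
qed

text \<open>Membership depends on degrees alone, so all places over infinity have the same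
  intersection with 'f(s).\<close>

lemma rat_field_at_infinity:
 assumes U: "is_place U" "s \<notin> U" and q: "ceval q s ~= 0"
 shows "ceval p s / ceval q s : U \<longleftrightarrow> p = 0 \<or> degree p <= degree q"
proof (cases "p = 0")
 case True
 thus ?thesis using place_0[OF U(1)] by simp
next
 case p: False
 have q0: "q ~= 0" using q by auto
 have s0: "s ~= 0" using U place_0 by metis
 have i: "inverse s : mi U" using place_not_mem[OF U] .
 obtain u where u: "ceval p s = s ^ degree p * u" "u : U" "inverse u : U" "u ~= 0"
  by (rule ceval_at_infinity[OF U p])
 obtain w where w: "ceval q s = s ^ degree q * w" "w : U" "inverse w : U" "w ~= 0"
  by (rule ceval_at_infinity[OF U q0])
 show ?thesis
 proof (cases "degree p <= degree q")
  case True
  hence "s ^ degree q = s ^ degree p * s ^ (degree q - degree p)" by (simp flip: power_add)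
  hence "ceval p s / ceval q s = inverse s ^ (degree q - degree p) * (u * inverse w)" using s0 w(4) by (simp add: u w field_simps)
  also have "... : U" by (intro place_mult[OF U(1)] place_power[OF U(1)] mi_subset[OF U(1) i] u w)
  finally show ?thesis using True by simp
 next
  case False
  hence "s ^ degree p = s ^ degree q * s ^ (degree p - degree q)" by (simp flip: power_add)
  hence 1: "ceval p s / ceval q s * (inverse s ^ (degree p - degree q) * (w * inverse u)) = 1" using s0 w(4) u(4) by (simp add: u w field_simps)
  have "inverse s ^ (degree p - degree q) : mi U"
   using False i mi_power_iff[OF U(1) mi_subset[OF U(1) i]] by simp
  hence "inverse s ^ (degree p - degree q) * (w * inverse u) : mi U"
   by (rule mi_mult[OF U(1) _ place_mult[OF U(1) w(2) u(3)]])
  thus ?thesis using mi_mult[OF U(1)] one_not_in_mi[OF U(1)] 1 False p by (metis mult.commute)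
 qed
qed

text \<open>The curve has a single point at infinity: a rotation maps \<open>U\<close> to a place
  that agrees with \<open>U\<close> on 'f(s), and conjugacy of places over 'f(s) brings it back.
  This correction may add 1 to z, which turns the rotation into the inverse of one.\<close>

lemma rotation_at_infinity:
 fixes U :: "'f acf set"
 assumes U: "is_place U" "t_ac \<notin> U" obtains \<gamma> where "\<gamma> : gal_geom" "\<gamma> s = s + 1" "\<gamma> z = z + s + 1" "\<gamma> ` U = U"
proof -
 obtain \<gamma>0 where \<gamma>0: "\<gamma>0 : gal_geom" "\<gamma>0 s = s + 1" "\<gamma>0 z = z + s + 1" by (rule rotation_exists)
 have F0: "\<gamma>0 : field_auts" and t0: "\<gamma>0 t_ac = t_ac" using \<gamma>0(1) by (simp_all add: gal_geom_def t_ac_def)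
 have cst: "\<gamma>0 ` range cst = range cst" using gal_geom_const[OF \<gamma>0(1)] by (auto simp: image_iff)
 have U0: "is_place (\<gamma>0 ` U)" by (rule is_place_image[OF F0 U(1) cst])
 have "t_ac \<notin> \<gamma>0 ` U"
 proof
  assume "t_ac : \<gamma>0 ` U"
  then obtain x where "x : U" "\<gamma>0 t_ac = \<gamma>0 x" using t0 by auto
  thus False using U(2) aut_eq_iff[OF F0] by auto
 qed
 hence sU: "s \<notin> U" "s \<notin> \<gamma>0 ` U" using s_mem_place_iff[OF U(1)] s_mem_place_iff[OF U0] U(2) by auto
 have "\<gamma>0 ` U \<inter> rat_field s = U \<inter> rat_field s"
 proof (rule Set.set_eqI)
  fix x
  show "x : \<gamma>0 ` U \<inter> rat_field s \<longleftrightarrow> x : U \<inter> rat_field s"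
  proof (cases "x : rat_field s")
   case True
   then obtain p q where "x = ceval p s / ceval q s" "ceval q s ~= 0" unfolding rat_field_def by blast
   thus ?thesis using rat_field_at_infinity[OF U(1) sU(1)] rat_field_at_infinity[OF U0 sU(2)] by simp
  qed simp
 qed
 then obtain h where h: "h : Aut (rat_field s)" "h ` (\<gamma>0 ` U) = U"
  using places_conjugate[OF subfield_rat_field range_to_ac_subset_rat_field_s const_char2[OF char2] U0 U(1)] by metis
 have H: "h : field_auts" using h(1) by (rule AutD)
 have hs: "h s = s" by (rule AutD(2)[OF h(1) rat_field_self])
 define \<gamma>1 where "\<gamma>1 = h o \<gamma>0"
 have "h : gal_geom" unfolding gal_geom_eq using h(1) range_to_ac_subset_rat_field_s by (auto simp: Aut_def)
 hence G1: "\<gamma>1 : Aut (range to_ac)" using \<gamma>0(1) unfolding \<gamma>1_def gal_geom_eq by (rule Aut_comp)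
 have F1: "\<gamma>1 : field_auts" using G1 by (rule AutD)
 have im: "\<gamma>1 ` U = U" by (simp only: \<gamma>1_def image_comp[symmetric] h(2))
 have s1: "\<gamma>1 s = s + 1" by (simp add: \<gamma>1_def \<gamma>0 aut[OF H] hs)
 have z1: "\<gamma>1 z = h z + s + 1" by (simp add: \<gamma>1_def \<gamma>0 aut[OF H] hs)
 have "(h z)\<^sup>2 + h z = z\<^sup>2 + z"
 proof -
  have "h (z\<^sup>2 + z) = h (s ^ 3 + s\<^sup>2)" by (simp only: z_eq)
  hence "(h z)\<^sup>2 + h z = s ^ 3 + s\<^sup>2" by (simp only: aut[OF H] hs)
  thus ?thesis by (simp only: z_eq)
 qed
 hence "(h z + z) * (h z + z + 1) = 0" by (simp add: sq_simps cw)
 hence "h z + z = 0 \<or> h z + z + 1 = 0" by simp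
 hence "h z = z \<or> h z = z + 1" by (metis add.assoc add_right_cancel cw(1))
 thus ?thesis
 proof
  assume "h z = z"
  thus ?thesis using that[of \<gamma>1] G1 s1 z1 im by (simp add: gal_geom_eq)
 next
  assume hz: "h z = z + 1"
  let ?\<tau> = "iv \<gamma>1"
  have "?\<tau> s = s + 1" "?\<tau> z = z + s + 1" using aut_inv_eq_iff[OF F1] by (auto simp: aut[OF F1] s1 z1 hz cw add_ac)
  moreover have "?\<tau> ` U = U"
  proof -
   have "?\<tau> ` (\<gamma>1 ` U) = U" by (simp add: image_image aut_inv_f[OF F1])
   thus ?thesis by (simp only: im)
  qed
  ultimately show ?thesis using that[of ?\<tau>] Aut_inv[OF G1] by (simp add: gal_geom_eq)
 qed
qed

text \<open>Residues are constants, and \<sigma> fixes these: decomposition and inertia groups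
  coincide.\<close>

lemma decomposition_residue:
 fixes U :: "'f acf set"
 assumes U: "is_place U" and \<sigma>: "\<sigma> : gal_geom" "\<sigma> ` U = U" and x: "x : U"
 shows "\<sigma> x - x : mi U"
proof -
 have F: "\<sigma> : field_auts" using \<sigma>(1) by (simp add: gal_geom_def)
 obtain c where c: "x - cst c : mi U" using place_residue_exists[OF U x] by blast
 hence "\<sigma> (x - cst c) : mi (\<sigma> ` U)" unfolding mi_image[OF F] by (rule imageI)
 hence "\<sigma> x - cst c : mi U" by (simp add: \<sigma>(2) aut_diff[OF F] gal_geom_const[OF \<sigma>(1)])
 hence "(\<sigma> x - cst c) - (x - cst c) : mi U" by (rule mi_diff[OF U _ c])
 thus ?thesis by simp
qed

lemma decomposition_scalar:
 fixes U :: "'f acf set"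
 assumes U: "is_place U" and \<sigma>: "\<sigma> : gal_geom" "\<sigma> ` U = U" and u: "u : U" "inverse u : U" "u ~= 0"
  and c: "\<sigma> u = cst c * u"
 shows "c = 1"
proof -
 have "\<sigma> u - u : mi U" by (rule decomposition_residue[OF U \<sigma> u(1)])
 hence "(\<sigma> u - u) * inverse u : mi U" using u(2) by (rule mi_mult[OF U])
 moreover have "(\<sigma> u - u) * inverse u = cst (c - 1)" using u(3) by (simp add: c cst_diff field_simps)
 ultimately show ?thesis using const_in_mi_iff[OF U] by simp
qed

text \<open>x returns to itself under some power of \<sigma>. If \<sigma> x / x were in the ideal,
  so would be the product of its translates over such a period, which telescopes to 1; likewise for
  the inverse.\<close>

lemma orbit_unit:
 fixes U :: "'f acf set"
 assumes U: "is_place U" and \<sigma>: "\<sigma> : gal_geom" "\<sigma> ` U = U" and x: "x ~= 0"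
 shows "\<sigma> x / x : U" "inverse (\<sigma> x / x) : U"
proof -
 have A: "\<sigma> : Aut (range to_ac)" using \<sigma>(1) by (simp add: gal_geom_eq)
 have F: "\<sigma> : field_auts" using A by (rule AutD)
 have An: "(\<sigma> ^^ n) : Aut (range to_ac)" for n
  by (induction n) (simp_all only: funpow.simps Aut_id Aut_comp[OF A])
 have "range (%n. (\<sigma> ^^ n) x) <= {\<tau> x | \<tau>. \<tau> : Aut (range to_ac)}" using An by blast
 hence "finite (range (%n. (\<sigma> ^^ n) x))"
  using Aut_orbit_finite[OF algebraic_over_range_to_ac[OF order_refl]] by (rule finite_subset)
 hence "~ inj (%n. (\<sigma> ^^ n) x)" using finite_imageD by blast
 then obtain i j where ij: "i < j" "(\<sigma> ^^ i) x = (\<sigma> ^^ j) x" unfolding inj_def by (metis linorder_neqE_nat)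
 have "(\<sigma> ^^ i) ((\<sigma> ^^ (j - i)) x) = (\<sigma> ^^ i) x" using ij by (simp flip: funpow_add[THEN fun_cong, unfolded o_apply])
 hence k: "(\<sigma> ^^ (j - i)) x = x" using aut_eq_iff[OF AutD(1)[OF An]] by blast
 have "False" if y: "y : mi U" and prod: "!!n. (\<Prod>m<n. (\<sigma> ^^ m) y) = (\<sigma> ^^ n) w / w" and w: "(\<sigma> ^^ (j - i)) w = w" "w ~= 0" for y w
 proof -
  have im: "(\<sigma> ^^ m) y : mi U" for m
  proof (induction m)
   case (Suc m)
   hence "\<sigma> ((\<sigma> ^^ m) y) : mi (\<sigma> ` U)" unfolding mi_image[OF F] by (rule imageI)
   thus ?case by (simp add: \<sigma>(2))
  qed (simp add: y)
  obtain n where n: "j - i = Suc n" using ij(1) by (metis Suc_diff_Suc)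
  have "(\<sigma> ^^ n) y * (\<Prod>m<n. (\<sigma> ^^ m) y) : mi U"
   by (rule mi_mult[OF U im]) (intro place_prod[OF U] mi_subset[OF U im])
  moreover have "(\<sigma> ^^ n) y * (\<Prod>m<n. (\<sigma> ^^ m) y) = (\<Prod>m<Suc n. (\<sigma> ^^ m) y)" by simp
  moreover have "(\<Prod>m<Suc n. (\<sigma> ^^ m) y) = 1" using prod[of "j - i"] w unfolding n by simp
  ultimately show False using one_not_in_mi[OF U] by simp
 qed
 note no = this
 have tel: "(\<Prod>m<n. (\<sigma> ^^ m) (\<sigma> w / w)) = (\<sigma> ^^ n) w / w" if w: "w ~= 0" for n w
 proof (induction n)
  case (Suc n)
  have "(\<sigma> ^^ n) w ~= 0" using w aut_0_iff[OF AutD(1)[OF An]] by simp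
  thus ?case using Suc w by (simp add: aut_divide[OF AutD(1)[OF An]] funpow_swap1)
 qed (simp add: w)
 have x': "(\<sigma> ^^ (j - i)) (inverse x) = inverse x" by (simp add: aut_inverse[OF AutD(1)[OF An]] k)
 show "\<sigma> x / x : U"
 proof (rule ccontr)
  assume "\<sigma> x / x \<notin> U"
  hence "\<sigma> (inverse x) / inverse x : mi U" using place_not_mem[OF U] by (force simp: aut_inverse[OF F] field_class.field_divide_inverse mult.commute)
  thus False by (rule no[OF _ tel x']) (use x in simp_all)
 qed
 show "inverse (\<sigma> x / x) : U"
 proof (rule ccontr)
  assume "inverse (\<sigma> x / x) \<notin> U"
  hence "\<sigma> x / x : mi U" using place_not_mem[OF U] by fastforce
  thus False by (rule no[OF _ tel k]) (use x in simp_all)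
 qed
qed

lemma root_div_scalar:
 assumes g: "root_div g D" and \<nu>: "\<nu> : NN"
 shows "\<exists>c. \<nu> g = cst c * g"
proof -
 obtain n where n: "n > 0" "g ^ n : Lf" "g ~= 0" using g by (auto simp: root_div_def)
 have "ceval (monom 1 n - 1) (\<nu> g / g) = 0" using NN_Lf[OF \<nu> n(2)] n(3) by (simp add: power_divide aut_power[OF NN_aut[OF \<nu>]] ceval_diff ceval_monom)
 moreover have "monom 1 n - 1 ~= (0 :: 'f poly)" using n(1) by (simp add: monom_eq_1_iff)
 ultimately obtain c where "\<nu> g / g = cst c" using root_of_const_poly by blast
 thus ?thesis using n(3) by (auto simp: field_simps)
qed

text \<open>The multiplicity of D at P is an integer, so g divided by that power of s - x_P is a
  unit at \<open>W\<close>, scaled by the same c.\<close>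

lemma root_div_unramified:
 assumes g: "root_div g D" and W: "place_at W P" and \<nu>: "\<nu> : NN" "\<nu> ` W = W" and c: "\<nu> g = cst c * g"
 shows "c = 1"
proof -
 have pl: "is_place W" and P: "P : Ec" using W by (simp_all add: place_at_def)
 obtain n where n: "n > 0" "g ^ n : Lf" "ordE P (g ^ n) = int n * mlt D P" "g ~= 0"
  using g P by (auto simp: root_div_def)
 define k where "k = mlt D P"
 define x where "x = s - cst (fst P)"
 have x0: "x ~= 0" unfolding x_def by (rule s_minus_const_nz)
 obtain w where w: "g ^ n = x powi (int n * k) * w" "w : W" "inverse w : W" "w ~= 0"
  using place_unit_iff_ord[OF W n(2)] n(3,4) unfolding x_def k_def by (metis power_not_zero)
 define u where "u = g / x powi k"
 have un: "u ^ n = w" using x0 w(1) by (simp add: power_int_mult mult.commute[of "int n"] u_def power_divide)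
 have u0: "u ~= 0" using x0 n(4) by (simp add: u_def)
 have "u : W" "inverse u : W" using place_power_iff[OF pl n(1)] un w(2,3) by (metis, metis power_inverse)
 moreover have "\<nu> u = cst c * u"
 proof -
  have "x powi k : Lf" unfolding x_def using subfld_D(7)[OF subfield_Lf s_in_Lf const_in_Lf] by (intro Lf_powi)
  thus ?thesis by (simp add: u_def aut_divide[OF NN_aut[OF \<nu>(1)]] c NN_Lf[OF \<nu>(1)])
 qed
 ultimately show ?thesis using decomposition_scalar[OF pl _ \<nu>(2) _ _ u0] \<nu>(1) NN_gal_iff by blast
qed

text \<open>The quotient of \<gamma> (\<gamma> g) by g is a unit at \<open>U\<close>, and the
  decomposition group acts trivially on residues; so the scalar d / c is 1.\<close>

lemma root_div_decomposition_infinity: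
 assumes g: "g ~= 0" and U: "is_place U" and \<gamma>: "\<gamma> : gal_geom" "\<gamma> ` U = U" and \<nu>: "\<nu> : NN" "\<nu> ` U = U"
  and c: "\<nu> g = cst c * g" "\<nu> (\<gamma> (\<gamma> g)) = cst d * \<gamma> (\<gamma> g)"
 shows "c = d"
proof -
 have F: "\<gamma> : field_auts" using \<gamma>(1) by (simp add: gal_geom_def)
 have gg: "\<gamma> o \<gamma> : gal_geom" using \<gamma>(1) unfolding gal_geom_eq by (intro Aut_comp)
 have im: "(\<gamma> o \<gamma>) ` U = U" by (simp only: image_comp[symmetric] \<gamma>(2))
 define u where "u = (\<gamma> o \<gamma>) g / g"
 have u0: "u ~= 0" using g by (simp add: u_def aut_0_iff[OF F])
 have uU: "u : U" "inverse u : U" unfolding u_def by (rule orbit_unit[OF U gg im g])+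
 have "\<nu> u = cst (d / c) * u" using c(1) g aut_0_iff[OF NN_aut[OF \<nu>(1)], of g] by (simp add: u_def aut_divide[OF NN_aut[OF \<nu>(1)]] c cst_divide)
 thus ?thesis using decomposition_scalar[OF U _ \<nu>(2) uU u0] \<nu>(1) NN_gal_iff by force
qed

end

section \<open>The homomorphism given by the Tate module\<close>

context ell
begin

text \<open>For \<open>r\<^sup>4 = r\<close> the curve has the automorphisms \<open>(x, y) \<mapsto> (x + r, y + r\<^sup>2 x + u)\<close> with
  \<open>u\<^sup>2 + u = r\<^sup>3 + r\<^sup>2\<close>; together with \<open>(x, y) \<mapsto> (x, y + 1)\<close> those with \<open>r : GF 4\<close> contain the quaternion group.\<close>

lemma shift_exists:
 assumes r: "r ^ 4 = r" obtains \<sigma> u where "\<sigma> : field_auts" "!!c. \<sigma> (cst c) = cst c" "\<sigma> s = s + cst r"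
  "\<sigma> z = z + cst (r\<^sup>2) * s + cst u"
proof -
 have sr: "ceval p (s + cst r) = ceval (pcompose p [:r, 1:]) s" for p by (simp add: ceval_pcompose add.commute)
 have "p = 0" if "ceval p (s + cst r) = 0" for p
  using s_transcendental[of "pcompose p [:r, 1:]"] that pcompose_eq_0[of p "[:r, 1:]"] by (simp add: sr)
 moreover have "t_ac : rat_field (s + cst r)"
 proof -
  have "s = ceval [:- r, 1:] (s + cst r)" by (simp add: cst_minus)
  hence "s : rat_field (s + cst r)" by (metis ceval_in_rat_field)
  thus ?thesis using rat_field_subset t_in_rat_field_s by blast
 qed
 ultimately obtain \<sigma> where \<sigma>: "\<sigma> : field_auts" "!!c. \<sigma> (cst c) = cst c" "\<sigma> s = s + cst r"
  using transcendental_automorphism[OF s_transcendental _ t_in_rat_field_s] by metis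
 define w where "w = \<sigma> z + z + cst (r\<^sup>2) * s"
 have "\<sigma> (z\<^sup>2 + z) = \<sigma> (s ^ 3 + s\<^sup>2)" by (simp only: z_eq)
 hence 1: "(\<sigma> z)\<^sup>2 + \<sigma> z = (s + cst r) ^ 3 + (s + cst r)\<^sup>2" by (simp only: aut[OF \<sigma>(1)] \<sigma>(3))
 have r4: "cst r * (cst r * (cst r * cst r)) = cst r"
 proof -
  have "cst r ^ 4 = cst r" by (simp only: cst_power[symmetric] r)
  thus ?thesis by (simp only: power4_eq_xxxx mult.assoc)
 qed
 have "w\<^sup>2 + w = ((\<sigma> z)\<^sup>2 + \<sigma> z) + (z\<^sup>2 + z) + cst r * (cst r * (cst r * cst r)) * s\<^sup>2 + cst r * cst r * s"
  unfolding w_def by (simp add: cst_mult sq_simps cw)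
 also have "... = cst (r ^ 3 + r\<^sup>2)"
  unfolding 1 z_eq r4 by (simp add: cst_mult cst_add sqr power3_eq_cube algebra_simps cw)
 finally have "ceval [:r ^ 3 + r\<^sup>2, 1, 1:] w = 0" by (simp add: sq_simps cw cst_add)
 then obtain u where u: "w = cst u" using root_of_const_poly[of "[:r ^ 3 + r\<^sup>2, 1, 1:]" w] by auto
 have "\<sigma> z = z + cst (r\<^sup>2) * s + w" by (simp add: w_def cw)
 thus ?thesis using that \<sigma> u by blast
qed

end

context ell_ladic
begin

text \<open>Stronger than \<open>unr_hom\<close>: trivial on the decomposition groups at infinity as
  well, as required for extending to a cocycle that vanishes there.\<close>

definition good :: "(('f acf => 'f acf) => 'k) => bool" where "good C \<longleftrightarrow> (\<forall>\<nu>\<in>NN. \<forall>\<mu>\<in>NN. C (\<nu> o \<mu>) = C \<nu> + C \<mu>) &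
   (\<forall>\<epsilon>>0. \<exists>S. finite S & (\<forall>\<nu>\<in>NN. (\<forall>x\<in>S. \<nu> x = x) --> v (C \<nu>) < \<epsilon>)) &
   (\<forall>W. is_place W --> (\<forall>\<nu>\<in>NN. \<nu> ` W = W --> C \<nu> = 0))"

lemma goodI:
 assumes "!!\<nu> \<mu>. \<nu> : NN ==> \<mu> : NN ==> C (\<nu> o \<mu>) = C \<nu> + C \<mu>"
  and "!!\<epsilon>. \<epsilon> > 0 ==> \<exists>S. finite S & (\<forall>\<nu>\<in>NN. (\<forall>x\<in>S. \<nu> x = x) --> v (C \<nu>) < \<epsilon>)"
  and "!!W \<nu>. is_place W ==> \<nu> : NN ==> \<nu> ` W = W ==> C \<nu> = 0"
 shows "good C" unfolding good_def using assms by auto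

lemma goodD:
 assumes "good C"
 shows "\<nu> : NN ==> \<mu> : NN ==> C (\<nu> o \<mu>) = C \<nu> + C \<mu>"
  and "\<epsilon> > 0 ==> \<exists>S. finite S & (\<forall>\<nu>\<in>NN. (\<forall>x\<in>S. \<nu> x = x) --> v (C \<nu>) < \<epsilon>)"
  and "is_place W ==> \<nu> : NN ==> \<nu> ` W = W ==> C \<nu> = 0" using assms unfolding good_def by auto

lemma good_unr_hom: "good C ==> unr_hom C" unfolding good_def unr_hom_def place_at_def by blast

lemma is_rotE: "\<exists>\<gamma>. is_rot \<gamma>" using rotation_exists unfolding is_rot_def by blast

lemma rotation_at: "is_place U ==> t_ac \<notin> U ==> \<exists>\<gamma>. is_rot \<gamma> & \<gamma> ` U = U"
 using rotation_at_infinity[of U] unfolding is_rot_def by metis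

text \<open>The torsion tower gives radicals g n with the divisors of the points R n and g (n + 1)^l
  = g n * h n. Each \<nu> scales them by an element of \<open>tate\<close>, and C is its logarithm.
  If C vanished, g 1 would be fixed by \<open>NN\<close>, and R 1 would be killed by a power of 2 as
  well as by l.\<close>

lemma good_exists: "\<exists>C. good C & (\<exists>\<nu>\<in>NN. C \<nu> ~= 0)"
proof -
 obtain R where R: "!!n. R n : pts" "R 0 = None" "R 1 ~= None" "!!n. mul (int l) (dv (R (Suc n))) \<approx> dv (R n)"
  using torsion_tower[OF prime_l odd_l] by metis
 obtain L :: "(nat => 'f) => 'k" where L: "\<forall>x\<in>tate. \<forall>y\<in>tate. L (%n. x n * y n) = L x + L y"
  "\<forall>x\<in>tate. L x = 0 --> (\<forall>n. x n = 1)" "\<forall>x\<in>tate. \<forall>n. x n = 1 --> v (L x) <= 1 / real l ^ n"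
  by (rule ladic_log_exists[OF char2])
 have "\<exists>h\<in>Lf. root_div h (mul (int l) (dv (R (Suc n))) - dv (R n))" for n
  using R(4)[of n] unfolding lin_eq_def by (rule root_div_Prin)
 then obtain h where h: "!!n. h n : Lf" "!!n. root_div (h n) (mul (int l) (dv (R (Suc n))) - dv (R n))" by metis
 define g where "g = rec_nat 1 (%n y. SOME w. w ^ l = y * h n)"
 have g0: "g 0 = 1" by (simp add: g_def)
 have gS: "g (Suc n) ^ l = g n * h n" for n using someI_ex[OF root_exists[of l "g n * h n"]] l_gt_1 by (simp add: g_def)
 have gd: "root_div (g n) (dv (R n))" for n
 proof (induction n)
  case 0
  have "root_div 1 0" using root_div_power[OF h(2)[of 0], of 0] by simp
  thus ?case by (simp add: g0 R(2))
 next
  case (Suc n)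
  have "root_div (g (Suc n) ^ l) (dv (R n) + (mul (int l) (dv (R (Suc n))) - dv (R n)))"
   unfolding gS by (rule root_div_mult[OF Suc h(2)])
  hence "root_div (g (Suc n) ^ l) (mul (int l) (dv (R (Suc n))))" by simp
  thus ?case by (rule root_div_root[OF _ _ dv_in_divs[OF R(1)]]) (use l_gt_1 in simp)
 qed
 have gnz: "g n ~= 0" for n using gd[of n] by (simp add: root_div_def)
 have "\<exists>c. \<nu> (g n) = cst c * g n" if "\<nu> : NN" for \<nu> n by (rule root_div_scalar[OF gd that])
 then obtain \<chi> where \<chi>: "!!\<nu> n. \<nu> : NN ==> \<nu> (g n) = cst (\<chi> \<nu> n) * g n" by metis
 have inj: "c = d" if "cst c * g n = cst d * g n" for c d n using that gnz by simp
 have \<chi>_tate: "\<chi> \<nu> : tate" if \<nu>: "\<nu> : NN" for \<nu> unfolding tate_def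
 proof (intro CollectI conjI allI)
  note F = NN_aut[OF \<nu>]
  show "\<chi> \<nu> 0 = 1" using \<chi>[OF \<nu>, of 0] by (simp add: g0 aut_1[OF F])
  fix n
  have "\<nu> (g (Suc n) ^ l) = cst (\<chi> \<nu> (Suc n) ^ l) * g (Suc n) ^ l"
   by (simp add: aut_power[OF F] \<chi>[OF \<nu>] power_mult_distrib cst_power)
  moreover have "\<nu> (g (Suc n) ^ l) = cst (\<chi> \<nu> n) * g (Suc n) ^ l"
   unfolding gS by (simp add: aut_mult[OF F] \<chi>[OF \<nu>] NN_Lf[OF \<nu> h(1)])
  ultimately show "\<chi> \<nu> (Suc n) ^ l = \<chi> \<nu> n" using gnz[of "Suc n"] by simp
 qed
 have \<chi>_comp: "\<chi> (\<nu> o \<mu>) = (%n. \<chi> \<nu> n * \<chi> \<mu> n)" if "\<nu> : NN" "\<mu> : NN" for \<nu> \<mu>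
 proof
  fix n
  have "cst (\<chi> (\<nu> o \<mu>) n) * g n = \<nu> (\<mu> (g n))" using \<chi>[OF NN_comp[OF that]] by simp
  also have "... = cst (\<chi> \<nu> n * \<chi> \<mu> n) * g n"
   by (simp add: \<chi> that aut_mult[OF NN_aut[OF that(1)]] NN_const[OF that(1)] cst_mult mult_ac)
  finally show "\<chi> (\<nu> o \<mu>) n = \<chi> \<nu> n * \<chi> \<mu> n" by (rule inj)
 qed
 define C where "C \<nu> = L (\<chi> \<nu>)" for \<nu>
 have hom: "C (\<nu> o \<mu>) = C \<nu> + C \<mu>" if "\<nu> : NN" "\<mu> : NN" for \<nu> \<mu>
  using L(1) \<chi>_tate that by (simp add: C_def \<chi>_comp)
 have cont: "\<exists>S. finite S & (\<forall>\<nu>\<in>NN. (\<forall>x\<in>S. \<nu> x = x) --> v (C \<nu>) < \<epsilon>)" if "\<epsilon> > 0" for \<epsilon>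
 proof -
  have "1 / real l < 1" using l_gt_1 by simp
  from real_arch_pow_inv[OF that this] obtain n where n: "(1 / real l) ^ n < \<epsilon>" by blast
  have "v (C \<nu>) < \<epsilon>" if \<nu>: "\<nu> : NN" "\<nu> (g n) = g n" for \<nu>
  proof -
   have "\<chi> \<nu> n = 1" using \<chi>[OF \<nu>(1), of n] \<nu>(2) gnz[of n] by simp
   hence "v (C \<nu>) <= 1 / real l ^ n" using L(3) \<chi>_tate[OF \<nu>(1)] by (simp add: C_def)
   thus ?thesis using n by (simp add: power_one_over)
  qed
  thus ?thesis by (intro exI[of _ "{g n}"]) auto
 qed
 have L1: "L (%n. 1) = 0"
 proof -
  have one: "(%n. 1) : tate" by (simp add: tate_def)
  show ?thesis using bspec[OF bspec[OF L(1) one] one] by simp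
 qed
 have fin: "C \<nu> = 0" if W: "is_place W" "t_ac : W" and \<nu>: "\<nu> : NN" "\<nu> ` W = W" for W \<nu>
 proof -
  obtain P where P: "place_at W P" using place_at_exists[OF W] by blast
  have "\<chi> \<nu> = (%n. 1)" by (rule ext) (rule root_div_unramified[OF gd P \<nu> \<chi>[OF \<nu>(1)]])
  thus ?thesis by (simp add: C_def L1)
 qed
 have unr: "unr_hom C" unfolding unr_hom_def
 proof (intro conjI ballI allI impI)
  show "C \<nu> = 0" if "\<nu> : NN" "place_at W P" "\<nu> ` W = W" for \<nu> W P
   by (rule fin[OF _ _ that(1,3)]) (use that(2) in \<open>simp_all add: place_at_def\<close>)
 qed (use hom cont in simp_all)
 \<comment> \<open>At infinity \<nu> scales g n and its image under the square of a rotation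
   equally, whereas that square acts on C as -1; so C \<nu> = - C \<nu>.\<close>
 have inf: "C \<nu> = 0" if U: "is_place U" "t_ac \<notin> U" and \<nu>: "\<nu> : NN" "\<nu> ` U = U" for U \<nu>
 proof -
  obtain \<gamma> where \<gamma>: "is_rot \<gamma>" "\<gamma> ` U = U" using rotation_at[OF U] by blast
  have G: "\<gamma> : gal_geom" using \<gamma>(1) by (simp add: is_rot_def)
  have F: "\<gamma> : field_auts" "!!c. \<gamma> (cst c) = cst (id c)" using G by (simp_all add: gal_aut gal_geom_const)
  have \<mu>: "cj \<gamma> (cj \<gamma> \<nu>) : NN" "cj \<gamma> \<nu> : NN" using cj_rot_NN[OF \<gamma>(1)] \<nu>(1) by blast+
  have "\<chi> \<nu> n = \<chi> (cj \<gamma> (cj \<gamma> \<nu>)) n" for n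
  proof (rule root_div_decomposition_infinity[OF gnz U(1) G \<gamma>(2) \<nu> \<chi>[OF \<nu>(1)]])
   have "cj \<gamma> \<nu> (\<gamma> (g n)) = cst (id (\<chi> (cj \<gamma> (cj \<gamma> \<nu>)) n)) * \<gamma> (g n)" by (rule NN_scalar_root[OF F \<chi>[OF \<mu>(1)]])
   thus "\<nu> (\<gamma> (\<gamma> (g n))) = cst (\<chi> (cj \<gamma> (cj \<gamma> \<nu>)) n) * \<gamma> (\<gamma> (g n))"
    using NN_scalar_root[OF F, of \<nu> "\<gamma> (g n)"] by simp
  qed
  hence "\<chi> \<nu> = \<chi> (cj \<gamma> (cj \<gamma> \<nu>))" by (rule ext)
  hence "C \<nu> = C (cj \<gamma> (cj \<gamma> \<nu>))" by (simp add: C_def)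
  hence "C \<nu> = - C \<nu>" using unr_hom_rot_rot[OF unr \<gamma>(1) \<nu>(1)] by simp
  thus ?thesis by simp
 qed
 have "good C" by (rule goodI[OF hom cont]) (use fin inf in blast)+
 moreover have "\<exists>\<nu>\<in>NN. C \<nu> ~= 0"
 proof (rule ccontr)
  assume "~ ?thesis"
  hence "\<chi> \<nu> 1 = 1" if "\<nu> : NN" for \<nu> using L(2) \<chi>_tate[OF that] that by (simp add: C_def)
  hence "\<nu> (g 1) = g 1" if "\<nu> : NN" for \<nu> using \<chi>[OF that, of 1] that by simp
  then obtain j where j: "g 1 ^ (2 ^ j) : Lf" using fixed_by_NN by blast
  have "Prin (mul (int (2 ^ j)) (dv (R 1)))" by (rule root_div_Lf[OF root_div_power[OF gd] j])
  hence "mul (2 ^ j) (dv (R 1)) \<approx> 0" by (simp add: lin_eq_def)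
  moreover have "mul (int l) (dv (R 1)) \<approx> 0" using R(4)[of 0] R(2) by simp
  moreover have "coprime (2 ^ j) (int l)" using odd_l by simp
  ultimately have "dv (R 1) \<approx> 0" using coprime_lin_eq_0 by blast
  hence "dv (R 1) \<approx> dv None" by simp
  hence "R 1 = None" using dv_unique[OF R(1), of None 1] by (simp add: pts_def)
  thus False using R(3) by simp
 qed
 ultimately show ?thesis by blast
qed

lemma good_id: "good C ==> C id = 0" using goodD(1)[of C id id] NN_id by simp

lemma good_inv: "good C ==> \<nu> : NN ==> C (iv \<nu>) = - C \<nu>"
 using goodD(1)[of C \<nu> "iv \<nu>"] NN_inv[of \<nu>] good_id[of C] aut_o_inv(1)[OF NN_aut[of \<nu>]]
 by (simp add: add_eq_0_iff)

lemma good_cj_NN: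
 assumes "good C" "\<mu> : NN" "\<nu> : NN"
 shows "C (cj \<mu> \<nu>) = C \<nu>" using goodD(1)[OF assms(1) NN_comp[OF NN_inv[OF assms(2)] assms(3)] assms(2)]
  goodD(1)[OF assms(1) NN_inv[OF assms(2)] assms(3)] good_inv[OF assms(1,2)] by (simp add: cj_def)

text \<open>Two rotations differ by an element of \<open>NN\<close>, and a homomorphism to a
  commutative group is invariant under inner automorphisms.\<close>

lemma rot_indep:
 assumes C: "good C" and \<gamma>: "is_rot \<gamma>" "is_rot \<gamma>'" and \<nu>: "\<nu> : NN"
 shows "C (cj \<gamma>' \<nu>) = C (cj \<gamma> \<nu>)"
proof -
 have G: "\<gamma> : Aut (range to_ac)" "\<gamma>' : Aut (range to_ac)" using \<gamma> by (simp_all add: is_rot_def gal_geom_eq)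
 note F = AutD(1)[OF G(1)]
 define \<mu> where "\<mu> = iv \<gamma> o \<gamma>'"
 have \<gamma>': "\<gamma>' = \<gamma> o \<mu>" by (simp add: \<mu>_def fun_eq_iff aut_f_inv[OF F])
 have \<mu>: "\<mu> : NN" unfolding NN_gal_iff gal_geom_eq
  using Aut_comp[OF Aut_inv[OF G(1)] G(2)] \<gamma> by (simp add: \<mu>_def is_rot_def aut_inv_eq_iff[OF F])
 have "cj \<gamma>' \<nu> = cj \<mu> (cj \<gamma> \<nu>)" unfolding \<gamma>' by (rule cj_cj[symmetric, OF F NN_aut[OF \<mu>]])
 thus ?thesis using good_cj_NN[OF C \<mu> cj_rot_NN[OF \<gamma>(1) \<nu>]] by simp
qed

lemma good_comb:
 assumes "good C" "good C'"
 shows "good (%\<nu>. C \<nu> + k * C' \<nu>)"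
proof (rule goodI)
 fix \<epsilon> :: real assume e: "\<epsilon> > 0"
 have vk: "v k + 1 > 0" using v_nonneg[of k] by linarith
 obtain S where S: "finite S" "!!\<nu>. \<nu> : NN ==> \<forall>x\<in>S. \<nu> x = x ==> v (C \<nu>) < \<epsilon>" using goodD(2)[OF assms(1) e] by blast
 obtain S' where S': "finite S'" "!!\<nu>. \<nu> : NN ==> \<forall>x\<in>S'. \<nu> x = x ==> v (C' \<nu>) < \<epsilon> / (v k + 1)"
  using goodD(2)[OF assms(2), of "\<epsilon> / (v k + 1)"] e vk by auto
 have "v (C \<nu> + k * C' \<nu>) < \<epsilon>" if \<nu>: "\<nu> : NN" "\<forall>x\<in>S \<union> S'. \<nu> x = x" for \<nu>
 proof -
  have "v k * v (C' \<nu>) <= (v k + 1) * v (C' \<nu>)" using v_nonneg by (intro mult_right_mono) auto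
  also have "... < \<epsilon>" using S'(2)[OF \<nu>(1)] \<nu>(2) vk by (simp add: field_simps)
  finally have "v (k * C' \<nu>) < \<epsilon>" by (simp add: v_mult)
  thus ?thesis using S(2)[OF \<nu>(1)] \<nu>(2) v_add[of "C \<nu>" "k * C' \<nu>"] by auto
 qed
 thus "\<exists>S. finite S & (\<forall>\<nu>\<in>NN. (\<forall>x\<in>S. \<nu> x = x) --> v (C \<nu> + k * C' \<nu>) < \<epsilon>)"
  using S(1) S'(1) by (intro exI[of _ "S \<union> S'"]) auto
qed (use goodD[OF assms(1)] goodD[OF assms(2)] in \<open>auto simp: distrib_left\<close>)

lemma good_shift:
 assumes C: "good C" and \<sigma>: "\<sigma> : field_auts" "!!c. \<sigma> (cst c) = cst c" "\<sigma> s : Lf" "\<sigma> z : Lf"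
 shows "good (%\<nu>. C (cj \<sigma> \<nu>))"
proof (rule goodI)
 have N: "cj \<sigma> \<nu> : NN" if "\<nu> : NN" for \<nu> using that \<sigma> by (intro cj_NN) (simp_all add: const_in_Lf)
 show "C (cj \<sigma> (\<nu> o \<mu>)) = C (cj \<sigma> \<nu>) + C (cj \<sigma> \<mu>)" if "\<nu> : NN" "\<mu> : NN" for \<nu> \<mu>
  using goodD(1)[OF C N[OF that(1)] N[OF that(2)]] by (simp add: cj_comp[OF \<sigma>(1)])
 fix \<epsilon> :: real assume e: "\<epsilon> > 0"
 obtain S where S: "finite S" "\<forall>\<nu>\<in>NN. (\<forall>x\<in>S. \<nu> x = x) --> v (C \<nu>) < \<epsilon>" using goodD(2)[OF C e] by blast
 have "v (C (cj \<sigma> \<nu>)) < \<epsilon>" if "\<nu> : NN" "\<forall>x\<in>\<sigma> ` S. \<nu> x = x" for \<nu>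
  using bspec[OF S(2) N[OF that(1)]] that(2) by (simp add: cj_eq[OF \<sigma>(1)])
 thus "\<exists>S. finite S & (\<forall>\<nu>\<in>NN. (\<forall>x\<in>S. \<nu> x = x) --> v (C (cj \<sigma> \<nu>)) < \<epsilon>)" using S(1) by (intro exI[of _ "\<sigma> ` S"]) auto
next
 fix W \<nu> assume W: "is_place W" and \<nu>: "\<nu> : NN" "\<nu> ` W = W"
 let ?\<tau> = "iv \<sigma>"
 have "?\<tau> (cst c) = cst c" for c by (simp add: aut_inv_eq_iff[OF \<sigma>(1)] \<sigma>(2))
 hence "is_place (?\<tau> ` W)" by (intro is_place_image[OF aut_inv[OF \<sigma>(1)] W]) (auto simp: image_iff)
 moreover have "cj \<sigma> \<nu> ` (?\<tau> ` W) = ?\<tau> ` W"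
 proof (rule cj_image[OF \<sigma>(1)])
  show "\<nu> ` \<sigma> ` ?\<tau> ` W = \<sigma> ` ?\<tau> ` W" using \<nu>(2) by (simp add: image_image aut_f_inv[OF \<sigma>(1)])
 qed
 moreover have "cj \<sigma> \<nu> : NN" using \<nu>(1) \<sigma> by (intro cj_NN) (simp_all add: const_in_Lf)
 ultimately show "C (cj \<sigma> \<nu>) = 0" using goodD(3)[OF C] by metis
qed

text \<open>The square of the rotation acts as -1, so C minus \<iota> times its rotated form is an
  eigenvector for \<iota>. If this vanishes, C belongs to -\<iota> and is transported by an
  automorphism of the curve that conjugates a rotation to the inverse of one, as in the quaternion
  group.\<close>

theorem good_eigen_exists:
 assumes \<iota>: "\<iota>\<^sup>2 = (-1 :: 'k)"
 shows "\<exists>C. good C & (\<exists>\<nu>\<in>NN. C \<nu> ~= 0) & (\<forall>\<gamma> \<nu>. is_rot \<gamma> --> \<nu> : NN --> C (cj \<gamma> \<nu>) = \<iota> * C \<nu>)"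
proof -
 have \<iota>\<iota>: "\<iota> * (\<iota> * y) = - y" for y using \<iota> by (simp add: sqr mult.assoc[symmetric])
 obtain C where C: "good C" "\<exists>\<nu>\<in>NN. C \<nu> ~= 0" using good_exists by blast
 obtain \<gamma> where \<gamma>: "is_rot \<gamma>" using is_rotE by blast
 have F: "\<gamma> : field_auts" "!!c. \<gamma> (cst c) = cst c" "\<gamma> s : Lf" "\<gamma> z : Lf"
  using \<gamma> subfld_D(1,5)[OF subfield_Lf] s_in_Lf z_in_Lf by (auto simp: is_rot_def gal_aut gal_geom_const)
 define C1 where "C1 \<nu> = C \<nu> + (- \<iota>) * C (cj \<gamma> \<nu>)" for \<nu>
 have C1: "good C1" unfolding C1_def by (rule good_comb[OF C(1) good_shift[OF C(1) F]])
 have eig: "C1 (cj \<gamma>' \<nu>) = \<iota> * C1 \<nu>" if "is_rot \<gamma>'" "\<nu> : NN" for \<gamma>' \<nu>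
  unfolding rot_indep[OF C1 \<gamma> that] using unr_hom_rot_rot[OF good_unr_hom[OF C(1)] \<gamma> that(2)] \<iota>\<iota>
  by (simp add: C1_def distrib_left right_diff_distrib)
 show ?thesis
 proof (cases "\<exists>\<nu>\<in>NN. C1 \<nu> ~= 0")
  case True
  thus ?thesis using C1 eig by blast
 next
  case False
  have neg: "C (cj \<gamma> \<nu>) = - \<iota> * C \<nu>" if \<nu>: "\<nu> : NN" for \<nu>   using False \<nu> \<iota>\<iota>[of "C (cj \<gamma> \<nu>)"] by (simp add: C1_def)
  \<comment> \<open>A primitive cube root of unity: w^4 = w is what the shift requires, and w^2 = w
    + 1 produces the inverse below.\<close>
  obtain w :: 'f where w: "poly [:1, 1, 1:] w = 0" using has_root[of "[:1, 1, 1 :: 'f:]"] by auto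
  hence "w\<^sup>2 + (w + 1) = 0" by (simp add: sq_simps)
  hence w2: "w\<^sup>2 = w + 1" by (simp only: add_eq_0_char2)
  have "w ^ 4 = (w\<^sup>2)\<^sup>2" by simp
  also have "... = w" by (simp add: w2 sq_add cf)
  finally have w4: "w ^ 4 = w" .
  obtain \<sigma> u where \<sigma>: "\<sigma> : field_auts" "!!c. \<sigma> (cst c) = cst c" "\<sigma> s = s + cst w"
   "\<sigma> z = z + cst (w\<^sup>2) * s + cst u" using shift_exists[OF w4] by blast
  let ?\<tau> = "iv \<sigma>"
  have \<tau>: "?\<tau> : field_auts" by (rule aut_inv[OF \<sigma>(1)])
  have \<sigma>L: "\<sigma> s : Lf" "\<sigma> z : Lf" unfolding \<sigma>
   by (intro subfld_D(5)[OF subfield_Lf] subfld_D(6)[OF subfield_Lf] s_in_Lf z_in_Lf const_in_Lf)+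
  have \<tau>c: "?\<tau> (cst c) = cst c" for c by (simp add: aut_inv_eq_iff[OF \<sigma>(1)] \<sigma>(2))
  have \<tau>s: "?\<tau> s = s + cst w" by (simp add: aut_inv_eq_iff[OF \<sigma>(1)] aut_add[OF \<sigma>(1)] \<sigma> cw)
  have \<tau>z: "?\<tau> z = z + cst (w\<^sup>2) * s + cst (w ^ 3 + u)" unfolding aut_inv_eq_iff[OF \<sigma>(1)]
   by (simp add: aut[OF \<sigma>(1)] \<sigma> cst_add cst_mult power3_eq_cube sq_simps cw)
  define C2 where "C2 \<nu> = C (cj \<sigma> \<nu>)" for \<nu>
  have C2: "good C2" unfolding C2_def by (rule good_shift[OF C(1) \<sigma>(1,2) \<sigma>L])
  have nz: "\<exists>\<nu>\<in>NN. C2 \<nu> ~= 0"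
  proof -
   obtain \<nu> where \<nu>: "\<nu> : NN" "C \<nu> ~= 0" using C(2) by blast
   have "cj ?\<tau> \<nu> : NN" by (rule cj_NN[OF \<tau> _ _ _ \<nu>(1)])
     (simp_all add: \<tau>c \<tau>s \<tau>z const_in_Lf, (intro subfld_D(5)[OF subfield_Lf] subfld_D(6)[OF subfield_Lf] s_in_Lf z_in_Lf const_in_Lf)+)
   moreover have "cj \<sigma> (cj ?\<tau> \<nu>) = \<nu>" unfolding cj_cj[OF \<tau> \<sigma>(1)] aut_o_inv[OF \<sigma>(1)] by (simp add: cj_def)
   ultimately show ?thesis using \<nu>(2) unfolding C2_def by (intro bexI[of _ "cj ?\<tau> \<nu>"]) simp_all
  qed
  \<comment> \<open>This conjugate of \<gamma> sends z to z + s instead of z + s + 1, so its inverse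
    is a rotation.\<close>
  define \<delta> where "\<delta> = ?\<tau> o \<gamma> o \<sigma>"
  have \<delta>F: "\<delta> : field_auts" unfolding \<delta>_def by (intro aut_comp \<tau> F(1) \<sigma>(1))
  have \<gamma>s: "\<gamma> s = s + 1" "\<gamma> z = z + s + 1" using \<gamma> by (simp_all add: is_rot_def)
  have \<delta>s: "\<delta> s = s + 1" by (simp add: \<delta>_def \<sigma>(3) aut_add[OF F(1)] F(2) \<gamma>s aut_inv_eq_iff[OF \<sigma>(1)] aut[OF \<sigma>(1)])
  have \<delta>z: "\<delta> z = z + s" by (simp add: \<delta>_def \<sigma> aut[OF F(1)] F(2) \<gamma>s aut_inv_eq_iff[OF \<sigma>(1)]
     aut_add[OF \<sigma>(1)] w2 cst_add algebra_simps cw)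
  have \<delta>c: "\<delta> (cst c) = cst c" for c by (simp add: \<delta>_def \<sigma>(2) F(2) \<tau>c)
  let ?\<rho> = "iv \<delta>"
  have \<rho>: "?\<rho> s = s + 1" "?\<rho> z = z + s + 1" "!!c. ?\<rho> (cst c) = cst c" by (simp_all add: aut_inv_eq_iff[OF \<delta>F] aut[OF \<delta>F] \<delta>s \<delta>z \<delta>c cw)
  have "?\<rho> t_ac = t_ac"
  proof -
   have "?\<rho> (ceval p s) = ceval p (s + 1)" for p
    by (induction p) (simp_all add: aut_0[OF aut_inv[OF \<delta>F]] aut_add[OF aut_inv[OF \<delta>F]]
      aut_mult[OF aut_inv[OF \<delta>F]] \<rho>)
   hence "?\<rho> t_ac = ceval (smult (1/a) [:-b, 1, 1:]) (s + 1)" by (metis t_eq)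
   also have "... = cst (1/a) * ceval [:-b, 1, 1:] s" unfolding ceval_smult by (simp add: algebra_simps cw)
   also have "... = t_ac" by (simp only: t_eq ceval_smult)
   finally show ?thesis .
  qed
  hence "?\<rho> (ceval p t_ac) = ceval p t_ac" for p
   by (induction p) (simp_all add: aut_0[OF aut_inv[OF \<delta>F]] aut_add[OF aut_inv[OF \<delta>F]]
      aut_mult[OF aut_inv[OF \<delta>F]] \<rho>)
  hence "?\<rho> : gal_geom" unfolding gal_geom_eq Aut_def range_to_ac
   using aut_inv[OF \<delta>F] by (auto simp: aut_divide[OF aut_inv[OF \<delta>F]])
  hence rot: "is_rot ?\<rho>" using \<rho> by (simp add: is_rot_def)
  have "C2 (cj \<gamma> \<nu>) = \<iota> * C2 \<nu>" if \<nu>: "\<nu> : NN" for \<nu>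
  proof -
   have \<mu>: "cj \<sigma> \<nu> : NN" "cj \<sigma> (cj \<gamma> \<nu>) : NN"
    using \<nu> \<sigma>L cj_rot_NN[OF \<gamma>] by (auto intro!: cj_NN[OF \<sigma>(1)] simp: \<sigma>(2) const_in_Lf)
   have "\<gamma> o \<sigma> = \<sigma> o \<delta>" by (simp add: \<delta>_def fun_eq_iff aut_f_inv[OF \<sigma>(1)])
   hence 1: "cj \<sigma> (cj \<gamma> \<nu>) = cj \<delta> (cj \<sigma> \<nu>)" by (simp only: cj_cj F(1) \<sigma>(1) \<delta>F)
   have "cj ?\<rho> (cj \<delta> (cj \<sigma> \<nu>)) = cj \<sigma> \<nu>"
    unfolding cj_cj[OF \<delta>F aut_inv[OF \<delta>F]] aut_o_inv[OF \<delta>F] by (simp add: cj_def)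
   thus ?thesis using rot_indep[OF C(1) \<gamma> rot \<mu>(2)] neg[OF \<mu>(2)] 1 \<iota>\<iota> by (simp add: C2_def)
  qed
  hence "C2 (cj \<gamma>' \<nu>) = \<iota> * C2 \<nu>" if "is_rot \<gamma>'" "\<nu> : NN" for \<gamma>' \<nu> using rot_indep[OF C2 \<gamma> that] that(2) by simp
  thus ?thesis using C2 nz by blast
 qed
qed

end

section \<open>The cohomology\<close>

context ell_ladic
begin

text \<open>The conjugates of (s, z) over 'f(t), which form one orbit under the rotation.\<close>

definition quarter :: "('f acf \<times> 'f acf) set" where
 "quarter = {(s, z), (s, z + 1), (s + 1, z + s + 1), (s + 1, z + s)}"

lemma quarterI:
 assumes "x\<^sup>2 + x = s\<^sup>2 + s" "y\<^sup>2 + y = x ^ 3 + x\<^sup>2"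
 shows "(x, y) : quarter"
proof -
 have add_eq: "u = w" if "u + w = 0" for u w :: "'f acf" using that by (metis add_right_cancel cw(1))
 have "(x + s) * (x + (s + 1)) = (x\<^sup>2 + x) + (s\<^sup>2 + s)" by (simp add: sq_simps cw)
 also have "... = 0" by (simp add: assms(1) cw)
 finally have "x = s \<or> x = s + 1" using add_eq by auto
 thus ?thesis
 proof
  assume x: "x = s"
  have "(y + z) * (y + (z + 1)) = (y\<^sup>2 + y) + (z\<^sup>2 + z)" by (simp add: sq_simps cw)
  also have "... = 0" by (simp add: assms(2) z_eq x cw)
  finally have "y = z \<or> y = z + 1" using add_eq by auto
  thus ?thesis by (auto simp: quarter_def x)
 next
  assume x: "x = s + 1"
  have 1: "(s + 1) ^ 3 + (s + 1)\<^sup>2 = (s ^ 3 + s\<^sup>2) + (s\<^sup>2 + s)"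
   by (simp add: sqr power3_eq_cube algebra_simps cw)
  have "(y + (z + s)) * (y + (z + s + 1)) = (y\<^sup>2 + y) + (z\<^sup>2 + z) + (s\<^sup>2 + s)" by (simp add: sq_simps cw)
  also have "... = 0" unfolding assms(2) x z_eq 1 by (simp add: cw add_ac)
  finally have "y = z + s \<or> y = z + s + 1" using add_eq by auto
  thus ?thesis by (auto simp: quarter_def x)
 qed
qed

end

text \<open>\<open>\<rho>0\<close> expresses the character through the images of s and z. In this
  form it applies to the geometric Galois group and, up to the constant twist \<kappa>, also to the
  Frobenius lift \<Phi>, which moves the constants.\<close>

locale ell_sheaf = ell_ladic s z a b V l v
 for s z :: "'f::alg_closed_field acf" and a b :: 'f and V :: "'f acf set"
  and l :: nat and v :: "'k::{field_char_0, alg_closed_field} => real" +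
 fixes \<rho> :: "('f acf => 'f acf) => 'k" and \<Phi> :: "'f acf => 'f acf" and i \<kappa> :: 'k and M :: nat
  and \<rho>0 :: "'f acf => 'f acf => 'k"
 assumes i: "i\<^sup>2 = -1"
  and \<rho>0: "\<rho>0 s z = 1" "\<rho>0 s (z + 1) = - 1" "\<rho>0 (s + 1) (z + s + 1) = i" "\<rho>0 (s + 1) (z + s) = - i"
  and \<rho>: "!!\<sigma>. \<sigma> : gal_geom ==> \<rho> \<sigma> = \<rho>0 (\<sigma> s) (\<sigma> z)"
  and \<Phi>: "\<Phi> : field_auts" "\<Phi> t_ac = t_ac" "!!u. \<Phi> (cst (u ^ (2 ^ M))) = cst u" "\<Phi> ` V = V"
   "\<Phi> (cst a) = cst a" "\<Phi> (cst b) = cst b" and \<rho>\<Phi>: "\<rho> \<Phi> = \<kappa> * \<rho>0 (\<Phi> s) (\<Phi> z)"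
begin

lemma ii: "i * i = - 1" "i * (i * y) = - y" using i by (simp_all add: sqr mult.assoc[symmetric])

lemma gal_geom_id: "id : gal_geom" and gal_geom_comp: "\<sigma> : gal_geom ==> \<tau> : gal_geom ==> \<sigma> o \<tau> : gal_geom"
 and gal_geom_inv: "\<sigma> : gal_geom ==> iv \<sigma> : gal_geom"
 unfolding gal_geom_eq by (rule Aut_id Aut_comp Aut_inv; assumption)+

lemma gal_geom_t: "\<sigma> : gal_geom ==> \<sigma> t_ac = t_ac" by (simp add: gal_geom_def t_ac_def)

lemma gal_geomI:
 assumes "\<sigma> : field_auts" "\<sigma> t_ac = t_ac" "!!c. \<sigma> (cst c) = cst c"
 shows "\<sigma> : gal_geom"
proof -
 have "\<sigma> (ceval p t_ac) = ceval p t_ac" for p by (induction p) (simp_all add: assms aut[OF assms(1)])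
 thus ?thesis unfolding gal_geom_eq Aut_def range_to_ac using assms(1) by (auto simp: aut_divide[OF assms(1)])
qed

lemma quarter_aut:
 assumes \<sigma>: "\<sigma> : field_auts" "\<sigma> t_ac = t_ac" "\<sigma> (cst a) = cst a" "\<sigma> (cst b) = cst b"
 shows "(\<sigma> s, \<sigma> z) : quarter"
proof (rule quarterI)
 have "\<sigma> (s\<^sup>2 + s) = s\<^sup>2 + s" by (simp only: s_eq aut[OF \<sigma>(1)] \<sigma>)
 thus "(\<sigma> s)\<^sup>2 + \<sigma> s = s\<^sup>2 + s" by (simp only: aut[OF \<sigma>(1)])
 have "\<sigma> (z\<^sup>2 + z) = \<sigma> (s ^ 3 + s\<^sup>2)" by (simp only: z_eq)
 thus "(\<sigma> z)\<^sup>2 + \<sigma> z = \<sigma> s ^ 3 + (\<sigma> s)\<^sup>2" by (simp only: aut[OF \<sigma>(1)])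
qed

lemma quarter_gal_geom: "\<sigma> : gal_geom ==> (\<sigma> s, \<sigma> z) : quarter"
 by (rule quarter_aut) (simp_all add: gal_aut gal_geom_t gal_geom_const)

lemma quarter_rot:
 assumes "is_rot \<gamma>" "(x, y) : quarter"
 shows "(\<gamma> x, \<gamma> y) : quarter" "\<rho>0 (\<gamma> x) (\<gamma> y) = i * \<rho>0 x y"
proof -
 have G: "\<gamma> s = s + 1" "\<gamma> z = z + s + 1" "\<gamma> : field_auts" using assms(1) by (simp_all add: is_rot_def gal_aut)
 have 1: "s + 1 + 1 = s" "z + s + 1 + (s + 1) + 1 = z + 1" "z + s + 1 + (s + 1) = z" "z + s + 1 + 1 = z + s" by (simp_all add: cw)
 note f = aut[OF G(3)] G(1,2) 1
 show "(\<gamma> x, \<gamma> y) : quarter" using assms(2) unfolding quarter_def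
  by (elim insertE emptyE) (simp_all only: prod.inject f, simp_all)
 show "\<rho>0 (\<gamma> x) (\<gamma> y) = i * \<rho>0 x y" using assms(2) unfolding quarter_def
  by (elim insertE emptyE) (simp_all only: prod.inject f \<rho>0, simp_all add: ii)
qed

lemma rot_pow:
 assumes \<gamma>: "is_rot \<gamma>"
 shows "(\<gamma> ^^ j) : gal_geom" "\<rho>0 ((\<gamma> ^^ j) s) ((\<gamma> ^^ j) z) = i ^ j"
proof -
 have g: "\<gamma> : gal_geom" using \<gamma> by (simp add: is_rot_def)
 show G: "(\<gamma> ^^ j) : gal_geom" for j by (induction j) (simp_all only: funpow.simps gal_geom_id gal_geom_comp[OF g])
 show "\<rho>0 ((\<gamma> ^^ j) s) ((\<gamma> ^^ j) z) = i ^ j"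
  by (induction j) (simp_all add: \<rho>0 quarter_rot(2)[OF \<gamma> quarter_gal_geom[OF G]])
qed

lemma quarter_pow:
 assumes \<gamma>: "is_rot \<gamma>" and q: "(x, y) : quarter"
 shows "\<exists>j. x = (\<gamma> ^^ j) s & y = (\<gamma> ^^ j) z"
proof -
 have G: "\<gamma> s = s + 1" "\<gamma> z = z + s + 1" "\<gamma> : field_auts" using \<gamma> by (simp_all add: is_rot_def gal_aut)
 have 1: "s + 1 + 1 = s" "z + s + 1 + (s + 1) + 1 = z + 1" "z + s + 1 + 1 = z + s" by (simp_all add: cw)
 note f = aut[OF G(3)] G(1,2) 1
 have p: "\<gamma> (\<gamma> s) = s" "\<gamma> (\<gamma> z) = z + 1" "\<gamma> (\<gamma> (\<gamma> s)) = s + 1" "\<gamma> (\<gamma> (\<gamma> z)) = z + s" by (simp_all only: f)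
 show ?thesis using q unfolding quarter_def
 proof (elim insertE emptyE)
  show ?thesis if "(x, y) = (s, z)" using that by (intro exI[of _ 0]) simp
  show ?thesis if "(x, y) = (s, z + 1)" using that p by (intro exI[of _ 2]) (simp add: numeral_2_eq_2)
  show ?thesis if "(x, y) = (s + 1, z + s + 1)" using that G by (intro exI[of _ 1]) simp
  show ?thesis if "(x, y) = (s + 1, z + s)" using that p by (intro exI[of _ 3]) (simp add: numeral_3_eq_3)
 qed
qed

lemma gal_geom_rot_pow:
 assumes \<gamma>: "is_rot \<gamma>" and \<sigma>: "\<sigma> : field_auts" "\<sigma> : gal_geom"
 shows "\<exists>j. iv (\<gamma> ^^ j) o \<sigma> : NN & \<rho> \<sigma> = i ^ j"
proof -
 obtain j where j: "\<sigma> s = (\<gamma> ^^ j) s" "\<sigma> z = (\<gamma> ^^ j) z" using quarter_pow[OF \<gamma> quarter_gal_geom[OF \<sigma>(2)]] by blast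
 note F = gal_aut[OF rot_pow(1)[OF \<gamma>, of j]]
 have "iv (\<gamma> ^^ j) o \<sigma> : NN"
  unfolding NN_gal_iff using gal_geom_comp[OF gal_geom_inv[OF rot_pow(1)[OF \<gamma>, of j]] \<sigma>(2)] j
  by (simp add: aut_inv_eq_iff[OF F])
 thus ?thesis using rot_pow(2)[OF \<gamma>, of j] \<rho>[OF \<sigma>(2)] j by auto
qed

lemma NN_gal: "\<nu> : NN ==> \<nu> : gal_geom" by (simp add: NN_gal_iff)

lemma \<rho>_NN: "\<nu> : NN ==> \<rho> \<nu> = 1" by (simp add: \<rho> NN_gal_iff \<rho>0)

lemma cj_gal_geom: "\<delta> : gal_geom ==> \<sigma> : gal_geom ==> cj \<delta> \<sigma> : gal_geom"
 unfolding cj_def by (intro gal_geom_comp gal_geom_inv)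

lemma cj_gal_NN: "\<delta> : gal_geom ==> \<nu> : NN ==> cj \<delta> \<nu> : NN"
proof (rule cj_NN)
 assume d: "\<delta> : gal_geom"
 show "\<delta> : field_auts" by (rule gal_aut[OF d])
 show "\<delta> (cst c) : Lf" for c by (simp add: gal_geom_const[OF d] const_in_Lf)
 show "\<delta> s : Lf" "\<delta> z : Lf" using quarter_gal_geom[OF d] s_in_Lf z_in_Lf subfld_D(1,5)[OF subfield_Lf] by (auto simp: quarter_def)
qed

lemma split_rot:
 assumes \<gamma>: "is_rot \<gamma>" and \<sigma>: "\<sigma> : gal_geom" obtains j \<nu> where "\<nu> : NN" "\<sigma> = (\<gamma> ^^ j) o \<nu>" "\<rho> \<sigma> = i ^ j"
proof -
 obtain j where j: "iv (\<gamma> ^^ j) o \<sigma> : NN" "\<rho> \<sigma> = i ^ j" using gal_geom_rot_pow[OF \<gamma> gal_aut[OF \<sigma>] \<sigma>] by blast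
 note F = gal_aut[OF rot_pow(1)[OF \<gamma>, of j]]
 show ?thesis using that j by (force simp: fun_eq_iff aut_f_inv[OF F])
qed

lemma \<rho>_rot_pow_NN: "is_rot \<gamma> ==> \<nu> : NN ==> \<rho> ((\<gamma> ^^ j) o \<nu>) = i ^ j"
 using rot_pow[of \<gamma> j] \<rho>[OF gal_geom_comp[OF rot_pow(1)[of \<gamma> j] NN_gal[of \<nu>]]] by (simp add: NN_gal_iff)

text \<open>Both factors are a power of one rotation times an element of \<open>NN\<close>; moving
  the rotation past \<open>NN\<close> only conjugates inside \<open>NN\<close>, where \<rho> is
  1.\<close>

lemma \<rho>_mult:
 assumes \<sigma>: "\<sigma> : gal_geom" and \<tau>: "\<tau> : gal_geom"
 shows "\<rho> (\<sigma> o \<tau>) = \<rho> \<sigma> * \<rho> \<tau>"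
proof -
 obtain \<gamma> where \<gamma>: "is_rot \<gamma>" using is_rotE by blast
 obtain j \<nu> where j: "\<nu> : NN" "\<sigma> = (\<gamma> ^^ j) o \<nu>" "\<rho> \<sigma> = i ^ j" by (rule split_rot[OF \<gamma> \<sigma>])
 obtain k \<mu> where k: "\<mu> : NN" "\<tau> = (\<gamma> ^^ k) o \<mu>" "\<rho> \<tau> = i ^ k" by (rule split_rot[OF \<gamma> \<tau>])
 note G = rot_pow(1)[OF \<gamma>, of k]
 have N: "cj (\<gamma> ^^ k) \<nu> o \<mu> : NN" by (intro NN_comp cj_gal_NN G j k)
 have "\<sigma> o \<tau> = (\<gamma> ^^ (j + k)) o (cj (\<gamma> ^^ k) \<nu> o \<mu>)"
  by (simp add: j(2) k(2) fun_eq_iff funpow_add cj_apply[OF gal_aut[OF G]])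
 thus ?thesis using \<rho>_rot_pow_NN[OF \<gamma> N] by (simp add: j(3) k(3) power_add)
qed

lemma \<rho>_pow4: "\<sigma> : gal_geom ==> \<rho> \<sigma> ^ 4 = 1"
proof -
 assume \<sigma>: "\<sigma> : gal_geom"
 obtain \<gamma> where \<gamma>: "is_rot \<gamma>" using is_rotE by blast
 obtain j \<nu> where j: "\<nu> : NN" "\<sigma> = (\<gamma> ^^ j) o \<nu>" "\<rho> \<sigma> = i ^ j" by (rule split_rot[OF \<gamma> \<sigma>])
 have "i ^ 4 = 1" by (simp add: power4_eq_xxxx ii)
 thus ?thesis unfolding j(3) by (metis mult.commute power_mult power_one)
qed

lemma \<rho>_nz: "\<sigma> : gal_geom ==> \<rho> \<sigma> ~= 0" using \<rho>_pow4[of \<sigma>] by auto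

lemma v_\<rho>: "\<sigma> : gal_geom ==> v (\<rho> \<sigma>) = 1"
 using \<rho>_pow4[of \<sigma>] v_power[of "\<rho> \<sigma>" 4] v_nonneg[of "\<rho> \<sigma>"] power_eq_imp_eq_base[of "v (\<rho> \<sigma>)" 4 1]
 by (simp add: v_1)

lemma \<rho>_cj: "\<delta> : gal_geom ==> \<sigma> : gal_geom ==> \<rho> (cj \<delta> \<sigma>) = \<rho> \<sigma>"
proof -
 assume d: "\<delta> : gal_geom" and s: "\<sigma> : gal_geom"
 have "\<delta> o cj \<delta> \<sigma> = \<sigma> o \<delta>" by (simp add: fun_eq_iff cj_apply[OF gal_aut[OF d]])
 hence "\<rho> \<delta> * \<rho> (cj \<delta> \<sigma>) = \<rho> \<sigma> * \<rho> \<delta>" using \<rho>_mult d s cj_gal_geom[OF d s] by metis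
 thus ?thesis using \<rho>_nz[OF d] by simp
qed

lemma gi_eq: "of_int (fst (gi m)) + of_int (snd (gi m)) * j = (- 1 - j) ^ m" if "j * j = (- 1 :: 'k)"
proof (induction m)
 case (Suc m)
 have "(- 1 - j) ^ Suc m = (- 1 - j) * (of_int (fst (gi m)) + of_int (snd (gi m)) * j)" using Suc by simp
 also have "... = - of_int (fst (gi m)) - of_int (snd (gi m)) * (j * j) - (of_int (fst (gi m)) + of_int (snd (gi m))) * j"
  by (simp add: algebra_simps)
 finally show ?case unfolding that by (simp add: algebra_simps)
qed simp

text \<open>For the eigenvalue -i of the rotation the relation of \<open>unr_hom_frob\<close> has
  the scalar (-1 + i)^m; the factor 2^m on its other side is removed by (-1 - i) (-1 + i) =
  2.\<close>

lemma frob_scalar: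
 assumes C: "unr_hom C" and rot: "!!\<gamma> \<nu>. is_rot \<gamma> ==> \<nu> : NN ==> C (cj \<gamma> \<nu>) = - i * C \<nu>"
  and \<psi>: "is_frob m \<psi>" and \<nu>: "\<nu> : NN"
 shows "(- 1 - i) ^ m * C (cj \<psi> \<nu>) = C \<nu>"
proof -
 obtain \<gamma> where \<gamma>: "is_rot \<gamma>" using is_rotE by blast
 have "2 ^ m * C (cj \<psi> \<nu>) = (of_int (fst (gi m)) + of_int (snd (gi m)) * (- i)) * C \<nu>"
  using unr_hom_frob[OF C \<gamma> \<psi> \<nu>] by (simp add: rot[OF \<gamma> \<nu>] algebra_simps)
 also have "... = (- 1 - (- i)) ^ m * C \<nu>" by (subst gi_eq) (simp_all add: ii)
 finally have "(- 1 - i) ^ m * (2 ^ m * C (cj \<psi> \<nu>)) = (- 1 - i) ^ m * ((- 1 - (- i)) ^ m * C \<nu>)" by (simp only:)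
 also have "... = ((- 1 - i) * (- 1 - (- i))) ^ m * C \<nu>" by (simp add: power_mult_distrib)
 also have "(- 1 - i) * (- 1 - (- i)) = 2" by (simp add: algebra_simps ii)
 finally show ?thesis by simp
qed

text \<open>\<Phi> moves (s, z) like a power of the rotation. Removing it leaves the inverse of an
  automorphism that fixes s and z and raises constants to the power 2^M.\<close>

lemma \<Phi>_split: "\<exists>\<gamma>' \<psi>. \<gamma>' : gal_geom & is_frob M \<psi> & \<Phi> = \<gamma>' o iv \<psi> & \<rho> \<Phi> = \<kappa> * \<rho> \<gamma>'"
proof -
 obtain \<gamma> where \<gamma>: "is_rot \<gamma>" using is_rotE by blast
 obtain j where j: "\<Phi> s = (\<gamma> ^^ j) s" "\<Phi> z = (\<gamma> ^^ j) z"
  using quarter_pow[OF \<gamma> quarter_aut[OF \<Phi>(1,2,5,6)]] by blast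
 define \<gamma>' where "\<gamma>' = \<gamma> ^^ j"
 have G: "\<gamma>' : gal_geom" unfolding \<gamma>'_def by (rule rot_pow(1)[OF \<gamma>])
 note F = gal_aut[OF G]
 define \<psi> where "\<psi> = iv \<Phi> o \<gamma>'"
 have \<psi>F: "\<psi> : field_auts" unfolding \<psi>_def by (intro aut_comp aut_inv \<Phi>(1) F)
 have "is_frob M \<psi>" unfolding is_frob_def
  using \<psi>F j by (simp add: \<psi>_def aut_inv_eq_iff[OF \<Phi>(1)] gal_geom_const[OF rot_pow(1)[OF \<gamma>]] \<Phi>(3) \<gamma>'_def)
 moreover have "\<Phi> = \<gamma>' o iv \<psi>"
 proof -
  have "\<gamma>' = \<Phi> o \<psi>" by (simp add: \<psi>_def fun_eq_iff aut_f_inv[OF \<Phi>(1)])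
  thus ?thesis by (simp add: fun_eq_iff aut_f_inv[OF \<psi>F])
 qed
 moreover have "\<rho> \<Phi> = \<kappa> * \<rho> \<gamma>'" by (simp add: \<rho>\<Phi> \<rho>[OF rot_pow(1)[OF \<gamma>]] j \<gamma>'_def)
 ultimately show ?thesis using G by blast
qed

lemma cj_\<Phi>_gal: "\<sigma> : gal_geom ==> cj \<Phi> \<sigma> : gal_geom & \<rho> (cj \<Phi> \<sigma>) = \<rho> \<sigma>"
proof -
 assume \<sigma>: "\<sigma> : gal_geom"
 obtain \<gamma>' \<psi> where *: "\<gamma>' : gal_geom" "is_frob M \<psi>" "\<Phi> = \<gamma>' o iv \<psi>" using \<Phi>_split by blast
 have \<psi>: "\<psi> : field_auts" "\<psi> s = s" "\<psi> z = z" using *(2) by (simp_all add: is_frob_def)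
 define \<tau> where "\<tau> = cj \<gamma>' \<sigma>"
 have \<tau>: "\<tau> : gal_geom" unfolding \<tau>_def by (rule cj_gal_geom[OF *(1) \<sigma>])
 have eq: "cj \<Phi> \<sigma> = cj (iv \<psi>) \<tau>"
  unfolding \<tau>_def *(3) by (rule cj_cj[symmetric, OF gal_aut[OF *(1)] aut_inv[OF \<psi>(1)]])
 have G: "cj \<Phi> \<sigma> : gal_geom"
 proof (rule gal_geomI)
  show "cj \<Phi> \<sigma> : field_auts" by (rule cj_aut[OF \<Phi>(1) gal_aut[OF \<sigma>]])
  show "cj \<Phi> \<sigma> t_ac = t_ac" by (simp add: cj_eq[OF \<Phi>(1)] \<Phi>(2) gal_geom_t[OF \<sigma>])
  fix c :: 'f
  obtain u where u: "c = u ^ (2 ^ M)" using root_exists[of "2 ^ M" c] by auto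
  show "cj \<Phi> \<sigma> (cst c) = cst c" unfolding u by (simp add: cj_eq[OF \<Phi>(1)] \<Phi>(3) gal_geom_const[OF \<sigma>])
 qed
 have \<psi>q: "\<psi> x = x & \<psi> y = y" if "(x, y) : quarter" for x y
  using that by (auto simp: quarter_def \<psi> aut[OF \<psi>(1)])
 have "cj (iv \<psi>) \<tau> s = \<tau> s" "cj (iv \<psi>) \<tau> z = \<tau> z" using \<psi>q[OF quarter_gal_geom[OF \<tau>]] \<psi>
  by (simp_all add: cj_def inv_into_inv_into[OF \<psi>(1)] aut_inv_eq_iff[OF \<psi>(1)]) (metis \<psi> aut_inv_f)+
 thus ?thesis using \<rho>[OF G] \<rho>[OF \<tau>] eq G \<rho>_cj[OF *(1) \<sigma>] by (simp add: \<tau>_def)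
qed

lemma \<Phi>_scalar:
 assumes C: "unr_hom C" and gal: "!!\<delta> \<nu>. \<delta> : gal_geom ==> \<nu> : NN ==> \<rho> \<delta> * C (cj \<delta> \<nu>) = C \<nu>" and \<nu>: "\<nu> : NN"
 shows "cj \<Phi> \<nu> : NN" "\<rho> \<Phi> * C (cj \<Phi> \<nu>) = \<kappa> * (- 1 - i) ^ M * C \<nu>"
proof -
 obtain \<gamma>' \<psi> where *: "\<gamma>' : gal_geom" "is_frob M \<psi>" "\<Phi> = \<gamma>' o iv \<psi>" "\<rho> \<Phi> = \<kappa> * \<rho> \<gamma>'" using \<Phi>_split by blast
 have \<psi>: "\<psi> : field_auts" "\<psi> s = s" "\<psi> z = z" "!!c. \<psi> (cst c) = cst (c ^ 2 ^ M)"
  using *(2) by (simp_all add: is_frob_def)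
 have \<mu>: "cj \<gamma>' \<nu> : NN" by (rule cj_gal_NN[OF *(1) \<nu>])
 have eq: "cj \<Phi> \<nu> = cj (iv \<psi>) (cj \<gamma>' \<nu>)"
  unfolding *(3) by (rule cj_cj[symmetric, OF gal_aut[OF *(1)] aut_inv[OF \<psi>(1)]])
 have "cj (iv \<psi>) (cj \<gamma>' \<nu>) : NN"
 proof (rule cj_NN[OF aut_inv[OF \<psi>(1)] _ _ _ \<mu>])
  show "iv \<psi> (cst c) : Lf" for c
  proof -
   obtain u where u: "c = u ^ (2 ^ M)" using root_exists[of "2 ^ M" c] by auto
   have "iv \<psi> (cst c) = cst u" by (simp add: aut_inv_eq_iff[OF \<psi>(1)] \<psi>(4) u)
   thus ?thesis by (simp add: const_in_Lf)
  qed
  have "iv \<psi> s = s" "iv \<psi> z = z" by (simp_all add: aut_inv_eq_iff[OF \<psi>(1)] \<psi>)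
  thus "iv \<psi> s : Lf" "iv \<psi> z : Lf" by (simp_all add: s_in_Lf z_in_Lf)
 qed
 thus N: "cj \<Phi> \<nu> : NN" unfolding eq .
 have rot: "C (cj \<gamma> \<nu>) = - i * C \<nu>" if "is_rot \<gamma>" "\<nu> : NN" for \<gamma> \<nu>
 proof -
  have "i * C (cj \<gamma> \<nu>) = C \<nu>" using that(1) \<rho>0(3) gal[of \<gamma> \<nu>] that(2) by (simp add: is_rot_def \<rho>)
  thus ?thesis using ii(2)[of "C (cj \<gamma> \<nu>)"] by simp
 qed
 have "cj \<psi> (cj \<Phi> \<nu>) = cj \<gamma>' \<nu>"
  unfolding eq cj_cj[OF aut_inv[OF \<psi>(1)] \<psi>(1)] aut_o_inv[OF \<psi>(1)] by (simp add: cj_def)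
 hence "\<rho> \<Phi> * C (cj \<Phi> \<nu>) = \<kappa> * (- 1 - i) ^ M * (\<rho> \<gamma>' * C (cj \<gamma>' \<nu>))" using frob_scalar[OF C rot *(2) N] by (simp add: *(4) mult_ac)
 thus "\<rho> \<Phi> * C (cj \<Phi> \<nu>) = \<kappa> * (- 1 - i) ^ M * C \<nu>" by (simp only: gal[OF *(1) \<nu>])
qed

text \<open>The covering is totally ramified at infinity: there is a rotation preserving
  \<open>V\<close>, and its powers represent all classes modulo \<open>NN\<close>.\<close>

lemma decomp_lift:
 assumes "\<sigma> : gal_geom" obtains \<delta> where "\<delta> : decomp_group V" "iv \<delta> o \<sigma> : NN" "\<sigma> = \<delta> o (iv \<delta> o \<sigma>)"
proof -
 obtain \<gamma> where \<gamma>: "is_rot \<gamma>" "\<gamma> ` V = V" using rotation_at[OF V_place V_inf] by blast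
 obtain j where j: "iv (\<gamma> ^^ j) o \<sigma> : NN" using gal_geom_rot_pow[OF \<gamma>(1) gal_aut[OF assms] assms] by blast
 note G = rot_pow(1)[OF \<gamma>(1), of j]
 have "(\<gamma> ^^ j) ` V = V"
 proof (induction j)
  case (Suc j)
  thus ?case by (simp only: funpow.simps image_comp[symmetric] \<gamma>(2))
 qed simp
 hence "(\<gamma> ^^ j) : decomp_group V" using G by (simp add: decomp_group_def)
 moreover have "\<sigma> = (\<gamma> ^^ j) o (iv (\<gamma> ^^ j) o \<sigma>)" by (simp add: fun_eq_iff aut_f_inv[OF gal_aut[OF G]])
 ultimately show ?thesis using that j by blast
qed

lemma decomp_gal: "\<delta> : decomp_group U ==> \<delta> : gal_geom" and decomp_image: "\<delta> : decomp_group U ==> \<delta> ` U = U"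
 by (simp_all add: decomp_group_def)

lemma decomp_comp: "\<delta> : decomp_group U ==> \<delta>' : decomp_group U ==> \<delta> o \<delta>' : decomp_group U"
 unfolding decomp_group_def by (simp only: mem_Collect_eq gal_geom_comp image_comp[symmetric] simp_thms)

lemma decomp_inv: "\<delta> : decomp_group U ==> iv \<delta> : decomp_group U"
proof -
 assume d: "\<delta> : decomp_group U"
 have "iv \<delta> ` (\<delta> ` U) = U" by (simp add: image_image aut_inv_f[OF gal_aut[OF decomp_gal[OF d]]])
 hence "iv \<delta> ` U = U" by (simp only: decomp_image[OF d])
 thus ?thesis using gal_geom_inv[OF decomp_gal[OF d]] by (simp add: decomp_group_def)
qed

text \<open>The covering is unramified over the affine line: \<tau> s - s is 0 or 1 and lies in the
  ideal, hence is 0, and then the same argument applies to z.\<close>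

lemma inertia_NN:
 assumes W: "is_place W" "t_ac : W" and \<tau>: "\<tau> : inertia_group W"
 shows "\<tau> : NN" "\<tau> ` W = W"
proof -
 have \<tau>': "\<tau> : gal_geom" "\<tau> ` W = W" "!!x. x : W ==> \<tau> x - x : mi W"
  using \<tau> by (simp_all add: inertia_group_def decomp_group_def)
 have sW: "s : W" "z : W" using s_mem_place_iff[OF W(1)] W(2) z_mem_place[OF W(1)] by auto
 have no: "1 \<notin> mi W" by (rule one_not_in_mi[OF W(1)])
 have s: "\<tau> s = s" using \<tau>'(3)[OF sW(1)] no quarter_gal_geom[OF \<tau>'(1)] by (auto simp: quarter_def)
 have "s ~= s + 1" by simp
 hence "\<tau> z = z" using quarter_gal_geom[OF \<tau>'(1)] \<tau>'(3)[OF sW(2)] no unfolding s quarter_def by auto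
 thus "\<tau> : NN" "\<tau> ` W = W" using \<tau>' s by (simp_all add: NN_gal_iff)
qed

lemma decomp_inertia:
 fixes W :: "'f acf set"
 shows "is_place W ==> \<sigma> : decomp_group W ==> \<sigma> : inertia_group W"
 using decomposition_residue[of W \<sigma>] by (simp add: inertia_group_def decomp_group_def)

lemma good_gal:
 assumes C: "good C" and rot: "!!\<gamma> \<nu>. is_rot \<gamma> ==> \<nu> : NN ==> C (cj \<gamma> \<nu>) = - i * C \<nu>"
  and \<delta>: "\<delta> : gal_geom" and \<nu>: "\<nu> : NN"
 shows "\<rho> \<delta> * C (cj \<delta> \<nu>) = C \<nu>"
proof -
 obtain \<gamma> where \<gamma>: "is_rot \<gamma>" using is_rotE by blast
 have gF: "\<gamma> : field_auts" using \<gamma> by (simp add: is_rot_def gal_aut)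
 obtain j \<mu> where j: "\<mu> : NN" "\<delta> = (\<gamma> ^^ j) o \<mu>" "\<rho> \<delta> = i ^ j" by (rule split_rot[OF \<gamma> \<delta>])
 have pF: "(\<gamma> ^^ j) : field_auts" for j by (rule gal_aut[OF rot_pow(1)[OF \<gamma>]])
 have pow: "i ^ j * C (cj (\<gamma> ^^ j) \<nu>) = C \<nu>" if "\<nu> : NN" for j \<nu> using that
 proof (induction j arbitrary: \<nu>)
  case 0
  thus ?case by (simp add: cj_def)
 next
  case (Suc j)
  have "cj (\<gamma> ^^ Suc j) \<nu> = cj (\<gamma> ^^ j) (cj \<gamma> \<nu>)" unfolding funpow.simps by (rule cj_cj[symmetric, OF gF pF])
  hence "i ^ Suc j * C (cj (\<gamma> ^^ Suc j) \<nu>) = i * C (cj \<gamma> \<nu>)"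
   using Suc.IH[OF cj_rot_NN[OF \<gamma> Suc.prems]] by (simp add: mult.assoc)
  moreover have "i * C (cj \<gamma> \<nu>) = C \<nu>" using rot[OF \<gamma> Suc.prems] ii(2)[of "C \<nu>"] by simp
  ultimately show ?case by (simp only:)
 qed
 have "cj \<delta> \<nu> = cj \<mu> (cj (\<gamma> ^^ j) \<nu>)" unfolding j(2) by (rule cj_cj[symmetric, OF pF NN_aut[OF j(1)]])
 hence "C (cj \<delta> \<nu>) = C (cj (\<gamma> ^^ j) \<nu>)" using good_cj_NN[OF C j(1) cj_gal_NN[OF rot_pow(1)[OF \<gamma>] \<nu>]] by simp
 thus ?thesis using pow[OF \<nu>] j(3) by simp
qed

text \<open>On \<open>NN\<close> the cocycle is an unramified homomorphism on which the Galois group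
  acts through \<rho>, and coboundaries vanish there, so the scalar is the one of
  \<open>\<Phi>_scalar\<close>. If the restriction were zero, the cocycle would be determined by the
  decomposition group at infinity and be the coboundary of \<open>m\<close>.\<close>

lemma eigenvalue_unique:
 assumes ev: "H1c_eigenvalue v \<rho> V \<Phi> \<tau>"
 shows "\<tau> = \<kappa> * (- 1 - i) ^ M"
proof -
 obtain c m where z: "(c, m) : Z1c v \<rho> V" "(c, m) \<notin> B1c \<rho>"
  and b: "((%\<sigma>. fst (frob_act \<rho> \<Phi> (c, m)) \<sigma> - \<tau> * c \<sigma>), snd (frob_act \<rho> \<Phi> (c, m)) - \<tau> * m) : B1c \<rho>"
  using ev unfolding H1c_eigenvalue_def by force
 have coc: "!!\<sigma> \<tau>. \<sigma> : gal_geom ==> \<tau> : gal_geom ==> c (\<sigma> o \<tau>) = c \<sigma> + \<rho> \<sigma> * c \<tau>"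
  and dec: "!!\<sigma>. \<sigma> : decomp_group V ==> c \<sigma> = \<rho> \<sigma> * m - m"
  and cont: "continuous_cochain v c" and pi1: "pi1_cochain c" using z(1) unfolding Z1c_def by auto
 have c_id: "c id = 0" using coc[OF gal_geom_id gal_geom_id] \<rho>_NN[OF NN_id] by simp
 have unr: "unr_hom c" unfolding unr_hom_def
 proof (intro conjI ballI allI impI)
  show "c (\<nu> o \<mu>) = c \<nu> + c \<mu>" if "\<nu> : NN" "\<mu> : NN" for \<nu> \<mu>
   using coc[OF NN_gal[OF that(1)] NN_gal[OF that(2)]] \<rho>_NN[OF that(1)] by simp
  show "\<exists>S. finite S & (\<forall>\<nu>\<in>NN. (\<forall>x\<in>S. \<nu> x = x) --> v (c \<nu>) < \<epsilon>)" if \<epsilon>: "\<epsilon> > 0" for \<epsilon>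
  proof -
   obtain S where S: "finite S" "\<forall>\<tau>\<in>gal_geom. (\<forall>s\<in>S. \<tau> s = id s) --> v (c \<tau> - c id) < \<epsilon>"
    using cont gal_geom_id \<epsilon> unfolding continuous_cochain_def by blast
   thus ?thesis using NN_gal S(1) by (auto simp: c_id)
  qed
  fix W P \<nu> assume \<nu>: "\<nu> : NN" "place_at W P" "\<nu> ` W = W"
  hence W: "is_place W" "t_ac : W" by (simp_all add: place_at_def)
  have "\<nu> : inertia_group W" using \<nu> NN_gal by (intro decomp_inertia W) (simp add: decomp_group_def)
  thus "c \<nu> = 0" using pi1 W gal_geom_id unfolding pi1_cochain_def by (force simp: c_id)
 qed
 have gal: "\<rho> \<delta> * c (cj \<delta> \<nu>) = c \<nu>" if \<delta>: "\<delta> : gal_geom" and \<nu>: "\<nu> : NN" for \<delta> \<nu>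
 proof -
  have "\<delta> o cj \<delta> \<nu> = \<nu> o \<delta>" by (simp add: fun_eq_iff cj_apply[OF gal_aut[OF \<delta>]])
  thus ?thesis using coc[OF \<delta> cj_gal_geom[OF \<delta> NN_gal[OF \<nu>]]] coc[OF NN_gal[OF \<nu>] \<delta>] \<rho>_NN[OF \<nu>] by simp
 qed
 have "\<exists>\<nu>\<in>NN. c \<nu> ~= 0"
 proof (rule ccontr)
  assume no: "~ ?thesis"
  have "c \<sigma> = \<rho> \<sigma> * m - m" if \<sigma>: "\<sigma> : gal_geom" for \<sigma>
  proof -
   obtain \<delta> where \<delta>: "\<delta> : decomp_group V" "iv \<delta> o \<sigma> : NN" "\<sigma> = \<delta> o (iv \<delta> o \<sigma>)" by (rule decomp_lift[OF \<sigma>])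
   have "c \<sigma> = c \<delta>" using coc[OF decomp_gal[OF \<delta>(1)] NN_gal[OF \<delta>(2)]] \<delta>(2,3) no by auto
   moreover have "\<rho> \<sigma> = \<rho> \<delta>" using \<rho>_mult[OF decomp_gal[OF \<delta>(1)] NN_gal[OF \<delta>(2)]] \<delta>(3) \<rho>_NN[OF \<delta>(2)] by simp
   ultimately show ?thesis using dec[OF \<delta>(1)] by simp
  qed
  thus False using z(2) unfolding B1c_def by auto
 qed
 then obtain \<nu> where \<nu>: "\<nu> : NN" "c \<nu> ~= 0" by blast
 have "\<rho> \<Phi> * c (cj \<Phi> \<nu>) = \<tau> * c \<nu>" using b NN_gal[OF \<nu>(1)] \<rho>_NN[OF \<nu>(1)] unfolding B1c_def by (auto simp: frob_act_def cj_def)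
 thus ?thesis using \<Phi>_scalar(2)[OF unr gal \<nu>(1)] \<nu>(2) by simp
qed

text \<open>The eigenvector C on \<open>NN\<close> is extended by c (\<delta> o \<nu>) = \<rho>
  \<delta> * C \<nu> for \<delta> in the decomposition group at infinity, with local component 0.
  This is well defined because C vanishes on the intersection of that group with
  \<open>NN\<close>.\<close>

lemma eigenvalue_exists: "H1c_eigenvalue v \<rho> V \<Phi> (\<kappa> * (- 1 - i) ^ M)"
proof -
 \<comment> \<open>The cocycle relation requires \<rho> \<gamma> * C (cj \<gamma> \<nu>) = C \<nu>,
   and a rotation \<gamma> has \<rho> \<gamma> = i; hence the eigenvalue -i.\<close>
 have "(- i)\<^sup>2 = - 1" using i by simp
 then obtain C where C: "good C" "\<exists>\<nu>\<in>NN. C \<nu> ~= 0" "!!\<gamma> \<nu>. is_rot \<gamma> ==> \<nu> : NN ==> C (cj \<gamma> \<nu>) = - i * C \<nu>"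
  using good_eigen_exists[of "- i"] by blast
 have gal: "\<rho> \<delta> * C (cj \<delta> \<nu>) = C \<nu>" if "\<delta> : gal_geom" "\<nu> : NN" for \<delta> \<nu>
  by (rule good_gal[OF C(1) _ that]) (rule C(3))
 define D where "D \<sigma> = (SOME \<delta>. \<delta> : decomp_group V & iv \<delta> o \<sigma> : NN)" for \<sigma>
 have D: "D \<sigma> : decomp_group V & iv (D \<sigma>) o \<sigma> : NN" if \<sigma>: "\<sigma> : gal_geom" for \<sigma>
 proof -
  obtain \<delta> where "\<delta> : decomp_group V" "iv \<delta> o \<sigma> : NN" by (rule decomp_lift[OF \<sigma>])
  thus ?thesis unfolding D_def by (intro someI_ex[of "%\<delta>. \<delta> : decomp_group V & iv \<delta> o \<sigma> : NN"]) blast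
 qed
 define c where "c \<sigma> = \<rho> \<sigma> * C (iv (D \<sigma>) o \<sigma>)" for \<sigma>
 have c: "c (\<delta> o \<nu>) = \<rho> \<delta> * C \<nu>" if \<delta>: "\<delta> : decomp_group V" and \<nu>: "\<nu> : NN" for \<delta> \<nu>
 proof -
  define \<sigma> where "\<sigma> = \<delta> o \<nu>"
  have \<sigma>: "\<sigma> : gal_geom" unfolding \<sigma>_def by (rule gal_geom_comp[OF decomp_gal[OF \<delta>] NN_gal[OF \<nu>]])
  note F = gal_aut[OF decomp_gal[OF conjunct1[OF D[OF \<sigma>]]]]
  define \<mu> where "\<mu> = iv (D \<sigma>) o \<delta>"
  have \<mu>D: "\<mu> : decomp_group V" unfolding \<mu>_def using D[OF \<sigma>] by (intro decomp_comp decomp_inv \<delta>) blast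
  have eq: "iv (D \<sigma>) o \<sigma> = \<mu> o \<nu>" by (simp add: \<mu>_def \<sigma>_def comp_assoc)
  have "\<mu> = (\<mu> o \<nu>) o iv \<nu>" by (simp add: fun_eq_iff aut_f_inv[OF NN_aut[OF \<nu>]])
  hence \<mu>N: "\<mu> : NN" using NN_comp[OF _ NN_inv[OF \<nu>]] D[OF \<sigma>] eq by metis
  show ?thesis using goodD(1)[OF C(1) \<mu>N \<nu>] goodD(3)[OF C(1) V_place \<mu>N decomp_image[OF \<mu>D]] \<rho>_mult[OF decomp_gal[OF \<delta>] NN_gal[OF \<nu>]] \<rho>_NN[OF \<nu>] unfolding \<sigma>_def[symmetric] by (simp add: c_def eq)
 qed
 have cN: "c \<nu> = C \<nu>" if "\<nu> : NN" for \<nu>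
  using c[of id \<nu>] that gal_geom_id \<rho>_NN[OF NN_id] by (simp add: decomp_group_def)
 have cD: "c \<delta> = 0" if "\<delta> : decomp_group V" for \<delta> using c[OF that NN_id] good_id[OF C(1)] by simp
 have coc: "c (\<sigma> o \<tau>) = c \<sigma> + \<rho> \<sigma> * c \<tau>" if \<sigma>: "\<sigma> : gal_geom" and \<tau>: "\<tau> : gal_geom" for \<sigma> \<tau>
 proof -
  obtain \<delta> where \<delta>: "\<delta> : decomp_group V" "iv \<delta> o \<sigma> : NN" "\<sigma> = \<delta> o (iv \<delta> o \<sigma>)" by (rule decomp_lift[OF \<sigma>])
  obtain \<epsilon> where \<epsilon>: "\<epsilon> : decomp_group V" "iv \<epsilon> o \<tau> : NN" "\<tau> = \<epsilon> o (iv \<epsilon> o \<tau>)" by (rule decomp_lift[OF \<tau>])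
  define \<nu> \<mu> where "\<nu> = iv \<delta> o \<sigma>" and "\<mu> = iv \<epsilon> o \<tau>"
  have eqs: "\<sigma> = \<delta> o \<nu>" "\<tau> = \<epsilon> o \<mu>" and N: "\<nu> : NN" "\<mu> : NN" using \<delta> \<epsilon> by (simp_all add: \<nu>_def \<mu>_def)
  note G = decomp_gal[OF \<delta>(1)] decomp_gal[OF \<epsilon>(1)]
  have N': "cj \<epsilon> \<nu> : NN" by (rule cj_gal_NN[OF G(2) N(1)])
  have "\<sigma> o \<tau> = (\<delta> o \<epsilon>) o (cj \<epsilon> \<nu> o \<mu>)" by (simp add: eqs fun_eq_iff cj_apply[OF gal_aut[OF G(2)]])
  hence "c (\<sigma> o \<tau>) = \<rho> (\<delta> o \<epsilon>) * C (cj \<epsilon> \<nu> o \<mu>)"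
   using c[OF decomp_comp[OF \<delta>(1) \<epsilon>(1)] NN_comp[OF N' N(2)]] by simp
  also have "... = \<rho> \<delta> * (\<rho> \<epsilon> * C (cj \<epsilon> \<nu>)) + \<rho> \<delta> * (\<rho> \<epsilon> * C \<mu>)"
   by (simp add: goodD(1)[OF C(1) N' N(2)] \<rho>_mult[OF G] algebra_simps)
  also have "... = c \<sigma> + \<rho> \<delta> * c \<tau>" using c[OF \<delta>(1) N(1)] c[OF \<epsilon>(1) N(2)] by (simp add: gal[OF G(2) N(1)] eqs)
  also have "\<rho> \<delta> = \<rho> \<sigma>" using \<rho>_mult[OF G(1) NN_gal[OF N(1)]] \<rho>_NN[OF N(1)] eqs by simp
  finally show ?thesis .
 qed
 have cont: "continuous_cochain v c" unfolding continuous_cochain_def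
 proof (intro ballI allI impI)
  fix \<sigma> and \<epsilon> :: real assume \<sigma>: "\<sigma> : (gal_geom :: ('f acf => 'f acf) set)" and \<epsilon>: "\<epsilon> > 0"
  note F = gal_aut[OF \<sigma>]
  obtain S where S: "finite S" "\<forall>\<nu>\<in>NN. (\<forall>x\<in>S. \<nu> x = x) --> v (C \<nu>) < \<epsilon>" using goodD(2)[OF C(1) \<epsilon>] by blast
  have "v (c \<tau> - c \<sigma>) < \<epsilon>" if \<tau>: "\<tau> : gal_geom" and eq: "\<forall>x\<in>insert s (insert z S). \<tau> x = \<sigma> x" for \<tau>
  proof -
   define \<nu> where "\<nu> = iv \<sigma> o \<tau>"
   have \<nu>: "\<nu> : NN" unfolding NN_gal_iff \<nu>_def using gal_geom_comp[OF gal_geom_inv[OF \<sigma>] \<tau>] eq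
    by (simp add: aut_inv_eq_iff[OF F])
   have "\<forall>x\<in>S. \<nu> x = x" using eq by (simp add: \<nu>_def aut_inv_eq_iff[OF F])
   hence "v (C \<nu>) < \<epsilon>" using S(2) \<nu> by blast
   moreover have "\<tau> = \<sigma> o \<nu>" by (simp add: \<nu>_def fun_eq_iff aut_f_inv[OF F])
   ultimately show ?thesis using coc[OF \<sigma> NN_gal[OF \<nu>]] cN[OF \<nu>] v_\<rho>[OF \<sigma>] by (simp add: v_mult)
  qed
  thus "\<exists>S. finite S & (\<forall>\<tau>\<in>gal_geom. (\<forall>s\<in>S. \<tau> s = \<sigma> s) --> v (c \<tau> - c \<sigma>) < \<epsilon>)"
   using S(1) by (intro exI[of _ "insert s (insert z S)"]) simp
 qed
 have pi1: "pi1_cochain c" unfolding pi1_cochain_def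
 proof (intro allI impI ballI)
  fix W :: "'f acf set" and \<sigma> \<tau> :: "'f acf => 'f acf"
  assume W: "is_place W" "t_ac : W" and \<sigma>: "\<sigma> : gal_geom" and \<tau>: "\<tau> : inertia_group W"
  note N = inertia_NN[OF W \<tau>]
  show "c (\<sigma> o \<tau>) = c \<sigma>" using coc[OF \<sigma> NN_gal[OF N(1)]] cN[OF N(1)] goodD(3)[OF C(1) W(1) N] by simp
 qed
 have Z: "(c, 0) : Z1c v \<rho> V" unfolding Z1c_def using cont pi1 coc cD by auto
 have nB: "(c, 0) \<notin> B1c \<rho>"
 proof
  assume "(c, 0) : B1c \<rho>"
  hence "c \<nu> = 0" if "\<nu> : NN" for \<nu> using NN_gal[OF that] unfolding B1c_def by auto
  thus False using C(2) cN by auto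
 qed
 have \<Phi>D: "cj \<Phi> \<delta> : decomp_group V" if "\<delta> : decomp_group V" for \<delta>
  using cj_\<Phi>_gal[OF decomp_gal[OF that]] cj_image[OF \<Phi>(1), of \<delta> V] decomp_image[OF that]
  by (simp add: decomp_group_def \<Phi>(4))
 have "\<rho> \<Phi> * c (cj \<Phi> \<sigma>) - \<kappa> * (- 1 - i) ^ M * c \<sigma> = 0" if \<sigma>: "\<sigma> : gal_geom" for \<sigma>
 proof -
  obtain \<delta> where \<delta>: "\<delta> : decomp_group V" "iv \<delta> o \<sigma> : NN" "\<sigma> = \<delta> o (iv \<delta> o \<sigma>)" by (rule decomp_lift[OF \<sigma>])
  define \<nu> where "\<nu> = iv \<delta> o \<sigma>"
  have \<nu>: "\<nu> : NN" "\<sigma> = \<delta> o \<nu>" using \<delta> by (simp_all add: \<nu>_def)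
  note S = \<Phi>_scalar[OF good_unr_hom[OF C(1)] gal \<nu>(1)]
  have "c (cj \<Phi> \<sigma>) = \<rho> \<delta> * C (cj \<Phi> \<nu>)"
   using c[OF \<Phi>D[OF \<delta>(1)] S(1)] cj_\<Phi>_gal[OF decomp_gal[OF \<delta>(1)]] by (simp add: \<nu>(2) cj_comp[OF \<Phi>(1)])
  hence "\<rho> \<Phi> * c (cj \<Phi> \<sigma>) = \<rho> \<delta> * (\<rho> \<Phi> * C (cj \<Phi> \<nu>))" by (simp add: mult_ac)
  also have "... = \<kappa> * (- 1 - i) ^ M * (\<rho> \<delta> * C \<nu>)" by (simp only: S(2) mult_ac)
  also have "\<rho> \<delta> * C \<nu> = c \<sigma>" using c[OF \<delta>(1) \<nu>(1)] \<nu>(2) by simp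
  finally show ?thesis by simp
 qed
 hence "((%\<sigma>. fst (frob_act \<rho> \<Phi> (c, 0)) \<sigma> - \<kappa> * (- 1 - i) ^ M * c \<sigma>),
   snd (frob_act \<rho> \<Phi> (c, 0)) - \<kappa> * (- 1 - i) ^ M * 0) : B1c \<rho>" by (simp add: B1c_def frob_act_def cj_def)
 thus ?thesis unfolding H1c_eigenvalue_def using Z nB by (intro bexI[of _ "(c, 0)"]) auto
qed

theorem H1c_eigenvalues: "{\<tau>. H1c_eigenvalue v \<rho> V \<Phi> \<tau>} = {\<kappa> * (- 1 - i) ^ M}"
proof (rule subset_antisym)
 show "{\<tau>. H1c_eigenvalue v \<rho> V \<Phi> \<tau>} <= {\<kappa> * (- 1 - i) ^ M}"
  by (intro subsetI singleton_iff[THEN iffD2] eigenvalue_unique) (rule CollectD)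
qed (simp add: eigenvalue_exists)

end

section \<open>The Heisenberg cocycle and Witt vectors\<close>

text \<open>The field is arbitrary because the formulas are used twice, for the constants and for
  the algebraic closure of the function field.\<close>

locale char2_pow =
 fixes p k :: nat and dummy :: "'c::field itself"
 assumes two: "(1::'c) + 1 = 0" and p: "p = 2 ^ k" and k: "k > 0"
begin

lemmas c2 = char2_simps[OF two]

lemma pw_add: "((x::'c) + y) ^ (p ^ i) = x ^ (p ^ i) + y ^ (p ^ i)"
 unfolding p power_mult[symmetric] by (rule char2_power_add[OF two])

lemma pw_sum: "(sum f I :: 'c) ^ (p ^ i) = (\<Sum>j\<in>I. f j ^ (p ^ i))"
 unfolding p power_mult[symmetric] by (rule char2_power_sum[OF two])

lemma pw_add1: "((x::'c) + y) ^ p = x ^ p + y ^ p" and pw_sum1: "(sum f I :: 'c) ^ p = (\<Sum>j\<in>I. f j ^ p)"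
 using pw_add[of x y 1] pw_sum[of f I 1] by simp_all

lemma add_eq_0: "(x::'c) + y = 0 \<longleftrightarrow> x = y" by (metis add.right_neutral c2(1) c2(2))

lemma R_poly_eval: "poly (R_poly p e a) (x::'c) = (\<Sum>i\<le>e. a i * x ^ (p ^ i))"
 by (simp add: R_poly_def poly_sum poly_monom)

lemma R_poly_add: "poly (R_poly p e a) ((x::'c) + y) = poly (R_poly p e a) x + poly (R_poly p e a) y"
 by (simp add: R_poly_eval pw_add distrib_left sum.distrib)

lemma f_R_alt: "f_R p e a (x::'c) y = (\<Sum>i<e. (\<Sum>j<e - i. (a i * x ^ (p ^ i) * y) ^ (p ^ j)) + (x * poly (R_poly p e a) y) ^ (p ^ i))"
 unfolding f_R_def by (rule c2(3))

lemma f_R_add_left: "f_R p e a ((x::'c) + x') y = f_R p e a x y + f_R p e a x' y"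
 unfolding f_R_alt sum.distrib[symmetric]
 by (intro sum.cong refl) (simp add: pw_add distrib_left distrib_right sum.distrib add_ac)

lemma f_R_add_right: "f_R p e a (x::'c) (y + y') = f_R p e a x y + f_R p e a x y'"
 unfolding f_R_alt sum.distrib[symmetric]
 by (intro sum.cong refl) (simp add: pw_add R_poly_add distrib_left distrib_right sum.distrib add_ac)

lemma f_R_0 [simp]: "f_R p e a (0::'c) y = 0" "f_R p e a x (0::'c) = 0"
 using f_R_add_left[of e a 0 0 y] f_R_add_right[of e a x 0 0] by (simp_all add: c2)

lemma telescope: "(\<Sum>j<m. (u::'c) ^ (p ^ j)) ^ p + (\<Sum>j<m. u ^ (p ^ j)) = u ^ (p ^ m) + u"
proof (induction m)
 case (Suc m)
 have "(\<Sum>j<Suc m. u ^ (p ^ j)) ^ p + (\<Sum>j<Suc m. u ^ (p ^ j)) =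
   ((\<Sum>j<m. u ^ (p ^ j)) ^ p + (\<Sum>j<m. u ^ (p ^ j))) + (u ^ (p ^ Suc m) + u ^ (p ^ m))" by (simp add: pw_add1 power_mult[symmetric] mult.commute)
 also have "... = u ^ (p ^ Suc m) + u" unfolding Suc by (simp add: add_ac c2)
 finally show ?case .
qed (simp add: c2 p)

text \<open>Both kinds of inner sums telescope under u |-> u^p + u, and
  \<open>E_R p e a y = 0\<close> makes the remaining terms with x^(p^e) cancel. This is what makes
  the Heisenberg translation preserve the equation of the curve.\<close>

lemma f_R_frob:
 assumes "E_R p e a (y::'c) = 0"
 shows "f_R p e a x y ^ p + f_R p e a x y = x * poly (R_poly p e a) y + y * poly (R_poly p e a) x"
proof -
 have pp: "p ^ i * p ^ (e - i) = p ^ e" if "i <= e" for i using that by (simp flip: power_add)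
 define A where "A = (\<Sum>i<e. \<Sum>j<e - i. (a i * x ^ (p ^ i) * y) ^ (p ^ j))"
 define B where "B = (\<Sum>i<e. (x * poly (R_poly p e a) y) ^ (p ^ i))"
 define T where "T = (\<Sum>i<e. (a i * y) ^ (p ^ (e - i)))"
 have f: "f_R p e a x y = A + B" by (simp add: f_R_alt A_def B_def sum.distrib)
 have "A ^ p + A = (\<Sum>i<e. (\<Sum>j<e - i. (a i * x ^ (p ^ i) * y) ^ (p ^ j)) ^ p + (\<Sum>j<e - i. (a i * x ^ (p ^ i) * y) ^ (p ^ j)))"
  unfolding A_def pw_sum1[of _ "{..<e}"] sum.distrib ..
 also have "... = (\<Sum>i<e. x ^ (p ^ e) * (a i * y) ^ (p ^ (e - i)) + a i * x ^ (p ^ i) * y)" unfolding telescope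
  by (intro sum.cong refl) (simp add: power_mult_distrib power_mult[symmetric] pp mult_ac)
 also have "... = x ^ (p ^ e) * T + (\<Sum>i<e. a i * x ^ (p ^ i) * y)"
  by (simp add: sum.distrib T_def sum_distrib_left)
 finally have 1: "A ^ p + A = x ^ (p ^ e) * T + (\<Sum>i<e. a i * x ^ (p ^ i) * y)" .
 have "poly (R_poly p e a) y ^ (p ^ e) = T + a e * y" using assms by (simp add: T_def lessThan_Suc_atMost[symmetric] E_R_def add_eq_0)
 hence 2: "B ^ p + B = x ^ (p ^ e) * (T + a e * y) + x * poly (R_poly p e a) y"
  unfolding B_def telescope by (simp add: power_mult_distrib)
 have "y * poly (R_poly p e a) x = (\<Sum>i<e. a i * x ^ (p ^ i) * y) + x ^ (p ^ e) * (a e * y)" unfolding R_poly_eval lessThan_Suc_atMost[symmetric] by (simp add: sum_distrib_left algebra_simps)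
 thus ?thesis
 proof -
  assume y: "y * poly (R_poly p e a) x = (\<Sum>i<e. a i * x ^ (p ^ i) * y) + x ^ (p ^ e) * (a e * y)"
  have "f_R p e a x y ^ p + f_R p e a x y = (A ^ p + A) + (B ^ p + B)" by (simp add: f pw_add1)
  also have "... = x * poly (R_poly p e a) y + y * poly (R_poly p e a) x"
   unfolding 1 2 y by (simp add: distrib_left add_ac c2)
  finally show ?thesis .
 qed
qed

section \<open>Witt vectors of length two as pairs, with Frobenius and trace\<close>

definition wadd :: "'c \<times> 'c => 'c \<times> 'c => 'c \<times> 'c" where
 "wadd x y = (fst x + fst y, snd x + snd y + fst x * fst y)"

lemma wadd_commute: "wadd x y = wadd y x" and wadd_assoc: "wadd (wadd x y) z = wadd x (wadd y z)"
 and wadd_0 [simp]: "wadd x (0, 0) = x" "wadd (0, 0) x = x" by (simp_all add: wadd_def algebra_simps)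

lemma wadd_left_commute: "wadd x (wadd y z) = wadd y (wadd x z)" by (metis wadd_commute wadd_assoc)

lemmas wadd_ac = wadd_assoc wadd_commute wadd_left_commute

lemma wadd_cancel: "wadd x y = wadd x z \<longleftrightarrow> y = z" by (auto simp: wadd_def prod_eq_iff)

lemma wadd_neg: "wadd x (fst x, snd x + (fst x)\<^sup>2) = (0, 0)" by (simp add: wadd_def c2 sqr)

definition wfr :: "nat => 'c \<times> 'c => 'c \<times> 'c" where "wfr i x = (fst x ^ (2 ^ i), snd x ^ (2 ^ i))"

lemma wfr_add: "wfr i (wadd x y) = wadd (wfr i x) (wfr i y)"
 by (simp add: wfr_def wadd_def char2_power_add[OF two] power_mult_distrib)

lemma wfr_wfr: "wfr i (wfr j x) = wfr (i + j) x" by (simp add: wfr_def power_add mult.commute flip: power_mult)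

lemma wfr_0 [simp]: "wfr 0 x = x" and wfr_00 [simp]: "wfr i (0, 0) = (0, 0)" by (simp_all add: wfr_def)

primrec wtr :: "nat => 'c \<times> 'c => 'c \<times> 'c" where "wtr 0 x = (0, 0)" | "wtr (Suc m) x = wadd (wtr m x) (wfr m x)"

lemma wtr_add: "wtr m (wadd x y) = wadd (wtr m x) (wtr m y)" by (induction m) (simp_all add: wfr_add wadd_ac)

text \<open>The Witt vector form of \<open>telescope\<close>, written with sums on both sides
  because subtraction of Witt vectors is not componentwise.\<close>

lemma wtr_telescope: "wadd (wfr 1 (wtr m x)) x = wadd (wtr m x) (wfr m x)"
proof (induction m)
 case (Suc m)
 have "wadd (wfr 1 (wtr (Suc m) x)) x = wadd (wadd (wfr 1 (wtr m x)) x) (wfr (Suc m) x)"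
  by (simp add: wfr_add wfr_wfr wadd_ac)
 thus ?case unfolding Suc by simp
qed simp

lemma wtr_GF: "wfr m x = x ==> wfr 1 (wtr m x) = wtr m x"
 using wtr_telescope[of m x] by (metis wadd_cancel wadd_commute)

lemma W2_trace_eq: "W2_trace m 1 x = wtr m x"
proof -
 interpret A: abelian_monoid "W2 (UNIV :: 'c set)" by (rule abelian_monoidI) (auto simp: W2_def algebra_simps)
 have "finsum (W2 UNIV) (%i. (fst x ^ (2 ^ i), snd x ^ (2 ^ i))) {..<m} = wtr m x"
 proof (induction m)
  case 0
  show ?case by (simp only: wtr.simps lessThan_0 A.finsum_empty) (simp add: W2_def)
 next
  case (Suc m)
  have "finsum (W2 UNIV) (%i. (fst x ^ (2 ^ i), snd x ^ (2 ^ i))) {..<Suc m} =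
    (fst x ^ (2 ^ m), snd x ^ (2 ^ m)) \<oplus>\<^bsub>W2 UNIV\<^esub> finsum (W2 UNIV) (%i. (fst x ^ (2 ^ i), snd x ^ (2 ^ i))) {..<m}"
   unfolding lessThan_Suc by (rule A.finsum_insert) (auto simp: W2_def)
  thus ?case unfolding Suc by (simp add: W2_def wadd_def wfr_def split: prod.splits)
 qed
 thus ?thesis by (simp add: W2_trace_def)
qed

end

lemma linearized_add:
 fixes g :: "'f::field poly"
 assumes two: "(1::'f) + 1 = 0" and p: "p = 2 ^ k" and g: "g : linearized p K"
 shows "poly g (x + y) = poly g x + poly g y" "ceval g (u + w) = ceval g u + ceval g w"
proof -
 obtain m c where "g = (\<Sum>i<m. monom (c i) (p ^ i))" using g unfolding linearized_def by blast
 moreover have "(x + y) ^ (p ^ i) = x ^ (p ^ i) + y ^ (p ^ i)" for i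
  unfolding p power_mult[symmetric] by (rule char2_power_add[OF two])
 moreover have "(u + w) ^ (p ^ i) = u ^ (p ^ i) + w ^ (p ^ i)" for i
  unfolding p power_mult[symmetric] by (rule char2_power_add[OF const_char2[OF two]])
 ultimately show "poly g (x + y) = poly g x + poly g y" "ceval g (u + w) = ceval g u + ceval g w"
  by (simp_all add: poly_sum poly_monom ceval_sum ceval_monom distrib_left sum.distrib)
qed

lemma linearized_polys_over:
 assumes "g : linearized p K" "subfld K"
 shows "g : polys_over K"
proof -
 obtain m c where "g = (\<Sum>i<m. monom (c i) (p ^ i))" "\<forall>i<m. c i : K" using assms(1) unfolding linearized_def by blast
 thus ?thesis using assms(2) by (auto simp: polys_over_def coeff_sum intro!: subfld_sum subfld_D(2))
qed

lemma polys_over_pCons: "pCons c g : polys_over K ==> c : K & g : polys_over K"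
proof -
 assume "pCons c g : polys_over K"
 hence *: "coeff (pCons c g) i : K" for i by (simp add: polys_over_def)
 show ?thesis using *[of 0] *[of "Suc _"] by (simp add: polys_over_def)
qed

lemma aut_ceval:
 assumes \<sigma>: "\<sigma> : field_auts" and g: "g : polys_over K" and K: "!!c. c : K ==> \<sigma> (cst c) = cst c"
 shows "\<sigma> (ceval g x) = ceval g (\<sigma> x)" using g
proof (induction g)
 case (pCons c g)
 hence "c : K" "g : polys_over K" using polys_over_pCons by blast+
 thus ?case using pCons.IH K by (simp add: aut[OF \<sigma>])
qed (simp add: aut_0[OF \<sigma>])

section \<open>Reduction to the elliptic curve\<close>

lemma froot_power:
 assumes two: "(1::'f::alg_closed_field) + 1 = 0"
 shows "froot (2 ^ m) (u::'f) ^ (2 ^ m) = u" "x ^ (2 ^ m) = u ==> froot (2 ^ m) u = x"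
proof -
 have uniq: "x = y" if "x ^ (2 ^ m) = y ^ (2 ^ m)" for x y :: 'f
 proof -
  have "(x + y) ^ (2 ^ m) = 0" using that by (simp add: char2_power_add[OF two] char2_simps(1)[OF two])
  hence "x + y = 0" by simp
  thus ?thesis using char2_simps(2)[OF two] by (metis add.right_neutral)
 qed
 obtain y where "y ^ (2 ^ m) = u" using root_exists[of "2 ^ m" u] by auto
 hence *: "\<exists>!x. x ^ (2 ^ m) = u" using uniq by metis
 show "froot (2 ^ m) u ^ (2 ^ m) = u" unfolding froot_def by (rule theI'[OF *])
 show "froot (2 ^ m) u = x" if "x ^ (2 ^ m) = u" unfolding froot_def using * that by (rule the1_equality)
qed

locale q_data =
 fixes p q k n e :: nat and a :: "nat => 'f::alg_closed_field" and A :: "('f \<times> 'f) set"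
  and \<xi>2 :: "'f \<times> 'f => 'k::field_char_0" and \<psi> :: "'f => 'k" and \<xi> :: "'f \<times> 'f => 'k" and fU \<Delta> F_A ax :: "'f poly"
  and Abar Ubar :: "'f set" and s0 \<alpha> \<beta> aW bW c :: 'f and r :: "'f => 'f" and \<xi>W :: "'f \<times> 'f => 'k"
  and \<xi>U :: "'f => 'k"
 assumes p: "p = 2 ^ k" "k >= 1" and q: "q = p ^ n" "n >= 1" and F_char: "CHAR('f) = 2"
  and R: "!!i. i <= e ==> a i : GF q" and A: "max_abelian_subgroup A (H_R p e a)" "A <= GF q \<times> GF q"
  and \<xi>: "!!c. c : GF p ==> \<xi> (0, c) = \<psi> c"
  and \<xi>2: "\<xi>2 : dual (add_monoid (W2 (GF 2)))" "inj_on \<xi>2 (carrier (W2 (GF 2)))" and Abar: "Abar = fst ` A"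
  and Ubar: "Ubar = {x : Abar. f_R p e a x x = 0}" and fU: "fU : linearized p (GF q)"
  and F_A: "F_A = fU ^ p + fU" "Abar = Ker F_A" and \<Delta>: "\<Delta> : polys_over (GF q)" "poly \<Delta> 0 = 0"
   "\<Delta> ^ p + \<Delta> = [:0, 1:] * R_poly p e a + fU * (fU ^ p + Polynomial.smult s0 fU)"
  and \<alpha>: "\<alpha> : GF q" "froot p \<alpha> + \<alpha> = s0 + 1" and r: "!!x y. x : Abar ==> y : Abar ==> r (x + y) = r x + r y"
  and \<xi>W_\<xi>U: "\<xi>U : dual (add_group_on Ubar)" "!!x b. (x, b) : A ==>
     \<xi> (x, b) = \<xi>W (poly fU x, b + poly \<Delta> x + froot p \<alpha> * (poly fU x)\<^sup>2) * \<xi>U (r x)"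
  and aW_bW: "(aW, bW) : Units (W2 (GF p))" "!!z. z : carrier (W2 (GF p)) ==>
     \<xi>W z = W2_char \<xi>2 k ((aW, bW) \<otimes>\<^bsub>W2 (GF p)\<^esub> z)" and ax: "ax : linearized p (GF q)"
   "Polynomial.monom 1 q + [:0, 1:] = pcompose ax F_A" "pcompose ax F_A = pcompose F_A ax" and \<beta>: "\<beta> : GF q"
   "!!x. x : GF q ==> \<xi>U (r (poly ax x)) = \<psi> (\<Sum>i<n. (\<beta> * x) ^ (p ^ i))"
  and c: "c = froot 2 (\<alpha> + bW / aW\<^sup>2) + aW * \<beta>"
begin

lemma two: "(1::'f) + 1 = 0"
proof -
 have "of_nat CHAR('f) = (0::'f)" by (rule of_nat_CHAR)
 thus ?thesis by (simp add: F_char)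
qed

sublocale f: char2_pow p k "TYPE('f)" using two p by unfold_locales auto

sublocale w: char2_pow p k "TYPE('f acf)" using const_char2[OF two] p by unfold_locales auto

lemma q2: "q = 2 ^ (k * n)" and kn: "k * n > 0" and p_gt_1: "p > 1" and q_gt_1: "q > 1"
proof -
 show 1: "q = 2 ^ (k * n)" by (simp add: q p power_mult)
 show 2: "k * n > 0" using p q by simp
 show "p > 1" unfolding p(1) by (intro one_less_power) (use p(2) in auto)
 show "q > 1" unfolding 1 using 2 by (intro one_less_power) auto
qed

lemma sub_p: "subfld (GF p :: 'f set)" and sub_q: "subfld (GF q :: 'f set)"
 unfolding p(1) q2 using subfield_GF[OF two] kn p(2) by auto

lemma GF_p_q: "x : GF p ==> x : GF q" for x :: 'f
proof -
 assume x: "x : GF p"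
 have "x ^ (p ^ m) = x" for m by (induction m) (use x in \<open>simp_all add: GF_def power_mult mult.commute[of p]\<close>)
 thus ?thesis by (simp add: GF_def q)
qed

lemma GF2: "GF 2 = {0, 1 :: 'f}"
proof -
 have "x = 0 \<or> x = 1" if "x\<^sup>2 = x" for x :: 'f  using that by (simp add: sq_simps)
 thus ?thesis by (auto simp: GF_def)
qed

lemma froot_GF: "u : GF q ==> froot (2 ^ m) u : GF q" for u :: 'f
proof -
 assume u: "u : GF q"
 have "(froot (2 ^ m) u ^ q) ^ (2 ^ m) = (froot (2 ^ m) u ^ (2 ^ m)) ^ q" by (simp only: power_mult[symmetric] mult.commute)
 also have "... = u" using u by (simp only: froot_power(1)[OF two]) (simp add: GF_def)
 finally show ?thesis using froot_power(2)[OF two, of "froot (2 ^ m) u ^ q" m u] by (simp add: GF_def)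
qed

subsection \<open>The group \<open>A\<close>\<close>

lemma subgroup_A: "subgroup A (H_R p e a)" and comm_A: "comm_group ((H_R p e a)\<lparr>carrier := A\<rparr>)"
 and max_A: "subgroup B (H_R p e a) ==> comm_group ((H_R p e a)\<lparr>carrier := B\<rparr>) ==> A <= B ==> B = A"
 using A(1) by (auto simp: max_abelian_subgroup_def)

lemma mem_A:
 assumes "(h, b) : A"
 shows "E_R p e a h = 0" "b ^ p + b = h * poly (R_poly p e a) h" "h : GF q" "b : GF q" "h : Abar"
 using assms subgroup.subset[OF subgroup_A] A(2) unfolding Abar by (force simp: H_R_def f.c2)+

lemma A_mult: "(h, b) : A ==> (h', b') : A ==> (h + h', b + b' + f_R p e a h h') : A"
 using subgroup.m_closed[OF subgroup_A, of "(h, b)" "(h', b')"] by (simp add: H_R_def)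

lemma A_zero: "(0, 0) : A" using subgroup.one_closed[OF subgroup_A] by (simp add: H_R_def)

lemma A_comm: "(h, b) : A ==> (h', b') : A ==> f_R p e a h h' = f_R p e a h' h"
proof -
 assume "(h, b) : A" "(h', b') : A"
 thus ?thesis using comm_monoid.m_comm[OF comm_group.axioms(1)[OF comm_A], of "(h, b)" "(h', b')"] by (simp add: H_R_def)
qed

lemma A_inv: "(h, b) : A ==> (h, b + f_R p e a h h) : A"
proof -
 assume hb: "(h, b) : A"
 obtain h' b' where *: "(h', b') : A" "h' + h = 0" "b' + b + f_R p e a h' h = 0"
  using group.l_inv_ex[OF comm_group.axioms(2)[OF comm_A], of "(h, b)"] hb by (auto simp: H_R_def)
 have "h' = h" using *(2) by (simp only: f.add_eq_0)
 moreover have "b' = b + f_R p e a h h" using *(3) calculation f.add_eq_0[of b' "b + f_R p e a h h"] by (simp add: add.assoc)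
 ultimately show ?thesis using *(1) by simp
qed

text \<open>The product of \<open>A\<close> with the centre is again an abelian subgroup, so
  maximality puts the centre into \<open>A\<close>.\<close>

lemma A_center:
 assumes "d : GF p"
 shows "(0, d) : A"
proof -
 let ?H = "H_R p e a"
 define B where "B = {(h, b + d) | h b d. (h, b) : A & d : GF p}"
 have BI: "(h, b + d) : B" if "(h, b) : A" "d : GF p" for h b d using that by (auto simp: B_def)
 have add: "d + d' : GF p" if "d : GF p" "d' : GF p" for d d' :: 'f using subfld_D(5)[OF sub_p that] .
 have zero: "(0::'f) : GF p" using subfld_D(2)[OF sub_p] .
 have mB: "(h + h', b + b' + f_R p e a h h') : B" if hb: "(h, b) : B" "(h', b') : B" for h b h' b'
 proof -
  obtain b1 d1 where 1: "b = b1 + d1" "(h, b1) : A" "d1 : GF p" using hb(1) by (auto simp: B_def)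
  obtain b2 d2 where 2: "b' = b2 + d2" "(h', b2) : A" "d2 : GF p" using hb(2) by (auto simp: B_def)
  have "(h + h', (b1 + b2 + f_R p e a h h') + (d1 + d2)) : B"
   by (rule BI[OF A_mult[OF 1(2) 2(2)] add[OF 1(3) 2(3)]])
  thus ?thesis by (simp add: 1(1) 2(1) add_ac)
 qed
 have iB: "(h, b + f_R p e a h h) : B" if hb: "(h, b) : B" for h b
 proof -
  obtain b1 d1 where 1: "b = b1 + d1" "(h, b1) : A" "d1 : GF p" using hb by (auto simp: B_def)
  have "(h, (b1 + f_R p e a h h) + d1) : B" by (rule BI[OF A_inv[OF 1(2)] 1(3)])
  thus ?thesis by (simp add: 1(1) add_ac)
 qed
 have cB: "f_R p e a h h' = f_R p e a h' h" if "(h, b) : B" "(h', b') : B" for h b h' b'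
  using that A_comm unfolding B_def by blast
 have oB: "(0, 0) : B" using BI[OF A_zero zero] by simp
 have sub: "B <= carrier ?H"
 proof
  fix x assume "x : B"
  then obtain h b d where x: "x = (h, b + d)" "(h, b) : A" "d : GF p" by (auto simp: B_def)
  have "d ^ p = d" using x(3) by (simp add: GF_def)
  thus "x : carrier ?H" using mem_A[OF x(2)] by (simp add: f.pw_add1 add_ac f.c2 H_R_def x(1))
 qed
 have "subgroup B ?H"
 proof
  show "inv\<^bsub>?H\<^esub> x : B" if x: "x : B" for x
  proof -
   obtain h b where hb: "x = (h, b)" by (cases x)
   note i = iB[OF x[unfolded hb]]
   have "inv\<^bsub>?H\<^esub> x = (h, b + f_R p e a h h)" unfolding m_inv_def
   proof (rule the_equality)
    fix y assume "y : carrier ?H & x \<otimes>\<^bsub>?H\<^esub> y = \<one>\<^bsub>?H\<^esub> & y \<otimes>\<^bsub>?H\<^esub> x = \<one>\<^bsub>?H\<^esub>"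
    hence y: "fst y + h = 0" "snd y + (b + f_R p e a (fst y) h) = 0" by (auto simp: H_R_def hb add_ac)
    thus "y = (h, b + f_R p e a h h)" by (simp add: f.add_eq_0 prod_eq_iff)
   qed (use subsetD[OF sub i] in \<open>auto simp: H_R_def hb add_ac f.c2\<close>)
   thus ?thesis using i by simp
  qed
 qed (use sub oB mB in \<open>auto simp: H_R_def\<close>)
 moreover have "comm_group (?H\<lparr>carrier := B\<rparr>)"
 proof (rule comm_groupI)
  show "\<exists>y\<in>carrier (?H\<lparr>carrier := B\<rparr>). y \<otimes>\<^bsub>?H\<lparr>carrier := B\<rparr>\<^esub> x = \<one>\<^bsub>?H\<lparr>carrier := B\<rparr>\<^esub>"
   if "x : carrier (?H\<lparr>carrier := B\<rparr>)" for x using iB[of "fst x" "snd x"] that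
   by (intro bexI[of _ "(fst x, snd x + f_R p e a (fst x) (fst x))"]) (auto simp: H_R_def add_ac f.c2 split_beta)
 qed (use oB mB cB in \<open>auto simp: H_R_def f.f_R_add_left f.f_R_add_right add_ac\<close>)
 moreover have "A <= B" using BI[OF _ zero] by auto
 ultimately have "B = A" by (rule max_A)
 thus ?thesis using BI[OF A_zero assms] by simp
qed

subsection \<open>The generic fibre\<close>

abbreviation ca :: "nat => 'f acf" where "ca \<equiv> cst o a"
abbreviation Rw :: "'f acf => 'f acf" where "Rw \<equiv> poly (R_poly p e ca)"
abbreviation fw :: "'f acf => 'f => 'f acf" where "fw x h \<equiv> f_R p e ca x (cst h)"

lemma Rw_const: "Rw (cst h) = cst (poly (R_poly p e a) h)"
 by (simp add: f.R_poly_eval w.R_poly_eval cst_sum cst_mult cst_power)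

lemma Rw_ceval: "Rw x = ceval (R_poly p e a) x"
 unfolding w.R_poly_eval by (simp add: R_poly_def ceval_sum ceval_monom)

lemma E_R_const: "E_R p e ca (cst h) = cst (E_R p e a h)"
 by (simp add: E_R_def Rw_const cst_add cst_sum cst_mult cst_power)

lemma fw_const: "fw (cst x) h = cst (f_R p e a x h)"
 by (simp add: f.f_R_alt w.f_R_alt Rw_const cst_add cst_sum cst_mult cst_power)

lemma fibre_iff: "(x, y) : generic_fibre p e a F_A \<longleftrightarrow> y ^ p + y = x * Rw x & ceval F_A x = t_ac"
 by (simp add: generic_fibre_def w.c2 ceval_def)

lemma curve_act_eq: "curve_act p e a (x, y) (h, b) = (x + cst h, y + cst b + fw x h)"
 by (simp add: curve_act_def)

lemma ceval_F_A: "ceval F_A x = ceval fU x ^ p + ceval fU x" by (simp add: F_A(1) ceval_add ceval_power)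

lemma F_A_nz: "F_A ~= 0"
proof
 assume "F_A = 0"
 hence "coeff (Polynomial.monom 1 q + [:0, 1:]) q = (0 :: 'f)" using ax(2,3) by simp
 thus False using q_gt_1 by (simp add: coeff_pCons split: nat.splits)
qed

lemma power_eq_self_const:
 assumes "x ^ m = x" "m > 1"
 shows "\<exists>u. x = cst u & u ^ m = (u :: 'f)"
proof -
 have "ceval (Polynomial.monom 1 m - [:0, 1:]) x = 0" by (simp add: ceval_diff ceval_monom assms(1))
 moreover have "Polynomial.monom 1 m - [:0, 1:] ~= (0 :: 'f poly)"
 proof
  assume "Polynomial.monom 1 m - [:0, 1:] = (0 :: 'f poly)"
  hence "coeff (Polynomial.monom 1 m - [:0, 1:]) m = (0 :: 'f)" by simp
  thus False using assms(2) by (simp add: coeff_pCons split: nat.splits)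
 qed
 ultimately obtain u where "x = cst u" using root_of_const_poly by blast
 thus ?thesis using assms(1) by (auto simp flip: cst_power)
qed

text \<open>The x-coordinates differ by a root of \<open>F_A\<close>, that is by an element of
  \<open>Abar\<close>. After acting by any lift of it to \<open>A\<close>, the y-coordinates differ
  by a solution of \<epsilon>^p = \<epsilon>, which the centre absorbs.\<close>

lemma torsor:
 assumes P: "(x, y) : generic_fibre p e a F_A" and P': "(x', y') : generic_fibre p e a F_A"
 shows "\<exists>g\<in>A. (x', y') = curve_act p e a (x, y) g"
proof -
 have 1: "y ^ p + y = x * Rw x" "ceval F_A x = t_ac" "y' ^ p + y' = x' * Rw x'" "ceval F_A x' = t_ac"
  using P P' by (simp_all add: fibre_iff)
 have "ceval F_A (x' + x) = 0" using 1 unfolding ceval_F_A by (simp add: linearized_add(2)[OF two p(1) fU] w.pw_add1 add_ac w.c2)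
 then obtain h where h: "x' + x = cst h" "poly F_A h = 0" using root_of_const_poly[OF _ F_A_nz] by blast
 hence "h : Abar" by (simp add: F_A(2) Ker_def)
 then obtain b0 where b0: "(h, b0) : A" unfolding Abar by force
 have x': "x' = x + cst h" using h(1) by (metis add.commute w.c2(2))
 define \<epsilon> where "\<epsilon> = y' + y + cst b0 + fw x h"
 have f: "fw x h ^ p + fw x h = x * Rw (cst h) + cst h * Rw x"
  by (rule w.f_R_frob) (simp add: E_R_const mem_A(1)[OF b0])
 have b: "cst b0 ^ p + cst b0 = cst h * Rw (cst h)"
  using arg_cong[OF mem_A(2)[OF b0], of cst] by (simp add: cst_add cst_power cst_mult Rw_const)
 have "\<epsilon> ^ p + \<epsilon> = (y' ^ p + y') + (y ^ p + y) + (cst b0 ^ p + cst b0) + (fw x h ^ p + fw x h)" by (simp add: \<epsilon>_def w.pw_add1)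
 also have "... = 0" unfolding 1 b f by (simp add: x' w.R_poly_add distrib_left distrib_right add_ac w.c2)
 finally have "\<epsilon> ^ p = \<epsilon>" by (simp only: w.add_eq_0)
 then obtain d where d: "\<epsilon> = cst d" "d ^ p = d" using power_eq_self_const p_gt_1 by blast
 have "(h + 0, b0 + d + f_R p e a h 0) : A" using d(2) by (intro A_mult b0 A_center) (simp add: GF_def)
 hence g: "(h, b0 + d) : A" by simp
 have "y + cst (b0 + d) + fw x h = y + cst b0 + fw x h + \<epsilon>" by (simp add: d(1) cst_add)
 also have "... = y'" by (simp add: \<epsilon>_def add_ac w.c2)
 finally have "(x', y') = curve_act p e a (x, y) (h, b0 + d)" by (simp add: curve_act_eq x')
 thus ?thesis using g by blast
qed

lemma gal_arithD:
 assumes "\<sigma> : gal_arith q"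
 shows "\<sigma> : field_auts" "\<sigma> t_ac = t_ac" "u : GF q ==> \<sigma> (cst u) = cst u" using assms by (auto simp: gal_arith_def)

lemma gal_arith_fw:
 assumes \<sigma>: "\<sigma> : gal_arith q" and h: "h : GF q"
 shows "\<sigma> (Rw x) = Rw (\<sigma> x)" "\<sigma> (fw x h) = fw (\<sigma> x) h"
proof -
 note F = gal_arithD(1)[OF \<sigma>]
 have a: "\<sigma> (cst (a i)) = cst (a i)" if "i <= e" for i using gal_arithD(3)[OF \<sigma> R[OF that]] .
 show R: "\<sigma> (Rw x) = Rw (\<sigma> x)" for x by (simp add: w.R_poly_eval aut_sum[OF F] aut[OF F] a)
 show "\<sigma> (fw x h) = fw (\<sigma> x) h" by (simp add: w.f_R_alt aut_sum[OF F] aut[OF F] a R gal_arithD(3)[OF \<sigma> h])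
qed

lemma fibre_gal_arith:
 assumes \<sigma>: "\<sigma> : gal_arith q" and P: "(x, y) : generic_fibre p e a F_A"
 shows "(\<sigma> x, \<sigma> y) : generic_fibre p e a F_A"
proof -
 note F = gal_arithD(1)[OF \<sigma>]
 have 1: "y ^ p + y = x * Rw x" "ceval fU x ^ p + ceval fU x = t_ac" using P by (simp_all add: fibre_iff ceval_F_A)
 have "\<sigma> (y ^ p + y) = \<sigma> (x * Rw x)" "\<sigma> (ceval fU x ^ p + ceval fU x) = \<sigma> t_ac" unfolding 1 by (rule refl)+
 thus ?thesis by (simp add: fibre_iff ceval_F_A aut[OF F]
    gal_arith_fw[OF \<sigma> subfld_D(2)[OF sub_q]] gal_arithD(2)[OF \<sigma>]
    aut_ceval[OF F linearized_polys_over[OF fU sub_q] gal_arithD(3)[OF \<sigma>]])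
qed

text \<open>A single point suffices to determine the group element: \<open>A\<close> acts
  transitively on the generic fibre, is commutative, and has coordinates fixed by \<sigma>.\<close>

lemma Q_char_eq:
 assumes \<sigma>: "\<sigma> : gal_arith q" and P: "(x, y) : generic_fibre p e a F_A"
  and g: "(h, b) : A" "\<sigma> x = x + cst h" "\<sigma> y = y + cst b + fw x h"
 shows "Q_char p e a A F_A \<xi> \<sigma> = inverse (\<xi> (h, b))"
proof -
 note F = gal_arithD(1)[OF \<sigma>]
 have "(THE g. g : A & (\<forall>P  \<in>generic_fibre p e a F_A. map_prod \<sigma> \<sigma> P = curve_act p e a P g)) = (h, b)"
 proof (rule the_equality)
  show "(h, b) : A & (\<forall>P  \<in>generic_fibre p e a F_A. map_prod \<sigma> \<sigma> P = curve_act p e a P (h, b))"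
  proof (intro conjI ballI)
   show "(h, b) : A" by (rule g)
   fix P' assume P': "P' : generic_fibre p e a F_A"
   obtain x' y' where xy': "P' = (x', y')" by (cases P')
   obtain h' b' where g': "(h', b') : A" "x' = x + cst h'" "y' = y + cst b' + fw x h'"
    using torsor[OF P P'[unfolded xy']] by (auto simp: curve_act_eq)
   have sx: "\<sigma> x' = x' + cst h" using gal_arithD(3)[OF \<sigma> mem_A(3)[OF g'(1)]] by (simp add: g'(2) aut_add[OF F] g(2))
   have "\<sigma> y' = y + cst b + fw x h + cst b' + fw (x + cst h) h'" using gal_arithD(3)[OF \<sigma> mem_A(4)[OF g'(1)]]
    by (simp add: g'(3) aut_add[OF F] g(2,3) gal_arith_fw(2)[OF \<sigma> mem_A(3)[OF g'(1)]])
   also have "... = y' + cst b + fw x' h"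
    using A_comm[OF g(1) g'(1)] by (simp add: g'(2,3) w.f_R_add_left fw_const add_ac)
   finally show "map_prod \<sigma> \<sigma> P' = curve_act p e a P' (h, b)" by (simp add: xy' curve_act_eq sx)
  qed
  fix g' assume g': "g' : A & (\<forall>P  \<in>generic_fibre p e a F_A. map_prod \<sigma> \<sigma> P = curve_act p e a P g')"
  obtain h' b' where hb: "g' = (h', b')" by (cases g')
  show "g' = (h, b)" using g' P g(2,3) by (force simp: hb curve_act_eq)
 qed
 thus ?thesis by (simp add: Q_char_def)
qed

end

context q_data
begin

lemma fU_add: "poly fU (u + h) = poly fU u + poly fU h" and fU_0: "poly fU 0 = 0"
proof -
 show add: "poly fU (u + h) = poly fU u + poly fU h" for u h by (rule linearized_add(1)[OF two p(1) fU])
 have "poly fU 0 + poly fU 0 = poly fU 0 + 0" using add[of 0 0] by (simp only: add_0_right)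
 thus "poly fU 0 = 0" by (simp only: add_left_cancel)
qed

text \<open>The difference of both sides is a polynomial \<open>G\<close> in \<open>x\<close> with \<open>G\<^sup>p + G = 0\<close>, hence constant.\<close>

lemma cocycle_identity:
 assumes hb: "(h, b) : A"
 shows "fw x h = ceval \<Delta> (x + cst h) + ceval \<Delta> x + cst (poly \<Delta> h) + ceval fU x * cst (poly fU h)"
proof -
 let ?R = "R_poly p e a"
 define G where "G = (\<Sum>i<e. (\<Sum>j<e - i. (smult (a i * h) (Polynomial.monom 1 (p ^ i))) ^ (p ^ j))
   + (smult (poly ?R h) [:0, 1:]) ^ (p ^ i)) + (pcompose \<Delta> [:h, 1:] + \<Delta> + [:poly \<Delta> h:] + smult (poly fU h) fU)"
 have G: "poly G u = f_R p e a u h + (poly \<Delta> (u + h) + poly \<Delta> u + poly \<Delta> h + poly fU u * poly fU h)" for u by (simp add: G_def f.f_R_alt poly_sum poly_monom poly_pcompose mult_ac add_ac)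
 have cG: "ceval G x = fw x h + (ceval \<Delta> (x + cst h) + ceval \<Delta> x + cst (poly \<Delta> h) + ceval fU x * cst (poly fU h))" for x
  by (simp add: G_def w.f_R_alt Rw_const ceval_add ceval_sum ceval_power ceval_smult ceval_monom ceval_pcompose cst_mult mult_ac add_ac)
 have hK: "poly fU h ^ p = poly fU h" using mem_A(5)[OF hb] by (simp add: F_A(2) Ker_def F_A(1) f.add_eq_0)
 have D: "poly \<Delta> u ^ p + poly \<Delta> u = u * poly ?R u + poly fU u * (poly fU u ^ p + s0 * poly fU u)" for u
  using arg_cong[OF \<Delta>(3), of "%P. poly P u"] by simp
 have "poly G u ^ p + poly G u = 0" for u
 proof -
  have "poly G u ^ p + poly G u = (f_R p e a u h ^ p + f_R p e a u h) + (poly \<Delta> (u + h) ^ p + poly \<Delta> (u + h))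
    + (poly \<Delta> u ^ p + poly \<Delta> u) + (poly \<Delta> h ^ p + poly \<Delta> h) + (poly fU u ^ p * poly fU h ^ p + poly fU u * poly fU h)" unfolding G by (simp add: f.pw_add1 power_mult_distrib)
  also have "... = 0" unfolding f.f_R_frob[OF mem_A(1)[OF hb]] D fU_add f.R_poly_add
   by (simp add: f.pw_add1 hK distrib_left distrib_right add_ac mult_ac f.c2)
  finally show ?thesis .
 qed
 hence "poly (G ^ p + G) u = 0" for u by simp
 hence "G ^ p + G = 0" using poly_roots_finite[of "G ^ p + G"] alg_closed_field_infinite by auto
 hence "G ^ p = - G" by (simp only: eq_neg_iff_add_eq_0)
 hence "degree G = 0" using p_gt_1 degree_power_eq[of G p] by force
 then obtain u where u: "G = [:u:]" using degree_0_id by metis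
 have "poly G 0 = 0" unfolding G by (simp add: \<Delta>(2) f.c2 fU_0)
 hence "ceval G x = 0" by (simp add: u)
 thus ?thesis unfolding cG by (simp only: w.add_eq_0)
qed

subsection \<open>A point of the elliptic curve\<close>

text \<open>Starting from w with w^q + w = t, the point with x = a(w) lies over t because F_A(a(w))
  = w^q + w. Galois translates w by elements of GF q, and these are what \<beta> pairs with to
  describe \<open>\<xi>U\<close>.\<close>

definition ww :: "'f acf" where "ww = (SOME w. w ^ q + w = t_ac)"
definition xx :: "'f acf" where "xx = ceval ax ww"
definition yy :: "'f acf" where "yy = (SOME y. y ^ p + y = xx * Rw xx)"
text \<open>\<open>SS\<close> and \<open>ZZ\<close> are the Witt coordinates of the isomorphism phi,
  with the point (xx, yy) in place of an element of \<open>A\<close>.\<close>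

definition SS :: "'f acf" where "SS = ceval fU xx"
definition ZZ :: "'f acf" where "ZZ = yy + ceval \<Delta> xx + cst (froot p \<alpha>) * SS\<^sup>2"

lemma power_add_root: "m > 1 ==> \<exists>y. y ^ m + y = (u :: 'f acf)"
proof -
 assume m: "m > 1"
 let ?P = "Polynomial.monom 1 m + [:- u, 1:]"
 have "coeff ?P m = 1" using m by (simp add: coeff_pCons split: nat.splits)
 hence "degree ?P >= m" by (intro le_degree) simp
 then obtain y where "poly ?P y = 0" using has_root[of ?P] m by auto
 thus ?thesis by (intro exI[of _ y]) (simp add: poly_monom algebra_simps eq_neg_iff_add_eq_0)
qed

lemma ww: "ww ^ q + ww = t_ac" unfolding ww_def by (rule someI_ex[OF power_add_root[OF q_gt_1]])

lemma yy: "yy ^ p + yy = xx * Rw xx" unfolding yy_def by (rule someI_ex[OF power_add_root[OF p_gt_1]])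

lemma F_A_xx: "ceval F_A xx = t_ac" using arg_cong[OF ax(2)[unfolded ax(3)], of "%P. ceval P ww"] ww
 by (simp add: xx_def ceval_add ceval_monom ceval_pcompose)

lemma fibre_xx: "(xx, yy) : generic_fibre p e a F_A" by (simp add: fibre_iff yy F_A_xx)

lemma SS_eq: "SS ^ p + SS = t_ac" using F_A_xx by (simp add: ceval_F_A SS_def)

lemma froot_\<alpha>: "froot p \<alpha> ^ p = \<alpha>" "froot p \<alpha> : GF q"
 unfolding p(1) by (rule froot_power(1)[OF two], rule froot_GF[OF \<alpha>(1)])

lemma power_p_2: "((u :: 'f acf)\<^sup>2) ^ p = (u ^ p)\<^sup>2" "((d :: 'f)\<^sup>2) ^ p = (d ^ p)\<^sup>2"
 by (simp_all flip: power_mult add: mult.commute)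

text \<open>The second component of an Artin-Schreier-Witt equation: Frobenius adds (t, \<alpha>
  t^2) to (S, Z), and S t is the cross term of Witt addition.\<close>

lemma ZZ_eq: "ZZ ^ p + ZZ = SS * t_ac + cst \<alpha> * t_ac\<^sup>2"
proof -
 have D: "ceval \<Delta> xx ^ p + ceval \<Delta> xx = xx * Rw xx + SS * (SS ^ p + cst s0 * SS)"
  using arg_cong[OF \<Delta>(3), of "%P. ceval P xx"]
  by (simp add: ceval_add ceval_mult ceval_power ceval_smult Rw_ceval SS_def)
 have Sp: "SS ^ p = SS + t_ac" using SS_eq by (metis add.commute w.c2(2))
 have r1: "cst (froot p \<alpha>) ^ p = cst \<alpha>" by (simp add: froot_\<alpha>(1) flip: cst_power)
 have r2: "cst (froot p \<alpha>) = cst \<alpha> + cst s0 + 1"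
  using arg_cong[OF \<alpha>(2), of cst] by (simp add: cst_add add_ac) (metis add.commute add.left_commute w.c2(2))
 have "ZZ ^ p + ZZ = (yy ^ p + yy) + (ceval \<Delta> xx ^ p + ceval \<Delta> xx)
   + (cst (froot p \<alpha>) ^ p * (SS ^ p)\<^sup>2 + cst (froot p \<alpha>) * SS\<^sup>2)" by (simp add: ZZ_def w.pw_add1 power_mult_distrib power_p_2)
 also have "... = SS * t_ac + cst \<alpha> * t_ac\<^sup>2" unfolding yy D r1 unfolding r2 Sp by (simp add: sq_simps w.c2)
 finally show ?thesis .
qed

definition TT :: "'f acf => 'f acf" where "TT u = (\<Sum>i<n. u ^ (p ^ i))"

lemma TT_add: "TT (u + u') = TT u + TT u'" by (simp add: TT_def w.pw_add sum.distrib)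

lemma TT_const: "TT (cst d) = cst (\<Sum>i<n. d ^ (p ^ i))" by (simp add: TT_def cst_sum cst_power)

lemma TT_frob: "TT u ^ p + TT u = u ^ q + u" unfolding TT_def q(1) by (rule w.telescope)

lemma aW: "aW : GF p" "bW : GF p" "aW ~= 0"
proof -
 show "aW : GF p" "bW : GF p" using aW_bW(1) by (auto simp: Units_def W2_def)
 show "aW ~= 0" using aW_bW(1) by (auto simp: Units_def W2_def)
qed

lemma c_GF: "c : GF q"
proof -
 note S = subfld_D[OF sub_q]
 have "\<alpha> + bW / aW\<^sup>2 : GF q" using aW(1,2)[THEN GF_p_q] \<alpha>(1) by (intro S(5) S(8) S(9))
 hence "froot 2 (\<alpha> + bW / aW\<^sup>2) : GF q" using froot_GF[of _ 1] by simp
 thus ?thesis unfolding c using aW(1)[THEN GF_p_q] \<beta>(1) by (intro S(5) S(6))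
qed

text \<open>The square root of bW + aW^2 \<alpha>, the coefficient of t^2 in the equation of
  \<open>UU\<close>. Adding (0, dd t) replaces this term by one linear in t; the square root in
  \<open>c\<close> comes from here.\<close>

definition dd :: 'f where "dd = aW * froot 2 (\<alpha> + bW / aW\<^sup>2)"

lemma dd: "dd\<^sup>2 = bW + aW\<^sup>2 * \<alpha>" "aW * c = dd + aW\<^sup>2 * \<beta>" "dd : GF q"
proof -
 have "froot 2 (\<alpha> + bW / aW\<^sup>2) ^ 2 = \<alpha> + bW / aW\<^sup>2" using froot_power(1)[OF two, of 1] by simp
 thus "dd\<^sup>2 = bW + aW\<^sup>2 * \<alpha>" using aW(3) by (simp add: dd_def field_simps)
 show e: "aW * c = dd + aW\<^sup>2 * \<beta>" by (simp add: dd_def c distrib_left sqr)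
 have "dd = aW * c + aW\<^sup>2 * \<beta>" by (simp add: e f.c2)
 thus "dd : GF q" using aW(1)[THEN GF_p_q] \<beta>(1) c_GF subfld_D(5,6,9)[OF sub_q] by simp
qed

definition cw :: "'f \<times> 'f => 'f acf \<times> 'f acf" where "cw = map_prod cst cst"

lemma cw_eq: "cw x = (cst (fst x), cst (snd x))" by (simp add: cw_def prod_eq_iff)

lemma cw_wadd: "cw (f.wadd x y) = w.wadd (cw x) (cw y)" and cw_wfr: "cw (f.wfr m x) = w.wfr m (cw x)"
 by (simp_all add: cw_eq f.wadd_def w.wadd_def f.wfr_def w.wfr_def cst_add cst_mult cst_power)

lemma cw_wtr: "cw (f.wtr m x) = w.wtr m (cw x)" by (induction m) (simp_all add: cw_wadd cw_wfr, simp add: cw_eq)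

text \<open>A solution of the Lang equation for the constant Witt vector (c, 0). It shifts the
  equation of the covering by (c, 0), and the q-Frobenius moves it by the trace of (c, 0).\<close>

definition \<kappa>\<kappa> :: "'f \<times> 'f" where "\<kappa>\<kappa> = (SOME x. f.wfr 1 x = f.wadd x (c, 0))"

lemma \<kappa>\<kappa>: "f.wfr 1 \<kappa>\<kappa> = f.wadd \<kappa>\<kappa> (c, 0)"
proof -
 have root: "\<exists>y. y\<^sup>2 + y = u" for u :: 'f
 proof -
  obtain y where "poly [:- u, 1, 1:] y = 0" using has_root[of "[:- u, 1, 1:]"] by auto
  thus ?thesis by (intro exI[of _ y]) (simp add: sq_simps eq_neg_iff_add_eq_0)
 qed
 obtain x where x: "x\<^sup>2 + x = c" using root by blast
 obtain y where y: "y\<^sup>2 + y = x * c" using root by blast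
 have "x\<^sup>2 = x + c" "y\<^sup>2 = y + x * c" using x y by (metis add.commute f.c2(2))+
 hence "f.wfr 1 (x, y) = f.wadd (x, y) (c, 0)" by (simp add: f.wfr_def f.wadd_def)
 thus ?thesis unfolding \<kappa>\<kappa>_def by (rule someI)
qed

text \<open>The Witt vector (aW, bW) times (SS, ZZ), with the contribution of \<open>\<xi>U\<close>
  added in the second component. The partial trace \<open>wtr k\<close> then descends from GF p to
  the field with two elements.\<close>

definition UU :: "'f acf \<times> 'f acf" where
 "UU = (cst aW * SS, cst bW * SS\<^sup>2 + (cst aW)\<^sup>2 * (ZZ + TT (cst \<beta> * ww)))"
definition Y1 :: "'f acf \<times> 'f acf" where "Y1 = w.wadd (w.wtr k UU) (0, cst dd * t_ac)"
definition YY :: "'f acf \<times> 'f acf" where "YY = w.wadd Y1 (cw \<kappa>\<kappa>)"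

lemma GF_p_const: "d : GF p ==> cst d ^ p = cst d" and GF_q_const: "d : GF q ==> cst d ^ q = cst d"
 by (simp_all add: GF_def flip: cst_power)

lemma UU_frob: "w.wfr k UU = w.wadd UU (cst aW * t_ac, cst (dd\<^sup>2) * t_ac\<^sup>2 + cst (aW\<^sup>2 * \<beta>) * t_ac)"
proof -
 have Sp: "SS ^ p = SS + t_ac" using SS_eq by (metis add.commute w.c2(2))
 have Zp: "ZZ ^ p = ZZ + (SS * t_ac + cst \<alpha> * t_ac\<^sup>2)" using ZZ_eq by (metis add.commute w.c2(2))
 have "TT (cst \<beta> * ww) ^ p + TT (cst \<beta> * ww) = cst \<beta> * (ww ^ q + ww)"
  by (simp add: TT_frob power_mult_distrib GF_q_const[OF \<beta>(1)] distrib_left)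
 hence Tp: "TT (cst \<beta> * ww) ^ p = TT (cst \<beta> * ww) + cst \<beta> * t_ac" unfolding ww by (metis add.commute w.c2(2))
 note G = GF_p_const[OF aW(1)] GF_p_const[OF aW(2)]
 have 1: "(cst aW * SS) ^ p = cst aW * SS + cst aW * t_ac" by (simp add: power_mult_distrib G Sp distrib_left)
 have 2: "(cst bW * SS\<^sup>2 + (cst aW)\<^sup>2 * (ZZ + TT (cst \<beta> * ww))) ^ p =
   cst bW * (SS + t_ac)\<^sup>2 + (cst aW)\<^sup>2 * (ZZ + (SS * t_ac + cst \<alpha> * t_ac\<^sup>2) + (TT (cst \<beta> * ww) + cst \<beta> * t_ac))"
  by (simp only: w.pw_add1 power_mult_distrib power_p_2 G Sp Zp Tp)
 show ?thesis unfolding UU_def w.wfr_def w.wadd_def fst_conv snd_conv p(1)[symmetric] 1 2 dd(1) by (simp add: cst_add cst_mult sq_simps w.c2)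
qed

text \<open>The linear terms dd t and aW^2 \<beta> t add up to aW c t, exactly the cross term of the
  Witt sum of (aW t, 0) and (c, 0); this is the origin of \<open>c\<close>. As the second component
  vanishes, the covering becomes z^2 + z = s (s^2 + s).\<close>

lemma YY_frob: "w.wfr 1 YY = w.wadd YY (cst aW * t_ac + cst c, 0)"
proof -
 let ?v = "(cst aW * t_ac, cst (dd\<^sup>2) * t_ac\<^sup>2 + cst (aW\<^sup>2 * \<beta>) * t_ac)"
 have "w.wadd UU (w.wfr 1 (w.wtr k UU)) = w.wadd UU (w.wadd (w.wtr k UU) ?v)"
  using w.wtr_telescope[of k UU] unfolding UU_frob by (simp add: w.wadd_ac)
 hence 1: "w.wfr 1 (w.wtr k UU) = w.wadd (w.wtr k UU) ?v" by (simp only: w.wadd_cancel)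
 have 2: "w.wfr 1 (0, cst dd * t_ac) = w.wadd (0, cst dd * t_ac) (0, cst (dd\<^sup>2) * t_ac\<^sup>2 + cst dd * t_ac)" by (simp add: w.wfr_def w.wadd_def sqr cst_mult add_ac w.c2)
 have 3: "w.wfr 1 (cw \<kappa>\<kappa>) = w.wadd (cw \<kappa>\<kappa>) (cst c, 0)"
  using arg_cong[OF \<kappa>\<kappa>, of cw] by (simp add: cw_wadd cw_wfr) (simp add: cw_eq)
 have "cst aW * (cst c * t_ac) = cst dd * t_ac + cst (aW\<^sup>2 * \<beta>) * t_ac" using arg_cong[OF dd(2), of cst] by (simp add: cst_add cst_mult mult.assoc[symmetric] distrib_right)
 hence 4: "w.wadd ?v (w.wadd (0, cst (dd\<^sup>2) * t_ac\<^sup>2 + cst dd * t_ac) (cst c, 0)) = (cst aW * t_ac + cst c, 0)" by (simp add: w.wadd_def mult_ac w.c2)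
 show ?thesis unfolding YY_def Y1_def w.wfr_add 1 2 3 4[symmetric] by (simp only: w.wadd_ac)
qed

definition ss :: "'f acf" where "ss = fst YY"
definition zz :: "'f acf" where "zz = snd YY"

lemma YY: "YY = (ss, zz)" by (simp add: ss_def zz_def)

sublocale E: ell ss zz aW c
proof
 show "(1::'f) + 1 = 0" by (rule two)
 show "aW ~= 0" by (rule aW(3))
 have "ss\<^sup>2 = ss + (cst aW * t_ac + cst c)" "zz\<^sup>2 = zz + ss * (cst aW * t_ac + cst c)"
  using YY_frob by (simp_all add: YY w.wfr_def w.wadd_def)
 hence 1: "ss\<^sup>2 + ss = cst aW * t_ac + cst c" and 2: "zz\<^sup>2 + zz = ss * (cst aW * t_ac + cst c)" by (simp_all add: w.c2)
 show "ss\<^sup>2 + ss = cst aW * t_ac + cst c" by (rule 1)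
 show "zz\<^sup>2 + zz = ss ^ 3 + ss\<^sup>2" unfolding 2 1[symmetric] by (simp add: sqr power3_eq_cube distrib_left)
qed

subsection \<open>The Galois action\<close>

lemma \<xi>2_add: "x : GF 2 \<times> GF 2 ==> y : GF 2 \<times> GF 2 ==> \<xi>2 (f.wadd x y) = \<xi>2 x * \<xi>2 y"
proof -
 assume "x : GF 2 \<times> GF 2" "y : GF 2 \<times> GF 2"
 moreover have "f.wadd x y = x \<otimes>\<^bsub>add_monoid (W2 (GF 2))\<^esub> y" by (simp add: f.wadd_def W2_def split_beta)
 ultimately show ?thesis using \<xi>2(1) unfolding dual_def hom_def
  by (cases x; cases y) (simp add: W2_def mult_group_of_field_def)
qed

definition ii :: 'k where "ii = \<xi>2 (1, 0)"

lemma \<xi>2_values: "\<xi>2 (0, 0) = 1" "\<xi>2 (0, 1) = -1" "\<xi>2 (1, 0) = ii" "\<xi>2 (1, 1) = - ii" "ii\<^sup>2 = -1"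
proof -
 have in2: "(0, 0) : (GF 2 :: 'f set) \<times> (GF 2 :: 'f set)" "(0, 1) : (GF 2 :: 'f set) \<times> (GF 2 :: 'f set)" "(1, 0) : (GF 2 :: 'f set) \<times> (GF 2 :: 'f set)"
  "(0 :: 'f) : GF 2" "(1 :: 'f) : GF 2" by (simp_all add: GF2)
 have w: "f.wadd (0, 0) (0, 0) = (0, 0)" "f.wadd (0, 1) (0, 1) = (0, 0)" "f.wadd (1, 0) (1, 0) = (0, 1)" "f.wadd (0, 1) (1, 0) = (1, 1)"
  by (simp_all add: f.wadd_def f.c2)
 show 0: "\<xi>2 (0, 0) = 1" using \<xi>2_add[OF in2(1,1)] \<xi>2(1) in2(1) unfolding dual_def hom_def by (auto simp: W2_def mult_group_of_field_def)
 have "\<xi>2 (0, 1) * \<xi>2 (0, 1) = 1" using \<xi>2_add[OF in2(2,2)] 0 by (simp add: w)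
 hence "\<xi>2 (0, 1) = 1 \<or> \<xi>2 (0, 1) = - 1" by (metis sqr power2_eq_1_iff)
 moreover have "\<xi>2 (0, 1) ~= \<xi>2 (0, 0)"
 proof
  assume "\<xi>2 (0, 1) = \<xi>2 (0, 0)"
  hence "(0, 1) = (0 :: 'f, 0 :: 'f)" by (rule inj_onD[OF \<xi>2(2)]) (use in2 in \<open>simp_all add: W2_def\<close>)
  thus False by simp
 qed
 ultimately show 1: "\<xi>2 (0, 1) = -1" using 0 by auto
 show "\<xi>2 (1, 0) = ii" by (simp add: ii_def)
 show "ii\<^sup>2 = -1" using \<xi>2_add[OF in2(3,3)] 1 by (simp add: w ii_def sqr)
 show "\<xi>2 (1, 1) = - ii" using \<xi>2_add[OF in2(2,3)] 1 by (simp add: w ii_def)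
qed

text \<open>The inverse of \<open>\<xi>2\<close> at the Witt vector by which (x, y) differs from
  (ss, zz). The rotation is the translation by (1, 1), the negative of (1, 0), and therefore has the
  value \<open>ii\<close>.\<close>

definition \<rho>0 :: "'f acf => 'f acf => 'k" where
 "\<rho>0 x y = (if x = ss then if y = zz then 1 else -1 else if y = zz + ss then - ii else ii)"

lemma \<rho>0_values: "\<rho>0 ss zz = 1" "\<rho>0 ss (zz + 1) = - 1" "\<rho>0 (ss + 1) (zz + ss + 1) = ii" "\<rho>0 (ss + 1) (zz + ss) = - ii"
 by (simp_all add: \<rho>0_def)

lemma \<rho>0_wadd:
 assumes "\<theta> : GF 2 \<times> GF 2" "w.wadd YY (cw \<theta>) = (x, y)"
 shows "\<rho>0 x y = inverse (\<xi>2 \<theta>)"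
proof -
 have ii: "inverse ii = - ii" using \<xi>2_values(5) by (metis inverse_unique mult_minus_right minus_minus sqr)
 have "x = ss + cst (fst \<theta>)" "y = zz + ss * cst (fst \<theta>) + cst (snd \<theta>)" using assms(2) by (auto simp: w.wadd_def YY cw_eq)
 moreover have "\<theta> : {(0, 0), (0, 1), (1, 0), (1, 1)}" using assms(1) by (auto simp: GF2)
 ultimately show ?thesis using \<rho>0_values \<xi>2_values ii by auto
qed

lemma wtr_GF2: "x : GF (2 ^ m) \<times> GF (2 ^ m) ==> f.wtr m x : GF 2 \<times> GF 2"
 using f.wtr_GF[of m x] by (auto simp: f.wfr_def GF_def prod_eq_iff mem_Times_iff)

lemma \<xi>W_eq:
 assumes "x : GF p" "y : GF p"
 shows "\<xi>W (x, y) = \<xi>2 (f.wtr k (aW * x, bW * x\<^sup>2 + aW\<^sup>2 * y))"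
 using aW_bW(2)[of "(x, y)"] assms unfolding W2_char_def o_apply f.W2_trace_eq by (simp add: W2_def)

text \<open>The restriction of \<xi> to the centre, where phi is (0, d) |-> ((0, d), 0); it makes
  the contribution of \<beta> a value of \<open>\<xi>2\<close>.\<close>

lemma \<psi>_eq: "d : GF p ==> \<psi> d = \<xi>2 (f.wtr k (0, aW\<^sup>2 * d))"
proof -
 assume d: "d : GF p"
 have 0: "0 : Abar" using A_zero by (force simp: Abar)
 have "r 0 + r 0 = r 0 + 0" using r[OF 0 0] by (simp only: add_0_right)
 hence "r 0 = 0" by (simp only: add_left_cancel)
 moreover have "\<xi>U 0 = 1"
 proof -
  have "0 : Ubar" using 0 by (simp add: Ubar)
  thus ?thesis using \<xi>W_\<xi>U(1) unfolding dual_def hom_def by (force simp: add_group_on_def mult_group_of_field_def)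
 qed
 moreover have "(0, d) : A" by (rule A_center[OF d])
 moreover have "(0::'f) : GF p" using subfld_D(2)[OF sub_p] .
 ultimately show ?thesis using \<xi>[OF d] \<xi>W_\<xi>U(2)[of 0 d] \<xi>W_eq[of 0 d] d by (simp add: fU_0 \<Delta>(2))
qed

text \<open>\<sigma> translates S by d, Z by d2 apart from the cross term, and the trace of \<beta>
  w by d3, all in GF p. The translation \<theta> of \<open>Y1\<close> is the trace of the resulting
  Witt vector \<eta>, and evaluating \<xi> on the group element leads to \<open>\<xi>2\<close> of
  the same trace.\<close>

lemma gal_arith_act:
 assumes \<sigma>: "\<sigma> : gal_arith q"
 shows "\<exists>\<theta>\<in>GF 2 \<times> GF 2. map_prod \<sigma> \<sigma> Y1 = w.wadd Y1 (cw \<theta>) & Q_char p e a A F_A \<xi> \<sigma> = inverse (\<xi>2 \<theta>)"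
proof -
 note F = gal_arithD(1)[OF \<sigma>] and T = gal_arithD(2)[OF \<sigma>] and K = gal_arithD(3)[OF \<sigma>]
 obtain h b where hb: "(h, b) : A" "\<sigma> xx = xx + cst h" "\<sigma> yy = yy + cst b + fw xx h"
  using torsor[OF fibre_xx fibre_gal_arith[OF \<sigma> fibre_xx]] by (auto simp: curve_act_eq)
 have "(\<sigma> ww) ^ q + \<sigma> ww = ww ^ q + ww"
 proof -
  have "(\<sigma> ww) ^ q + \<sigma> ww = \<sigma> (ww ^ q + ww)" by (simp only: aut[OF F])
  also have "... = ww ^ q + ww" by (simp only: ww T)
  finally show ?thesis .
 qed
 moreover have "(\<sigma> ww + ww) ^ q + (\<sigma> ww + ww) = ((\<sigma> ww) ^ q + \<sigma> ww) + (ww ^ q + ww)" unfolding q(1) by (simp add: w.pw_add)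
 ultimately have "(\<sigma> ww + ww) ^ q + (\<sigma> ww + ww) = 0" by (simp only: w.c2(1))
 hence "(\<sigma> ww + ww) ^ q = \<sigma> ww + ww" by (simp only: w.add_eq_0)
 then obtain \<mu> where \<mu>: "\<sigma> ww + ww = cst \<mu>" "\<mu> ^ q = \<mu>" using power_eq_self_const q_gt_1 by blast
 have \<mu>q: "\<mu> : GF q" using \<mu>(2) by (simp add: GF_def)
 have sw: "\<sigma> ww = ww + cst \<mu>" using \<mu>(1) by (metis add.commute w.c2(2))
 \<comment> \<open>The group element is read off from the translation of w, which brings in the
   defining property of \<beta>.\<close>
 have h: "h = poly ax \<mu>" using hb(2) unfolding xx_def by (simp add: aut_ceval[OF F linearized_polys_over[OF ax(1) sub_q] K] sw linearized_add(2)[OF two p(1) ax(1)] ceval_const)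
 define d where "d = poly fU h"
 define d2 where "d2 = b + poly \<Delta> h + froot p \<alpha> * d\<^sup>2"
 have dp: "d ^ p = d" using mem_A(5)[OF hb(1)] by (simp add: F_A(2) Ker_def F_A(1) f.add_eq_0 d_def)
 have d2p: "d2 ^ p = d2"
 proof -
  have D: "poly \<Delta> h ^ p + poly \<Delta> h = h * poly (R_poly p e a) h + d * (d ^ p + s0 * d)"
   using arg_cong[OF \<Delta>(3), of "%P. poly P h"] by (simp add: d_def)
  have "d2 ^ p + d2 = (b ^ p + b) + (poly \<Delta> h ^ p + poly \<Delta> h) + (froot p \<alpha> ^ p + froot p \<alpha>) * d\<^sup>2" by (simp add: d2_def f.pw_add1 power_mult_distrib power_p_2 dp distrib_right)
  also have "froot p \<alpha> ^ p + froot p \<alpha> = s0 + 1" using \<alpha>(2) by (simp add: froot_\<alpha>(1) add.commute)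
  finally have "d2 ^ p + d2 = 0" unfolding mem_A(2)[OF hb(1)] D dp by (simp add: sq_simps f.c2)
  thus ?thesis by (simp only: f.add_eq_0)
 qed
 have dK: "d : GF p" "d2 : GF p" using dp d2p by (simp_all add: GF_def)
 have sS: "\<sigma> SS = SS + cst d"
  unfolding SS_def by (simp add: aut_ceval[OF F linearized_polys_over[OF fU sub_q] K] hb(2)
    linearized_add(2)[OF two p(1) fU] ceval_const d_def)
 \<comment> \<open>The cocycle identity exchanges the Heisenberg cocycle for a coboundary of
   \<open>\<Delta>\<close> and the product S d, the cross term of Witt addition.\<close>
 have "\<sigma> ZZ = (yy + cst b + fw xx h) + ceval \<Delta> (xx + cst h) + cst (froot p \<alpha>) * (SS + cst d)\<^sup>2"
  by (simp add: ZZ_def aut[OF F] hb(2,3) sS aut_ceval[OF F \<Delta>(1) K] K[OF froot_\<alpha>(2)])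
 also have "... = ZZ + cst d2 + SS * cst d" unfolding cocycle_identity[OF hb(1)]
  by (simp add: ZZ_def d2_def SS_def d_def cst_add cst_mult cst_power sq_simps w.c2)
 finally have sZ: "\<sigma> ZZ = ZZ + cst d2 + SS * cst d" .
 define d3 where "d3 = (\<Sum>i<n. (\<beta> * \<mu>) ^ (p ^ i))"
 have d3K: "d3 : GF p"
 proof -
  have "d3 ^ p + d3 = (\<beta> * \<mu>) ^ q + \<beta> * \<mu>" unfolding d3_def q(1) by (rule f.telescope)
  also have "... = 0" using \<beta>(1) \<mu>q by (simp add: power_mult_distrib GF_def f.c2)
  finally show ?thesis by (simp add: GF_def f.add_eq_0)
 qed
 have sT: "\<sigma> (TT (cst \<beta> * ww)) = TT (cst \<beta> * ww) + cst d3"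
 proof -
  have "\<sigma> (TT (cst \<beta> * ww)) = TT (cst \<beta> * ww + cst (\<beta> * \<mu>))"
   by (simp add: TT_def aut_sum[OF F] aut[OF F] K[OF \<beta>(1)] sw distrib_left cst_mult)
  thus ?thesis unfolding TT_add TT_const d3_def .
 qed
 define \<eta> where "\<eta> = (aW * d, bW * d\<^sup>2 + aW\<^sup>2 * d2 + aW\<^sup>2 * d3)"
 note S = subfld_D[OF sub_p]
 have \<eta>K: "\<eta> : GF p \<times> GF p" unfolding \<eta>_def using aW(1,2) dK d3K by (intro SigmaI S(5) S(6) S(9))
 note aK = K[OF aW(1)[THEN GF_p_q]] K[OF aW(2)[THEN GF_p_q]]
 have sU: "map_prod \<sigma> \<sigma> UU = w.wadd UU (cw \<eta>)"
  by (simp add: UU_def w.wadd_def cw_eq \<eta>_def aut[OF F] aK sS sZ sT)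
   (simp add: cst_add cst_mult cst_power sq_simps w.c2)
 have s_add: "map_prod \<sigma> \<sigma> (w.wadd x y) = w.wadd (map_prod \<sigma> \<sigma> x) (map_prod \<sigma> \<sigma> y)" for x y
  by (simp add: w.wadd_def aut[OF F])
 have s_fr: "map_prod \<sigma> \<sigma> (w.wfr m x) = w.wfr m (map_prod \<sigma> \<sigma> x)" for m x
  by (simp add: w.wfr_def aut_power[OF F])
 have s_tr: "map_prod \<sigma> \<sigma> (w.wtr m x) = w.wtr m (map_prod \<sigma> \<sigma> x)" for m x
  by (induction m) (simp_all add: s_add s_fr aut_0[OF F])
 define \<theta> where "\<theta> = f.wtr k \<eta>"
 have \<theta>: "\<theta> : GF 2 \<times> GF 2" unfolding \<theta>_def by (rule wtr_GF2) (use \<eta>K p(1) in simp)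
 have "map_prod \<sigma> \<sigma> Y1 = w.wadd (w.wadd (w.wtr k UU) (cw \<theta>)) (0, cst dd * t_ac)"
  by (simp add: Y1_def s_add s_tr sU w.wtr_add cw_wtr \<theta>_def aut[OF F] K[OF dd(3)] T)
 also have "... = w.wadd Y1 (cw \<theta>)" by (simp only: Y1_def w.wadd_ac)
 finally have 1: "map_prod \<sigma> \<sigma> Y1 = w.wadd Y1 (cw \<theta>)" .
 have "\<xi> (h, b) = \<xi>W (d, d2) * \<xi>U (r h)" using \<xi>W_\<xi>U(2)[OF hb(1)] by (simp add: d_def d2_def)
 also have "\<xi>U (r h) = \<xi>2 (f.wtr k (0, aW\<^sup>2 * d3))"
  unfolding h using \<beta>(2)[OF \<mu>q] \<psi>_eq[OF d3K] by (simp add: d3_def)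
 also have "\<xi>W (d, d2) = \<xi>2 (f.wtr k (aW * d, bW * d\<^sup>2 + aW\<^sup>2 * d2))" by (rule \<xi>W_eq[OF dK])
 also have "\<xi>2 (f.wtr k (aW * d, bW * d\<^sup>2 + aW\<^sup>2 * d2)) * \<xi>2 (f.wtr k (0, aW\<^sup>2 * d3)) = \<xi>2 \<theta>"
 proof -
  have "(aW * d, bW * d\<^sup>2 + aW\<^sup>2 * d2) : GF p \<times> GF p" "(0 :: 'f, aW\<^sup>2 * d3) : GF p \<times> GF p"
   by (intro SigmaI S(2) S(5) S(6) S(9) aW(1,2) dK d3K)+
  from this[unfolded p(1), THEN wtr_GF2] have "f.wtr k (aW * d, bW * d\<^sup>2 + aW\<^sup>2 * d2) : GF 2 \<times> GF 2" "f.wtr k (0, aW\<^sup>2 * d3) : GF 2 \<times> GF 2"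
   .
  hence "\<xi>2 (f.wtr k (aW * d, bW * d\<^sup>2 + aW\<^sup>2 * d2)) * \<xi>2 (f.wtr k (0, aW\<^sup>2 * d3)) =
    \<xi>2 (f.wtr k (f.wadd (aW * d, bW * d\<^sup>2 + aW\<^sup>2 * d2) (0, aW\<^sup>2 * d3)))" by (simp only: f.wtr_add \<xi>2_add)
  also have "f.wadd (aW * d, bW * d\<^sup>2 + aW\<^sup>2 * d2) (0, aW\<^sup>2 * d3) = \<eta>" by (simp add: f.wadd_def \<eta>_def)
  finally show ?thesis by (simp only: \<theta>_def)
 qed
 finally have "\<xi> (h, b) = \<xi>2 \<theta>" .
 thus ?thesis using Q_char_eq[OF \<sigma> fibre_xx hb] 1 \<theta> by auto
qed

lemma gal_geom_arith: "\<sigma> : gal_geom ==> \<sigma> : gal_arith q"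
 by (simp add: gal_geom_def gal_arith_def t_ac_def const_ac_def)

lemma Q_char_geom:
 assumes \<sigma>: "\<sigma> : gal_geom"
 shows "Q_char p e a A F_A \<xi> \<sigma> = \<rho>0 (\<sigma> ss) (\<sigma> zz)"
proof -
 have F: "\<sigma> : field_auts" using \<sigma> by (simp add: gal_geom_def)
 obtain \<theta> where \<theta>: "\<theta> : GF 2 \<times> GF 2" "map_prod \<sigma> \<sigma> Y1 = w.wadd Y1 (cw \<theta>)"
  "Q_char p e a A F_A \<xi> \<sigma> = inverse (\<xi>2 \<theta>)" using gal_arith_act[OF gal_geom_arith[OF \<sigma>]] by blast
 have "map_prod \<sigma> \<sigma> YY = w.wadd (map_prod \<sigma> \<sigma> Y1) (map_prod \<sigma> \<sigma> (cw \<kappa>\<kappa>))"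
  unfolding YY_def by (simp add: w.wadd_def aut[OF F])
 also have "map_prod \<sigma> \<sigma> (cw \<kappa>\<kappa>) = cw \<kappa>\<kappa>" by (simp add: cw_eq E.gal_geom_const[OF \<sigma>])
 also have "w.wadd (map_prod \<sigma> \<sigma> Y1) (cw \<kappa>\<kappa>) = w.wadd YY (cw \<theta>)" by (simp only: \<theta>(2) YY_def w.wadd_ac)
 finally have "w.wadd YY (cw \<theta>) = (\<sigma> ss, \<sigma> zz)" by (simp add: YY)
 thus ?thesis using \<rho>0_wadd[OF \<theta>(1)] \<theta>(3) by simp
qed

text \<open>On \<open>Y1\<close> the lift \<Phi> acts through \<xi> like any other \<sigma>. On the
  constant \<open>\<kappa>\<kappa>\<close> it subtracts the trace \<omega> of (c, 0) over GF q, and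
  this discrepancy is the twist.\<close>

lemma Q_char_frob:
 assumes \<Phi>: "\<Phi> : gal_arith q" "!!u. \<Phi> (cst (u ^ q)) = cst u"
 shows "Q_char p e a A F_A \<xi> \<Phi> = inverse (W2_char \<xi>2 (k * n) (c, 0)) * \<rho>0 (\<Phi> ss) (\<Phi> zz)"
proof -
 note F = gal_arithD(1)[OF \<Phi>(1)] and K = gal_arithD(3)[OF \<Phi>(1)]
 obtain \<theta> where \<theta>: "\<theta> : GF 2 \<times> GF 2" "map_prod \<Phi> \<Phi> Y1 = w.wadd Y1 (cw \<theta>)"
  "Q_char p e a A F_A \<xi> \<Phi> = inverse (\<xi>2 \<theta>)" using gal_arith_act[OF \<Phi>(1)] by blast
 have \<Phi>_add: "map_prod \<Phi> \<Phi> (w.wadd x y) = w.wadd (map_prod \<Phi> \<Phi> x) (map_prod \<Phi> \<Phi> y)" for x y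
  by (simp add: w.wadd_def aut[OF F])
 define \<omega> where "\<omega> = f.wtr (k * n) (c, 0)"
 have \<omega>: "\<omega> : GF 2 \<times> GF 2" unfolding \<omega>_def by (rule wtr_GF2) (use c_GF q2 in \<open>simp add: GF_def\<close>)
 have "f.wfr m \<kappa>\<kappa> = f.wadd \<kappa>\<kappa> (f.wtr m (c, 0))" for m
 proof (induction m)
  case (Suc m)
  have "f.wfr (Suc m) \<kappa>\<kappa> = f.wfr m (f.wfr 1 \<kappa>\<kappa>)" by (simp add: f.wfr_wfr)
  also have "... = f.wadd (f.wfr m \<kappa>\<kappa>) (f.wfr m (c, 0))" by (simp only: \<kappa>\<kappa> f.wfr_add)
  finally show ?case unfolding Suc by (simp add: f.wadd_ac)
 qed simp
 hence \<kappa>: "f.wfr (k * n) \<kappa>\<kappa> = f.wadd \<kappa>\<kappa> \<omega>" by (simp add: \<omega>_def)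
 have "map_prod \<Phi> \<Phi> (cw (f.wfr (k * n) \<kappa>\<kappa>)) = cw \<kappa>\<kappa>" using \<Phi>(2) by (simp add: cw_eq f.wfr_def q2)
 moreover have "map_prod \<Phi> \<Phi> (cw \<omega>) = cw \<omega>" using \<omega> by (auto simp: GF2 cw_eq aut[OF F])
 ultimately have cw\<kappa>: "cw \<kappa>\<kappa> = w.wadd (map_prod \<Phi> \<Phi> (cw \<kappa>\<kappa>)) (cw \<omega>)" unfolding \<kappa> cw_wadd \<Phi>_add by simp
 \<comment> \<open>The difference of \<theta> and \<omega>: the negative of a Witt vector (x, y) is
   (x, y + x^2).\<close>
 define \<theta>' where "\<theta>' = f.wadd \<theta> (fst \<omega>, snd \<omega> + (fst \<omega>)\<^sup>2)"
 have \<theta>'2: "\<theta>' : GF 2 \<times> GF 2" using \<theta>(1) \<omega> by (auto simp: \<theta>'_def f.wadd_def GF2 f.c2)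
 have \<theta>\<theta>': "f.wadd \<theta>' \<omega> = \<theta>"
  unfolding \<theta>'_def using f.wadd_neg[of \<omega>] by (metis f.wadd_0(1) f.wadd_assoc f.wadd_commute)
 have "w.wadd (cw \<omega>) (map_prod \<Phi> \<Phi> YY) = w.wadd (map_prod \<Phi> \<Phi> Y1) (w.wadd (map_prod \<Phi> \<Phi> (cw \<kappa>\<kappa>)) (cw \<omega>))"
  unfolding YY_def \<Phi>_add by (simp only: w.wadd_ac)
 also have "... = w.wadd YY (cw \<theta>)" unfolding cw\<kappa>[symmetric] \<theta>(2) YY_def by (simp only: w.wadd_ac)
 also have "... = w.wadd (cw \<omega>) (w.wadd YY (cw \<theta>'))" unfolding \<theta>\<theta>'[symmetric] cw_wadd by (simp only: w.wadd_ac)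
 finally have "w.wadd YY (cw \<theta>') = map_prod \<Phi> \<Phi> YY" by (simp only: w.wadd_cancel)
 hence "\<rho>0 (\<Phi> ss) (\<Phi> zz) = inverse (\<xi>2 \<theta>')" using \<rho>0_wadd[OF \<theta>'2] by (simp add: YY)
 moreover have "\<xi>2 \<theta> = \<xi>2 \<theta>' * \<xi>2 \<omega>" using \<xi>2_add[OF \<theta>'2 \<omega>] \<theta>\<theta>' by simp
 moreover have "W2_char \<xi>2 (k * n) (c, 0) = \<xi>2 \<omega>" unfolding W2_char_def o_apply f.W2_trace_eq \<omega>_def ..
 ultimately show ?thesis using \<theta>(3) by simp
qed

end

theorem theorem1p1:
  fixes p q k n e l :: nat
    and a :: "nat \<Rightarrow> 'f::alg_closed_field"
    and A :: "('f \<times> 'f) set"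
    and v :: "'k::{field_char_0, alg_closed_field} \<Rightarrow> real"
    and \<xi>2 :: "'f \<times> 'f \<Rightarrow> 'k"
    and \<psi> :: "'f \<Rightarrow> 'k"
    and \<xi> :: "'f \<times> 'f \<Rightarrow> 'k"
    and fU \<Delta> F_A ax :: "'f poly"
    and Abar Ubar :: "'f set"
    and s0 \<alpha> \<beta> aW bW c :: 'f
    and r :: "'f \<Rightarrow> 'f"
    and \<xi>W :: "'f \<times> 'f \<Rightarrow> 'k"
    and \<xi>U :: "'f \<Rightarrow> 'k"
    and V :: "'f poly fract alg_closure set"
    and \<Phi> :: "'f poly fract alg_closure \<Rightarrow> 'f poly fract alg_closure"
  assumes p: "p = 2 ^ k" "k \<ge> 1" and q: "q = p ^ n" "n \<ge> 1"
    and F_char: "CHAR('f) = 2"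
    and F_alg: "\<And>x :: 'f. algebraic_over (GF q) x"
    and l: "Factorial_Ring.prime l" "odd l"
    and Qlbar: "is_Qlbar l v"
    and R: "e \<ge> 1" "\<And>i. i \<le> e \<Longrightarrow> a i \<in> GF q" "a e \<noteq> 0"
    and A: "max_abelian_subgroup A (H_R p e a)" "A \<subseteq> GF q \<times> GF q"
    and \<psi>: "\<psi> \<in> dual (add_group_on (GF p))" "\<exists>c \<in> GF p. \<psi> c \<noteq> 1"
    and \<xi>: "\<xi> \<in> dual ((H_R p e a)\<lparr>carrier := A\<rparr>)" "\<And>c. c \<in> GF p \<Longrightarrow> \<xi> (0, c) = \<psi> c"
    and \<xi>2: "\<xi>2 \<in> dual (add_monoid (W2 (GF 2)))" "inj_on \<xi>2 (carrier (W2 (GF 2)))"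
    and Abar: "Abar = fst ` A"
    and Ubar: "Ubar = {x \<in> Abar. f_R p e a x x = 0}"
    and fU: "fU \<in> linearized p (GF q)" "coprime fU (pderiv fU)" "Ubar = Ker fU"
    and F_A: "F_A = fU ^ p + fU" "Abar = Ker F_A"
    and s0: "s0 \<in> GF q"
    and \<Delta>: "\<Delta> \<in> polys_over (GF q)" "poly \<Delta> 0 = 0"
      "\<Delta> ^ p + \<Delta> = [:0, 1:] * R_poly p e a + fU * (fU ^ p + Polynomial.smult s0 fU)"
    and \<alpha>: "\<alpha> \<in> GF q" "froot p \<alpha> + \<alpha> = s0 + 1"
    and r: "r \<in> Abar \<rightarrow> Ubar"
      "\<And>x y. x \<in> Abar \<Longrightarrow> y \<in> Abar \<Longrightarrow> r (x + y) = r x + r y"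
      "\<And>c x. c \<in> GF p \<Longrightarrow> x \<in> Abar \<Longrightarrow> r (c * x) = c * r x"
      "\<And>x. x \<in> Ubar \<Longrightarrow> r x = x"
    and \<xi>W_\<xi>U: "\<xi>W \<in> dual (add_monoid (W2 (GF p)))" "\<xi>U \<in> dual (add_group_on Ubar)"
      "\<And>x b. (x, b) \<in> A \<Longrightarrow>
         \<xi> (x, b) = \<xi>W (poly fU x, b + poly \<Delta> x + froot p \<alpha> * (poly fU x)\<^sup>2) * \<xi>U (r x)"
    and aW_bW: "(aW, bW) \<in> Units (W2 (GF p))"
      "\<And>z. z \<in> carrier (W2 (GF p)) \<Longrightarrow>
         \<xi>W z = W2_char \<xi>2 k ((aW, bW) \<otimes>\<^bsub>W2 (GF p)\<^esub> z)"
    and ax: "ax \<in> linearized p (GF q)"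
      "Polynomial.monom 1 q + [:0, 1:] = pcompose ax F_A"
      "pcompose ax F_A = pcompose F_A ax"
    and \<beta>: "\<beta> \<in> GF q"
      "\<And>x. x \<in> GF q \<Longrightarrow> \<xi>U (r (poly ax x)) = \<psi> (\<Sum>i<n. (\<beta> * x) ^ (p ^ i))"
    and V: "is_place V" "t_ac \<notin> V"
    and \<Phi>: "is_geom_frob_lift q V \<Phi>"
    and c: "c = froot 2 (\<alpha> + bW / aW\<^sup>2) + aW * \<beta>"
  shows "c \<in> GF q \<and>
    {\<tau>. H1c_eigenvalue v (Q_char p e a A F_A \<xi>) V \<Phi> \<tau>} =
      {inverse (W2_char \<xi>2 (k * n) (c, 0)) * (- 1 - \<xi>2 (1, 0)) ^ (k * n)}"
proof -
 interpret q_data p q k n e a A \<xi>2 \<psi> \<xi> fU \<Delta> F_A ax Abar Ubar s0 \<alpha> \<beta> aW bW c r \<xi>W \<xi>U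
  by unfold_locales (fact p q F_char R(2) A \<xi>(2) \<xi>2 Abar Ubar fU(1) F_A \<Delta> \<alpha> r(2) \<xi>W_\<xi>U(2,3) aW_bW ax \<beta> c)+
 note lift = \<Phi>[unfolded is_geom_frob_lift_def]
 have \<Phi>_gal: "\<Phi> \<in> gal_arith q" and \<Phi>_const: "\<And>u. \<Phi> (cst (u ^ q)) = cst u" and \<Phi>_V: "\<Phi> ` V = V"
  using lift by blast+
 have aW_q: "aW \<in> GF q" using aW(1) by (rule GF_p_q)
 \<comment> \<open>The curve has the parameters aW and c of \<open>YY_frob\<close>; \<kappa> is the
   twist of \<open>Q_char_frob\<close>, and q = 2^(k * n) fixes the exponent.\<close>
 interpret ell_sheaf ss zz aW c V l v "Q_char p e a A F_A \<xi>" \<Phi> ii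
  "inverse (W2_char \<xi>2 (k * n) (c, 0))" "k * n" \<rho>0
 proof unfold_locales
  show "\<And>u. \<Phi> (cst (u ^ 2 ^ (k * n))) = cst u" using \<Phi>_const by (simp only: q2)
  show "Q_char p e a A F_A \<xi> \<Phi> = inverse (W2_char \<xi>2 (k * n) (c, 0)) * \<rho>0 (\<Phi> ss) (\<Phi> zz)"
   by (rule Q_char_frob[OF \<Phi>_gal \<Phi>_const])
 qed (fact V l Qlbar \<xi>2_values(5) \<rho>0_values Q_char_geom gal_arithD(1,2)[OF \<Phi>_gal] \<Phi>_V
   gal_arithD(3)[OF \<Phi>_gal aW_q] gal_arithD(3)[OF \<Phi>_gal c_GF])+
 show ?thesis using c_GF H1c_eigenvalues by (simp only: ii_def simp_thms)
qed

end
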